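(* Let $A$ be an associative unital algebra over a field $\mathbf{k}$, let $(P,\mu_P)$ be an $A^e$-projective resolution of $A$, and let $\Delta_P^{(2)}:P\to P\otimes_AP\otimes_AP$ be a diagonal $3$-approximation of $P$. Let $\phi_P:P\otimes_AP\to P[1]$ satisfy $\mathbf{d}\phi_P=\mu_P\otimes1_P-1_P\otimes\mu_P$, and let $\epsilon_P:P\to(P\otimes_AP)[1]$ satisfy $\mathbf{d}\epsilon_P=(\mu_P\otimes1_P\otimes1_P-1_P\otimes1_P\otimes\mu_P)\Delta_P^{(2)}$. For $f:P\to A[-n]$ and $g:P\to A[-m]$ set $$f\circ_{\Delta_P^{(2)},\phi_P,\epsilon_P}g=f\phi_P(1_P\otimes g\otimes1_P)\Delta_P^{(2)}-(-1)^m(f\otimes g)\epsilon_P:P\to A[1-n-m],$$ $$[f,g]_{\Delta_P^{(2)},\phi_P,\epsilon_P}=f\circ_{\Delta_P^{(2)},\phi_P,\epsilon_P}g-(-1)^{(n-1)(m-1)}g\circ_{\Delta_P^{(2)},\phi_P,\epsilon_P}f.$$ Then the operation $[\,,]_{\Delta_P^{(2)},\phi_P,\epsilon_P}$ induces an operation on $\mathrm{HH}^*(A)$ that coincides with the usual Lie (Gerstenhaber) bracket on the Hochschild cohomology.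
   Context: Complexes. $A^e=A\otimes_{\mathbf{k}}A^{op}$. An $A^e$-complex is a $\mathbb{Z}$-graded $A$-bimodule $P=\bigoplus_n P_n$ with a bimodule differential $d_P$ of degree $-1$. $P[t]$ is the complex with $P[t]_n=P_{t+n}$ and $d_{P[t]}=(-1)^td_P$. A map of complexes $f:P\to Q$ is a degree-preserving bimodule homomorphism (not necessarily commuting with differentials); it is also regarded as a map $P[t]\to Q[t]$. Put $\mathbf{d}f=fd_P-d_Qf:P\to Q[-1]$ (so for $f:P\to Q[m]$, $\mathbf{d}f=fd_P-(-1)^md_Qf$); $f$ is a chain map if $\mathbf{d}f=0$. A bimodule is viewed as a complex concentrated in degree $0$. $P\otimes_AQ$ has differential $d(x\otimes y)=d_P(x)\otimes y+(-1)^ix\otimes d_Q(y)$ for $x\in P_i$. For $f:P\to P'[n]$, $g:Q\to Q'[m]$, the map $f\otimes g:P\otimes_AQ\to (P'\otimes_AQ')[n+m]$ is $(f\otimes g)(x\otimes y)=(-1)^{im}f(x)\otimes g(y)$ for $x\in P_i$. $P\otimes_AA$ and $A\otimes_AP$ are identified with $P$, and $A\otimes_AA$ with $A$. Resolutions. An $A^e$-projective resolution $(P,\mu_P)$ of $A$ is an $A^e$-complex $P$ of projective bimodules with $P_n=0$ for $n<0$, $H_n(P)=0$ for $n>0$, and a bimodule map $\mu_P:P_0\to A$ inducing $H_0(P)\cong A$ ($\mu_P$ is extended by zero to $P\to A$). A diagonal $3$-approximation is a chain map $\Delta_P^{(2)}:P\to P\otimes_AP\otimes_AP$ with $(\mu_P\otimes\mu_P\otimes\mu_P)\Delta_P^{(2)}=\mu_P$.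 Hochschild cohomology. $\mathrm{HH}^n(A)$ is the space of maps $f:P\to A[-n]$ (i.e. bimodule maps $P_n\to A$) with $fd_P=0$ modulo those of the form $hd_P$; different resolutions are identified via comparison chain maps over $A$. For the bar resolution ($\mathrm{Bar}_n(A)=A^{\otimes(n+2)}$, $d(a_0\otimes\cdots\otimes a_{n+1})=\sum_{i=0}^n(-1)^ia_0\otimes\cdots\otimes a_ia_{i+1}\otimes\cdots\otimes a_{n+1}$, $\mu$ the multiplication), cochains are $C^n(A)=\mathrm{Hom}_{\mathbf{k}}(A^{\otimes n},A)$, and the Gerstenhaber bracket of $\alpha\in C^n(A)$, $\beta\in C^m(A)$ is $[\alpha,\beta]=\alpha\circ\beta-(-1)^{(n-1)(m-1)}\beta\circ\alpha$ with $\alpha\circ\beta=\sum_{i=1}^n(-1)^{(m-1)(i-1)}\alpha\circ_i\beta$, where $(\alpha\circ_i\beta)(a_1\otimes\cdots\otimes a_{n+m-1})=\alpha(a_1\otimes\cdots\otimes a_{i-1}\otimes\beta(a_i\otimes\cdots\otimes a_{i+m-1})\otimes a_{i+m}\otimes\cdots\otimes a_{n+m-1})$ (for $m=0$ the element $\beta\in A$ is inserted in position $i$; for $n=0$, $\alpha\circ\beta=0$). *)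

theory Defs
  imports Complex_Main "HOL-Library.Poly_Mapping"
begin

section \<open>Algebras and bimodules\<close>

text \<open>The sort \<open>{ring, monoid_mult}\<close> consists of all associative unital rings, the zero ring
  included (which \<open>ring_1\<close> would exclude).\<close>

locale k_algebra = vector_space scale
  for scale :: "'k::field \<Rightarrow> 'a::{ring,monoid_mult} \<Rightarrow> 'a" +
  assumes scale_mult_left: "scale c x * y = scale c (x * y)"
    and scale_mult_right: "x * scale c y = scale c (x * y)"

text \<open>An \<open>A\<^sup>e\<close>-module is an \<open>A\<close>-\<open>A\<close>-bimodule on which the two induced actions of the
  ground field agree. The underlying set is a subgroup of an ambient type.\<close>

record ('k, 'a, 'm) bimod =
  carr :: "'m set"
  bscale :: "'k \<Rightarrow> 'm \<Rightarrow> 'm"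
  lact :: "'a \<Rightarrow> 'm \<Rightarrow> 'm"
  ract :: "'m \<Rightarrow> 'a \<Rightarrow> 'm"

definition bimodule ::
  "('k::field \<Rightarrow> 'a::{ring,monoid_mult} \<Rightarrow> 'a) \<Rightarrow> ('k, 'a, 'm::ab_group_add) bimod \<Rightarrow> bool" where
  "bimodule s M \<longleftrightarrow>
     0 \<in> carr M \<and>
     (\<forall>x\<in>carr M. \<forall>y\<in>carr M. x + y \<in> carr M) \<and>
     (\<forall>x\<in>carr M. - x \<in> carr M) \<and>
     (\<forall>a. \<forall>x\<in>carr M. lact M a x \<in> carr M \<and> ract M x a \<in> carr M) \<and>
     (\<forall>a. \<forall>x\<in>carr M. \<forall>y\<in>carr M.
        lact M a (x + y) = lact M a x + lact M a y \<and> ract M (x + y) a = ract M x a + ract M y a) \<and>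
     (\<forall>a b. \<forall>x\<in>carr M.
        lact M (a + b) x = lact M a x + lact M b x \<and> ract M x (a + b) = ract M x a + ract M x b \<and>
        lact M (a * b) x = lact M a (lact M b x) \<and> ract M x (a * b) = ract M (ract M x a) b \<and>
        lact M a (ract M x b) = ract M (lact M a x) b) \<and>
     (\<forall>x\<in>carr M. lact M 1 x = x \<and> ract M x 1 = x) \<and>
     (\<forall>c. \<forall>x\<in>carr M. lact M (s c 1) x = bscale M c x \<and> ract M x (s c 1) = bscale M c x)"

definition bimod_hom ::
  "('k, 'a, 'm::ab_group_add) bimod \<Rightarrow> ('k, 'a, 'n::ab_group_add) bimod \<Rightarrow> ('m \<Rightarrow> 'n) \<Rightarrow> bool" where
  "bimod_hom M N f \<longleftrightarrow>
     (\<forall>x\<in>carr M. f x \<in> carr N) \<and>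
     (\<forall>x\<in>carr M. \<forall>y\<in>carr M. f (x + y) = f x + f y) \<and>
     (\<forall>a. \<forall>x\<in>carr M. f (lact M a x) = lact N a (f x) \<and> f (ract M x a) = ract N (f x) a)"

section \<open>Vector spaces given by generators and relations\<close>

text \<open>\<open>'x \<Rightarrow>\<^sub>0 'k\<close> is the vector space with basis \<open>'x\<close>. Its quotient by the span of a set
  \<open>R\<close> of relations is realised inside \<open>'x \<Rightarrow>\<^sub>0 'k\<close> itself, by a linear choice
  \<open>nform R\<close> of representatives: \<open>nform R u\<close> plays the role of the coset of \<open>u\<close>
  (lemma \<open>nform_eq_iff\<close>). So quotients again live in an abelian group type, and a map out of the
  quotient that is prescribed on generators is just the linear extension \<open>lext\<close>
  (lemma \<open>lext_nform\<close>).\<close>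

definition pscale :: "'k::field \<Rightarrow> ('x \<Rightarrow>\<^sub>0 'k) \<Rightarrow> ('x \<Rightarrow>\<^sub>0 'k)" where
  "pscale c = Poly_Mapping.map ((*) c)"

lemma lookup_pscale: "Poly_Mapping.lookup (pscale c u) x = c * Poly_Mapping.lookup u x"
  unfolding pscale_def by (simp add: Poly_Mapping.map.rep_eq when_def)

global_interpretation fv: vector_space "pscale :: 'k::field \<Rightarrow> ('x \<Rightarrow>\<^sub>0 'k) \<Rightarrow> _"
  by unfold_locales
    (auto intro!: poly_mapping_eqI simp: lookup_pscale lookup_add algebra_simps)

definition gen :: "'x \<Rightarrow> ('x \<Rightarrow>\<^sub>0 'k::field)" where
  "gen x = Poly_Mapping.single x 1"

definition lext :: "('k::field \<Rightarrow> 'm \<Rightarrow> 'm) \<Rightarrow> ('x \<Rightarrow> 'm) \<Rightarrow> ('x \<Rightarrow>\<^sub>0 'k) \<Rightarrow> 'm::ab_group_add" where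
  "lext sc b u = (\<Sum>x\<in>Poly_Mapping.keys u. sc (Poly_Mapping.lookup u x) (b x))"

definition is_nform :: "('x \<Rightarrow>\<^sub>0 'k::field) set \<Rightarrow> (('x \<Rightarrow>\<^sub>0 'k) \<Rightarrow> ('x \<Rightarrow>\<^sub>0 'k)) \<Rightarrow> bool" where
  "is_nform R p \<longleftrightarrow> Vector_Spaces.linear pscale pscale p \<and>
     (\<forall>u\<in>fv.span R. p u = 0) \<and> (\<forall>u. u - p u \<in> fv.span R)"

definition nform :: "('x \<Rightarrow>\<^sub>0 'k::field) set \<Rightarrow> ('x \<Rightarrow>\<^sub>0 'k) \<Rightarrow> ('x \<Rightarrow>\<^sub>0 'k)" where
  "nform R = (SOME p. is_nform R p)"

lemma is_nform_nform:
  fixes R :: "('x \<Rightarrow>\<^sub>0 'k::field) set"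
  shows "is_nform R (nform R)"
proof -
  interpret fp: vector_space_pair "pscale :: 'k::field \<Rightarrow> ('x \<Rightarrow>\<^sub>0 'k) \<Rightarrow> _"
    "pscale :: 'k::field \<Rightarrow> ('x \<Rightarrow>\<^sub>0 'k) \<Rightarrow> _" by unfold_locales
  obtain g where g: "range g \<subseteq> fv.span R" "Vector_Spaces.linear pscale pscale g"
    "\<forall>v\<in>fv.span R. g v = v"
    using fp.linear_exists_left_inverse_on[of "\<lambda>x. x" "fv.span R"] fv.linear_ident
    by (auto simp: fv.subspace_span)
  have "is_nform R (\<lambda>x. x - g x)"
    unfolding is_nform_def
    using g fp.linear_compose_sub[OF fv.linear_ident g(2)] by auto
  then show ?thesis
    unfolding nform_def by (rule someI[where P = "is_nform R"])
qed

lemma nform_eq_iff: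
  fixes R :: "('x \<Rightarrow>\<^sub>0 'k::field) set"
  shows "nform R u = nform R v \<longleftrightarrow> u - v \<in> fv.span R"
proof -
  interpret fp: vector_space_pair "pscale :: 'k::field \<Rightarrow> ('x \<Rightarrow>\<^sub>0 'k) \<Rightarrow> _"
    "pscale :: 'k::field \<Rightarrow> ('x \<Rightarrow>\<^sub>0 'k) \<Rightarrow> _" by unfold_locales
  have n: "is_nform R (nform R)" by (rule is_nform_nform)
  have d: "nform R (u - v) = nform R u - nform R v"
    using n fp.linear_diff unfolding is_nform_def by blast
  show ?thesis
  proof
    assume "nform R u = nform R v"
    then have "nform R (u - v) = 0" using d by simp
    then show "u - v \<in> fv.span R"
      using n unfolding is_nform_def by (metis diff_zero)
  next
    assume "u - v \<in> fv.span R"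
    then have "nform R (u - v) = 0" using n unfolding is_nform_def by blast
    then show "nform R u = nform R v" using d by simp
  qed
qed

lemma linear_lext:
  assumes "vector_space sc"
  shows "Vector_Spaces.linear pscale sc (lext sc b)"
proof -
  interpret V: vector_space sc by fact
  have *: "lext sc b u = (\<Sum>x\<in>S. sc (Poly_Mapping.lookup u x) (b x))"
    if "finite S" "Poly_Mapping.keys u \<subseteq> S" for S u
    unfolding lext_def using that
    by (intro sum.mono_neutral_left) (auto simp: in_keys_iff)
  show ?thesis
  proof (unfold_locales, goal_cases)
    case (1 u v)
    let ?S = "Poly_Mapping.keys u \<union> Poly_Mapping.keys v"
    show ?case
      using *[of ?S u] *[of ?S v] *[of ?S "u + v"] keys_add[of u v]
      by (simp add: lookup_add V.scale_left_distrib sum.distrib)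
  next
    case (2 c u)
    have "Poly_Mapping.keys (pscale c u) \<subseteq> Poly_Mapping.keys u"
      by (auto simp: in_keys_iff lookup_pscale)
    then show ?case
      using *[of "Poly_Mapping.keys u" u] *[of "Poly_Mapping.keys u" "pscale c u"]
      by (simp add: lookup_pscale V.scale_sum_right)
  qed
qed

lemma lext_nform:
  assumes "vector_space sc" and "\<And>r. r \<in> R \<Longrightarrow> lext sc b r = 0"
  shows "lext sc b (nform R u) = lext sc b u"
proof -
  interpret V: vector_space sc by fact
  interpret fp: vector_space_pair "pscale :: _ \<Rightarrow> (_ \<Rightarrow>\<^sub>0 _) \<Rightarrow> _" sc by unfold_locales
  have l: "Vector_Spaces.linear pscale sc (lext sc b)" by (rule linear_lext) fact
  have "u - nform R u \<in> fv.span R" using is_nform_nform unfolding is_nform_def by blast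
  then have "lext sc b (u - nform R u) = 0"
    using fp.linear_eq_0_on_span[OF l assms(2)] by blast
  then show ?thesis using fp.linear_diff[OF l] by auto
qed

section \<open>Projective bimodules\<close>

text \<open>The free bimodule with basis \<open>X\<close> is \<open>\<Oplus>\<^sub>X A \<otimes>\<^sub>k A\<close>; the generator \<open>(a, x, b)\<close> stands
  for \<open>a \<otimes> b\<close> in the summand of \<open>x\<close>, that is for \<open>a \<cdot> x \<cdot> b\<close>.\<close>

definition free_rel ::
  "('k::field \<Rightarrow> 'a::{ring,monoid_mult} \<Rightarrow> 'a) \<Rightarrow> ('a \<times> 'x \<times> 'a \<Rightarrow>\<^sub>0 'k) set" where
  "free_rel s =
     {gen (a + a', x, b) - gen (a, x, b) - gen (a', x, b) | a a' x b. True} \<union>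
     {gen (a, x, b + b') - gen (a, x, b) - gen (a, x, b') | a x b b'. True} \<union>
     {gen (s c a, x, b) - pscale c (gen (a, x, b)) | c a x b. True} \<union>
     {gen (a, x, s c b) - pscale c (gen (a, x, b)) | c a x b. True}"

definition free_bimod ::
  "('k::field \<Rightarrow> 'a::{ring,monoid_mult} \<Rightarrow> 'a) \<Rightarrow> 'x set \<Rightarrow> ('k, 'a, 'a \<times> 'x \<times> 'a \<Rightarrow>\<^sub>0 'k) bimod" where
  "free_bimod s X =
    \<lparr> carr = fv.span {nform (free_rel s) (gen (a, x, b)) | a x b. x \<in> X},
      bscale = pscale,
      lact = (\<lambda>a'. lext pscale (\<lambda>(a, x, b). nform (free_rel s) (gen (a' * a, x, b)))),
      ract = (\<lambda>u b'. lext pscale (\<lambda>(a, x, b). nform (free_rel s) (gen (a, x, b * b'))) u) \<rparr>"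

text \<open>Projective means: direct summand of a free bimodule. Bases taken from the ambient type
  of \<open>M\<close> suffice, since a projective \<open>M\<close> is a summand of the free bimodule on its own
  underlying set.\<close>

definition projective_bimod ::
  "('k::field \<Rightarrow> 'a::{ring,monoid_mult} \<Rightarrow> 'a) \<Rightarrow> ('k, 'a, 'm::ab_group_add) bimod \<Rightarrow> bool" where
  "projective_bimod s M \<longleftrightarrow> bimodule s M \<and>
     (\<exists>(X :: 'm set) i r. bimod_hom M (free_bimod s X) i \<and> bimod_hom (free_bimod s X) M r \<and>
        (\<forall>x\<in>carr M. r (i x) = x))"

section \<open>Complexes and their maps\<close>

text \<open>\<open>diff P n\<close> is the differential from degree \<open>n\<close> to degree \<open>n - 1\<close>. A map
  \<open>P \<rightarrow> Q[t]\<close> is a family \<open>f\<close> with \<open>f i : P\<^sub>i \<rightarrow> Q\<^bsub>i+t\<^esub>\<close>. Families are only meaningful on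
  the carriers.\<close>

record ('k, 'a, 'm) cplx =
  obj :: "int \<Rightarrow> ('k, 'a, 'm) bimod"
  diff :: "int \<Rightarrow> 'm \<Rightarrow> 'm"

definition ksgn :: "int \<Rightarrow> 'm::ab_group_add \<Rightarrow> 'm" where
  "ksgn n x = (if even n then x else - x)"

definition is_complex ::
  "('k::field \<Rightarrow> 'a::{ring,monoid_mult} \<Rightarrow> 'a) \<Rightarrow> ('k, 'a, 'm::ab_group_add) cplx \<Rightarrow> bool" where
  "is_complex s P \<longleftrightarrow>
     (\<forall>n. bimodule s (obj P n) \<and> bimod_hom (obj P n) (obj P (n - 1)) (diff P n)) \<and>
     (\<forall>n. \<forall>x\<in>carr (obj P n). diff P (n - 1) (diff P n x) = 0)"

definition deg_hom ::
  "('k, 'a, 'm::ab_group_add) cplx \<Rightarrow> ('k, 'a, 'n::ab_group_add) cplx \<Rightarrow> int \<Rightarrow>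
    (int \<Rightarrow> 'm \<Rightarrow> 'n) \<Rightarrow> bool" where
  "deg_hom P Q t f \<longleftrightarrow> (\<forall>i. bimod_hom (obj P i) (obj Q (i + t)) (f i))"

text \<open>\<open>bd P Q m f\<close> is \<open>f d\<^sub>P - (-1)\<^sup>m d\<^sub>Q f\<close>, for \<open>f : P \<rightarrow> Q[m]\<close>.\<close>

definition bd ::
  "('k, 'a, 'm::ab_group_add) cplx \<Rightarrow> ('k, 'a, 'n::ab_group_add) cplx \<Rightarrow> int \<Rightarrow>
    (int \<Rightarrow> 'm \<Rightarrow> 'n) \<Rightarrow> (int \<Rightarrow> 'm \<Rightarrow> 'n)" where
  "bd P Q m f = (\<lambda>i x. f (i - 1) (diff P i x) - ksgn m (diff Q (i + m) (f i x)))"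

definition eq_on :: "('k, 'a, 'm) cplx \<Rightarrow> (int \<Rightarrow> 'm \<Rightarrow> 'n) \<Rightarrow> (int \<Rightarrow> 'm \<Rightarrow> 'n) \<Rightarrow> bool" where
  "eq_on P f g \<longleftrightarrow> (\<forall>i. \<forall>x\<in>carr (obj P i). f i x = g i x)"

definition chain_map ::
  "('k, 'a, 'm::ab_group_add) cplx \<Rightarrow> ('k, 'a, 'n::ab_group_add) cplx \<Rightarrow> (int \<Rightarrow> 'm \<Rightarrow> 'n) \<Rightarrow> bool" where
  "chain_map P Q f \<longleftrightarrow> deg_hom P Q 0 f \<and> eq_on P (bd P Q 0 f) (\<lambda>i x. 0)"

abbreviation idm :: "int \<Rightarrow> 'm \<Rightarrow> 'm" where
  "idm \<equiv> (\<lambda>i x. x)"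

definition alg_bimod ::
  "('k::field \<Rightarrow> 'a::{ring,monoid_mult} \<Rightarrow> 'a) \<Rightarrow> 'a set \<Rightarrow> ('k, 'a, 'a) bimod" where
  "alg_bimod s C = \<lparr> carr = C, bscale = s, lact = (*), ract = (*) \<rparr>"

definition alg_cplx ::
  "('k::field \<Rightarrow> 'a::{ring,monoid_mult} \<Rightarrow> 'a) \<Rightarrow> ('k, 'a, 'a) cplx" where
  "alg_cplx s = \<lparr> obj = (\<lambda>n. alg_bimod s (if n = 0 then UNIV else {0})), diff = (\<lambda>n x. 0) \<rparr>"

definition zext :: "('m \<Rightarrow> 'a::zero) \<Rightarrow> (int \<Rightarrow> 'm \<Rightarrow> 'a)" where
  "zext h = (\<lambda>i x. if i = 0 then h x else 0)"

section \<open>Tensor products over the algebra\<close>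

text \<open>The degree \<open>n\<close> part of \<open>P \<otimes>\<^sub>A Q\<close> is presented by the generators \<open>((i, x), (j, y))\<close>
  with \<open>i + j = n\<close>, \<open>x \<in> P\<^sub>i\<close>, \<open>y \<in> Q\<^sub>j\<close>.\<close>

type_synonym ('k, 'm, 'n) tens = "(int \<times> 'm) \<times> (int \<times> 'n) \<Rightarrow>\<^sub>0 'k"

definition tens_rel ::
  "('k::field, 'a, 'm::ab_group_add) cplx \<Rightarrow> ('k, 'a, 'n::ab_group_add) cplx \<Rightarrow> int \<Rightarrow>
    ('k, 'm, 'n) tens set" where
  "tens_rel P Q n =
     {gen ((i, x + x'), (j, y)) - gen ((i, x), (j, y)) - gen ((i, x'), (j, y)) | i j x x' y.
        i + j = n \<and> x \<in> carr (obj P i) \<and> x' \<in> carr (obj P i) \<and> y \<in> carr (obj Q j)} \<union>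
     {gen ((i, x), (j, y + y')) - gen ((i, x), (j, y)) - gen ((i, x), (j, y')) | i j x y y'.
        i + j = n \<and> x \<in> carr (obj P i) \<and> y \<in> carr (obj Q j) \<and> y' \<in> carr (obj Q j)} \<union>
     {gen ((i, ract (obj P i) x a), (j, y)) - gen ((i, x), (j, lact (obj Q j) a y)) | i j x a y.
        i + j = n \<and> x \<in> carr (obj P i) \<and> y \<in> carr (obj Q j)} \<union>
     {gen ((i, bscale (obj P i) c x), (j, y)) - pscale c (gen ((i, x), (j, y))) | i j c x y.
        i + j = n \<and> x \<in> carr (obj P i) \<and> y \<in> carr (obj Q j)}"

definition tprod ::
  "('k::field, 'a, 'm::ab_group_add) cplx \<Rightarrow> ('k, 'a, 'n::ab_group_add) cplx \<Rightarrow>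
    int \<Rightarrow> 'm \<Rightarrow> int \<Rightarrow> 'n \<Rightarrow> ('k, 'm, 'n) tens" where
  "tprod P Q i x j y = nform (tens_rel P Q (i + j)) (gen ((i, x), (j, y)))"

definition tensor ::
  "('k::field, 'a, 'm::ab_group_add) cplx \<Rightarrow> ('k, 'a, 'n::ab_group_add) cplx \<Rightarrow>
    ('k, 'a, ('k, 'm, 'n) tens) cplx"  (infixl \<open>\<otimes>\<close> 70) where
  "P \<otimes> Q =
    \<lparr> obj = (\<lambda>n.
        \<lparr> carr = fv.span {tprod P Q i x j y | i x j y.
            i + j = n \<and> x \<in> carr (obj P i) \<and> y \<in> carr (obj Q j)},
          bscale = pscale,
          lact = (\<lambda>a. lext pscale (\<lambda>((i, x), (j, y)). tprod P Q i (lact (obj P i) a x) j y)),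
          ract = (\<lambda>t a. lext pscale (\<lambda>((i, x), (j, y)). tprod P Q i x j (ract (obj Q j) y a)) t) \<rparr>),
      diff = (\<lambda>n. lext pscale (\<lambda>((i, x), (j, y)).
          tprod P Q (i - 1) (diff P i x) j y + ksgn i (tprod P Q i x (j - 1) (diff Q j y)))) \<rparr>"

text \<open>\<open>tmap P' Q' n m f g\<close> is \<open>f \<otimes> g\<close> with its Koszul sign, for \<open>f : P \<rightarrow> P'[n]\<close> and
  \<open>g : Q \<rightarrow> Q'[m]\<close>.\<close>

definition tmap ::
  "('k::field, 'a, 'm1::ab_group_add) cplx \<Rightarrow> ('k, 'a, 'n1::ab_group_add) cplx \<Rightarrow> int \<Rightarrow> int \<Rightarrow>
    (int \<Rightarrow> 'm \<Rightarrow> 'm1) \<Rightarrow> (int \<Rightarrow> 'n \<Rightarrow> 'n1) \<Rightarrow>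
    (int \<Rightarrow> ('k, 'm, 'n) tens \<Rightarrow> ('k, 'm1, 'n1) tens)" where
  "tmap P' Q' n m f g = (\<lambda>k. lext pscale (\<lambda>((i, x), (j, y)).
     ksgn (i * m) (tprod P' Q' (i + n) (f i x) (j + m) (g j y))))"

text \<open>The identifications \<open>A \<otimes>\<^sub>A P = P\<close> and \<open>P \<otimes>\<^sub>A A = P\<close>.\<close>

definition lunit ::
  "('k::field, 'a, 'm::ab_group_add) cplx \<Rightarrow> (int \<Rightarrow> ('k, 'a, 'm) tens \<Rightarrow> 'm)" where
  "lunit P = (\<lambda>n. lext (bscale (obj P n)) (\<lambda>((i, a), (j, x)). lact (obj P j) a x))"

definition runit ::
  "('k::field, 'a, 'm::ab_group_add) cplx \<Rightarrow> (int \<Rightarrow> ('k, 'm, 'a) tens \<Rightarrow> 'm)" where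
  "runit P = (\<lambda>n. lext (bscale (obj P n)) (\<lambda>((i, x), (j, a)). ract (obj P i) x a))"

section \<open>Resolutions\<close>

text \<open>As \<open>P\<^bsub>-1\<^esub> = 0\<close>, \<open>H\<^sub>0(P)\<close> is \<open>P\<^sub>0\<close> modulo the image of \<open>P\<^sub>1\<close>.\<close>

definition proj_resolution ::
  "('k::field \<Rightarrow> 'a::{ring,monoid_mult} \<Rightarrow> 'a) \<Rightarrow> ('k, 'a, 'm::ab_group_add) cplx \<Rightarrow>
    ('m \<Rightarrow> 'a) \<Rightarrow> bool" where
  "proj_resolution s P \<mu> \<longleftrightarrow>
     is_complex s P \<and>
     (\<forall>n. projective_bimod s (obj P n)) \<and>
     (\<forall>n<0. carr (obj P n) = {0}) \<and>
     (\<forall>n>0. {x \<in> carr (obj P n). diff P n x = 0} = diff P (n + 1) ` carr (obj P (n + 1))) \<and>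
     bimod_hom (obj P 0) (alg_bimod s UNIV) \<mu> \<and>
     \<mu> ` carr (obj P 0) = UNIV \<and>
     {x \<in> carr (obj P 0). \<mu> x = 0} = diff P 1 ` carr (obj P 1)"

definition comparison ::
  "('k, 'a, 'm::ab_group_add) cplx \<Rightarrow> ('m \<Rightarrow> 'a) \<Rightarrow> ('k, 'a, 'n::ab_group_add) cplx \<Rightarrow> ('n \<Rightarrow> 'a) \<Rightarrow>
    (int \<Rightarrow> 'm \<Rightarrow> 'n) \<Rightarrow> bool" where
  "comparison P \<mu> Q \<nu> \<Psi> \<longleftrightarrow> chain_map P Q \<Psi> \<and> (\<forall>x\<in>carr (obj P 0). \<nu> (\<Psi> 0 x) = \<mu> x)"

definition diag3_approx ::
  "('k::field \<Rightarrow> 'a::{ring,monoid_mult} \<Rightarrow> 'a) \<Rightarrow> ('k, 'a, 'm::ab_group_add) cplx \<Rightarrow>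
    ('m \<Rightarrow> 'a) \<Rightarrow> (int \<Rightarrow> 'm \<Rightarrow> ('k, ('k, 'm, 'm) tens, 'm) tens) \<Rightarrow> bool" where
  "diag3_approx s P \<mu> \<Delta> \<longleftrightarrow>
     (let A = alg_cplx s;
          \<mu>\<mu> = (\<lambda>i t. lunit A i (tmap A A 0 0 (zext \<mu>) (zext \<mu>) i t));
          \<mu>\<mu>\<mu> = (\<lambda>i t. lunit A i (tmap A A 0 0 \<mu>\<mu> (zext \<mu>) i t))
      in chain_map P (P \<otimes> P \<otimes> P) \<Delta> \<and> eq_on P (\<lambda>i x. \<mu>\<mu>\<mu> i (\<Delta> i x)) (zext \<mu>))"

definition phi_condition ::
  "('k::field \<Rightarrow> 'a::{ring,monoid_mult} \<Rightarrow> 'a) \<Rightarrow> ('k, 'a, 'm::ab_group_add) cplx \<Rightarrow>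
    ('m \<Rightarrow> 'a) \<Rightarrow> (int \<Rightarrow> ('k, 'm, 'm) tens \<Rightarrow> 'm) \<Rightarrow> bool" where
  "phi_condition s P \<mu> \<phi> \<longleftrightarrow>
     deg_hom (P \<otimes> P) P 1 \<phi> \<and>
     eq_on (P \<otimes> P) (bd (P \<otimes> P) P 1 \<phi>)
       (\<lambda>i t. lunit P i (tmap (alg_cplx s) P 0 0 (zext \<mu>) idm i t)
            - runit P i (tmap P (alg_cplx s) 0 0 idm (zext \<mu>) i t))"

definition eps_condition ::
  "('k::field \<Rightarrow> 'a::{ring,monoid_mult} \<Rightarrow> 'a) \<Rightarrow> ('k, 'a, 'm::ab_group_add) cplx \<Rightarrow>
    ('m \<Rightarrow> 'a) \<Rightarrow> (int \<Rightarrow> 'm \<Rightarrow> ('k, ('k, 'm, 'm) tens, 'm) tens) \<Rightarrow>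
    (int \<Rightarrow> 'm \<Rightarrow> ('k, 'm, 'm) tens) \<Rightarrow> bool" where
  "eps_condition s P \<mu> \<Delta> \<epsilon> \<longleftrightarrow>
     (let \<mu>1 = (\<lambda>i t. lunit P i (tmap (alg_cplx s) P 0 0 (zext \<mu>) idm i t));
          \<mu>11 = tmap P P 0 0 \<mu>1 idm;
          oneone\<mu> = (\<lambda>i t. runit (P \<otimes> P) i (tmap (P \<otimes> P) (alg_cplx s) 0 0 idm (zext \<mu>) i t))
      in deg_hom P (P \<otimes> P) 1 \<epsilon> \<and>
         eq_on P (bd P (P \<otimes> P) 1 \<epsilon>) (\<lambda>i x. \<mu>11 i (\<Delta> i x) - oneone\<mu> i (\<Delta> i x)))"

section \<open>Hochschild cohomology\<close>

definition cocycles ::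
  "('k::field \<Rightarrow> 'a::{ring,monoid_mult} \<Rightarrow> 'a) \<Rightarrow> ('k, 'a, 'm::ab_group_add) cplx \<Rightarrow> int \<Rightarrow>
    (int \<Rightarrow> 'm \<Rightarrow> 'a) set" where
  "cocycles s P n =
     {f. deg_hom P (alg_cplx s) (- n) f \<and> eq_on P (\<lambda>i x. f (i - 1) (diff P i x)) (\<lambda>i x. 0)}"

definition hh_rel ::
  "('k::field \<Rightarrow> 'a::{ring,monoid_mult} \<Rightarrow> 'a) \<Rightarrow> ('k, 'a, 'm::ab_group_add) cplx \<Rightarrow> int \<Rightarrow>
    ((int \<Rightarrow> 'm \<Rightarrow> 'a) \<times> (int \<Rightarrow> 'm \<Rightarrow> 'a)) set" where
  "hh_rel s P n =
     {(f, g). f \<in> cocycles s P n \<and> g \<in> cocycles s P n \<and>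
        (\<exists>h. deg_hom P (alg_cplx s) (1 - n) h \<and>
             eq_on P (\<lambda>i x. f i x - g i x) (\<lambda>i x. h (i - 1) (diff P i x)))}"

definition HH ::
  "('k::field \<Rightarrow> 'a::{ring,monoid_mult} \<Rightarrow> 'a) \<Rightarrow> ('k, 'a, 'm::ab_group_add) cplx \<Rightarrow> int \<Rightarrow>
    (int \<Rightarrow> 'm \<Rightarrow> 'a) set set" where
  "HH s P n = cocycles s P n // hh_rel s P n"

text \<open>The map \<open>HH(P) \<rightarrow> HH(Q)\<close>, \<open>[f] \<mapsto> [f \<Psi>]\<close>, induced by \<open>\<Psi> : Q \<rightarrow> P\<close>.\<close>

definition hh_map ::
  "('k::field \<Rightarrow> 'a::{ring,monoid_mult} \<Rightarrow> 'a) \<Rightarrow> ('k, 'a, 'n::ab_group_add) cplx \<Rightarrow>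
    (int \<Rightarrow> 'n \<Rightarrow> 'm) \<Rightarrow> int \<Rightarrow> (int \<Rightarrow> 'm \<Rightarrow> 'a) set \<Rightarrow> (int \<Rightarrow> 'n \<Rightarrow> 'a) set" where
  "hh_map s Q \<Psi> n X = (\<Union>f\<in>X. hh_rel s Q n `` {\<lambda>i x. f i (\<Psi> i x)})"

text \<open>The operation on classes induced by an operation \<open>B\<close> on cocycles, of degrees \<open>n\<close> and
  \<open>m\<close>, with values in degree \<open>n + m - 1\<close>.\<close>

definition hh_op ::
  "('k::field \<Rightarrow> 'a::{ring,monoid_mult} \<Rightarrow> 'a) \<Rightarrow> ('k, 'a, 'm::ab_group_add) cplx \<Rightarrow>
    ((int \<Rightarrow> 'm \<Rightarrow> 'a) \<Rightarrow> (int \<Rightarrow> 'm \<Rightarrow> 'a) \<Rightarrow> (int \<Rightarrow> 'm \<Rightarrow> 'a)) \<Rightarrow> int \<Rightarrow> int \<Rightarrow>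
    (int \<Rightarrow> 'm \<Rightarrow> 'a) set \<Rightarrow> (int \<Rightarrow> 'm \<Rightarrow> 'a) set \<Rightarrow> (int \<Rightarrow> 'm \<Rightarrow> 'a) set" where
  "hh_op s P B n m X Y = (\<Union>f\<in>X. \<Union>g\<in>Y. hh_rel s P (n + m - 1) `` {B f g})"

section \<open>The bracket attached to a diagonal approximation\<close>

definition circ_P ::
  "('k::field \<Rightarrow> 'a::{ring,monoid_mult} \<Rightarrow> 'a) \<Rightarrow> ('k, 'a, 'm::ab_group_add) cplx \<Rightarrow>
    (int \<Rightarrow> 'm \<Rightarrow> ('k, ('k, 'm, 'm) tens, 'm) tens) \<Rightarrow> (int \<Rightarrow> ('k, 'm, 'm) tens \<Rightarrow> 'm) \<Rightarrow>
    (int \<Rightarrow> 'm \<Rightarrow> ('k, 'm, 'm) tens) \<Rightarrow> int \<Rightarrow> int \<Rightarrow>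
    (int \<Rightarrow> 'm \<Rightarrow> 'a) \<Rightarrow> (int \<Rightarrow> 'm \<Rightarrow> 'a) \<Rightarrow> (int \<Rightarrow> 'm \<Rightarrow> 'a)" where
  "circ_P s P \<Delta> \<phi> \<epsilon> n m f g =
     (let A = alg_cplx s;
          oneg = (\<lambda>i t. runit P (i - m) (tmap P A 0 (- m) idm g i t));
          oneg1 = tmap P P (- m) 0 oneg idm;
          fg = (\<lambda>i t. lunit A (i - n - m) (tmap A A (- n) (- m) f g i t))
      in (\<lambda>i x. f (i - m + 1) (\<phi> (i - m) (oneg1 i (\<Delta> i x))) - ksgn m (fg (i + 1) (\<epsilon> i x))))"

definition bracket_P ::
  "('k::field \<Rightarrow> 'a::{ring,monoid_mult} \<Rightarrow> 'a) \<Rightarrow> ('k, 'a, 'm::ab_group_add) cplx \<Rightarrow>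
    (int \<Rightarrow> 'm \<Rightarrow> ('k, ('k, 'm, 'm) tens, 'm) tens) \<Rightarrow> (int \<Rightarrow> ('k, 'm, 'm) tens \<Rightarrow> 'm) \<Rightarrow>
    (int \<Rightarrow> 'm \<Rightarrow> ('k, 'm, 'm) tens) \<Rightarrow> int \<Rightarrow> int \<Rightarrow>
    (int \<Rightarrow> 'm \<Rightarrow> 'a) \<Rightarrow> (int \<Rightarrow> 'm \<Rightarrow> 'a) \<Rightarrow> (int \<Rightarrow> 'm \<Rightarrow> 'a)" where
  "bracket_P s P \<Delta> \<phi> \<epsilon> n m f g = (\<lambda>i x.
     circ_P s P \<Delta> \<phi> \<epsilon> n m f g i x - ksgn ((n - 1) * (m - 1)) (circ_P s P \<Delta> \<phi> \<epsilon> m n g f i x))"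

section \<open>The bar resolution and the Gerstenhaber bracket\<close>

text \<open>\<open>A\<^bsup>\<otimes>N\<^esup>\<close> is presented by the lists of length \<open>N\<close>.\<close>

definition bar_rel ::
  "('k::field \<Rightarrow> 'a::{ring,monoid_mult} \<Rightarrow> 'a) \<Rightarrow> nat \<Rightarrow> ('a list \<Rightarrow>\<^sub>0 'k) set" where
  "bar_rel s N =
     {gen (xs @ [a + b] @ ys) - gen (xs @ [a] @ ys) - gen (xs @ [b] @ ys) | xs a b ys.
        length xs + 1 + length ys = N} \<union>
     {gen (xs @ [s c a] @ ys) - pscale c (gen (xs @ [a] @ ys)) | xs c a ys.
        length xs + 1 + length ys = N}"

definition btens ::
  "('k::field \<Rightarrow> 'a::{ring,monoid_mult} \<Rightarrow> 'a) \<Rightarrow> 'a list \<Rightarrow> ('a list \<Rightarrow>\<^sub>0 'k)" where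
  "btens s xs = nform (bar_rel s (length xs)) (gen xs)"

definition bar_cplx ::
  "('k::field \<Rightarrow> 'a::{ring,monoid_mult} \<Rightarrow> 'a) \<Rightarrow> ('k, 'a, 'a list \<Rightarrow>\<^sub>0 'k) cplx" where
  "bar_cplx s =
    \<lparr> obj = (\<lambda>n.
        \<lparr> carr = (if n < 0 then {0} else fv.span {btens s xs | xs. int (length xs) = n + 2}),
          bscale = pscale,
          lact = (\<lambda>a. lext pscale (\<lambda>xs. btens s ((a * hd xs) # tl xs))),
          ract = (\<lambda>t a. lext pscale (\<lambda>xs. btens s (butlast xs @ [last xs * a])) t) \<rparr>),
      diff = (\<lambda>n. if n \<le> 0 then (\<lambda>t. 0) else lext pscale (\<lambda>xs.
          \<Sum>i<length xs - 1. ksgn (int i)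
             (btens s (take i xs @ [xs ! i * xs ! (i + 1)] @ drop (i + 2) xs)))) \<rparr>"

definition bar_aug ::
  "('k::field \<Rightarrow> 'a::{ring,monoid_mult} \<Rightarrow> 'a) \<Rightarrow> ('a list \<Rightarrow>\<^sub>0 'k) \<Rightarrow> 'a" where
  "bar_aug s = lext s (\<lambda>xs. hd xs * last xs)"

text \<open>\<open>C\<^sup>n(A)\<close> consists of the \<open>k\<close>-multilinear functions on lists of length \<open>n\<close>; values
  on other lists are irrelevant. It is identified with the maps \<open>Bar(A) \<rightarrow> A[-n]\<close> by
  \<open>\<alpha> \<mapsto> (a\<^sub>0 \<otimes> w \<otimes> b \<mapsto> a\<^sub>0 \<alpha>(w) b)\<close>.\<close>

definition to_cochain ::
  "('k::field \<Rightarrow> 'a::{ring,monoid_mult} \<Rightarrow> 'a) \<Rightarrow> nat \<Rightarrow>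
    (int \<Rightarrow> ('a list \<Rightarrow>\<^sub>0 'k) \<Rightarrow> 'a) \<Rightarrow> ('a list \<Rightarrow> 'a)" where
  "to_cochain s n f = (\<lambda>w. f (int n) (btens s ([1] @ w @ [1])))"

definition of_cochain ::
  "('k::field \<Rightarrow> 'a::{ring,monoid_mult} \<Rightarrow> 'a) \<Rightarrow> int \<Rightarrow>
    ('a list \<Rightarrow> 'a) \<Rightarrow> (int \<Rightarrow> ('a list \<Rightarrow>\<^sub>0 'k) \<Rightarrow> 'a)" where
  "of_cochain s n \<alpha> = (\<lambda>i t.
     if i = n then lext s (\<lambda>xs. hd xs * \<alpha> (butlast (tl xs)) * last xs) t else 0)"

text \<open>\<open>gcirc_at m i \<alpha> \<beta>\<close> is \<open>\<alpha> \<circ>\<^sub>i \<beta>\<close> for \<open>\<beta> \<in> C\<^sup>m(A)\<close>; positions \<open>i\<close> start at 1.\<close>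

definition gcirc_at ::
  "nat \<Rightarrow> nat \<Rightarrow> ('a list \<Rightarrow> 'a) \<Rightarrow> ('a list \<Rightarrow> 'a) \<Rightarrow> ('a list \<Rightarrow> 'a)" where
  "gcirc_at m i \<alpha> \<beta> = (\<lambda>w.
     \<alpha> (take (i - 1) w @ [\<beta> (take m (drop (i - 1) w))] @ drop (i - 1 + m) w))"

definition gcirc ::
  "nat \<Rightarrow> nat \<Rightarrow> ('a list \<Rightarrow> 'a::ring) \<Rightarrow> ('a list \<Rightarrow> 'a) \<Rightarrow> ('a list \<Rightarrow> 'a)" where
  "gcirc n m \<alpha> \<beta> = (\<lambda>w. \<Sum>i = 1..n. ksgn ((int m - 1) * (int i - 1)) (gcirc_at m i \<alpha> \<beta> w))"

definition gbracket ::
  "nat \<Rightarrow> nat \<Rightarrow> ('a list \<Rightarrow> 'a::ring) \<Rightarrow> ('a list \<Rightarrow> 'a) \<Rightarrow> ('a list \<Rightarrow> 'a)" where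
  "gbracket n m \<alpha> \<beta> = (\<lambda>w.
     gcirc n m \<alpha> \<beta> w - ksgn ((int n - 1) * (int m - 1)) (gcirc m n \<beta> \<alpha> w))"

definition bar_bracket ::
  "('k::field \<Rightarrow> 'a::{ring,monoid_mult} \<Rightarrow> 'a) \<Rightarrow> nat \<Rightarrow> nat \<Rightarrow>
    (int \<Rightarrow> ('a list \<Rightarrow>\<^sub>0 'k) \<Rightarrow> 'a) \<Rightarrow> (int \<Rightarrow> ('a list \<Rightarrow>\<^sub>0 'k) \<Rightarrow> 'a) \<Rightarrow>
    (int \<Rightarrow> ('a list \<Rightarrow>\<^sub>0 'k) \<Rightarrow> 'a)" where
  "bar_bracket s n m f g =
     of_cochain s (int n + int m - 1) (gbracket n m (to_cochain s n f) (to_cochain s m g))"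

end

theory Submission
  imports Defs
begin

text \<open>Let \<open>\<Delta> : Q \<rightarrow> Q \<otimes>\<^sub>A Q\<close> be a diagonal map on a resolution \<open>Q\<close> of \<open>A\<close>. For a cocycle \<open>g\<close> of degree
  \<open>m\<close> the map \<open>\<delta>\<^sub>g \<Delta>\<close> with \<open>\<delta>\<^sub>g = g \<otimes> 1 - 1 \<otimes> g\<close> is null homotopic, and a null homotopy
  \<open>\<psi>\<^sub>g : Q \<rightarrow> Q[1-m]\<close>, normalised on \<open>\<mu> \<psi>\<^sub>g\<close>, is unique up to homotopy. The bracket of \<open>f\<close> and \<open>g\<close> is the
  graded commutator \<open>f \<psi>\<^sub>g \<mp> g \<psi>\<^sub>f\<close>. Changing \<open>\<Delta>\<close> by a homotopy \<open>Z\<close>, or the resolution by a chain map,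
  changes \<open>f \<psi>\<^sub>g\<close> by \<open>\<plusminus> f \<delta>\<^sub>g Z\<close> modulo coboundaries; since \<open>f \<delta>\<^sub>g = \<mp> g \<delta>\<^sub>f\<close>, these errors cancel in
  the commutator, so the bracket on cohomology depends on no choice.

  The operation of the theorem is of this form for \<open>\<Delta> = (\<mu> \<otimes> 1 \<otimes> 1) \<Delta>\<^sub>P\<close>, the liftings being built
  from \<open>\<phi>\<^sub>P\<close> and \<open>\<epsilon>\<^sub>P\<close>. On the bar resolution with its usual diagonal, inserting \<open>g\<close> into a tensor at
  all positions is a lifting, and the commutator is Gerstenhaber's formula.\<close>

text \<open>The equation of a lifting leaves a class in degree \<open>m - 1\<close> undetermined,
  because a map that commutes with the differentials up to sign can be added to
  \<open>\<psi>\<close>. Its augmentation must therefore be prescribed. Applying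
  \<open>\<nu>\<close> to the equation and exchanging \<open>\<nu>\<close> with \<open>g\<close>
  shows that \<open>\<nu> \<psi> + (-1)^m g \<kappa>\<close> is a cocycle, where
  \<open>\<kappa>\<close> is a homotopy between \<open>(\<nu> \<otimes> 1) Dl\<close> and
  \<open>(1 \<otimes> \<nu>) Dl\<close>; the normalisation asks it to be a coboundary. On the bar
  resolution \<open>\<kappa> = 0\<close>, but the diagonal cut out of a 3-approximation is counital
  only up to homotopy, and \<open>\<epsilon>\<close> supplies that homotopy. Comparing diagonals
  requires an acyclic tensor square as target. For \<open>Bar \<otimes> Bar\<close> an explicit
  contraction gives this; for \<open>P \<otimes> P\<close> a Kuenneth argument would be required.
  Hence liftings are compared along a map \<open>P \<rightarrow> Bar\<close>, although the statement
  concerns an arbitrary map \<open>Bar \<rightarrow> P\<close>; the two are homotopy inverse, and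
  independence of representatives closes the gap.\<close>

abbreviation crr :: "('k, 'a, 'm) cplx \<Rightarrow> int \<Rightarrow> 'm set" where
  "crr P i \<equiv> carr (obj P i)"

section \<open>Signs and linear extension\<close>

lemma ksgn_0 [simp]: "ksgn 0 x = x"
  and ksgn_zero [simp]: "ksgn n 0 = 0"
  by (auto simp: ksgn_def)

lemma ksgn_add: "ksgn n (x + y) = ksgn n x + ksgn n y"
  and ksgn_diff: "ksgn n (x - y) = ksgn n x - ksgn n y"
  and ksgn_minus: "ksgn n (- x) = - ksgn n x"
  by (auto simp: ksgn_def)

lemma ksgn_ksgn: "ksgn m (ksgn n x) = ksgn (m + n) x"
  by (auto simp: ksgn_def)

lemma ksgn_self [simp]: "ksgn n (ksgn n x) = x"
  by (auto simp: ksgn_def)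

lemma ksgn_inject [simp]: "ksgn n x = ksgn n y \<longleftrightarrow> x = y"
  by (auto simp: ksgn_def)

lemma ksgn_parity: "even (m - n) \<Longrightarrow> ksgn m x = ksgn n x"
  by (auto simp: ksgn_def)

text \<open>The scalar action of a bimodule is only controlled on its carrier, so linear extensions into
  it need a vector space structure relative to a subset.\<close>

definition vs_on :: "('k::field \<Rightarrow> 'm \<Rightarrow> 'm) \<Rightarrow> 'm::ab_group_add set \<Rightarrow> bool" where
  "vs_on sc D \<longleftrightarrow> 0 \<in> D \<and> (\<forall>x\<in>D. \<forall>y\<in>D. x + y \<in> D) \<and> (\<forall>c. \<forall>x\<in>D. sc c x \<in> D) \<and>
     (\<forall>c. \<forall>x\<in>D. \<forall>y\<in>D. sc c (x + y) = sc c x + sc c y) \<and>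
     (\<forall>c c'. \<forall>x\<in>D. sc (c + c') x = sc c x + sc c' x) \<and>
     (\<forall>c c'. \<forall>x\<in>D. sc c (sc c' x) = sc (c * c') x) \<and> (\<forall>x\<in>D. sc 1 x = x)"

lemma keys_pscale: "Poly_Mapping.keys (pscale c u) \<subseteq> Poly_Mapping.keys u"
  by (auto simp: in_keys_iff lookup_pscale)

lemma keys_minus_subset: "Poly_Mapping.keys (u - v :: 'x \<Rightarrow>\<^sub>0 'k::field) \<subseteq> Poly_Mapping.keys u \<union> Poly_Mapping.keys v"
  by (auto simp: in_keys_iff lookup_minus)

lemma keys_gen [simp]: "Poly_Mapping.keys (gen x :: 'x \<Rightarrow>\<^sub>0 'k::field) = {x}"
  by (simp add: gen_def)

lemma vs_on_UNIV: "vector_space sc \<Longrightarrow> vs_on sc UNIV"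
  by (simp add: vs_on_def vector_space_def)

lemma vs_on_span: "vs_on pscale (fv.span S)"
  by (auto simp: vs_on_def fv.span_zero fv.span_add fv.span_scale
      fv.scale_left_distrib fv.scale_right_distrib)

lemma vs_on_pscale: "vs_on pscale UNIV"
  by (rule vs_on_UNIV) unfold_locales

context
  fixes sc :: "'k::field \<Rightarrow> 'm \<Rightarrow> 'm::ab_group_add" and D
  assumes vs: "vs_on sc D"
begin

lemma vs_zero: "0 \<in> D"
  and vs_add: "x \<in> D \<Longrightarrow> y \<in> D \<Longrightarrow> x + y \<in> D"
  and vs_scale: "x \<in> D \<Longrightarrow> sc c x \<in> D"
  and vs_scale_add: "x \<in> D \<Longrightarrow> y \<in> D \<Longrightarrow> sc c (x + y) = sc c x + sc c y"
  and vs_add_scale: "x \<in> D \<Longrightarrow> sc (c + c') x = sc c x + sc c' x"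
  and vs_scale_scale: "x \<in> D \<Longrightarrow> sc c (sc c' x) = sc (c * c') x"
  and vs_one: "x \<in> D \<Longrightarrow> sc 1 x = x"
  using vs by (auto simp: vs_on_def)

lemma vs_scale_0: "sc c 0 = 0"
  using vs_scale_add[of 0 0 c] vs_zero by simp

lemma vs_0_scale: "x \<in> D \<Longrightarrow> sc 0 x = 0"
  using vs_add_scale[of x 0 0] by simp

lemma vs_sum: "(\<And>x. x \<in> S \<Longrightarrow> h x \<in> D) \<Longrightarrow> sum h S \<in> D"
  by (induction S rule: infinite_finite_induct) (auto simp: vs_zero vs_add)

lemma vs_scale_sum: "(\<And>x. x \<in> S \<Longrightarrow> h x \<in> D) \<Longrightarrow> sc c (sum h S) = (\<Sum>x\<in>S. sc c (h x))"
  by (induction S rule: infinite_finite_induct) (auto simp: vs_scale_0 vs_scale_add vs_sum)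

context
  fixes K :: "'x set" and b
  assumes bK: "\<And>x. x \<in> K \<Longrightarrow> b x \<in> D"
begin

lemma lext_on_eq:
  assumes "finite S" "Poly_Mapping.keys u \<subseteq> S" "S \<subseteq> K"
  shows "lext sc b u = (\<Sum>x\<in>S. sc (Poly_Mapping.lookup u x) (b x))"
  unfolding lext_def using assms
  by (intro sum.mono_neutral_left) (auto simp: in_keys_iff vs_0_scale bK subset_iff)

lemma lext_on_mem: "Poly_Mapping.keys u \<subseteq> K \<Longrightarrow> lext sc b u \<in> D"
  unfolding lext_def by (intro vs_sum vs_scale bK) auto

lemma lext_on_add:
  assumes "Poly_Mapping.keys u \<subseteq> K" "Poly_Mapping.keys v \<subseteq> K"
  shows "lext sc b (u + v) = lext sc b u + lext sc b v"
proof -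
  let ?S = "Poly_Mapping.keys u \<union> Poly_Mapping.keys v"
  have S: "finite ?S" "?S \<subseteq> K" using assms by auto
  show ?thesis
    using lext_on_eq[OF S(1) _ S(2), of u] lext_on_eq[OF S(1) _ S(2), of v]
      lext_on_eq[OF S(1) keys_add S(2)] S
    by (auto simp: lookup_add vs_add_scale bK subset_iff sum.distrib[symmetric]
        intro!: sum.cong)
qed

lemma lext_on_scale:
  assumes "Poly_Mapping.keys u \<subseteq> K"
  shows "lext sc b (pscale c u) = sc c (lext sc b u)"
proof -
  have m: "x \<in> Poly_Mapping.keys u \<Longrightarrow> b x \<in> D" for x using assms bK by auto
  have "lext sc b (pscale c u) = (\<Sum>x\<in>Poly_Mapping.keys u. sc (c * Poly_Mapping.lookup u x) (b x))"
    using lext_on_eq[OF _ keys_pscale assms, of c] by (simp add: lookup_pscale)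
  also have "\<dots> = (\<Sum>x\<in>Poly_Mapping.keys u. sc c (sc (Poly_Mapping.lookup u x) (b x)))"
    by (intro sum.cong refl) (simp add: vs_scale_scale m)
  also have "\<dots> = sc c (lext sc b u)"
    unfolding lext_def by (rule vs_scale_sum[symmetric]) (simp add: vs_scale m)
  finally show ?thesis .
qed

lemma lext_on_diff:
  assumes "Poly_Mapping.keys u \<subseteq> K" "Poly_Mapping.keys v \<subseteq> K"
  shows "lext sc b (u - v) = lext sc b u - lext sc b v"
proof -
  have "Poly_Mapping.keys (u - v) \<subseteq> K" using keys_minus_subset[of u v] assms by blast
  from lext_on_add[OF this assms(2)] show ?thesis by simp
qed

lemma lext_gen: "x \<in> K \<Longrightarrow> lext sc b (gen x) = b x"
  by (simp add: lext_def gen_def vs_one bK)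

lemma lext_on_span:
  assumes R: "\<And>r. r \<in> R \<Longrightarrow> Poly_Mapping.keys r \<subseteq> K \<and> lext sc b r = 0"
    and "u \<in> fv.span R"
  shows "Poly_Mapping.keys u \<subseteq> K \<and> lext sc b u = 0"
  using assms(2)
proof (induction rule: fv.span_induct_alt)
  case base
  then show ?case by (simp add: lext_def)
next
  case (step c x y)
  have "Poly_Mapping.keys (pscale c x) \<subseteq> K" using R[OF step(1)] keys_pscale[of c x] by blast
  then show ?case
    using step R[OF step(1)] keys_add[of "pscale c x" y]
    by (auto simp: lext_on_add lext_on_scale vs_scale_0)
qed

text \<open>\<open>nform\<close> is an arbitrary linear choice of representatives, so a normal form
  might involve generators on which \<open>b\<close> is meaningless. It differs from
  \<open>u\<close> by an element of the span of \<open>R\<close>, which confines its keys to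
  \<open>K\<close> as well.\<close>

lemma lext_on_nform:
  assumes R: "\<And>r. r \<in> R \<Longrightarrow> Poly_Mapping.keys r \<subseteq> K \<and> lext sc b r = 0"
    and u: "Poly_Mapping.keys u \<subseteq> K"
  shows "Poly_Mapping.keys (nform R u) \<subseteq> K" "lext sc b (nform R u) = lext sc b u"
proof -
  have "u - nform R u \<in> fv.span R" using is_nform_nform unfolding is_nform_def by blast
  from lext_on_span[OF R this] have k: "Poly_Mapping.keys (u - nform R u) \<subseteq> K"
    and l: "lext sc b (u - nform R u) = 0" by auto
  have "nform R u = u - (u - nform R u)" by simp
  then show k': "Poly_Mapping.keys (nform R u) \<subseteq> K"
    using keys_minus_subset[of u "u - nform R u"] k u by (metis Un_subset_iff order_trans)
  show "lext sc b (nform R u) = lext sc b u"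
    using l lext_on_diff[OF u k'] by simp
qed

lemma lext_rel_add:
  assumes "x \<in> K" "y \<in> K" "z \<in> K" "b x = b y + b z"
  shows "Poly_Mapping.keys (gen x - gen y - gen z :: 'x \<Rightarrow>\<^sub>0 'k) \<subseteq> K \<and>
    lext sc b (gen x - gen y - gen z) = 0"
proof -
  have "Poly_Mapping.keys (gen x - gen y :: 'x \<Rightarrow>\<^sub>0 'k) \<subseteq> K"
    using keys_minus_subset[of "gen x :: _ \<Rightarrow>\<^sub>0 'k" "gen y"] assms(1-3) by (simp only: keys_gen) blast
  moreover then have "Poly_Mapping.keys (gen x - gen y - gen z :: 'x \<Rightarrow>\<^sub>0 'k) \<subseteq> K"
    using keys_minus_subset[of "gen x - gen y :: _ \<Rightarrow>\<^sub>0 'k" "gen z"] assms(3) by (simp only: keys_gen) blast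
  ultimately show ?thesis using assms by (simp add: lext_on_diff lext_gen)
qed

lemma lext_rel_eq:
  assumes "x \<in> K" "y \<in> K" "b x = b y"
  shows "Poly_Mapping.keys (gen x - gen y :: 'x \<Rightarrow>\<^sub>0 'k) \<subseteq> K \<and> lext sc b (gen x - gen y) = 0"
proof -
  have "Poly_Mapping.keys (gen x - gen y :: 'x \<Rightarrow>\<^sub>0 'k) \<subseteq> K"
    using keys_minus_subset[of "gen x :: _ \<Rightarrow>\<^sub>0 'k" "gen y"] assms(1,2) by (simp only: keys_gen) blast
  moreover have "lext sc b (gen x - gen y) = lext sc b (gen x) - lext sc b (gen y)"
    by (rule lext_on_diff) (use assms in \<open>simp_all only: keys_gen\<close>, blast+)
  ultimately show ?thesis using assms(3) lext_gen[OF assms(1)] lext_gen[OF assms(2)] by simp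
qed

lemma lext_rel_scale:
  assumes "x \<in> K" "y \<in> K" "b x = sc c (b y)"
  shows "Poly_Mapping.keys (gen x - pscale c (gen y) :: 'x \<Rightarrow>\<^sub>0 'k) \<subseteq> K \<and>
    lext sc b (gen x - pscale c (gen y)) = 0"
proof -
  have "Poly_Mapping.keys (pscale c (gen y) :: 'x \<Rightarrow>\<^sub>0 'k) \<subseteq> K"
    using keys_pscale[of c "gen y :: _ \<Rightarrow>\<^sub>0 'k"] assms(1,2) by (simp only: keys_gen) blast
  moreover from this have "Poly_Mapping.keys (gen x - pscale c (gen y) :: 'x \<Rightarrow>\<^sub>0 'k) \<subseteq> K"
    using keys_minus_subset[of "gen x :: _ \<Rightarrow>\<^sub>0 'k" "pscale c (gen y)"] assms(1,2) by (simp only: keys_gen) blast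
  ultimately show ?thesis using assms by (simp add: lext_on_diff lext_on_scale lext_gen)
qed

end

end

lemma nform_add: "nform (R :: ('a \<Rightarrow>\<^sub>0 'b::field) set) (u + v) = nform R u + nform R v"
  and nform_scale: "nform R (pscale c u) = pscale c (nform R u)"
proof -
  interpret fp: vector_space_pair "pscale :: 'b \<Rightarrow> ('a \<Rightarrow>\<^sub>0 'b) \<Rightarrow> _"
    "pscale :: 'b \<Rightarrow> ('a \<Rightarrow>\<^sub>0 'b) \<Rightarrow> _" by unfold_locales
  have "Vector_Spaces.linear pscale pscale (nform R)"
    using is_nform_nform[of R] unfolding is_nform_def by blast
  then show "nform R (u + v) = nform R u + nform R v" "nform R (pscale c u) = pscale c (nform R u)"
    by (simp_all add: fp.linear_add fp.linear_scale)
qed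

lemma nform_relD: "u - v \<in> R \<Longrightarrow> nform R u = nform R v"
  by (simp add: nform_eq_iff fv.span_base)

section \<open>Bimodules and bimodule maps\<close>

lemma bimod_homI:
  assumes "\<And>x. x \<in> carr M \<Longrightarrow> f x \<in> carr N"
    and "\<And>x y. x \<in> carr M \<Longrightarrow> y \<in> carr M \<Longrightarrow> f (x + y) = f x + f y"
    and "\<And>a x. x \<in> carr M \<Longrightarrow> f (lact M a x) = lact N a (f x)"
    and "\<And>a x. x \<in> carr M \<Longrightarrow> f (ract M x a) = ract N (f x) a"
  shows "bimod_hom M N f"
  using assms by (simp add: bimod_hom_def)

context k_algebra
begin

lemma scale_1_mult: "scale c 1 * x = scale c x" "x * scale c 1 = scale c x"
  using scale_mult_left[of c 1 x] scale_mult_right[of x c 1] by auto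

abbreviation bim where "bim \<equiv> bimodule scale"
abbreviation cpx where "cpx \<equiv> is_complex scale"
abbreviation "Alg \<equiv> alg_cplx scale"

context
  fixes M assumes M: "bim M"
begin

lemma bim_0 [simp]: "0 \<in> carr M"
  and bim_add [simp]: "x \<in> carr M \<Longrightarrow> y \<in> carr M \<Longrightarrow> x + y \<in> carr M"
  and bim_minus [simp]: "x \<in> carr M \<Longrightarrow> - x \<in> carr M"
  and bim_lact [simp]: "x \<in> carr M \<Longrightarrow> lact M a x \<in> carr M"
  and bim_ract [simp]: "x \<in> carr M \<Longrightarrow> ract M x a \<in> carr M"
  and lact_add: "x \<in> carr M \<Longrightarrow> y \<in> carr M \<Longrightarrow> lact M a (x + y) = lact M a x + lact M a y"
  and ract_add: "x \<in> carr M \<Longrightarrow> y \<in> carr M \<Longrightarrow> ract M (x + y) a = ract M x a + ract M y a"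
  and add_lact: "x \<in> carr M \<Longrightarrow> lact M (a + b) x = lact M a x + lact M b x"
  and add_ract: "x \<in> carr M \<Longrightarrow> ract M x (a + b) = ract M x a + ract M x b"
  and lact_lact: "x \<in> carr M \<Longrightarrow> lact M a (lact M b x) = lact M (a * b) x"
  and ract_ract: "x \<in> carr M \<Longrightarrow> ract M (ract M x a) b = ract M x (a * b)"
  and lact_ract: "x \<in> carr M \<Longrightarrow> lact M a (ract M x b) = ract M (lact M a x) b"
  and lact_1 [simp]: "x \<in> carr M \<Longrightarrow> lact M 1 x = x"
  and ract_1 [simp]: "x \<in> carr M \<Longrightarrow> ract M x 1 = x"
  and bscale_lact: "x \<in> carr M \<Longrightarrow> bscale M c x = lact M (scale c 1) x"
  and bscale_ract: "x \<in> carr M \<Longrightarrow> bscale M c x = ract M x (scale c 1)"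
  using M by (auto simp: bimodule_def)

lemma bim_diff [simp]: "x \<in> carr M \<Longrightarrow> y \<in> carr M \<Longrightarrow> x - y \<in> carr M"
  using bim_add[of x "- y"] by simp

lemma bim_ksgn [simp]: "x \<in> carr M \<Longrightarrow> ksgn n x \<in> carr M"
  by (simp add: ksgn_def)

lemma bim_bscale [simp]: "x \<in> carr M \<Longrightarrow> bscale M c x \<in> carr M"
  by (simp add: bscale_lact)

lemma lact_0 [simp]: "lact M a 0 = 0"
  using lact_add[of 0 0 a] by simp
lemma ract_0 [simp]: "ract M 0 a = 0"
  using ract_add[of 0 0 a] by simp
lemma lact_0' [simp]: "x \<in> carr M \<Longrightarrow> lact M 0 x = 0"
  using add_lact[of x 0 0] by simp
lemma ract_0' [simp]: "x \<in> carr M \<Longrightarrow> ract M x 0 = 0"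
  using add_ract[of x 0 0] by simp

lemma lact_minus: "x \<in> carr M \<Longrightarrow> lact M a (- x) = - lact M a x"
  using lact_add[of x "- x" a] by (simp add: eq_neg_iff_add_eq_0 add.commute)
lemma ract_minus: "x \<in> carr M \<Longrightarrow> ract M (- x) a = - ract M x a"
  using ract_add[of x "- x" a] by (simp add: eq_neg_iff_add_eq_0 add.commute)

lemma lact_diff: "x \<in> carr M \<Longrightarrow> y \<in> carr M \<Longrightarrow> lact M a (x - y) = lact M a x - lact M a y"
  using lact_add[of x "- y" a] by (simp add: lact_minus)
lemma ract_diff: "x \<in> carr M \<Longrightarrow> y \<in> carr M \<Longrightarrow> ract M (x - y) a = ract M x a - ract M y a"
  using ract_add[of x "- y" a] by (simp add: ract_minus)

lemma lact_ksgn: "x \<in> carr M \<Longrightarrow> lact M a (ksgn n x) = ksgn n (lact M a x)"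
  by (simp add: ksgn_def lact_minus)
lemma ract_ksgn: "x \<in> carr M \<Longrightarrow> ract M (ksgn n x) a = ksgn n (ract M x a)"
  by (simp add: ksgn_def ract_minus)

lemma vs_on_bim: "vs_on (bscale M) (carr M)"
  unfolding vs_on_def
  by (auto simp: bscale_lact lact_add add_lact lact_lact scale_left_distrib scale_mult_left)

end

context
  fixes M N f assumes M: "bim M" and f: "bimod_hom M N f"
begin

lemma hom_mem: "x \<in> carr M \<Longrightarrow> f x \<in> carr N"
  and hom_add: "x \<in> carr M \<Longrightarrow> y \<in> carr M \<Longrightarrow> f (x + y) = f x + f y"
  and hom_lact: "x \<in> carr M \<Longrightarrow> f (lact M a x) = lact N a (f x)"
  and hom_ract: "x \<in> carr M \<Longrightarrow> f (ract M x a) = ract N (f x) a"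
  using f by (auto simp: bimod_hom_def)

lemma hom_0: "f 0 = 0"
  using hom_add[of 0 0] M by simp

lemma hom_minus: "x \<in> carr M \<Longrightarrow> f (- x) = - f x"
  using hom_add[of x "- x"] M by (simp add: hom_0 eq_neg_iff_add_eq_0 add.commute)

lemma hom_diff: "x \<in> carr M \<Longrightarrow> y \<in> carr M \<Longrightarrow> f (x - y) = f x - f y"
  using hom_add[of x "- y"] M by (simp add: hom_minus)

lemma hom_ksgn: "x \<in> carr M \<Longrightarrow> f (ksgn n x) = ksgn n (f x)"
  by (simp add: ksgn_def hom_minus)

lemma hom_bscale: "bim N \<Longrightarrow> x \<in> carr M \<Longrightarrow> f (bscale M c x) = bscale N c (f x)"
  using M by (simp add: bscale_lact hom_lact hom_mem)

end

lemma cpx_bim [simp]: "cpx P \<Longrightarrow> bim (obj P n)"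
  and cpx_diff: "cpx P \<Longrightarrow> bimod_hom (obj P n) (obj P (n - 1)) (diff P n)"
  and cpx_dd: "cpx P \<Longrightarrow> x \<in> crr P n \<Longrightarrow> diff P (n - 1) (diff P n x) = 0"
  by (auto simp: is_complex_def)

lemma cpx_dd' [simp]: "cpx P \<Longrightarrow> x \<in> crr P n \<Longrightarrow> k = n - 1 \<Longrightarrow> diff P k (diff P n x) = 0"
  using cpx_dd by blast

lemma deg_homD: "deg_hom P Q t f \<Longrightarrow> k = i + t \<Longrightarrow> bimod_hom (obj P i) (obj Q k) (f i)"
  by (auto simp: deg_hom_def)

lemma diff_hom: "cpx P \<Longrightarrow> deg_hom P P (- 1) (diff P)"
  using cpx_diff[of P] by (auto simp: deg_hom_def)

context
  fixes P :: "('k, 'a, 'm::ab_group_add) cplx" and Q :: "('k, 'a, 'n::ab_group_add) cplx" and t f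
  assumes P: "cpx P" and f: "deg_hom P Q t f"
begin

lemma dh_mem: "x \<in> crr P i \<Longrightarrow> k = i + t \<Longrightarrow> f i x \<in> crr Q k"
  using hom_mem[OF _ deg_homD[OF f]] P by auto

lemma dh_add: "x \<in> crr P i \<Longrightarrow> y \<in> crr P i \<Longrightarrow> f i (x + y) = f i x + f i y"
  using hom_add[OF _ deg_homD[OF f refl]] P by auto

lemma dh_0: "f i 0 = 0"
  using hom_0[OF _ deg_homD[OF f refl]] P by auto

lemma dh_minus: "x \<in> crr P i \<Longrightarrow> f i (- x) = - f i x"
  using hom_minus[OF _ deg_homD[OF f refl]] P by auto

lemma dh_diff: "x \<in> crr P i \<Longrightarrow> y \<in> crr P i \<Longrightarrow> f i (x - y) = f i x - f i y"
  using hom_diff[OF _ deg_homD[OF f refl]] P by auto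

lemma dh_ksgn: "x \<in> crr P i \<Longrightarrow> f i (ksgn n x) = ksgn n (f i x)"
  using hom_ksgn[OF _ deg_homD[OF f refl]] P by auto

lemma dh_lact: "x \<in> crr P i \<Longrightarrow> k = i + t \<Longrightarrow> f i (lact (obj P i) a x) = lact (obj Q k) a (f i x)"
  using hom_lact[OF _ deg_homD[OF f]] P by auto

lemma dh_ract: "x \<in> crr P i \<Longrightarrow> k = i + t \<Longrightarrow> f i (ract (obj P i) x a) = ract (obj Q k) (f i x) a"
  using hom_ract[OF _ deg_homD[OF f]] P by auto

lemmas dh_simps = dh_mem dh_add dh_0 dh_minus dh_diff dh_ksgn
end

lemma d_mem [simp]: "cpx P \<Longrightarrow> x \<in> crr P i \<Longrightarrow> k = i - 1 \<Longrightarrow> diff P i x \<in> crr P k"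
  using dh_mem[OF _ diff_hom] by auto
lemma d_add: "cpx P \<Longrightarrow> x \<in> crr P i \<Longrightarrow> y \<in> crr P i \<Longrightarrow> diff P i (x + y) = diff P i x + diff P i y"
  and d_0 [simp]: "cpx P \<Longrightarrow> diff P i 0 = 0"
  and d_minus: "cpx P \<Longrightarrow> x \<in> crr P i \<Longrightarrow> diff P i (- x) = - diff P i x"
  and d_diff: "cpx P \<Longrightarrow> x \<in> crr P i \<Longrightarrow> y \<in> crr P i \<Longrightarrow> diff P i (x - y) = diff P i x - diff P i y"
  and d_ksgn: "cpx P \<Longrightarrow> x \<in> crr P i \<Longrightarrow> diff P i (ksgn n x) = ksgn n (diff P i x)"
  and d_lact: "cpx P \<Longrightarrow> x \<in> crr P i \<Longrightarrow> diff P i (lact (obj P i) a x) = lact (obj P (i - 1)) a (diff P i x)"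
  and d_ract: "cpx P \<Longrightarrow> x \<in> crr P i \<Longrightarrow> diff P i (ract (obj P i) x a) = ract (obj P (i - 1)) (diff P i x) a"
  by (simp_all add: dh_add[OF _ diff_hom] dh_0[OF _ diff_hom] dh_minus[OF _ diff_hom]
      dh_diff[OF _ diff_hom] dh_ksgn[OF _ diff_hom] dh_lact[OF _ diff_hom] dh_ract[OF _ diff_hom])
lemmas d_simps = d_add d_minus d_diff d_ksgn

lemma lact_Alg [simp]: "lact (obj Alg n) = (*)" and ract_Alg [simp]: "ract (obj Alg n) = (*)"
  and diff_Alg [simp]: "diff Alg n x = 0" and bscale_Alg [simp]: "bscale (obj Alg n) = scale"
  by (auto simp: alg_cplx_def alg_bimod_def)

lemma crr_Alg: "x \<in> crr Alg n \<longleftrightarrow> n = 0 \<or> x = 0"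
  by (simp add: alg_cplx_def alg_bimod_def)

lemma cpx_Alg [simp]: "cpx Alg"
  by (auto simp: is_complex_def bimodule_def bimod_hom_def crr_Alg distrib_left distrib_right
      mult.assoc scale_1_mult)


section \<open>Tensor products of complexes\<close>

definition tkeys :: "('k, 'a, 'm::ab_group_add) cplx \<Rightarrow> ('k, 'a, 'n::ab_group_add) cplx \<Rightarrow> int \<Rightarrow>
    ((int \<times> 'm) \<times> (int \<times> 'n)) set" where
  "tkeys P Q n = {((i, x), (j, y)) | i x j y. i + j = n \<and> x \<in> crr P i \<and> y \<in> crr Q j}"

text \<open>Balanced biadditive maps with values in \<open>D\<close>. Compatibility with scalars is
  asked on the left factor only, as in the presentation of the tensor product.\<close>

definition tbil :: "('k, 'a, 'm::ab_group_add) cplx \<Rightarrow> ('k, 'a, 'n::ab_group_add) cplx \<Rightarrow> int \<Rightarrow>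
    ('k \<Rightarrow> 'z \<Rightarrow> 'z) \<Rightarrow> 'z::ab_group_add set \<Rightarrow> ((int \<times> 'm) \<times> (int \<times> 'n) \<Rightarrow> 'z) \<Rightarrow> bool" where
  "tbil P Q n sc D b \<longleftrightarrow> (\<forall>i j. i + j = n \<longrightarrow> (\<forall>x\<in>crr P i. \<forall>y\<in>crr Q j.
     b ((i, x), (j, y)) \<in> D \<and>
     (\<forall>x'\<in>crr P i. b ((i, x + x'), (j, y)) = b ((i, x), (j, y)) + b ((i, x'), (j, y))) \<and>
     (\<forall>y'\<in>crr Q j. b ((i, x), (j, y + y')) = b ((i, x), (j, y)) + b ((i, x), (j, y'))) \<and>
     (\<forall>a. b ((i, ract (obj P i) x a), (j, y)) = b ((i, x), (j, lact (obj Q j) a y))) \<and>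
     (\<forall>c. b ((i, bscale (obj P i) c x), (j, y)) = sc c (b ((i, x), (j, y))))))"

context
  fixes P :: "('k, 'a, 'm::ab_group_add) cplx" and Q :: "('k, 'a, 'n::ab_group_add) cplx"
  assumes P [simp]: "cpx P" and Q [simp]: "cpx Q"
begin

lemma tprod_add_l:
  assumes "x \<in> crr P i" "x' \<in> crr P i" "y \<in> crr Q j"
  shows "tprod P Q i (x + x') j y = tprod P Q i x j y + tprod P Q i x' j y"
  unfolding tprod_def nform_add[symmetric]
  by (rule nform_relD) (use assms in \<open>auto simp: tens_rel_def diff_diff_eq[symmetric]\<close>)

lemma tprod_add_r:
  assumes "x \<in> crr P i" "y \<in> crr Q j" "y' \<in> crr Q j"
  shows "tprod P Q i x j (y + y') = tprod P Q i x j y + tprod P Q i x j y'"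
  unfolding tprod_def nform_add[symmetric]
  by (rule nform_relD) (use assms in \<open>auto simp: tens_rel_def diff_diff_eq[symmetric]\<close>)

lemma tprod_bal:
  assumes "x \<in> crr P i" "y \<in> crr Q j"
  shows "tprod P Q i (ract (obj P i) x a) j y = tprod P Q i x j (lact (obj Q j) a y)"
  unfolding tprod_def
  by (rule nform_relD) (use assms in \<open>auto simp: tens_rel_def\<close>)

lemma tprod_scale_l:
  assumes "x \<in> crr P i" "y \<in> crr Q j"
  shows "tprod P Q i (bscale (obj P i) c x) j y = pscale c (tprod P Q i x j y)"
  unfolding tprod_def nform_scale[symmetric]
  by (rule nform_relD) (use assms in \<open>auto simp: tens_rel_def\<close>)

text \<open>The presentation lets scalars pass on the left only. A scalar \<open>c\<close> acts on
  either side through \<open>scale c 1\<close>, so balancing carries it over.\<close>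

lemma tprod_scale_r:
  assumes "x \<in> crr P i" "y \<in> crr Q j"
  shows "tprod P Q i x j (bscale (obj Q j) c y) = pscale c (tprod P Q i x j y)"
  using assms tprod_scale_l[of x i y j c] tprod_bal[of x i y j "scale c 1"]
  by (simp add: bscale_lact[of "obj Q j"] bscale_ract[of "obj P i"])

lemma tprod_0_l [simp]: "y \<in> crr Q j \<Longrightarrow> tprod P Q i 0 j y = 0"
  using tprod_add_l[of 0 i 0 y j] by simp
lemma tprod_0_r [simp]: "x \<in> crr P i \<Longrightarrow> tprod P Q i x j 0 = 0"
  using tprod_add_r[of x i 0 j 0] by simp
lemma tprod_minus_l: "x \<in> crr P i \<Longrightarrow> y \<in> crr Q j \<Longrightarrow> tprod P Q i (- x) j y = - tprod P Q i x j y"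
  using tprod_add_l[of x i "- x" y j] by (simp add: eq_neg_iff_add_eq_0 add.commute)
lemma tprod_minus_r: "x \<in> crr P i \<Longrightarrow> y \<in> crr Q j \<Longrightarrow> tprod P Q i x j (- y) = - tprod P Q i x j y"
  using tprod_add_r[of x i y j "- y"] by (simp add: eq_neg_iff_add_eq_0 add.commute)
lemma tprod_ksgn_l: "x \<in> crr P i \<Longrightarrow> y \<in> crr Q j \<Longrightarrow> tprod P Q i (ksgn n x) j y = ksgn n (tprod P Q i x j y)"
  by (simp add: ksgn_def tprod_minus_l)
lemma tprod_ksgn_r: "x \<in> crr P i \<Longrightarrow> y \<in> crr Q j \<Longrightarrow> tprod P Q i x j (ksgn n y) = ksgn n (tprod P Q i x j y)"
  by (simp add: ksgn_def tprod_minus_r)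
lemma tprod_diff_l: "x \<in> crr P i \<Longrightarrow> x' \<in> crr P i \<Longrightarrow> y \<in> crr Q j \<Longrightarrow>
    tprod P Q i (x - x') j y = tprod P Q i x j y - tprod P Q i x' j y"
  using tprod_add_l[of x i "- x'" y j] by (simp add: tprod_minus_l)
lemma tprod_diff_r: "x \<in> crr P i \<Longrightarrow> y \<in> crr Q j \<Longrightarrow> y' \<in> crr Q j \<Longrightarrow>
    tprod P Q i x j (y - y') = tprod P Q i x j y - tprod P Q i x j y'"
  using tprod_add_r[of x i y j "- y'"] by (simp add: tprod_minus_r)

lemmas tprod_lin = tprod_add_l tprod_add_r tprod_minus_l tprod_minus_r tprod_ksgn_l tprod_ksgn_r
  tprod_diff_l tprod_diff_r

lemma carr_tensor: "crr (P \<otimes> Q) n = fv.span {tprod P Q i x j y | i x j y.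
    i + j = n \<and> x \<in> crr P i \<and> y \<in> crr Q j}"
  and bscale_tensor [simp]: "bscale (obj (P \<otimes> Q) n) = pscale"
  by (simp_all add: tensor_def)

lemma tprod_mem [simp]: "x \<in> crr P i \<Longrightarrow> y \<in> crr Q j \<Longrightarrow> k = i + j \<Longrightarrow> tprod P Q i x j y \<in> crr (P \<otimes> Q) k"
  unfolding carr_tensor by (rule fv.span_base) auto

lemma vs_on_tensor: "vs_on pscale (crr (P \<otimes> Q) n)"
  unfolding carr_tensor by (rule vs_on_span)

lemma tens_0 [simp]: "0 \<in> crr (P \<otimes> Q) n"
  and tens_add [simp]: "t \<in> crr (P \<otimes> Q) n \<Longrightarrow> t' \<in> crr (P \<otimes> Q) n \<Longrightarrow> t + t' \<in> crr (P \<otimes> Q) n"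
  and tens_minus [simp]: "t \<in> crr (P \<otimes> Q) n \<Longrightarrow> - t \<in> crr (P \<otimes> Q) n"
  unfolding carr_tensor by (auto simp: fv.span_zero fv.span_add fv.span_neg)

text \<open>There is no scalar case: a multiple of a pure tensor is again a pure tensor, the scalar
  being absorbed by the left factor.\<close>

lemma tens_induct [consumes 1, case_names zero tprod add]:
  assumes "t \<in> crr (P \<otimes> Q) n"
    and "pr 0"
    and tp: "\<And>i x j y. i + j = n \<Longrightarrow> x \<in> crr P i \<Longrightarrow> y \<in> crr Q j \<Longrightarrow> pr (tprod P Q i x j y)"
    and add: "\<And>t t'. t \<in> crr (P \<otimes> Q) n \<Longrightarrow> t' \<in> crr (P \<otimes> Q) n \<Longrightarrow> pr t \<Longrightarrow> pr t' \<Longrightarrow> pr (t + t')"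
  shows "pr t"
proof -
  have "pr t \<and> t \<in> crr (P \<otimes> Q) n"
    using assms(1) unfolding carr_tensor
  proof (induction rule: fv.span_induct_alt)
    case base
    then show ?case using assms(2) by (simp add: fv.span_zero)
  next
    case (step c t t')
    then obtain i x j y where t: "t = tprod P Q i x j y" "i + j = n" "x \<in> crr P i" "y \<in> crr Q j"
      by auto
    have "pscale c t = tprod P Q i (bscale (obj P i) c x) j y"
      using t tprod_scale_l by simp
    then have "pscale c t \<in> crr (P \<otimes> Q) n" "pr (pscale c t)"
      using t tp by auto
    with step add show ?case by (auto simp: carr_tensor[symmetric])
  qed
  then show ?thesis by simp
qed

lemma tens_rel_lext:
  assumes vs: "vs_on sc D" and b: "tbil P Q n sc D b" and r: "r \<in> tens_rel P Q n"
  shows "Poly_Mapping.keys r \<subseteq> tkeys P Q n \<and> lext sc b r = 0"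
proof -
  have bK: "\<And>z. z \<in> tkeys P Q n \<Longrightarrow> b z \<in> D" using b by (auto simp: tbil_def tkeys_def)
  have km: "i + j = n \<Longrightarrow> x \<in> crr P i \<Longrightarrow> y \<in> crr Q j \<Longrightarrow> ((i, x), (j, y)) \<in> tkeys P Q n"
    for i j x y by (auto simp: tkeys_def)
  from r consider
    (1) i j x x' y where "r = gen ((i, x + x'), (j, y)) - gen ((i, x), (j, y)) - gen ((i, x'), (j, y))"
      "i + j = n" "x \<in> crr P i" "x' \<in> crr P i" "y \<in> crr Q j"
  | (2) i j x y y' where "r = gen ((i, x), (j, y + y')) - gen ((i, x), (j, y)) - gen ((i, x), (j, y'))"
      "i + j = n" "x \<in> crr P i" "y' \<in> crr Q j" "y \<in> crr Q j"
  | (3) i j x a y where "r = gen ((i, ract (obj P i) x a), (j, y)) - gen ((i, x), (j, lact (obj Q j) a y))"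
      "i + j = n" "x \<in> crr P i" "y \<in> crr Q j"
  | (4) i j c x y where "r = gen ((i, bscale (obj P i) c x), (j, y)) - pscale c (gen ((i, x), (j, y)))"
      "i + j = n" "x \<in> crr P i" "y \<in> crr Q j"
    unfolding tens_rel_def by blast
  then show ?thesis
  proof cases
    case 1
    then show ?thesis unfolding 1(1)
      by (intro lext_rel_add[OF vs bK] km) (use b in \<open>simp_all add: tbil_def\<close>)
  next
    case 2
    then show ?thesis unfolding 2(1)
      by (intro lext_rel_add[OF vs bK] km) (use b in \<open>simp_all add: tbil_def\<close>)
  next
    case 3
    then show ?thesis unfolding 3(1)
      by (intro lext_rel_eq[OF vs bK] km) (use b in \<open>simp_all add: tbil_def\<close>)
  next
    case 4
    then show ?thesis unfolding 4(1)
      by (intro lext_rel_scale[OF vs bK] km) (use b in \<open>simp_all add: tbil_def\<close>)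
  qed
qed

lemma tens_keys: "t \<in> crr (P \<otimes> Q) n \<Longrightarrow> Poly_Mapping.keys t \<subseteq> tkeys P Q n"
proof (induction rule: tens_induct)
  case (tprod i x j y)
  \<comment> \<open>The zero map serves only to extract the statement about keys from
    \<open>tens_rel_lext\<close>, which asks for some balanced map.\<close>
  have b: "tbil P Q n pscale UNIV (\<lambda>_. 0 :: 'm \<Rightarrow>\<^sub>0 'k)" by (simp add: tbil_def)
  show ?case unfolding tprod_def
    by (rule lext_on_nform(1)[OF vs_on_pscale, of _ "\<lambda>_. 0 :: 'm \<Rightarrow>\<^sub>0 'k"])
      (use tens_rel_lext[OF vs_on_pscale b] tprod in \<open>auto simp: tkeys_def keys_gen\<close>)
next
  case (add t t')
  then show ?case using keys_add[of t t'] by auto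
qed simp

context
  fixes sc :: "'k \<Rightarrow> 'z \<Rightarrow> 'z::ab_group_add" and D n b
  assumes vs: "vs_on sc D" and b: "tbil P Q n sc D b"
begin

lemma tlext_tprod:
  assumes "i + j = n" "x \<in> crr P i" "y \<in> crr Q j"
  shows "lext sc b (tprod P Q i x j y) = b ((i, x), (j, y))"
proof -
  have bK: "\<And>z. z \<in> tkeys P Q n \<Longrightarrow> b z \<in> D" using b by (auto simp: tbil_def tkeys_def)
  have k: "((i, x), (j, y)) \<in> tkeys P Q n" using assms by (auto simp: tkeys_def)
  show ?thesis unfolding tprod_def assms(1)
    by (subst lext_on_nform(2)[OF vs bK]) (use tens_rel_lext[OF vs b] k in
      \<open>auto simp: lext_gen[OF vs bK k]\<close>)
qed

lemma tlext_add:
  assumes "t \<in> crr (P \<otimes> Q) n" "t' \<in> crr (P \<otimes> Q) n"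
  shows "lext sc b (t + t') = lext sc b t + lext sc b t'"
proof -
  have bK: "\<And>z. z \<in> tkeys P Q n \<Longrightarrow> b z \<in> D" using b by (auto simp: tbil_def tkeys_def)
  show ?thesis by (rule lext_on_add[OF vs bK]) (use assms tens_keys in auto)
qed

lemma tlext_mem:
  assumes "t \<in> crr (P \<otimes> Q) n"
  shows "lext sc b t \<in> D"
proof -
  have bK: "\<And>z. z \<in> tkeys P Q n \<Longrightarrow> b z \<in> D" using b by (auto simp: tbil_def tkeys_def)
  show ?thesis by (rule lext_on_mem[OF vs bK]) (use assms tens_keys in auto)
qed

end

lemma lext_0 [simp]: "lext sc b 0 = 0"
  by (simp add: lext_def)

lemma tbil_lact: "tbil P Q n pscale (crr (P \<otimes> Q) n)
    (\<lambda>((i, x), (j, y)). tprod P Q i (lact (obj P i) a x) j y)"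
  by (auto simp: tbil_def lact_add tprod_lin lact_ract tprod_bal tprod_scale_l[symmetric] bscale_ract)

lemma tbil_ract: "tbil P Q n pscale (crr (P \<otimes> Q) n)
    (\<lambda>((i, x), (j, y)). tprod P Q i x j (ract (obj Q j) y a))"
  by (auto simp: tbil_def ract_add tprod_lin lact_ract[symmetric] tprod_bal tprod_scale_l)

lemma tbil_diff: "tbil P Q n pscale (crr (P \<otimes> Q) (n - 1)) (\<lambda>((i, x), (j, y)).
          tprod P Q (i - 1) (diff P i x) j y + ksgn i (tprod P Q i x (j - 1) (diff Q j y)))"
proof -
  have ks: "ksgn i t \<in> crr (P \<otimes> Q) k" if "t \<in> crr (P \<otimes> Q) k" for i k t
    using that by (simp add: ksgn_def)
  have ksc: "ksgn i (pscale c t) = pscale c (ksgn i t)" for i c and t :: "('k, 'm, 'n) tens"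
    by (simp add: ksgn_def)
  show ?thesis
  proof (unfold tbil_def split, intro allI impI ballI conjI)
    fix i j x y c assume h: "i + j = n" "x \<in> crr P i" "y \<in> crr Q j"
    have "diff P i (bscale (obj P i) c x) = bscale (obj P (i - 1)) c (diff P i x)"
      using h hom_bscale[OF _ cpx_diff[of P i]] by simp
    then show "tprod P Q (i - 1) (diff P i (bscale (obj P i) c x)) j y +
       ksgn i (tprod P Q i (bscale (obj P i) c x) (j - 1) (diff Q j y)) =
       pscale c (tprod P Q (i - 1) (diff P i x) j y + ksgn i (tprod P Q i x (j - 1) (diff Q j y)))"
      using h by (simp add: tprod_scale_l fv.scale_right_distrib ksc)
  qed (auto simp: d_add tprod_lin ksgn_add d_ract d_lact tprod_bal intro!: tens_add ks)
qed

lemma lact_tensor: "lact (obj (P \<otimes> Q) n) a = lext pscale (\<lambda>((i, x), (j, y)). tprod P Q i (lact (obj P i) a x) j y)"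
  and ract_tensor: "ract (obj (P \<otimes> Q) n) t a = lext pscale (\<lambda>((i, x), (j, y)). tprod P Q i x j (ract (obj Q j) y a)) t"
  and diff_tensor: "diff (P \<otimes> Q) n = lext pscale (\<lambda>((i, x), (j, y)).
          tprod P Q (i - 1) (diff P i x) j y + ksgn i (tprod P Q i x (j - 1) (diff Q j y)))"
  by (simp_all add: tensor_def)

lemma lact_tprod: "k = i + j \<Longrightarrow> x \<in> crr P i \<Longrightarrow> y \<in> crr Q j \<Longrightarrow>
    lact (obj (P \<otimes> Q) k) a (tprod P Q i x j y) = tprod P Q i (lact (obj P i) a x) j y"
  and ract_tprod: "k = i + j \<Longrightarrow> x \<in> crr P i \<Longrightarrow> y \<in> crr Q j \<Longrightarrow>
    ract (obj (P \<otimes> Q) k) (tprod P Q i x j y) a = tprod P Q i x j (ract (obj Q j) y a)"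
  and diff_tprod: "k = i + j \<Longrightarrow> x \<in> crr P i \<Longrightarrow> y \<in> crr Q j \<Longrightarrow>
    diff (P \<otimes> Q) k (tprod P Q i x j y) =
      tprod P Q (i - 1) (diff P i x) j y + ksgn i (tprod P Q i x (j - 1) (diff Q j y))"
  unfolding lact_tensor ract_tensor diff_tensor
  by (simp_all add: tlext_tprod[OF vs_on_tensor tbil_lact] tlext_tprod[OF vs_on_tensor tbil_ract]
      tlext_tprod[OF vs_on_tensor tbil_diff])

lemma bim_tensor: "bim (obj (P \<otimes> Q) n)"
proof -
  let ?T = "obj (P \<otimes> Q) n"
  have l: "t \<in> carr ?T \<Longrightarrow> lact ?T a t \<in> carr ?T"
    "t \<in> carr ?T \<Longrightarrow> t' \<in> carr ?T \<Longrightarrow> lact ?T a (t + t') = lact ?T a t + lact ?T a t'" for a t t'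
    unfolding lact_tensor using tlext_mem[OF vs_on_tensor tbil_lact] tlext_add[OF vs_on_tensor tbil_lact]
    by auto
  have r: "t \<in> carr ?T \<Longrightarrow> ract ?T t a \<in> carr ?T"
    "t \<in> carr ?T \<Longrightarrow> t' \<in> carr ?T \<Longrightarrow> ract ?T (t + t') a = ract ?T t a + ract ?T t' a" for a t t'
    unfolding ract_tensor using tlext_mem[OF vs_on_tensor tbil_ract] tlext_add[OF vs_on_tensor tbil_ract]
    by auto
  have z: "lact ?T a 0 = 0" "ract ?T 0 a = 0" for a by (simp_all add: lact_tensor ract_tensor)
  note sm = l r z lact_tprod ract_tprod
  have 1: "t \<in> carr ?T \<Longrightarrow> lact ?T (a + b) t = lact ?T a t + lact ?T b t" for a b t
    by (induction rule: tens_induct) (auto simp: sm add_lact tprod_lin)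
  have 2: "t \<in> carr ?T \<Longrightarrow> ract ?T t (a + b) = ract ?T t a + ract ?T t b" for a b t
    by (induction rule: tens_induct) (auto simp: sm add_ract tprod_lin)
  have 3: "t \<in> carr ?T \<Longrightarrow> lact ?T (a * b) t = lact ?T a (lact ?T b t)" for a b t
    by (induction rule: tens_induct) (auto simp: sm lact_lact)
  have 4: "t \<in> carr ?T \<Longrightarrow> ract ?T t (a * b) = ract ?T (ract ?T t a) b" for a b t
    by (induction rule: tens_induct) (auto simp: sm ract_ract)
  have 5: "t \<in> carr ?T \<Longrightarrow> lact ?T a (ract ?T t b) = ract ?T (lact ?T a t) b" for a b t
    by (induction rule: tens_induct) (auto simp: sm)
  have 6: "t \<in> carr ?T \<Longrightarrow> lact ?T 1 t = t" "t \<in> carr ?T \<Longrightarrow> ract ?T t 1 = t" for t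
    by (induction rule: tens_induct) (auto simp: sm)
  have 7: "t \<in> carr ?T \<Longrightarrow> lact ?T (scale c 1) t = pscale c t" for c t
    by (induction rule: tens_induct)
      (auto simp: sm fv.scale_right_distrib bscale_lact[symmetric] tprod_scale_l)
  have 8: "t \<in> carr ?T \<Longrightarrow> ract ?T t (scale c 1) = pscale c t" for c t
    by (induction rule: tens_induct)
      (auto simp: sm fv.scale_right_distrib bscale_ract[symmetric] tprod_scale_r)
  show ?thesis
    unfolding bimodule_def using sm 1 2 3 4 5 6 7 8 by simp
qed

lemma cpx_tensor: "cpx (P \<otimes> Q)"
proof -
  let ?T = "P \<otimes> Q"
  note b = bim_tensor
  have d: "t \<in> crr ?T n \<Longrightarrow> diff ?T n t \<in> crr ?T (n - 1)"
    "t \<in> crr ?T n \<Longrightarrow> t' \<in> crr ?T n \<Longrightarrow> diff ?T n (t + t') = diff ?T n t + diff ?T n t'" for n t t'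
    unfolding diff_tensor using tlext_mem[OF vs_on_tensor tbil_diff] tlext_add[OF vs_on_tensor tbil_diff]
    by auto
  have z: "diff ?T n 0 = 0" for n by (simp add: diff_tensor)
  have zz: "diff ?T n (- t) = - diff ?T n t" if "t \<in> crr ?T n" for n t
    using d(2)[of t n "- t"] that by (simp add: z eq_neg_iff_add_eq_0 add.commute)
  have k: "diff ?T n (ksgn i t) = ksgn i (diff ?T n t)" if "t \<in> crr ?T n" for i n t
    using that by (simp add: ksgn_def zz)
  have ks: "ksgn i t \<in> crr ?T k" if "t \<in> crr ?T k" for i k t
    using that by (simp add: ksgn_def)
  have 1: "t \<in> crr ?T n \<Longrightarrow> diff ?T n (lact (obj ?T n) a t) = lact (obj ?T (n - 1)) a (diff ?T n t)" for n t a
    by (induction rule: tens_induct)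
      (auto simp: d z diff_tprod lact_tprod lact_add[OF b] lact_0[OF b] bim_lact[OF b] d_lact
        lact_ksgn[OF b] ks)
  have 2: "t \<in> crr ?T n \<Longrightarrow> diff ?T n (ract (obj ?T n) t a) = ract (obj ?T (n - 1)) (diff ?T n t) a" for n t a
    by (induction rule: tens_induct)
      (auto simp: d z diff_tprod ract_tprod ract_add[OF b] ract_0[OF b] bim_ract[OF b] d_ract
        ract_ksgn[OF b] ks)
  have 3: "t \<in> crr ?T n \<Longrightarrow> diff ?T (n - 1) (diff ?T n t) = 0" for n t
    by (induction rule: tens_induct)
      (auto simp: d z zz diff_tprod ks k tprod_lin ksgn_def)
  show ?thesis
    unfolding is_complex_def bimod_hom_def using b d 1 2 3 by blast
qed

end

lemmas cpx_tensor' [simp] = cpx_tensor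

lemma tens_ext:
  assumes "cpx P" "cpx Q" "t \<in> crr (P \<otimes> Q) n"
    and "\<And>x y. x \<in> crr (P \<otimes> Q) n \<Longrightarrow> y \<in> crr (P \<otimes> Q) n \<Longrightarrow> F (x + y) = F x + F y"
    and "\<And>x y. x \<in> crr (P \<otimes> Q) n \<Longrightarrow> y \<in> crr (P \<otimes> Q) n \<Longrightarrow> G (x + y) = G x + (G y :: 'z::ab_group_add)"
    and "\<And>i x j y. i + j = n \<Longrightarrow> x \<in> crr P i \<Longrightarrow> y \<in> crr Q j \<Longrightarrow> F (tprod P Q i x j y) = G (tprod P Q i x j y)"
  shows "F t = G t"
proof -
  have "F 0 = G 0" using assms(4,5)[of 0 0] assms(1,2) by simp
  then show ?thesis
    using assms(3) by (induction rule: tens_induct[OF assms(1,2)]) (use assms in auto)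
qed

text \<open>The universal property for bimodule valued maps. Compatibility with scalars follows from
  left linearity, as \<open>c\<close> acts through \<open>scale c 1\<close>.\<close>

lemma tens_hom:
  fixes P :: "('k, 'a, 'm::ab_group_add) cplx" and Q :: "('k, 'a, 'n::ab_group_add) cplx"
    and N :: "('k, 'a, 'z::ab_group_add) bimod"
  assumes P [simp]: "cpx P" and Q [simp]: "cpx Q" and N [simp]: "bim N"
    and mem: "\<And>i j x y. i + j = n \<Longrightarrow> x \<in> crr P i \<Longrightarrow> y \<in> crr Q j \<Longrightarrow> b i x j y \<in> carr N"
    and al: "\<And>i j x x' y. i + j = n \<Longrightarrow> x \<in> crr P i \<Longrightarrow> x' \<in> crr P i \<Longrightarrow> y \<in> crr Q j \<Longrightarrow>
      b i (x + x') j y = b i x j y + b i x' j y"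
    and ar: "\<And>i j x y' y. i + j = n \<Longrightarrow> x \<in> crr P i \<Longrightarrow> y \<in> crr Q j \<Longrightarrow> y' \<in> crr Q j \<Longrightarrow>
      b i x j (y + y') = b i x j y + b i x j y'"
    and bal: "\<And>i j x y a. i + j = n \<Longrightarrow> x \<in> crr P i \<Longrightarrow> y \<in> crr Q j \<Longrightarrow>
      b i (ract (obj P i) x a) j y = b i x j (lact (obj Q j) a y)"
    and ll: "\<And>i j x y a. i + j = n \<Longrightarrow> x \<in> crr P i \<Longrightarrow> y \<in> crr Q j \<Longrightarrow>
      b i (lact (obj P i) a x) j y = lact N a (b i x j y)"
    and rl: "\<And>i j x y a. i + j = n \<Longrightarrow> x \<in> crr P i \<Longrightarrow> y \<in> crr Q j \<Longrightarrow>
      b i x j (ract (obj Q j) y a) = ract N (b i x j y) a"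
  defines "F \<equiv> lext (bscale N) (\<lambda>((i, x), (j, y)). b i x j y)"
  shows "bimod_hom (obj (P \<otimes> Q) n) N F"
    and "\<And>i j x y. i + j = n \<Longrightarrow> x \<in> crr P i \<Longrightarrow> y \<in> crr Q j \<Longrightarrow> F (tprod P Q i x j y) = b i x j y"
proof -
  have vs: "vs_on (bscale N) (carr N)" by (rule vs_on_bim) fact
  have tb: "tbil P Q n (bscale N) (carr N) (\<lambda>((i, x), (j, y)). b i x j y)"
    by (auto simp: tbil_def mem al ar bal ll bscale_lact)
  show 1: "F (tprod P Q i x j y) = b i x j y" if "i + j = n" "x \<in> crr P i" "y \<in> crr Q j" for i j x y
    unfolding F_def using tlext_tprod[OF P Q vs tb that] by simp
  have 2: "t \<in> crr (P \<otimes> Q) n \<Longrightarrow> F t \<in> carr N" for t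
    unfolding F_def by (rule tlext_mem[OF P Q vs tb])
  have 3: "t \<in> crr (P \<otimes> Q) n \<Longrightarrow> t' \<in> crr (P \<otimes> Q) n \<Longrightarrow> F (t + t') = F t + F t'" for t t'
    unfolding F_def by (rule tlext_add[OF P Q vs tb])
  show "bimod_hom (obj (P \<otimes> Q) n) N F"
  proof (rule bimod_homI)
    show "F (lact (obj (P \<otimes> Q) n) a t) = lact N a (F t)" if "t \<in> crr (P \<otimes> Q) n" for t a
      using that
      by (rule tens_ext[OF P Q]) (auto simp: lact_add 2 3 lact_tprod 1 ll)
    show "F (ract (obj (P \<otimes> Q) n) t a) = ract N (F t) a" if "t \<in> crr (P \<otimes> Q) n" for t a
      using that
      by (rule tens_ext[OF P Q]) (auto simp: ract_add 2 3 ract_tprod 1 rl)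
  qed (use 2 3 in auto)
qed

lemma tmap:
  fixes P :: "('k, 'a, 'm::ab_group_add) cplx" and Q :: "('k, 'a, 'n::ab_group_add) cplx"
    and P' :: "('k, 'a, 'm1::ab_group_add) cplx" and Q' :: "('k, 'a, 'n1::ab_group_add) cplx"
  assumes c [simp]: "cpx P" "cpx Q" "cpx P'" "cpx Q'"
    and f: "deg_hom P P' t f" and g: "deg_hom Q Q' u g"
  shows "deg_hom (P \<otimes> Q) (P' \<otimes> Q') (t + u) (tmap P' Q' t u f g)"
    and "\<And>i j k x y. k = i + j \<Longrightarrow> x \<in> crr P i \<Longrightarrow> y \<in> crr Q j \<Longrightarrow>
      tmap P' Q' t u f g k (tprod P Q i x j y) = ksgn (i * u) (tprod P' Q' (i + t) (f i x) (j + u) (g j y))"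
proof -
  let ?b = "\<lambda>i x j y. ksgn (i * u) (tprod P' Q' (i + t) (f i x) (j + u) (g j y))"
  note sm = dh_simps[OF c(1) f] dh_simps[OF c(2) g] dh_lact[OF c(1) f _ refl] dh_ract[OF c(1) f _ refl]
     dh_lact[OF c(2) g _ refl] dh_ract[OF c(2) g _ refl] tprod_lin[OF c(3,4)] ksgn_add
     tprod_bal[OF c(3,4)] lact_tprod[OF c(3,4)] ract_tprod[OF c(3,4)] lact_ksgn ract_ksgn
  have 1: "bimod_hom (obj (P \<otimes> Q) k) (obj (P' \<otimes> Q') (k + (t + u))) (tmap P' Q' t u f g k)" for k
    unfolding tmap_def bscale_tensor[OF c(3,4), where n = "k + (t + u)", symmetric]
    by (rule tens_hom(1)[where b = ?b]) (simp_all add: sm)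
  have 2: "tmap P' Q' t u f g k (tprod P Q i x j y) = ?b i x j y"
    if "i + j = k" "x \<in> crr P i" "y \<in> crr Q j" for i j k x y
    unfolding tmap_def bscale_tensor[OF c(3,4), where n = "k + (t + u)", symmetric]
    by (rule tens_hom(2)[where b = ?b and n = k]) (simp_all add: sm that)
  show "deg_hom (P \<otimes> Q) (P' \<otimes> Q') (t + u) (tmap P' Q' t u f g)" using 1 by (simp add: deg_hom_def)
  show "k = i + j \<Longrightarrow> x \<in> crr P i \<Longrightarrow> y \<in> crr Q j \<Longrightarrow>
      tmap P' Q' t u f g k (tprod P Q i x j y) = ?b i x j y" for i j k x y
    using 2 by simp
qed


section \<open>Lifting along projectives\<close>

definition fbil :: "('k, 'a, 'm::ab_group_add) bimod \<Rightarrow> ('a \<times> 'x \<times> 'a \<Rightarrow> 'm) \<Rightarrow> bool" where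
  "fbil N b \<longleftrightarrow> (\<forall>a x c. b (a, x, c) \<in> carr N) \<and>
     (\<forall>a a' x c. b (a + a', x, c) = b (a, x, c) + b (a', x, c)) \<and>
     (\<forall>a x c c'. b (a, x, c + c') = b (a, x, c) + b (a, x, c')) \<and>
     (\<forall>k a x c. b (scale k a, x, c) = bscale N k (b (a, x, c))) \<and>
     (\<forall>k a x c. b (a, x, scale k c) = bscale N k (b (a, x, c)))"

abbreviation fgen :: "'a \<times> 'x \<times> 'a \<Rightarrow> ('a \<times> 'x \<times> 'a \<Rightarrow>\<^sub>0 'k)" where
  "fgen z \<equiv> nform (free_rel scale) (gen z)"

lemma free_rel_lext:
  assumes vs: "vs_on (bscale N) (carr N)" and b: "fbil N b" and r: "r \<in> free_rel scale"
  shows "Poly_Mapping.keys r \<subseteq> UNIV \<and> lext (bscale N) b r = 0"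
proof -
  have bK: "\<And>z. z \<in> UNIV \<Longrightarrow> b z \<in> carr N" using b by (auto simp: fbil_def)
  show ?thesis
    using r b unfolding free_rel_def fbil_def
    by (auto intro!: lext_rel_add[OF vs bK, THEN conjunct2] lext_rel_scale[OF vs bK, THEN conjunct2])
qed

lemma flext:
  assumes vs: "vs_on (bscale N) (carr N)" and b: "fbil N b"
  shows flext_gen: "lext (bscale N) b (fgen z) = b z"
    and flext_mem: "lext (bscale N) b u \<in> carr N"
    and flext_add: "lext (bscale N) b (u + v) = lext (bscale N) b u + lext (bscale N) b v"
    and flext_scale: "lext (bscale N) b (pscale k u) = bscale N k (lext (bscale N) b u)"
proof -
  have bK: "\<And>z. z \<in> UNIV \<Longrightarrow> b z \<in> carr N" using b by (auto simp: fbil_def)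
  show "lext (bscale N) b (fgen z) = b z"
    by (subst lext_on_nform(2)[OF vs bK free_rel_lext[OF vs b]]) (simp_all add: lext_gen[OF vs bK UNIV_I])
  show "lext (bscale N) b u \<in> carr N" by (rule lext_on_mem[OF vs, of UNIV, OF bK]) auto
  show "lext (bscale N) b (u + v) = lext (bscale N) b u + lext (bscale N) b v"
    by (rule lext_on_add[OF vs, of UNIV, OF bK]) auto
  show "lext (bscale N) b (pscale k u) = bscale N k (lext (bscale N) b u)"
    by (rule lext_on_scale[OF vs, of UNIV, OF bK]) auto
qed

lemma fgen_add: "fgen (a + a', x, c) = fgen (a, x, c) + fgen (a', x, c)"
  "fgen (a, x, c + c') = fgen (a, x, c) + fgen (a, x, c')"
  unfolding nform_add[symmetric]
  by (rule nform_relD; unfold diff_diff_eq[symmetric] free_rel_def; blast)+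

lemma fgen_scale: "fgen (scale k a, x, c) = pscale k (fgen (a, x, c))"
  "fgen (a, x, scale k c) = pscale k (fgen (a, x, c))"
  unfolding nform_scale[symmetric]
  by (rule nform_relD; unfold free_rel_def; blast)+

abbreviation "FB X \<equiv> free_bimod scale X"

lemma FB_simps: "bscale (FB X) = pscale"
  "carr (FB X) = fv.span {fgen (a, x, b) | a x b. x \<in> X}"
  by (simp_all add: free_bimod_def)

lemma FB_act:
  "lact (FB X) a (fgen (b, x, c)) = fgen (a * b, x, c)"
  "ract (FB X) (fgen (b, x, c)) a = fgen (b, x, c * a)"
  "lact (FB X) a (u + v) = lact (FB X) a u + lact (FB X) a v"
  "ract (FB X) (u + v) a = ract (FB X) u a + ract (FB X) v a"
  "lact (FB X) a (pscale k u) = pscale k (lact (FB X) a u)"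
  "ract (FB X) (pscale k u) a = pscale k (ract (FB X) u a)"
proof -
  \<comment> \<open>Enlarging the carrier to the whole type makes the linear extensions available on
    all vectors, not only on the span of the generators over \<open>X\<close>.\<close>
  let ?N = "FB X\<lparr>carr := UNIV\<rparr>"
  have vs: "vs_on (bscale ?N) (carr ?N)" by (simp add: FB_simps vs_on_pscale)
  have b: "fbil ?N (\<lambda>(b, x, c). fgen (a * b, x, c))" "fbil ?N (\<lambda>(b, x, c). fgen (b, x, c * a))"
    by (auto simp: fbil_def FB_simps distrib_left distrib_right fgen_add fgen_scale
        scale_mult_left scale_mult_right)
  have l: "lact (FB X) a = lext (bscale ?N) (\<lambda>(b, x, c). fgen (a * b, x, c))"
   and r: "ract (FB X) u a = lext (bscale ?N) (\<lambda>(b, x, c). fgen (b, x, c * a)) u" for u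
    by (simp_all add: free_bimod_def)
  note s = flext_gen[OF vs b(1)] flext_gen[OF vs b(2)] flext_add[OF vs b(1)] flext_add[OF vs b(2)]
    flext_scale[OF vs b(1)] flext_scale[OF vs b(2)]
  show "lact (FB X) a (fgen (b, x, c)) = fgen (a * b, x, c)"
  "ract (FB X) (fgen (b, x, c)) a = fgen (b, x, c * a)"
  "lact (FB X) a (u + v) = lact (FB X) a u + lact (FB X) a v"
  "ract (FB X) (u + v) a = ract (FB X) u a + ract (FB X) v a"
  "lact (FB X) a (pscale k u) = pscale k (lact (FB X) a u)"
  "ract (FB X) (pscale k u) a = pscale k (ract (FB X) u a)"
    unfolding l r s by (simp_all add: FB_simps)
qed

lemma FB_induct [consumes 1, case_names zero gen add]:
  assumes "u \<in> carr (FB X)" "pr 0"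
    and g: "\<And>a x b. x \<in> X \<Longrightarrow> pr (fgen (a, x, b))"
    and add: "\<And>u v. u \<in> carr (FB X) \<Longrightarrow> v \<in> carr (FB X) \<Longrightarrow> pr u \<Longrightarrow> pr v \<Longrightarrow> pr (u + v)"
  shows "pr u"
proof -
  have "pr u \<and> u \<in> carr (FB X)"
    using assms(1) unfolding FB_simps
  proof (induction rule: fv.span_induct_alt)
    case base
    then show ?case using assms(2) by (simp add: fv.span_zero)
  next
    case (step c t t')
    then obtain a x b where t: "t = fgen (a, x, b)" "x \<in> X" by auto
    then have p: "pscale c t = fgen (scale c a, x, b)" by (simp add: fgen_scale)
    have "pr (pscale c t)" unfolding p by (rule g[OF t(2)])
    moreover have "pscale c t \<in> carr (FB X)" unfolding p FB_simps by (rule fv.span_base) (use t in auto)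
    moreover have "pr t'" "t' \<in> carr (FB X)" using step by (simp_all add: FB_simps(2))
    ultimately have "pr (pscale c t + t')" "pscale c t + t' \<in> carr (FB X)"
      using add by (auto simp: FB_simps(2) intro: fv.span_add)
    then show ?case by (simp add: FB_simps(2))
  qed
  then show ?thesis by simp
qed

lemma FB_hom:
  assumes N [simp]: "bim N" and p: "\<And>x. x \<in> X \<Longrightarrow> p x \<in> carr N"
  shows "\<exists>e. bimod_hom (FB X) N e \<and>
    (\<forall>a x b. x \<in> X \<longrightarrow> e (fgen (a, x, b)) = lact N a (ract N (p x) b))"
proof (intro exI conjI allI impI)
  \<comment> \<open>\<open>fbil\<close> quantifies over all generators, so the map is set to 0 on
    those outside \<open>X\<close>.\<close>
  let ?b = "\<lambda>(a, x, c). if x \<in> X then lact N a (ract N (p x) c) else 0"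
  have vs: "vs_on (bscale N) (carr N)" by (rule vs_on_bim) fact
  have b: "fbil N ?b"
  proof -
    have 1: "lact N (scale k a) z = bscale N k (lact N a z)" if "z \<in> carr N" for k a z
      using that lact_lact[OF N, of z "scale k 1" a] by (simp add: bscale_lact[OF N] scale_1_mult)
    have 2: "ract N z (scale k a) = bscale N k (ract N z a)" if "z \<in> carr N" for k a z
      using that ract_ract[OF N, of z a "scale k 1"] by (simp add: bscale_ract[OF N] scale_1_mult)
    have 3: "lact N a (bscale N k z) = bscale N k (lact N a z)" if "z \<in> carr N" for k a z
      using that by (simp add: bscale_ract[OF N] lact_ract[OF N])
    show ?thesis
      by (auto simp: fbil_def add_lact[OF N] add_ract[OF N] lact_add[OF N] p 1 2 3 vs_scale_0[OF vs])
  qed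
  let ?e = "lext (bscale N) ?b"
  note s = flext_gen[OF vs b] flext_mem[OF vs b] flext_add[OF vs b]
  have z: "?e 0 = 0" by (simp add: lext_def)
  show g: "x \<in> X \<Longrightarrow> ?e (fgen (a, x, c)) = lact N a (ract N (p x) c)" for a x c
    by (simp add: s)
  have z': "lact (FB X) a 0 = 0" "ract (FB X) 0 a = 0" for a
    using FB_act(3)[of X a 0 0] FB_act(4)[of X 0 0 a] by auto
  show "bimod_hom (FB X) N ?e"
  proof (rule bimod_homI)
    show "?e (lact (FB X) a u) = lact N a (?e u)" if "u \<in> carr (FB X)" for a u
      using that by (induction rule: FB_induct)
        (auto simp: FB_act g z z' s lact_add[OF N] lact_lact[OF N] p)
    show "?e (ract (FB X) u a) = ract N (?e u) a" if "u \<in> carr (FB X)" for a u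
      using that by (induction rule: FB_induct)
        (auto simp: FB_act g z z' s ract_add[OF N] ract_ract[OF N] p lact_ract[OF N, symmetric])
  qed (auto simp: s)
qed

text \<open>Preimages under \<open>u\<close> are chosen for the basis of a free bimodule that has
  \<open>M\<close> as a summand, and the embedding \<open>i\<close> restricts the resulting map to
  \<open>M\<close>. The hypothesis is an inclusion of images because exactness yields preimages of
  cycles, not surjectivity.\<close>

lemma projective_lift:
  fixes M :: "('k, 'a, 'm::ab_group_add) bimod"
  assumes M: "projective_bimod scale M" and X [simp]: "bim X" and Y [simp]: "bim Y"
    and u: "bimod_hom X Y u" and v: "bimod_hom M Y v" and im: "v ` carr M \<subseteq> u ` carr X"
  obtains w where "bimod_hom M X w" "\<And>x. x \<in> carr M \<Longrightarrow> u (w x) = v x"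
proof -
  from M obtain B :: "'m set" and i r where Mb [simp]: "bim M"
    and i: "bimod_hom M (FB B) i" and r: "bimod_hom (FB B) M r" and ri: "\<And>x. x \<in> carr M \<Longrightarrow> r (i x) = x"
    unfolding projective_bimod_def by auto
  have rm: "z \<in> carr (FB B) \<Longrightarrow> r z \<in> carr M"
    and ra: "y \<in> carr (FB B) \<Longrightarrow> z \<in> carr (FB B) \<Longrightarrow> r (y + z) = r y + r z"
    and rl: "z \<in> carr (FB B) \<Longrightarrow> r (lact (FB B) a z) = lact M a (r z)"
    and rr: "z \<in> carr (FB B) \<Longrightarrow> r (ract (FB B) z a) = ract M (r z) a" for y z a
    using r by (auto simp: bimod_hom_def)
  have gm: "x \<in> B \<Longrightarrow> fgen (a, x, b) \<in> carr (FB B)" for a x b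
    unfolding FB_simps by (rule fv.span_base) auto
  have zm: "0 \<in> carr (FB B)" unfolding FB_simps by (rule fv.span_zero)
  define p where "p x = inv_into (carr X) u (v (r (fgen (1, x, 1))))" for x
  have pm: "v (r (fgen (1, x, 1))) \<in> u ` carr X" if "x \<in> B" for x
    using that by (intro subsetD[OF im] imageI rm gm)
  have p: "p x \<in> carr X" "u (p x) = v (r (fgen (1, x, 1)))" if "x \<in> B" for x
    unfolding p_def using inv_into_into[OF pm[OF that]] f_inv_into_f[OF pm[OF that]] by simp_all
  obtain e where e: "bimod_hom (FB B) X e"
    and eg: "\<And>a x b. x \<in> B \<Longrightarrow> e (fgen (a, x, b)) = lact X a (ract X (p x) b)"
    using FB_hom[where X = B and p = p, OF X p(1)] by auto
  have em: "z \<in> carr (FB B) \<Longrightarrow> e z \<in> carr X"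
    and ea: "y \<in> carr (FB B) \<Longrightarrow> z \<in> carr (FB B) \<Longrightarrow> e (y + z) = e y + e z" for y z
    using e by (auto simp: bimod_hom_def)
  have z: "e 0 = 0" "r 0 = 0" using ea[OF zm zm] ra[OF zm zm] by auto
  have ue: "t \<in> carr (FB B) \<Longrightarrow> u (e t) = v (r t)" for t
  proof (induction rule: FB_induct)
    case zero
    show ?case by (simp add: z hom_0[OF X u] hom_0[OF Mb v])
  next
    case (gen a x b)
    let ?g = "fgen (1, x, 1)"
    have g: "?g \<in> carr (FB B)" by (rule gm) fact
    have m: "ract (FB B) ?g b \<in> carr (FB B)" unfolding FB_act by (rule gm) fact
    have "r (fgen (a, x, b)) = r (lact (FB B) a (ract (FB B) ?g b))" by (simp add: FB_act)
    also have "\<dots> = lact M a (ract M (r ?g) b)" by (simp only: rl[OF m] rr[OF g])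
    finally have "v (r (fgen (a, x, b))) = lact Y a (ract Y (v (r ?g)) b)"
      using rm[OF g] by (simp add: hom_lact[OF Mb v] hom_ract[OF Mb v])
    moreover have "u (e (fgen (a, x, b))) = lact Y a (ract Y (u (p x)) b)"
      using gen p(1)[OF gen] by (simp add: eg hom_lact[OF X u] hom_ract[OF X u])
    ultimately show ?case using p(2)[OF gen] by simp
  next
    case (add y z)
    then show ?case by (simp add: ea ra hom_add[OF X u] hom_add[OF Mb v] em rm)
  qed
  have im: "x \<in> carr M \<Longrightarrow> i x \<in> carr (FB B)" for x using i by (auto simp: bimod_hom_def)
  show thesis
  proof (rule that[of "\<lambda>x. e (i x)"])
    show "bimod_hom M X (\<lambda>x. e (i x))" using e i unfolding bimod_hom_def by auto
    show "u (e (i x)) = v x" if "x \<in> carr M" for x using that by (simp add: ue im ri)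
  qed
qed

section \<open>Null homotopies into exact complexes\<close>

text \<open>Exactness and augmentation without projectivity: what the target of a null homotopy has
  to provide. In positive degrees only one inclusion is listed, since \<open>cpx\<close> contains
  the converse.\<close>

definition resolves :: "('k, 'a, 'm::ab_group_add) cplx \<Rightarrow> ('m \<Rightarrow> 'a) \<Rightarrow> bool" where
  "resolves Q \<nu> \<longleftrightarrow> cpx Q \<and> (\<forall>n<0. crr Q n = {0}) \<and>
     (\<forall>n>0. \<forall>x\<in>crr Q n. diff Q n x = 0 \<longrightarrow> x \<in> diff Q (n + 1) ` crr Q (n + 1)) \<and>
     bimod_hom (obj Q 0) (alg_bimod scale UNIV) \<nu> \<and> \<nu> ` crr Q 0 = UNIV \<and>
     (\<forall>x\<in>crr Q 0. \<nu> x = 0 \<longleftrightarrow> x \<in> diff Q 1 ` crr Q 1)"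

lemma proj_resolution_resolves: "proj_resolution scale P \<mu> \<Longrightarrow> resolves P \<mu>"
  unfolding proj_resolution_def resolves_def by blast

lemma bim_alg [simp]: "bim (alg_bimod scale UNIV)"
  using cpx_bim[OF cpx_Alg, of 0] by (simp add: alg_cplx_def)

text \<open>The comparison theorem with prescribed augmentation. The only obstruction sits in degree
  \<open>-t\<close>, where \<open>\<nu> D\<close> must be \<open>u d\<close>. With
  \<open>D = 0\<close>, \<open>t = -1\<close> and \<open>u = \<mu>\<close> the lemma yields a
  comparison map, with \<open>u = 0\<close> its uniqueness, and with general \<open>u\<close> the
  uniqueness of normalised liftings.\<close>

lemma null_homotopy:
  fixes P :: "('k, 'a, 'm::ab_group_add) cplx" and Q :: "('k, 'a, 'n::ab_group_add) cplx"
  assumes P [simp]: "cpx P" and proj: "\<And>i. projective_bimod scale (obj P i)"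
    and res: "resolves Q \<nu>" and D: "deg_hom P Q t D"
    and chain: "\<And>i x. x \<in> crr P i \<Longrightarrow> D (i - 1) (diff P i x) = ksgn t (diff Q (i + t) (D i x))"
    and u: "bimod_hom (obj P (- t - 1)) (alg_bimod scale UNIV) u"
    and \<nu>D: "\<And>x. x \<in> crr P (- t) \<Longrightarrow> \<nu> (D (- t) x) = u (diff P (- t) x)"
  shows "\<exists>K. deg_hom P Q (t + 1) K \<and>
    (\<forall>i. \<forall>x\<in>crr P i. K (i - 1) (diff P i x) + ksgn t (diff Q (i + t + 1) (K i x)) = D i x) \<and>
    (\<forall>x\<in>crr P (- t - 1). \<nu> (K (- t - 1) x) = u x)"
proof -
  have Q [simp]: "cpx Q" and neg: "\<And>n x. n < 0 \<Longrightarrow> x \<in> crr Q n \<Longrightarrow> x = 0"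
    and ex: "\<And>n x. n > 0 \<Longrightarrow> x \<in> crr Q n \<Longrightarrow> diff Q n x = 0 \<Longrightarrow> x \<in> diff Q (n + 1) ` crr Q (n + 1)"
    and \<nu>: "bimod_hom (obj Q 0) (alg_bimod scale UNIV) \<nu>" and sur: "\<nu> ` crr Q 0 = UNIV"
    and ker: "\<And>x. x \<in> crr Q 0 \<Longrightarrow> \<nu> x = 0 \<longleftrightarrow> x \<in> diff Q 1 ` crr Q 1"
    using res unfolding resolves_def by blast+
  \<comment> \<open>\<open>deg k\<close> is the source degree whose component of \<open>K\<close>
    lands in degree \<open>k\<close> of \<open>Q\<close>.\<close>
  define deg where "deg k = int k - t - 1" for k
  \<comment> \<open>The invariant of the recursion: the defect left by the component just built is a
    boundary, so that the next component can be chosen.\<close>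
  define bdry where "bdry k K \<longleftrightarrow> (\<forall>x\<in>crr P (deg (Suc k)).
     D (deg (Suc k)) x - K (diff P (deg (Suc k)) x) \<in> diff Q (int k + 1) ` crr Q (int k + 1))" for k K
  define pr where "pr k K \<longleftrightarrow> bimod_hom (obj P (deg k)) (obj Q (int k)) K \<and> bdry k K \<and>
      (k = 0 \<longrightarrow> (\<forall>x\<in>crr P (deg k). \<nu> (K x) = u x))" for k K
  define st where "st k K K' \<longleftrightarrow> (\<forall>x\<in>crr P (deg (Suc k)).
     K (diff P (deg (Suc k)) x) + ksgn t (diff Q (int k + 1) (K' x)) = D (deg (Suc k)) x)" for k K K'
  have dS: "deg (Suc k) - 1 = deg k" for k by (simp add: deg_def)
  have dhom: "bimod_hom (obj P (deg (Suc k))) (obj P (deg k)) (diff P (deg (Suc k)))" for k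
    using cpx_diff[OF P, of "deg (Suc k)"] by (simp add: dS)
  have Dhom: "bimod_hom (obj P (deg (Suc k))) (obj Q (int k)) (D (deg (Suc k)))" for k
    by (rule deg_homD[OF D]) (simp add: deg_def)
  have start: "\<exists>K. pr 0 K"
  proof -
    obtain K where K: "bimod_hom (obj P (- t - 1)) (obj Q 0) K"
      "\<And>x. x \<in> crr P (- t - 1) \<Longrightarrow> \<nu> (K x) = u x"
      by (rule projective_lift[OF proj cpx_bim[OF Q] bim_alg \<nu> u]) (use sur in auto)
    have "bdry 0 K"
      unfolding bdry_def
    proof
      fix x assume x: "x \<in> crr P (deg (Suc 0))"
      then have x': "x \<in> crr P (- t)" by (simp add: deg_def)
      have dx: "diff P (- t) x \<in> crr P (- t - 1)" using x' by simp
      have m: "D (- t) x \<in> crr Q 0" "K (diff P (- t) x) \<in> crr Q 0"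
        using dh_mem[OF P D x', of 0] hom_mem[OF _ K(1) dx] by auto
      then have "\<nu> (D (- t) x - K (diff P (- t) x)) = 0"
        using \<nu>D[OF x'] K(2)[OF dx] by (simp add: hom_diff[OF _ \<nu>])
      then show "D (deg (Suc 0)) x - K (diff P (deg (Suc 0)) x) \<in> diff Q (int 0 + 1) ` crr Q (int 0 + 1)"
        using ker m by (simp add: deg_def)
    qed
    then show ?thesis using K by (auto simp: pr_def deg_def)
  qed
  have next_step: "\<exists>K'. pr (Suc k) K' \<and> st k K K'" if k: "pr k K" for k K
  proof -
    let ?n = "deg (Suc k)"
    \<comment> \<open>\<open>K'\<close> is to satisfy \<open>d K' = ?v\<close>; the sign turns this
      into the equation \<open>st\<close>.\<close>
    let ?v = "\<lambda>x. ksgn t (D ?n x - K (diff P ?n x))"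
    have Kh: "bimod_hom (obj P (deg k)) (obj Q (int k)) K" using k by (simp add: pr_def)
    have vm: "\<And>x. x \<in> crr P ?n \<Longrightarrow> ?v x \<in> diff Q (int k + 1) ` crr Q (int k + 1)"
    proof -
      fix x assume "x \<in> crr P ?n"
      then obtain y where y: "y \<in> crr Q (int k + 1)" "D ?n x - K (diff P ?n x) = diff Q (int k + 1) y"
        using k unfolding pr_def bdry_def by blast
      then have "?v x = diff Q (int k + 1) (ksgn t y)" by (simp add: d_ksgn)
      then show "?v x \<in> diff Q (int k + 1) ` crr Q (int k + 1)" using y by auto
    qed
    have vh: "bimod_hom (obj P ?n) (obj Q (int k)) ?v"
    proof (rule bimod_homI)
      note s = hom_mem[OF _ dhom] hom_mem[OF _ Kh] hom_mem[OF _ Dhom] hom_add[OF _ dhom] hom_add[OF _ Kh]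
        hom_add[OF _ Dhom] hom_lact[OF _ dhom] hom_lact[OF _ Kh] hom_lact[OF _ Dhom]
        hom_ract[OF _ dhom] hom_ract[OF _ Kh] hom_ract[OF _ Dhom]
      show "?v x \<in> crr Q (int k)" if "x \<in> crr P ?n" for x using that by (simp add: s)
      show "?v (x + y) = ?v x + ?v y" if "x \<in> crr P ?n" "y \<in> crr P ?n" for x y
        using that by (simp add: s ksgn_add[symmetric] algebra_simps)
      show "?v (lact (obj P ?n) a x) = lact (obj Q (int k)) a (?v x)" if "x \<in> crr P ?n" for a x
        using that by (simp add: s lact_ksgn lact_diff)
      show "?v (ract (obj P ?n) x a) = ract (obj Q (int k)) (?v x) a" if "x \<in> crr P ?n" for a x
        using that by (simp add: s ract_ksgn ract_diff)
    qed
    have dQ: "bimod_hom (obj Q (int k + 1)) (obj Q (int k)) (diff Q (int k + 1))"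
      using cpx_diff[OF Q, of "int k + 1"] by simp
    obtain K' where K': "bimod_hom (obj P ?n) (obj Q (int k + 1)) K'"
      "\<And>x. x \<in> crr P ?n \<Longrightarrow> diff Q (int k + 1) (K' x) = ?v x"
      using projective_lift[OF proj _ _ dQ vh] vm Q by (auto simp: image_subset_iff)
    have s': "st k K K'"
      unfolding st_def using K'(2) by simp
    have "bdry (Suc k) K'"
      unfolding bdry_def
    proof
      fix x assume x: "x \<in> crr P (deg (Suc (Suc k)))"
      let ?m = "deg (Suc (Suc k))"
      have dx: "diff P ?m x \<in> crr P ?n" by (rule d_mem[OF P x]) (simp add: deg_def)
      have ddx: "diff P ?n (diff P ?m x) = 0" by (rule cpx_dd'[OF P x]) (simp add: deg_def)
      have m: "D ?m x \<in> crr Q (int k + 1)" "K' (diff P ?m x) \<in> crr Q (int k + 1)"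
        using dh_mem[OF P D x, of "int k + 1"] hom_mem[OF _ K'(1) dx] by (simp_all add: deg_def)
      have c: "D ?n (diff P ?m x) = ksgn t (diff Q (int k + 1) (D ?m x))"
        using chain[OF x] by (simp add: dS) (simp add: deg_def add.commute)
      \<comment> \<open>The defect is a cycle by the chain condition on \<open>D\<close>, and
        exactness of \<open>Q\<close> turns it into a boundary.\<close>
      have "diff Q (int k + 1) (D ?m x - K' (diff P ?m x)) = 0"
        using m dx by (simp add: d_diff K'(2) ddx c hom_0[OF _ Kh])
      then have "D ?m x - K' (diff P ?m x) \<in> diff Q (int k + 1 + 1) ` crr Q (int k + 1 + 1)"
        using m by (intro ex) auto
      then show "D ?m x - K' (diff P ?m x) \<in> diff Q (int (Suc k) + 1) ` crr Q (int (Suc k) + 1)"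
        by (simp add: ac_simps)
    qed
    then show ?thesis using K'(1) s' by (auto simp: pr_def add.commute)
  qed
  obtain \<kappa> where \<kappa>: "\<And>k. pr k (\<kappa> k)" "\<And>k. st k (\<kappa> k) (\<kappa> (Suc k))"
    using dependent_nat_choice[of pr st, OF start next_step] by blast
  \<comment> \<open>Below degree \<open>-t - 1\<close> the target lies in negative degrees, so
    \<open>K\<close> is zero there.\<close>
  define K where "K i = (if i \<ge> - t - 1 then \<kappa> (nat (i + t + 1)) else (\<lambda>_. 0))" for i
  have Kd: "K (deg k) = \<kappa> k" for k by (simp add: K_def deg_def)
  have cov: "i \<ge> - t - 1 \<Longrightarrow> i = deg (nat (i + t + 1))" for i by (simp add: deg_def)
  show ?thesis
  proof (intro exI[of _ K] conjI allI ballI)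
    show "deg_hom P Q (t + 1) K"
      unfolding deg_hom_def
    proof
      fix i
      show "bimod_hom (obj P i) (obj Q (i + (t + 1))) (K i)"
      proof (cases "i \<ge> - t - 1")
        case True
        let ?k = "nat (i + t + 1)"
        have e: "int ?k = i + (t + 1)" using True by simp
        have "bimod_hom (obj P (deg ?k)) (obj Q (int ?k)) (K (deg ?k))"
          using \<kappa>(1)[of ?k] by (simp add: pr_def Kd)
        then show ?thesis unfolding e cov[OF True, symmetric] .
      next
        case False
        then show ?thesis unfolding K_def by (intro bimod_homI) simp_all
      qed
    qed
    show "K (i - 1) (diff P i x) + ksgn t (diff Q (i + t + 1) (K i x)) = D i x" if x: "x \<in> crr P i" for i x
    proof (cases "i \<ge> - t")
      case True
      define k where "k = nat (i + t)"
      have i: "i = deg (Suc k)" and i1: "i - 1 = deg k" using True by (simp_all add: deg_def k_def)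
      have i2: "deg (Suc k) + t + 1 = int k + 1" by (simp add: deg_def)
      show ?thesis using \<kappa>(2)[of k] x unfolding i1 i st_def by (simp add: Kd dS i2)
    next
      case False
      then have "D i x = 0" using dh_mem[OF P D x refl] neg[of "i + t"] by simp
      moreover have "diff Q (i + t + 1) (K i x) = 0"
      proof -
        have "K i x \<in> crr Q (i + t + 1)"
        proof (cases "i = - t - 1")
          case True
          then show ?thesis
            using \<kappa>(1)[of 0] x hom_mem[of "obj P i" "obj Q 0" "\<kappa> 0" x]
            by (simp add: K_def pr_def deg_def)
        qed (use False in \<open>simp add: K_def\<close>)
        then have "diff Q (i + t + 1) (K i x) \<in> crr Q (i + t)" by simp
        then show ?thesis using False neg[of "i + t"] by simp
      qed
      moreover have "K (i - 1) = (\<lambda>_. 0)" using False by (simp add: K_def)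
      ultimately show ?thesis by simp
    qed
    show "\<nu> (K (- t - 1) x) = u x" if "x \<in> crr P (- t - 1)" for x
      using \<kappa>(1)[of 0] that Kd[of 0] by (simp add: pr_def deg_def)
  qed
qed


section \<open>Composing graded maps\<close>

text \<open>The index function \<open>k\<close> only has to agree with \<open>i + t\<close>, so that
  composites may carry their indices in whatever form the goal shows.\<close>

lemma deg_hom_comp:
  assumes "cpx P" and f: "deg_hom P Q t f" and g: "deg_hom Q R u g" and "v = t + u" "\<And>i. k i = i + t"
  shows "deg_hom P R v (\<lambda>i x. g (k i) (f i x))"
  using assms by (simp add: deg_hom_def bimod_hom_def add.assoc[symmetric])

lemma deg_hom_comp_d:
  assumes "cpx P" and f: "deg_hom P Q t f" and "v = t - 1"
  shows "deg_hom P Q v (\<lambda>i x. f (i - 1) (diff P i x))"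
  by (rule deg_hom_comp[OF assms(1) diff_hom[OF assms(1)] f]) (use assms in auto)

lemma deg_hom_cong:
  assumes "cpx P" "deg_hom P Q t f" "\<And>i x. x \<in> crr P i \<Longrightarrow> g i x = f i x"
  shows "deg_hom P Q t g"
  using assms by (auto simp: deg_hom_def bimod_hom_def)

lemma deg_hom_add:
  assumes "cpx P" "cpx Q" "deg_hom P Q t f" "deg_hom P Q t g"
  shows "deg_hom P Q t (\<lambda>i x. f i x + g i x)"
  unfolding deg_hom_def
  by (intro allI bimod_homI)
    (use assms in \<open>simp_all add: dh_simps[OF assms(1,3)] dh_simps[OF assms(1,4)] dh_lact[OF assms(1,3) _ refl]
      dh_lact[OF assms(1,4) _ refl] dh_ract[OF assms(1,3) _ refl]
      dh_ract[OF assms(1,4) _ refl] lact_add ract_add algebra_simps\<close>)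

lemma deg_hom_ksgn:
  assumes "cpx P" "cpx Q" "deg_hom P Q t f"
  shows "deg_hom P Q t (\<lambda>i x. ksgn n (f i x))"
  unfolding deg_hom_def
  by (intro allI bimod_homI)
    (use assms in \<open>simp_all add: dh_simps[OF assms(1,3)] dh_lact[OF assms(1,3) _ refl]
      dh_ract[OF assms(1,3) _ refl] lact_ksgn ract_ksgn ksgn_add\<close>)

lemma deg_hom_minus:
  assumes "cpx P" "cpx Q" "deg_hom P Q t f"
  shows "deg_hom P Q t (\<lambda>i x. - f i x)"
  using deg_hom_ksgn[OF assms, of 1] by (simp add: ksgn_def)

lemma deg_hom_diff:
  assumes "cpx P" "cpx Q" "deg_hom P Q t f" "deg_hom P Q t g"
  shows "deg_hom P Q t (\<lambda>i x. f i x - g i x)"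
  using deg_hom_add[OF assms(1-3) deg_hom_minus[OF assms(1,2,4)]] by simp

lemma deg_hom_zero: "cpx Q \<Longrightarrow> deg_hom P Q t (\<lambda>i x. 0)"
  by (simp add: deg_hom_def bimod_hom_def)

lemma deg_hom_id: "deg_hom P P 0 (\<lambda>i x. x)"
  by (simp add: deg_hom_def bimod_hom_def)

lemma cochain_0:
  assumes "cpx Q" "deg_hom Q Alg t g" "x \<in> crr Q i" "i \<noteq> - t"
  shows "g i x = 0"
  using dh_mem[OF assms(1,2,3) refl] assms(4) by (simp add: crr_Alg)

lemma cochain_act:
  assumes "cpx Q" "deg_hom Q Alg t g" "x \<in> crr Q i"
  shows "g i (lact (obj Q i) a x) = a * g i x" "g i (ract (obj Q i) x a) = g i x * a"
  using dh_lact[OF assms refl] dh_ract[OF assms refl] by auto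

lemma zext_hom:
  assumes "bimod_hom (obj Q 0) (alg_bimod scale UNIV) \<nu>"
  shows "deg_hom Q Alg 0 (zext \<nu>)"
  using assms unfolding deg_hom_def zext_def
  by (auto simp: alg_cplx_def bimod_hom_def alg_bimod_def)

section \<open>The commutator with a cochain\<close>

text \<open>\<open>Lop Q m g\<close> is \<open>g \<otimes> 1\<close>, \<open>Rop Q m g\<close> is \<open>1 \<otimes> g\<close> and \<open>del Q m g\<close> their difference, as maps
  \<open>Q \<otimes>\<^sub>A Q \<rightarrow> Q[-m]\<close>.\<close>

definition Lop :: "('k, 'a, 'm::ab_group_add) cplx \<Rightarrow> int \<Rightarrow> (int \<Rightarrow> 'm \<Rightarrow> 'a) \<Rightarrow> (int \<Rightarrow> ('k, 'm, 'm) tens \<Rightarrow> 'm)" where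
  "Lop Q m g n = lext (bscale (obj Q (n - m))) (\<lambda>((i, x), (j, y)). lact (obj Q j) (g i x) y)"

definition Rop :: "('k, 'a, 'm::ab_group_add) cplx \<Rightarrow> int \<Rightarrow> (int \<Rightarrow> 'm \<Rightarrow> 'a) \<Rightarrow> (int \<Rightarrow> ('k, 'm, 'm) tens \<Rightarrow> 'm)" where
  "Rop Q m g n = lext (bscale (obj Q (n - m))) (\<lambda>((i, x), (j, y)). ksgn (i * m) (ract (obj Q i) x (g j y)))"

definition del :: "('k, 'a, 'm::ab_group_add) cplx \<Rightarrow> int \<Rightarrow> (int \<Rightarrow> 'm \<Rightarrow> 'a) \<Rightarrow> (int \<Rightarrow> ('k, 'm, 'm) tens \<Rightarrow> 'm)" where
  "del Q m g n t = Lop Q m g n t - Rop Q m g n t"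

context
  fixes Q :: "('k, 'a, 'm::ab_group_add) cplx" and m g
  assumes Q [simp]: "cpx Q" and g: "deg_hom Q Alg (- m) g"
begin

lemma g0: "x \<in> crr Q i \<Longrightarrow> i \<noteq> m \<Longrightarrow> g i x = 0"
  using cochain_0[OF Q g] by simp

text \<open>\<open>Alg\<close> sits in degree 0, so \<open>g\<close> is nonzero in degree
  \<open>m\<close> only. There \<open>k = j\<close>, and in all other degrees the term is 0. This
  case distinction recurs throughout.\<close>

lemma Lop_mem0: "x \<in> crr Q i \<Longrightarrow> y \<in> crr Q j \<Longrightarrow> k = i + j - m \<Longrightarrow> lact (obj Q j) (g i x) y \<in> crr Q k"
  by (cases "i = m") (simp_all add: g0)

lemma Rop_mem0: "x \<in> crr Q i \<Longrightarrow> y \<in> crr Q j \<Longrightarrow> k = i + j - m \<Longrightarrow> ract (obj Q i) x (g j y) \<in> crr Q k"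
  by (cases "j = m") (simp_all add: g0)

lemma Lop: "deg_hom (Q \<otimes> Q) Q (- m) (Lop Q m g)"
  and Lop_tprod: "\<And>i j k x y. k = i + j \<Longrightarrow> x \<in> crr Q i \<Longrightarrow> y \<in> crr Q j \<Longrightarrow>
    Lop Q m g k (tprod Q Q i x j y) = lact (obj Q j) (g i x) y"
proof -
  let ?b = "\<lambda>i x j y. lact (obj Q j) (g i x) y"
  note c = dh_simps[OF Q g] and ca = cochain_act[OF Q g]
  have l: "?b i (lact (obj Q i) a x) j y = lact (obj Q (k - m)) a (?b i x j y)"
    if "i + j = k" "x \<in> crr Q i" "y \<in> crr Q j" for i j k x y a
    using that by (cases "i = m") (auto simp: g0 c ca lact_lact)
  have r: "?b i x j (ract (obj Q j) y a) = ract (obj Q (k - m)) (?b i x j y) a"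
    if "i + j = k" "x \<in> crr Q i" "y \<in> crr Q j" for i j k x y a
    using that by (cases "i = m") (auto simp: g0 c ca lact_ract)
  have "bimod_hom (obj (Q \<otimes> Q) k) (obj Q (k - m)) (Lop Q m g k)" for k
    unfolding Lop_def
    by (rule tens_hom(1)[where b = ?b]) (simp_all add: Lop_mem0 l r c ca(2) add_lact lact_add lact_lact)
  then show "deg_hom (Q \<otimes> Q) Q (- m) (Lop Q m g)" by (simp add: deg_hom_def)
  show "Lop Q m g k (tprod Q Q i x j y) = ?b i x j y"
    if "k = i + j" "x \<in> crr Q i" "y \<in> crr Q j" for i j k x y
    unfolding Lop_def
    by (rule tens_hom(2)[where b = ?b and n = k])
      (simp_all add: Lop_mem0 l r c ca(2) add_lact lact_add lact_lact that)
qed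

lemma Rop: "deg_hom (Q \<otimes> Q) Q (- m) (Rop Q m g)"
  and Rop_tprod: "\<And>i j k x y. k = i + j \<Longrightarrow> x \<in> crr Q i \<Longrightarrow> y \<in> crr Q j \<Longrightarrow>
    Rop Q m g k (tprod Q Q i x j y) = ksgn (i * m) (ract (obj Q i) x (g j y))"
proof -
  let ?b = "\<lambda>i x j y. ksgn (i * m) (ract (obj Q i) x (g j y))"
  note c = dh_simps[OF Q g] and ca = cochain_act[OF Q g]
  have l: "?b i (lact (obj Q i) a x) j y = lact (obj Q (k - m)) a (?b i x j y)"
    if "i + j = k" "x \<in> crr Q i" "y \<in> crr Q j" for i j k x y a
    using that by (cases "j = m") (auto simp: g0 c ca lact_ract lact_ksgn)
  have r: "?b i x j (ract (obj Q j) y a) = ract (obj Q (k - m)) (?b i x j y) a"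
    if "i + j = k" "x \<in> crr Q i" "y \<in> crr Q j" for i j k x y a
    using that by (cases "j = m") (auto simp: g0 c ca ract_ract ract_ksgn)
  have "bimod_hom (obj (Q \<otimes> Q) k) (obj Q (k - m)) (Rop Q m g k)" for k
    unfolding Rop_def
    by (rule tens_hom(1)[where b = ?b]) (simp_all add: Rop_mem0 l r c ca(1) add_ract ract_add ract_ract ksgn_add)
  then show "deg_hom (Q \<otimes> Q) Q (- m) (Rop Q m g)" by (simp add: deg_hom_def)
  show "Rop Q m g k (tprod Q Q i x j y) = ?b i x j y"
    if "k = i + j" "x \<in> crr Q i" "y \<in> crr Q j" for i j k x y
    unfolding Rop_def
    by (rule tens_hom(2)[where b = ?b and n = k])
      (simp_all add: Rop_mem0 l r c ca(1) add_ract ract_add ract_ract ksgn_add that)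
qed

lemma del_hom: "deg_hom (Q \<otimes> Q) Q (- m) (del Q m g)"
  unfolding del_def by (rule deg_hom_diff[OF _ _ Lop Rop]) simp_all

lemma del_tprod: "k = i + j \<Longrightarrow> x \<in> crr Q i \<Longrightarrow> y \<in> crr Q j \<Longrightarrow>
    del Q m g k (tprod Q Q i x j y) = lact (obj Q j) (g i x) y - ksgn (i * m) (ract (obj Q i) x (g j y))"
  by (simp add: del_def Lop_tprod Rop_tprod)

end

lemma QQ_ext:
  assumes Q: "cpx Q" and F: "deg_hom (Q \<otimes> Q) R u F" and G: "deg_hom (Q \<otimes> Q) R u' G"
    and "\<And>i x j y. i + j = n \<Longrightarrow> x \<in> crr Q i \<Longrightarrow> y \<in> crr Q j \<Longrightarrow> F n (tprod Q Q i x j y) = G n (tprod Q Q i x j y)"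
    and "t \<in> crr (Q \<otimes> Q) n"
  shows "F n t = G n t"
  by (rule tens_ext[OF Q Q assms(5)]) (use Q in \<open>simp_all add: assms(4) dh_add[OF _ F] dh_add[OF _ G]\<close>)

context
  fixes Q :: "('k, 'a, 'm::ab_group_add) cplx" and m h
  assumes Q [simp]: "cpx Q" and h: "deg_hom Q Alg (- m) h"
begin

lemma hd_hom: "deg_hom Q Alg (- (m + 1)) (\<lambda>i x. h (i - 1) (diff Q i x))"
  by (rule deg_hom_comp_d[OF Q h]) simp

text \<open>The Leibniz rule: the commutator of \<open>d\<close> with \<open>h \<otimes> 1\<close>
  is \<open>(h d) \<otimes> 1\<close>, because \<open>d\<close> commutes with the action of the
  values of \<open>h\<close>. The last term matters when \<open>h\<close> is not a cocycle: it
  produces the correction of a lifting in \<open>hlift_shift\<close>.\<close>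

lemma Lop_d:
  assumes "t \<in> crr (Q \<otimes> Q) n"
  shows "Lop Q m h (n - 1) (diff (Q \<otimes> Q) n t) =
    ksgn m (diff Q (n - m) (Lop Q m h n t)) + Lop Q (m + 1) (\<lambda>i x. h (i - 1) (diff Q i x)) n t"
proof (rule QQ_ext[OF Q _ _ _ assms, where u = "- m - 1" and u' = "- m - 1" and R = Q and
    F = "\<lambda>n t. Lop Q m h (n - 1) (diff (Q \<otimes> Q) n t)" and
    G = "\<lambda>n t. ksgn m (diff Q (n - m) (Lop Q m h n t)) + Lop Q (m + 1) (\<lambda>i x. h (i - 1) (diff Q i x)) n t"])
  show "deg_hom (Q \<otimes> Q) Q (- m - 1) (\<lambda>n t. Lop Q m h (n - 1) (diff (Q \<otimes> Q) n t))"
    by (rule deg_hom_comp[OF _ diff_hom Lop[OF Q h]]) simp_all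
  show "deg_hom (Q \<otimes> Q) Q (- m - 1)
     (\<lambda>n t. ksgn m (diff Q (n - m) (Lop Q m h n t)) + Lop Q (m + 1) (\<lambda>i x. h (i - 1) (diff Q i x)) n t)"
    using Lop[OF Q hd_hom]
    by (intro deg_hom_add deg_hom_ksgn deg_hom_comp[OF _ Lop[OF Q h] diff_hom]) simp_all
  fix i x j y assume a: "i + j = n" "x \<in> crr Q i" "y \<in> crr Q j"
  note c = dh_simps[OF Q h]
  have e: "ksgn i (lact (obj Q (j - 1)) (h i x) (diff Q j y)) = ksgn m (diff Q (n - m) (lact (obj Q j) (h i x) y))"
  proof (cases "i = m")
    case True
    then have "n - m = j" using a by simp
    then show ?thesis unfolding \<open>n - m = j\<close> using True a by (simp add: d_lact)
  next
    case False
    then show ?thesis using a g0[OF Q h] by simp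
  qed
  show "Lop Q m h (n - 1) (diff (Q \<otimes> Q) n (tprod Q Q i x j y)) =
    ksgn m (diff Q (n - m) (Lop Q m h n (tprod Q Q i x j y))) +
    Lop Q (m + 1) (\<lambda>i x. h (i - 1) (diff Q i x)) n (tprod Q Q i x j y)"
    using a by (simp add: diff_tprod Lop_tprod[OF Q h] Lop_tprod[OF Q hd_hom] e[symmetric]
        dh_simps[OF _ Lop[OF Q h]] c)
qed

lemma Rop_d:
  assumes "t \<in> crr (Q \<otimes> Q) n"
  shows "Rop Q m h (n - 1) (diff (Q \<otimes> Q) n t) =
    ksgn m (diff Q (n - m) (Rop Q m h n t)) + Rop Q (m + 1) (\<lambda>i x. h (i - 1) (diff Q i x)) n t"
proof (rule QQ_ext[OF Q _ _ _ assms, where u = "- m - 1" and u' = "- m - 1" and R = Q and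
    F = "\<lambda>n t. Rop Q m h (n - 1) (diff (Q \<otimes> Q) n t)" and
    G = "\<lambda>n t. ksgn m (diff Q (n - m) (Rop Q m h n t)) + Rop Q (m + 1) (\<lambda>i x. h (i - 1) (diff Q i x)) n t"])
  show "deg_hom (Q \<otimes> Q) Q (- m - 1) (\<lambda>n t. Rop Q m h (n - 1) (diff (Q \<otimes> Q) n t))"
    by (rule deg_hom_comp[OF _ diff_hom Rop[OF Q h]]) simp_all
  show "deg_hom (Q \<otimes> Q) Q (- m - 1)
     (\<lambda>n t. ksgn m (diff Q (n - m) (Rop Q m h n t)) + Rop Q (m + 1) (\<lambda>i x. h (i - 1) (diff Q i x)) n t)"
    using Rop[OF Q hd_hom]
    by (intro deg_hom_add deg_hom_ksgn deg_hom_comp[OF _ Rop[OF Q h] diff_hom]) simp_all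
  fix i x j y assume a: "i + j = n" "x \<in> crr Q i" "y \<in> crr Q j"
  note c = dh_simps[OF Q h]
  have e: "ksgn ((i - 1) * m) (ract (obj Q (i - 1)) (diff Q i x) (h j y)) =
    ksgn m (diff Q (n - m) (ksgn (i * m) (ract (obj Q i) x (h j y))))"
  proof (cases "j = m")
    case True
    then have "n - m = i" using a by simp
    then show ?thesis unfolding \<open>n - m = i\<close> using True a
      by (auto simp: d_ract d_ksgn ksgn_ksgn algebra_simps intro!: ksgn_parity)
  next
    case False
    then show ?thesis using a g0[OF Q h] by simp
  qed
  have e2: "ksgn i (ksgn (i * m) z) = ksgn (i * (m + 1)) (z :: 'm)" for z
    by (simp add: ksgn_ksgn algebra_simps)
  show "Rop Q m h (n - 1) (diff (Q \<otimes> Q) n (tprod Q Q i x j y)) =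
    ksgn m (diff Q (n - m) (Rop Q m h n (tprod Q Q i x j y))) +
    Rop Q (m + 1) (\<lambda>i x. h (i - 1) (diff Q i x)) n (tprod Q Q i x j y)"
    using a by (simp add: diff_tprod Rop_tprod[OF Q h] Rop_tprod[OF Q hd_hom] e[symmetric] e2[symmetric]
        dh_simps[OF _ Rop[OF Q h]] c)
qed

lemma del_d:
  assumes "t \<in> crr (Q \<otimes> Q) n"
  shows "del Q m h (n - 1) (diff (Q \<otimes> Q) n t) =
    ksgn m (diff Q (n - m) (del Q m h n t)) + del Q (m + 1) (\<lambda>i x. h (i - 1) (diff Q i x)) n t"
  using assms dh_mem[OF _ Lop[OF Q h] assms] dh_mem[OF _ Rop[OF Q h] assms]
  by (simp add: del_def Lop_d Rop_d d_diff ksgn_diff)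

end

lemma cocyclesD:
  assumes "g \<in> cocycles scale Q m"
  shows "deg_hom Q Alg (- m) g" "x \<in> crr Q i \<Longrightarrow> g (i - 1) (diff Q i x) = 0"
    "x \<in> crr Q i \<Longrightarrow> k = i - 1 \<Longrightarrow> g k (diff Q i x) = 0"
  using assms by (auto simp: cocycles_def eq_on_def)

context
  fixes Q :: "('k, 'a, 'm::ab_group_add) cplx" and m g
  assumes Q [simp]: "cpx Q" and g: "g \<in> cocycles scale Q m"
begin

lemma Lop_chain:
  assumes "t \<in> crr (Q \<otimes> Q) n"
  shows "Lop Q m g (n - 1) (diff (Q \<otimes> Q) n t) = ksgn m (diff Q (n - m) (Lop Q m g n t))"
proof -
  note gh = cocyclesD(1)[OF g] and gd = hd_hom[OF Q cocyclesD(1)[OF g]]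
  have "Lop Q (m + 1) (\<lambda>i x. g (i - 1) (diff Q i x)) n t = 0"
    by (rule QQ_ext[OF Q Lop[OF Q gd] deg_hom_zero[OF Q] _ assms]) (simp add: Lop_tprod[OF Q gd] cocyclesD(2)[OF g])
  then show ?thesis using Lop_d[OF Q gh assms] by simp
qed

lemma Rop_chain:
  assumes "t \<in> crr (Q \<otimes> Q) n"
  shows "Rop Q m g (n - 1) (diff (Q \<otimes> Q) n t) = ksgn m (diff Q (n - m) (Rop Q m g n t))"
proof -
  note gh = cocyclesD(1)[OF g] and gd = hd_hom[OF Q cocyclesD(1)[OF g]]
  have "Rop Q (m + 1) (\<lambda>i x. g (i - 1) (diff Q i x)) n t = 0"
    by (rule QQ_ext[OF Q Rop[OF Q gd] deg_hom_zero[OF Q] _ assms]) (simp add: Rop_tprod[OF Q gd] cocyclesD(2)[OF g])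
  then show ?thesis using Rop_d[OF Q gh assms] by simp
qed

lemma del_chain:
  assumes "t \<in> crr (Q \<otimes> Q) n"
  shows "del Q m g (n - 1) (diff (Q \<otimes> Q) n t) = ksgn m (diff Q (n - m) (del Q m g n t))"
  using assms dh_mem[OF _ Lop[OF Q cocyclesD(1)[OF g]] assms] dh_mem[OF _ Rop[OF Q cocyclesD(1)[OF g]] assms]
  by (simp add: del_def Lop_chain Rop_chain d_diff ksgn_diff)

end

lemma cochain_Lop:
  assumes Q [simp]: "cpx Q" and g: "deg_hom Q Alg (- m) g" and f: "deg_hom Q Alg (- n) f"
    and x: "x \<in> crr Q i" and y: "y \<in> crr Q j" and k: "k = i + j - m"
  shows "f k (lact (obj Q j) (g i x) y) = g i x * f j y"
proof (cases "i = m")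
  case True
  then show ?thesis using k y cochain_act[OF Q f y] by simp
next
  case False
  then show ?thesis using g0[OF Q g x] y dh_0[OF Q f] by simp
qed

lemma cochain_Rop:
  assumes Q [simp]: "cpx Q" and g: "deg_hom Q Alg (- m) g" and f: "deg_hom Q Alg (- n) f"
    and x: "x \<in> crr Q i" and y: "y \<in> crr Q j" and k: "k = i + j - m"
  shows "f k (ract (obj Q i) x (g j y)) = f i x * g j y"
proof (cases "j = m")
  case True
  then show ?thesis using k x cochain_act[OF Q f x] by simp
next
  case False
  then show ?thesis using g0[OF Q g y] x dh_0[OF Q f] by simp
qed

text \<open>On a pure tensor both sides are combinations of \<open>g(x) f(y)\<close> and
  \<open>f(x) g(y)\<close>, by linearity over \<open>A\<close>. The exchange is used for two
  cocycles, for a cocycle and the augmentation, and for a cochain whose coboundary is the difference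
  of two cocycles.\<close>

lemma del_swap:
  assumes Q [simp]: "cpx Q" and g: "deg_hom Q Alg (- m) g" and f: "deg_hom Q Alg (- n) f"
    and t: "t \<in> crr (Q \<otimes> Q) k"
  shows "f (k - m) (del Q m g k t) = - ksgn (n * m) (g (k - n) (del Q n f k t))"
proof (rule QQ_ext[OF Q _ _ _ t, where R = Alg and u = "- n - m" and u' = "- n - m" and
    F = "\<lambda>k t. f (k - m) (del Q m g k t)" and G = "\<lambda>k t. - ksgn (n * m) (g (k - n) (del Q n f k t))"])
  show "deg_hom (Q \<otimes> Q) Alg (- n - m) (\<lambda>k t. f (k - m) (del Q m g k t))"
    by (rule deg_hom_comp[OF _ del_hom[OF Q g] f]) simp_all
  show "deg_hom (Q \<otimes> Q) Alg (- n - m) (\<lambda>k t. - ksgn (n * m) (g (k - n) (del Q n f k t)))"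
    by (intro deg_hom_minus deg_hom_ksgn deg_hom_comp[OF _ del_hom[OF Q f] g]) simp_all
  fix i x j y assume a: "i + j = k" "x \<in> crr Q i" "y \<in> crr Q j"
  have m: "lact (obj Q j) (g i x) y \<in> crr Q (k - m)" "ract (obj Q i) x (g j y) \<in> crr Q (k - m)"
    "lact (obj Q j) (f i x) y \<in> crr Q (k - n)" "ract (obj Q i) x (f j y) \<in> crr Q (k - n)"
    using a by (auto intro: Lop_mem0[OF Q g] Lop_mem0[OF Q f] Rop_mem0[OF Q g] Rop_mem0[OF Q f])
  have 1: "f (k - m) (del Q m g k (tprod Q Q i x j y)) = g i x * f j y - ksgn (i * m) (f i x * g j y)"
    using a m by (simp add: del_tprod[OF Q g] dh_simps[OF Q f] cochain_Lop[OF Q g f] cochain_Rop[OF Q g f])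
  have 2: "g (k - n) (del Q n f k (tprod Q Q i x j y)) = f i x * g j y - ksgn (i * n) (g i x * f j y)"
    using a m by (simp add: del_tprod[OF Q f] dh_simps[OF Q g] cochain_Lop[OF Q f g] cochain_Rop[OF Q f g])
  \<comment> \<open>A nonzero \<open>f i x\<close> forces \<open>i = n\<close>, so the Koszul sign
    may be written without \<open>i\<close>.\<close>
  have 3: "ksgn (i * m) (f i x * g j y) = ksgn (n * m) (f i x * g j y)"
    using a g0[OF Q f, of x i] by (cases "i = n") auto
  have 4: "ksgn (n * m) (ksgn (i * n) (g i x * f j y)) = g i x * f j y"
    using a g0[OF Q g, of x i] by (cases "i = m") (auto simp: mult.commute)
  show "f (k - m) (del Q m g k (tprod Q Q i x j y)) = - ksgn (n * m) (g (k - n) (del Q n f k (tprod Q Q i x j y)))"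
    unfolding 1 2 ksgn_diff 3 4 by simp
qed

text \<open>The values of \<open>g\<close> are elements of \<open>A\<close>, and
  \<open>\<Theta>\<close> commutes with their action from either side.\<close>

lemma del_nat:
  assumes P [simp]: "cpx P" and Q [simp]: "cpx Q" and g: "deg_hom Q Alg (- m) g" and \<Theta>: "deg_hom P Q 0 \<Theta>"
    and t: "t \<in> crr (P \<otimes> P) k"
  shows "\<Theta> (k - m) (del P m (\<lambda>i x. g i (\<Theta> i x)) k t) = del Q m g k (tmap Q Q 0 0 \<Theta> \<Theta> k t)"
proof -
  have g\<Theta>: "deg_hom P Alg (- m) (\<lambda>i x. g i (\<Theta> i x))"
    by (rule deg_hom_comp[OF P \<Theta> g]) simp_all
  note T = tmap[OF P P Q Q \<Theta> \<Theta>]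
  show ?thesis
  proof (rule QQ_ext[OF P _ _ _ t, where R = Q and u = "- m" and u' = "- m" and
      F = "\<lambda>k t. \<Theta> (k - m) (del P m (\<lambda>i x. g i (\<Theta> i x)) k t)" and
      G = "\<lambda>k t. del Q m g k (tmap Q Q 0 0 \<Theta> \<Theta> k t)"])
    show "deg_hom (P \<otimes> P) Q (- m) (\<lambda>k t. \<Theta> (k - m) (del P m (\<lambda>i x. g i (\<Theta> i x)) k t))"
      by (rule deg_hom_comp[OF _ del_hom[OF P g\<Theta>] \<Theta>]) simp_all
    show "deg_hom (P \<otimes> P) Q (- m) (\<lambda>k t. del Q m g k (tmap Q Q 0 0 \<Theta> \<Theta> k t))"
      by (rule deg_hom_comp[OF _ T(1) del_hom[OF Q g]]) simp_all
    fix i x j y assume a: "i + j = k" "x \<in> crr P i" "y \<in> crr P j"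
    have m: "lact (obj P j) (g i (\<Theta> i x)) y \<in> crr P (k - m)" "ract (obj P i) x (g j (\<Theta> j y)) \<in> crr P (k - m)"
      using a by (auto intro: Lop_mem0[OF P g\<Theta>] Rop_mem0[OF P g\<Theta>])
    have 1: "\<Theta> (k - m) (lact (obj P j) (g i (\<Theta> i x)) y) = lact (obj Q j) (g i (\<Theta> i x)) (\<Theta> j y)"
      using a g0[OF P g\<Theta>, of x i] dh_lact[OF P \<Theta>, of y j j]
      by (cases "i = m") (auto simp: dh_simps[OF P \<Theta>])
    have 2: "\<Theta> (k - m) (ract (obj P i) x (g j (\<Theta> j y))) = ract (obj Q i) (\<Theta> i x) (g j (\<Theta> j y))"
      using a g0[OF P g\<Theta>, of y j] dh_ract[OF P \<Theta>, of x i i]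
      by (cases "j = m") (auto simp: dh_simps[OF P \<Theta>])
    show "\<Theta> (k - m) (del P m (\<lambda>i x. g i (\<Theta> i x)) k (tprod P P i x j y)) =
      del Q m g k (tmap Q Q 0 0 \<Theta> \<Theta> k (tprod P P i x j y))"
      using a m by (simp add: del_tprod[OF P g\<Theta>] T(2) del_tprod[OF Q g] dh_simps[OF P \<Theta>] 1 2)
  qed
qed


section \<open>Homotopy liftings and their brackets\<close>

lemma ksgn_pred: "ksgn (m - 1) y = - ksgn m y" and ksgn_1_minus: "ksgn (1 - m) y = - ksgn m y"
  by (auto simp: ksgn_def)

text \<open>A diagonal together with a homotopy \<open>\<kappa>\<close> between its two counit
  contractions. On the bar resolution \<open>\<kappa>\<close> can be 0; for the diagonal of a
  3-approximation it need not be.\<close>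

definition lifting_data :: "('k, 'a, 'm::ab_group_add) cplx \<Rightarrow> ('m \<Rightarrow> 'a) \<Rightarrow>
    (int \<Rightarrow> 'm \<Rightarrow> ('k, 'm, 'm) tens) \<Rightarrow> (int \<Rightarrow> 'm \<Rightarrow> 'm) \<Rightarrow> bool" where
  "lifting_data Q \<nu> Dl \<kappa> \<longleftrightarrow> resolves Q \<nu> \<and> deg_hom Q (Q \<otimes> Q) 0 Dl \<and>
     (\<forall>i. \<forall>x\<in>crr Q i. Dl (i - 1) (diff Q i x) = diff (Q \<otimes> Q) i (Dl i x)) \<and>
     deg_hom Q Q 1 \<kappa> \<and>
     (\<forall>i. \<forall>x\<in>crr Q i. \<kappa> (i - 1) (diff Q i x) + diff Q (i + 1) (\<kappa> i x) = del Q 0 (zext \<nu>) i (Dl i x))"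

text \<open>A homotopy lifting of a cocycle \<open>g\<close> trivialises the commutator with \<open>g\<close>; the last
  conjunct, a condition modulo coboundaries, makes it unique up to chain homotopy.\<close>

definition hlift :: "('k, 'a, 'm::ab_group_add) cplx \<Rightarrow> ('m \<Rightarrow> 'a) \<Rightarrow>
    (int \<Rightarrow> 'm \<Rightarrow> ('k, 'm, 'm) tens) \<Rightarrow> (int \<Rightarrow> 'm \<Rightarrow> 'm) \<Rightarrow> int \<Rightarrow> (int \<Rightarrow> 'm \<Rightarrow> 'a) \<Rightarrow> (int \<Rightarrow> 'm \<Rightarrow> 'm) \<Rightarrow> bool" where
  "hlift Q \<nu> Dl \<kappa> m g \<psi> \<longleftrightarrow> deg_hom Q Q (1 - m) \<psi> \<and>
     (\<forall>i. \<forall>x\<in>crr Q i. \<psi> (i - 1) (diff Q i x) + ksgn m (diff Q (i + 1 - m) (\<psi> i x)) = ksgn m (del Q m g i (Dl i x))) \<and>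
     (\<exists>u. deg_hom Q Alg (2 - m) u \<and>
       (\<forall>i. \<forall>x\<in>crr Q i. zext \<nu> (i + 1 - m) (\<psi> i x) = - ksgn m (g (i + 1) (\<kappa> i x)) + u (i - 1) (diff Q i x)))"

lemma resolvesD:
  assumes "resolves Q \<nu>"
  shows "cpx Q" "deg_hom Q Alg 0 (zext \<nu>)" "zext \<nu> \<in> cocycles scale Q 0"
    "\<And>n x. n < 0 \<Longrightarrow> x \<in> crr Q n \<Longrightarrow> x = 0" "bimod_hom (obj Q 0) (alg_bimod scale UNIV) \<nu>"
    "\<And>n x. n > 0 \<Longrightarrow> x \<in> crr Q n \<Longrightarrow> diff Q n x = 0 \<Longrightarrow> x \<in> diff Q (n + 1) ` crr Q (n + 1)"
    "\<And>x. x \<in> crr Q 0 \<Longrightarrow> \<nu> x = 0 \<Longrightarrow> x \<in> diff Q 1 ` crr Q 1"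
    "\<And>x. x \<in> crr Q 1 \<Longrightarrow> \<nu> (diff Q 1 x) = 0"
proof -
  note r = assms[unfolded resolves_def]
  show Q: "cpx Q" and \<nu>: "bimod_hom (obj Q 0) (alg_bimod scale UNIV) \<nu>" using r by auto
  show z: "deg_hom Q Alg 0 (zext \<nu>)" by (rule zext_hom) fact
  show d: "x \<in> crr Q 1 \<Longrightarrow> \<nu> (diff Q 1 x) = 0" for x using r Q by auto
  show "zext \<nu> \<in> cocycles scale Q 0"
    using z d by (auto simp: cocycles_def eq_on_def zext_def)
qed (use assms in \<open>auto simp: resolves_def\<close>)

section \<open>Comparison of liftings along a map of resolutions and a homotopy of diagonals\<close>

context
  fixes P :: "('k, 'a, 'p::ab_group_add) cplx" and Q :: "('k, 'a, 'q::ab_group_add) cplx"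
    and \<mu> \<nu> \<Theta> DP DQ \<kappa>P \<kappa>Q Z
  assumes proj: "\<And>i. projective_bimod scale (obj P i)"
    and ldP: "lifting_data P \<mu> DP \<kappa>P" and ldQ: "lifting_data Q \<nu> DQ \<kappa>Q"
    and \<Theta>: "deg_hom P Q 0 \<Theta>" and \<Theta>d: "\<And>i x. x \<in> crr P i \<Longrightarrow> \<Theta> (i - 1) (diff P i x) = diff Q i (\<Theta> i x)"
    and \<Theta>\<mu>: "\<And>x. x \<in> crr P 0 \<Longrightarrow> \<nu> (\<Theta> 0 x) = \<mu> x"
    and Z: "deg_hom P (Q \<otimes> Q) 1 Z"
    and Zd: "\<And>i x. x \<in> crr P i \<Longrightarrow> Z (i - 1) (diff P i x) + diff (Q \<otimes> Q) (i + 1) (Z i x) =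
      tmap Q Q 0 0 \<Theta> \<Theta> i (DP i x) - DQ i (\<Theta> i x)"
begin

text \<open>The combination on the left anticommutes with the differentials, and its bottom
  component starts in degree -1 of \<open>P\<close>, which is 0. After correction by
  \<open>Z\<close> the two counit homotopies thus agree up to a homotopy of second order.\<close>

lemma compare_kappa:
  "\<exists>V. deg_hom P Q 2 V \<and> (\<forall>i. \<forall>x\<in>crr P i.
     - \<Theta> (i + 1) (\<kappa>P i x) + \<kappa>Q i (\<Theta> i x) + del Q 0 (zext \<nu>) (i + 1) (Z i x) =
     V (i - 1) (diff P i x) - diff Q (i + 2) (V i x))"
proof -
  have rP: "resolves P \<mu>" and rQ: "resolves Q \<nu>" using ldP ldQ by (auto simp: lifting_data_def)
  note [simp] = resolvesD(1)[OF rP] resolvesD(1)[OF rQ]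
  have DP: "deg_hom P (P \<otimes> P) 0 DP" and \<kappa>P: "deg_hom P P 1 \<kappa>P" and DQ: "deg_hom Q (Q \<otimes> Q) 0 DQ"
    and \<kappa>Q: "deg_hom Q Q 1 \<kappa>Q"
    using ldP ldQ by (auto simp: lifting_data_def)
  have \<kappa>Pd: "\<And>i x. x \<in> crr P i \<Longrightarrow> \<kappa>P (i - 1) (diff P i x) = del P 0 (zext \<mu>) i (DP i x) - diff P (i + 1) (\<kappa>P i x)"
    and \<kappa>Qd: "\<And>i x. x \<in> crr Q i \<Longrightarrow> \<kappa>Q (i - 1) (diff Q i x) = del Q 0 (zext \<nu>) i (DQ i x) - diff Q (i + 1) (\<kappa>Q i x)"
    and Zd': "\<And>i x. x \<in> crr P i \<Longrightarrow> Z (i - 1) (diff P i x) =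
      tmap Q Q 0 0 \<Theta> \<Theta> i (DP i x) - DQ i (\<Theta> i x) - diff (Q \<otimes> Q) (i + 1) (Z i x)"
    using ldP ldQ Zd by (auto simp: lifting_data_def eq_diff_eq)
  note T = tmap[OF resolvesD(1)[OF rP] resolvesD(1)[OF rP] resolvesD(1)[OF rQ] resolvesD(1)[OF rQ] \<Theta> \<Theta>]
  note zP = resolvesD(2)[OF rP] and zQ = resolvesD(2)[OF rQ]
  have dlP: "deg_hom (P \<otimes> P) P 0 (del P 0 (zext \<mu>))" using del_hom[of P 0 "zext \<mu>"] zP by simp
  have dlQ: "deg_hom (Q \<otimes> Q) Q 0 (del Q 0 (zext \<nu>))" using del_hom[of Q 0 "zext \<nu>"] zQ by simp
  note s = dh_simps[OF _ \<Theta>] dh_simps[OF _ \<kappa>P] dh_simps[OF _ \<kappa>Q] dh_simps[OF _ Z] dh_simps[OF _ dlP]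
    dh_simps[OF _ dlQ] dh_simps[OF _ T(1)] dh_simps[OF _ DP] dh_simps[OF _ DQ] d_simps
  let ?W = "\<lambda>i x. - \<Theta> (i + 1) (\<kappa>P i x) + \<kappa>Q i (\<Theta> i x) + del Q 0 (zext \<nu>) (i + 1) (Z i x)"
  have W: "deg_hom P Q 1 ?W"
    by (intro deg_hom_add deg_hom_minus deg_hom_comp[OF _ \<kappa>P \<Theta>] deg_hom_comp[OF _ \<Theta> \<kappa>Q]
        deg_hom_comp[OF _ Z dlQ]) simp_all
  have nat: "\<Theta> i (del P 0 (zext \<mu>) i t) = del Q 0 (zext \<nu>) i (tmap Q Q 0 0 \<Theta> \<Theta> i t)"
    if t: "t \<in> crr (P \<otimes> P) i" for i t
  proof -
    have n: "deg_hom P Alg (- 0) (\<lambda>i x. zext \<nu> i (\<Theta> i x))"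
      by (rule deg_hom_comp[OF _ \<Theta> zQ]) simp_all
    have e: "zext \<mu> k y = zext \<nu> k (\<Theta> k y)" if "y \<in> crr P k" for k y
      using that \<Theta>\<mu> by (auto simp: zext_def)
    have "del P 0 (zext \<mu>) i t = del P 0 (\<lambda>i x. zext \<nu> i (\<Theta> i x)) i t"
      by (rule QQ_ext[OF _ dlP del_hom[OF _ n] _ t])
        (use zP in \<open>simp_all add: del_tprod[OF _ n] del_tprod[of P 0 "zext \<mu>"] e\<close>)
    then show ?thesis using del_nat[of P Q 0 "zext \<nu>" \<Theta> t i] zQ \<Theta> t by simp
  qed
  have dd: "del Q 0 (zext \<nu>) k (diff (Q \<otimes> Q) n t) = diff Q n (del Q 0 (zext \<nu>) n t)"
    if "t \<in> crr (Q \<otimes> Q) n" "k = n - 1" for n k t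
    using del_chain[OF _ resolvesD(3)[OF rQ] that(1)] that by simp
  have Wd: "?W (i - 1) (diff P i x) = ksgn 1 (diff Q (i + 1) (?W i x))" if x: "x \<in> crr P i" for i x
  proof -
    have t: "diff P (i + 1) (\<kappa>P i x) = diff P (i + 1) (\<kappa>P i x)" by simp
    have \<Theta>d': "\<Theta> i (diff P (i + 1) (\<kappa>P i x)) = diff Q (i + 1) (\<Theta> (i + 1) (\<kappa>P i x))"
      using \<Theta>d[of "\<kappa>P i x" "i + 1"] x by (simp add: s)
    show ?thesis
      using x by (simp add: \<kappa>Pd \<Theta>d \<kappa>Qd Zd' s \<Theta>d' nat dd ksgn_def)
  qed
  have neg: "?W (- 1) x = 0" if "x \<in> crr P (- 1)" for x
    using resolvesD(4)[OF rP, of "- 1" x] that by (simp add: s)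
  have "\<exists>V. deg_hom P Q (1 + 1) V \<and>
    (\<forall>i. \<forall>x\<in>crr P i. V (i - 1) (diff P i x) + ksgn 1 (diff Q (i + 1 + 1) (V i x)) = ?W i x) \<and>
    (\<forall>x\<in>crr P (- 1 - 1). \<nu> (V (- 1 - 1) x) = 0)"
    by (rule null_homotopy[OF resolvesD(1)[OF rP] proj rQ W Wd, where u = "\<lambda>_. 0"])
      (use neg hom_0[OF _ resolvesD(5)[OF rQ]] in \<open>auto simp: bimod_hom_def alg_bimod_def\<close>)
  then obtain V where "deg_hom P Q (1 + 1) V"
    "\<And>i x. x \<in> crr P i \<Longrightarrow> V (i - 1) (diff P i x) + ksgn 1 (diff Q (i + 1 + 1) (V i x)) = ?W i x"
    by auto
  then show ?thesis by (intro exI[of _ V]) (simp add: ksgn_def algebra_simps)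
qed

text \<open>The difference of the two liftings, corrected by the commutator with \<open>g\<close> on
  \<open>Z\<close>, commutes with the differentials up to sign. The normalisations make its
  augmentation a coboundary, so it is null homotopic; applying the cocycle \<open>f\<close> turns
  the null homotopy into the cochain \<open>h\<close>.\<close>

lemma compare_liftings:
  assumes g: "g \<in> cocycles scale Q m" and f: "f \<in> cocycles scale Q n"
    and lP: "hlift P \<mu> DP \<kappa>P m (\<lambda>i x. g i (\<Theta> i x)) \<psi>P" and lQ: "hlift Q \<nu> DQ \<kappa>Q m g \<psi>Q"
  shows "\<exists>h. deg_hom P Alg (2 - n - m) h \<and> (\<forall>i. \<forall>x\<in>crr P i.
     f (i + 1 - m) (\<Theta> (i + 1 - m) (\<psi>P i x)) - f (i + 1 - m) (\<psi>Q i (\<Theta> i x))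
       - ksgn m (f (i + 1 - m) (del Q m g (i + 1) (Z i x))) = h (i - 1) (diff P i x))"
proof -
  have rP: "resolves P \<mu>" and rQ: "resolves Q \<nu>" using ldP ldQ by (auto simp: lifting_data_def)
  note cP [simp] = resolvesD(1)[OF rP] and cQ [simp] = resolvesD(1)[OF rQ]
  have DP: "deg_hom P (P \<otimes> P) 0 DP" and DQ: "deg_hom Q (Q \<otimes> Q) 0 DQ"
    and \<kappa>P: "deg_hom P P 1 \<kappa>P" and \<kappa>Q: "deg_hom Q Q 1 \<kappa>Q"
    using ldP ldQ by (auto simp: lifting_data_def)
  have \<psi>P: "deg_hom P P (1 - m) \<psi>P" and \<psi>Q: "deg_hom Q Q (1 - m) \<psi>Q"
    and \<psi>Pd: "\<And>i x. x \<in> crr P i \<Longrightarrow> \<psi>P (i - 1) (diff P i x) =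
      ksgn m (del P m (\<lambda>i x. g i (\<Theta> i x)) i (DP i x)) - ksgn m (diff P (i + 1 - m) (\<psi>P i x))"
    and \<psi>Qd: "\<And>i x. x \<in> crr Q i \<Longrightarrow> \<psi>Q (i - 1) (diff Q i x) =
      ksgn m (del Q m g i (DQ i x)) - ksgn m (diff Q (i + 1 - m) (\<psi>Q i x))"
    using lP lQ by (auto simp: hlift_def eq_diff_eq)
  obtain uP uQ where uP: "deg_hom P Alg (2 - m) uP" and uQ: "deg_hom Q Alg (2 - m) uQ"
    and uPd: "\<And>i x. x \<in> crr P i \<Longrightarrow> zext \<mu> (i + 1 - m) (\<psi>P i x) =
      - ksgn m (g (i + 1) (\<Theta> (i + 1) (\<kappa>P i x))) + uP (i - 1) (diff P i x)"
    and uQd: "\<And>i x. x \<in> crr Q i \<Longrightarrow> zext \<nu> (i + 1 - m) (\<psi>Q i x) =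
      - ksgn m (g (i + 1) (\<kappa>Q i x)) + uQ (i - 1) (diff Q i x)"
    using lP lQ by (auto simp: hlift_def)
  obtain V where V: "deg_hom P Q 2 V" and Vd: "\<And>i x. x \<in> crr P i \<Longrightarrow>
     - \<Theta> (i + 1) (\<kappa>P i x) + \<kappa>Q i (\<Theta> i x) + del Q 0 (zext \<nu>) (i + 1) (Z i x) =
     V (i - 1) (diff P i x) - diff Q (i + 2) (V i x)"
    using compare_kappa by auto
  note gh = cocyclesD(1)[OF g] and fh = cocyclesD(1)[OF f]
  note T = tmap[OF cP cP cQ cQ \<Theta> \<Theta>]
  have g\<Theta>: "deg_hom P Alg (- m) (\<lambda>i x. g i (\<Theta> i x))" by (rule deg_hom_comp[OF _ \<Theta> gh]) simp_all
  note dlP = del_hom[OF cP g\<Theta>] and dlQ = del_hom[OF cQ gh] and zQ = resolvesD(2)[OF rQ]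
  have dnQ: "deg_hom (Q \<otimes> Q) Q 0 (del Q 0 (zext \<nu>))" using del_hom[of Q 0 "zext \<nu>"] zQ by simp
  note s = dh_simps[OF _ \<Theta>] dh_simps[OF _ \<kappa>P] dh_simps[OF _ \<kappa>Q] dh_simps[OF _ Z] dh_simps[OF _ dlP]
    dh_simps[OF _ dlQ] dh_simps[OF _ T(1)] dh_simps[OF _ DP] dh_simps[OF _ DQ] d_simps dh_simps[OF _ \<psi>P]
    dh_simps[OF _ \<psi>Q] dh_simps[OF _ V] dh_simps[OF _ dnQ]
  let ?D = "\<lambda>i x. \<Theta> (i + 1 - m) (\<psi>P i x) - \<psi>Q i (\<Theta> i x) - ksgn m (del Q m g (i + 1) (Z i x))"
  \<comment> \<open>The cochain whose coboundary is the augmentation of \<open>?D\<close>: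
    \<open>uP\<close> and \<open>uQ\<close> stem from the two normalisations, and \<open>V\<close>
    accounts for the difference between \<open>\<kappa>P\<close> and
    \<open>\<kappa>Q\<close>.\<close>
  let ?U = "\<lambda>i y. ksgn m (g (i + 2) (V i y)) + (uP i y - uQ i (\<Theta> i y))"
  have D: "deg_hom P Q (1 - m) ?D"
    by (intro deg_hom_diff deg_hom_ksgn deg_hom_comp[OF _ \<psi>P \<Theta>] deg_hom_comp[OF _ \<Theta> \<psi>Q]
        deg_hom_comp[OF _ Z dlQ]) simp_all
  have U: "deg_hom P Alg (2 - m) ?U"
    by (intro deg_hom_add deg_hom_diff deg_hom_ksgn deg_hom_comp[OF _ V gh] uP
        deg_hom_comp[OF _ \<Theta> uQ]) simp_all
  have nat: "\<Theta> (i - m) (del P m (\<lambda>i x. g i (\<Theta> i x)) i t) = del Q m g i (tmap Q Q 0 0 \<Theta> \<Theta> i t)"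
    if "t \<in> crr (P \<otimes> P) i" for i t
    using del_nat[OF cP cQ gh \<Theta> that] by simp
  have Dd: "?D (i - 1) (diff P i x) = ksgn (1 - m) (diff Q (i + (1 - m)) (?D i x))" if x: "x \<in> crr P i" for i x
  proof -
    have Zd': "Z (i - 1) (diff P i x) =
        tmap Q Q 0 0 \<Theta> \<Theta> i (DP i x) - DQ i (\<Theta> i x) - diff (Q \<otimes> Q) (i + 1) (Z i x)"
      using Zd[OF x] by (simp add: eq_diff_eq)
    have dd: "del Q m g i (diff (Q \<otimes> Q) (i + 1) (Z i x)) = ksgn m (diff Q (i + 1 - m) (del Q m g (i + 1) (Z i x)))"
      using del_chain[OF cQ g, of "Z i x" "i + 1"] x by (simp add: s)
    have \<Theta>d': "\<Theta> (i - m) (diff P (i + 1 - m) (\<psi>P i x)) = diff Q (i + 1 - m) (\<Theta> (i + 1 - m) (\<psi>P i x))"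
    proof -
      have "\<psi>P i x \<in> crr P (i + 1 - m)" using x by (simp add: s)
      from \<Theta>d[OF this] show ?thesis by simp
    qed
    have "?D (i - 1) (diff P i x) = \<Theta> (i - m) (\<psi>P (i - 1) (diff P i x)) - \<psi>Q (i - 1) (diff Q i (\<Theta> i x))
      - ksgn m (del Q m g i (Z (i - 1) (diff P i x)))"
      using x by (simp add: \<Theta>d)
    also have "\<dots> = - ksgn m (diff Q (i + 1 - m) (?D i x))"
      using x by (simp add: \<psi>Pd \<psi>Qd Zd' s nat dd \<Theta>d' ksgn_diff ksgn_minus ksgn_add)
    finally show ?thesis by (simp add: ksgn_1_minus algebra_simps)
  qed
  have \<nu>D: "zext \<nu> (i + 1 - m) (?D i x) = ?U (i - 1) (diff P i x)" if x: "x \<in> crr P i" for i x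
  proof -
    have m1: "\<Theta> (i + 1 - m) (\<psi>P i x) \<in> crr Q (i + 1 - m)" "\<psi>Q i (\<Theta> i x) \<in> crr Q (i + 1 - m)"
      "del Q m g (i + 1) (Z i x) \<in> crr Q (i + 1 - m)"
      using x by (simp_all add: s)
    have 1: "zext \<nu> (i + 1 - m) (\<Theta> (i + 1 - m) (\<psi>P i x)) = zext \<mu> (i + 1 - m) (\<psi>P i x)"
    proof (cases "i + 1 - m = 0")
      case True
      have "\<psi>P i x \<in> crr P 0" using dh_mem[OF cP \<psi>P x, of 0] True by simp
      then show ?thesis using True \<Theta>\<mu> by (simp add: zext_def)
    qed (simp add: zext_def)
    \<comment> \<open>Exchanging \<open>g\<close> and \<open>\<nu>\<close> turns the correction term
      into the one that occurs in \<open>compare_kappa\<close>, up to sign.\<close>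
    have 2: "zext \<nu> (i + 1 - m) (del Q m g (i + 1) (Z i x)) = - g (i + 1) (del Q 0 (zext \<nu>) (i + 1) (Z i x))"
      using del_swap[OF cQ gh, of 0 "zext \<nu>" "Z i x" "i + 1"] zQ x by (simp add: s)
    have 3: "g (i + 1) (V (i - 1) (diff P i x)) = - g (i + 1) (\<Theta> (i + 1) (\<kappa>P i x)) + g (i + 1) (\<kappa>Q i (\<Theta> i x))
        + g (i + 1) (del Q 0 (zext \<nu>) (i + 1) (Z i x))"
    proof -
      have "g (i + 1) (diff Q (i + 2) (V i x)) = 0"
        by (rule cocyclesD(3)[OF g]) (use x in \<open>simp_all add: s\<close>)
      then have "g (i + 1) (V (i - 1) (diff P i x)) = g (i + 1) (V (i - 1) (diff P i x) - diff Q (i + 2) (V i x))"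
        using x by (simp add: dh_diff[OF cQ gh] s)
      also have "\<dots> = - g (i + 1) (\<Theta> (i + 1) (\<kappa>P i x)) + g (i + 1) (\<kappa>Q i (\<Theta> i x))
        + g (i + 1) (del Q 0 (zext \<nu>) (i + 1) (Z i x))"
        unfolding Vd[OF x, symmetric] using x
        by (simp add: dh_add[OF cQ gh] dh_diff[OF cQ gh] dh_minus[OF cQ gh] s)
      finally show ?thesis .
    qed
    have \<Theta>x: "\<Theta> i x \<in> crr Q i" using x by (simp add: s)
    have e: "zext \<nu> (i + 1 - m) (?D i x) = zext \<nu> (i + 1 - m) (\<Theta> (i + 1 - m) (\<psi>P i x)) -
        zext \<nu> (i + 1 - m) (\<psi>Q i (\<Theta> i x)) - ksgn m (zext \<nu> (i + 1 - m) (del Q m g (i + 1) (Z i x)))"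
      using m1 by (simp add: dh_diff[OF cQ zQ] dh_ksgn[OF cQ zQ])
    have i: "i - 1 + 2 = i + 1" by simp
    show ?thesis
      unfolding e 1 2 uPd[OF x] uQd[OF \<Theta>x] \<Theta>d[OF x] i 3 by (simp add: ksgn_add ksgn_minus ksgn_diff)
  qed
  have "\<exists>K. deg_hom P Q (1 - m + 1) K \<and>
    (\<forall>i. \<forall>x\<in>crr P i. K (i - 1) (diff P i x) + ksgn (1 - m) (diff Q (i + (1 - m) + 1) (K i x)) = ?D i x) \<and>
    (\<forall>x\<in>crr P (- (1 - m) - 1). \<nu> (K (- (1 - m) - 1) x) = ?U (- (1 - m) - 1) x)"
  proof (rule null_homotopy[OF cP proj rQ D Dd, where u = "?U (- (1 - m) - 1)"])
    show "bimod_hom (obj P (- (1 - m) - 1)) (alg_bimod scale UNIV) (?U (- (1 - m) - 1))"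
      using deg_homD[OF U, of 0 "- (1 - m) - 1"] by (simp add: alg_cplx_def)
    show "\<nu> (?D (- (1 - m)) x) = ?U (- (1 - m) - 1) (diff P (- (1 - m)) x)" if "x \<in> crr P (- (1 - m))" for x
      using \<nu>D[OF that] by (simp add: zext_def)
  qed
  then obtain K where K: "deg_hom P Q (1 - m + 1) K"
    and Kd: "\<And>i x. x \<in> crr P i \<Longrightarrow> K (i - 1) (diff P i x) + ksgn (1 - m) (diff Q (i + (1 - m) + 1) (K i x)) = ?D i x"
    by auto
  show ?thesis
  proof (intro exI[of _ "\<lambda>i x. f (i + (2 - m)) (K i x)"] conjI allI ballI)
    show "deg_hom P Alg (2 - n - m) (\<lambda>i x. f (i + (2 - m)) (K i x))"
      by (rule deg_hom_comp[OF _ K fh]) simp_all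
    fix i x assume x: "x \<in> crr P i"
    have Kx: "K i x \<in> crr Q (i + (1 - m) + 1)" "K (i - 1) (diff P i x) \<in> crr Q (i + 1 - m)"
      using x by (auto intro: dh_mem[OF cP K])
    have "f (i + 1 - m) (diff Q (i + (1 - m) + 1) (K i x)) = 0"
      by (rule cocyclesD(3)[OF f Kx(1)]) simp
    then have "f (i + 1 - m) (K (i - 1) (diff P i x)) = f (i + 1 - m) (?D i x)"
      unfolding Kd[OF x, symmetric] using Kx by (simp add: dh_add[OF cQ fh] dh_ksgn[OF cQ fh])
    also have "\<dots> = f (i + 1 - m) (\<Theta> (i + 1 - m) (\<psi>P i x)) - f (i + 1 - m) (\<psi>Q i (\<Theta> i x))
       - ksgn m (f (i + 1 - m) (del Q m g (i + 1) (Z i x)))"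
      using x by (simp add: dh_diff[OF cQ fh] dh_ksgn[OF cQ fh] s)
    finally show "f (i + 1 - m) (\<Theta> (i + 1 - m) (\<psi>P i x)) - f (i + 1 - m) (\<psi>Q i (\<Theta> i x))
       - ksgn m (f (i + 1 - m) (del Q m g (i + 1) (Z i x))) = f (i - 1 + (2 - m)) (K (i - 1) (diff P i x))"
      by (simp add: algebra_simps)
  qed
qed

end


section \<open>Brackets of homotopy liftings and their invariance\<close>

definition brs :: "(int \<Rightarrow> (int \<Rightarrow> 'm \<Rightarrow> 'a) \<Rightarrow> int \<Rightarrow> 'm \<Rightarrow> 'm) \<Rightarrow> int \<Rightarrow> int \<Rightarrow>
    (int \<Rightarrow> 'm \<Rightarrow> 'a) \<Rightarrow> (int \<Rightarrow> 'm \<Rightarrow> 'a) \<Rightarrow> (int \<Rightarrow> 'm \<Rightarrow> 'a)" where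
  "brs \<Psi> n m f g = (\<lambda>i x. f (i + 1 - m) (\<Psi> m g i x) -
     ksgn ((n - 1) * (m - 1)) (g (i + 1 - n) (\<Psi> n f i x)))"

lemma brs_swap: "brs \<Psi> n m f g i x = - ksgn ((n - 1) * (m - 1)) (brs \<Psi> m n g f i x)"
  by (simp add: brs_def ksgn_diff mult.commute)

text \<open>\<open>\<Psi>\<close> selects a lifting for every cocycle. The degree is an argument of
  its own, since a family such as 0 is a cocycle in every degree. It is taken nonnegative because
  insertion on the bar resolution is indexed by a natural number.\<close>

definition lifting_system :: "('k, 'a, 'm::ab_group_add) cplx \<Rightarrow> ('m \<Rightarrow> 'a) \<Rightarrow>
    (int \<Rightarrow> 'm \<Rightarrow> ('k, 'm, 'm) tens) \<Rightarrow> (int \<Rightarrow> 'm \<Rightarrow> 'm) \<Rightarrow>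
    (int \<Rightarrow> (int \<Rightarrow> 'm \<Rightarrow> 'a) \<Rightarrow> int \<Rightarrow> 'm \<Rightarrow> 'm) \<Rightarrow> bool" where
  "lifting_system Q \<nu> Dl \<kappa> \<Psi> \<longleftrightarrow> lifting_data Q \<nu> Dl \<kappa> \<and>
     (\<forall>m\<ge>0. \<forall>g\<in>cocycles scale Q m. hlift Q \<nu> Dl \<kappa> m g (\<Psi> m g))"

text \<open>The error terms \<open>f \<delta>\<^sub>g\<close> of two homotopy liftings cancel in the bracket.\<close>

lemma del_cancel:
  assumes "cpx Q" "deg_hom Q Alg (- m) g" "deg_hom Q Alg (- n) f" "t \<in> crr (Q \<otimes> Q) k"
  shows "ksgn m (f (k - m) (del Q m g k t)) =
    ksgn ((n - 1) * (m - 1)) (ksgn n (g (k - n) (del Q n f k t)))"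
  unfolding del_swap[OF assms] ksgn_minus ksgn_ksgn by (auto simp: ksgn_def)

text \<open>Since \<open>f\<close> kills boundaries, the equation of the lifting turns
  \<open>f \<psi> d\<close> into \<open>f\<close> of the commutator with \<open>g\<close> on the
  diagonal; the two halves of the bracket then cancel by \<open>del_cancel\<close>.\<close>

lemma brs_cocycle:
  assumes sys: "lifting_system Q \<nu> Dl \<kappa> \<Psi>" and mn: "m \<ge> 0" "n \<ge> 0"
    and f: "f \<in> cocycles scale Q n" and g: "g \<in> cocycles scale Q m"
  shows "brs \<Psi> n m f g \<in> cocycles scale Q (n + m - 1)"
proof -
  have ld: "lifting_data Q \<nu> Dl \<kappa>" and lg: "hlift Q \<nu> Dl \<kappa> m g (\<Psi> m g)" and lf: "hlift Q \<nu> Dl \<kappa> n f (\<Psi> n f)"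
    using sys mn f g by (auto simp: lifting_system_def)
  have Q [simp]: "cpx Q" and Dl: "deg_hom Q (Q \<otimes> Q) 0 Dl" using ld by (auto simp: lifting_data_def resolves_def)
  note gh = cocyclesD(1)[OF g] and fh = cocyclesD(1)[OF f]
  have hg: "deg_hom Q Q (1 - m) (\<Psi> m g)" and hf: "deg_hom Q Q (1 - n) (\<Psi> n f)"
    using lg lf by (auto simp: hlift_def)
  have main: "u (i - m) (\<psi> (i - 1) (diff Q i x)) = ksgn m (u (i - m) (del Q m v i (Dl i x)))"
    if u: "u \<in> cocycles scale Q n" and v: "v \<in> cocycles scale Q m" and l: "hlift Q \<nu> Dl \<kappa> m v \<psi>"
      and x: "x \<in> crr Q i" for u v \<psi> m n i x
  proof -
    have h: "deg_hom Q Q (1 - m) \<psi>" and e: "\<psi> (i - 1) (diff Q i x) = ksgn m (del Q m v i (Dl i x)) -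
        ksgn m (diff Q (i + 1 - m) (\<psi> i x))"
      using l x by (auto simp: hlift_def eq_diff_eq)
    note uh = cocyclesD(1)[OF u]
    have "u (i - m) (diff Q (i + 1 - m) (\<psi> i x)) = 0"
      by (rule cocyclesD(3)[OF u]) (use x in \<open>simp_all add: dh_mem[OF Q h]\<close>)
    then show ?thesis
      unfolding e using x
      by (simp add: dh_diff[OF Q uh] dh_ksgn[OF Q uh] dh_mem[OF _ del_hom[OF Q cocyclesD(1)[OF v]]]
          dh_mem[OF Q Dl] dh_mem[OF Q h])
  qed
  have "deg_hom Q Alg (- (n + m - 1)) (brs \<Psi> n m f g)"
    unfolding brs_def
    by (intro deg_hom_diff deg_hom_ksgn deg_hom_comp[OF _ hg fh] deg_hom_comp[OF _ hf gh]) simp_all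
  moreover have "brs \<Psi> n m f g (i - 1) (diff Q i x) = 0" if x: "x \<in> crr Q i" for i x
    using main[OF f g lg x] main[OF g f lf x] del_cancel[OF Q gh fh dh_mem[OF Q Dl x refl]]
    by (simp add: brs_def)
  ultimately show ?thesis by (simp add: cocycles_def eq_on_def)
qed

text \<open>\<open>compare_liftings\<close> is used for \<open>f, g\<close> and for
  \<open>g, f\<close>. Both error terms are evaluated at the same element \<open>Z i x\<close>, so
  \<open>del_cancel\<close> applies to them.\<close>

lemma brs_compare:
  assumes proj: "\<And>i. projective_bimod scale (obj P i)"
    and sP: "lifting_system P \<mu> DP \<kappa>P \<Psi>P" and sQ: "lifting_system Q \<nu> DQ \<kappa>Q \<Psi>Q"
    and \<Theta>: "deg_hom P Q 0 \<Theta>" and \<Theta>d: "\<And>i x. x \<in> crr P i \<Longrightarrow> \<Theta> (i - 1) (diff P i x) = diff Q i (\<Theta> i x)"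
    and \<Theta>\<mu>: "\<And>x. x \<in> crr P 0 \<Longrightarrow> \<nu> (\<Theta> 0 x) = \<mu> x"
    and Z: "deg_hom P (Q \<otimes> Q) 1 Z"
    and Zd: "\<And>i x. x \<in> crr P i \<Longrightarrow> Z (i - 1) (diff P i x) + diff (Q \<otimes> Q) (i + 1) (Z i x) =
      tmap Q Q 0 0 \<Theta> \<Theta> i (DP i x) - DQ i (\<Theta> i x)"
    and mn: "m \<ge> 0" "n \<ge> 0" and f: "f \<in> cocycles scale Q n" and g: "g \<in> cocycles scale Q m"
  shows "\<exists>h. deg_hom P Alg (2 - n - m) h \<and> (\<forall>i. \<forall>x\<in>crr P i.
    brs \<Psi>P n m (\<lambda>i x. f i (\<Theta> i x)) (\<lambda>i x. g i (\<Theta> i x)) i x - brs \<Psi>Q n m f g i (\<Theta> i x) = h (i - 1) (diff P i x))"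
proof -
  have ldP: "lifting_data P \<mu> DP \<kappa>P" and ldQ: "lifting_data Q \<nu> DQ \<kappa>Q"
    using sP sQ by (auto simp: lifting_system_def)
  have P [simp]: "cpx P" and Q [simp]: "cpx Q" using ldP ldQ by (auto simp: lifting_data_def resolves_def)
  have pull: "(\<lambda>i x. u i (\<Theta> i x)) \<in> cocycles scale P k" if "u \<in> cocycles scale Q k" for u k
  proof -
    have "deg_hom P Alg (- k) (\<lambda>i x. u i (\<Theta> i x))"
      by (rule deg_hom_comp[OF P \<Theta> cocyclesD(1)[OF that]]) simp_all
    then show ?thesis using cocyclesD(2)[OF that] dh_mem[OF P \<Theta>]
      by (auto simp: cocycles_def eq_on_def \<Theta>d)
  qed
  have l: "hlift P \<mu> DP \<kappa>P m (\<lambda>i x. g i (\<Theta> i x)) (\<Psi>P m (\<lambda>i x. g i (\<Theta> i x)))"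
    "hlift P \<mu> DP \<kappa>P n (\<lambda>i x. f i (\<Theta> i x)) (\<Psi>P n (\<lambda>i x. f i (\<Theta> i x)))"
    "hlift Q \<nu> DQ \<kappa>Q m g (\<Psi>Q m g)" "hlift Q \<nu> DQ \<kappa>Q n f (\<Psi>Q n f)"
    using sP sQ mn f g pull by (auto simp: lifting_system_def)
  have cmp: "\<exists>h. deg_hom P Alg (2 - n - m) h \<and> (\<forall>i. \<forall>x\<in>crr P i.
     f (i + 1 - m) (\<Theta> (i + 1 - m) (\<psi>P i x)) - f (i + 1 - m) (\<psi>Q i (\<Theta> i x))
       - ksgn m (f (i + 1 - m) (del Q m g (i + 1) (Z i x))) = h (i - 1) (diff P i x))"
    if "g \<in> cocycles scale Q m" "f \<in> cocycles scale Q n"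
      "hlift P \<mu> DP \<kappa>P m (\<lambda>i x. g i (\<Theta> i x)) \<psi>P" "hlift Q \<nu> DQ \<kappa>Q m g \<psi>Q" for f g n m \<psi>P \<psi>Q
    by (rule compare_liftings[OF proj ldP ldQ \<Theta> _ _ Z _ that]) (simp_all add: \<Theta>d \<Theta>\<mu> Zd)
  from cmp[OF g f l(1,3)] cmp[OF f g l(2,4)] obtain h1 h2 where
    h1: "deg_hom P Alg (2 - n - m) h1" and h2: "deg_hom P Alg (2 - m - n) h2"
    and e1: "\<And>i x. x \<in> crr P i \<Longrightarrow> f (i + 1 - m) (\<Theta> (i + 1 - m) (\<Psi>P m (\<lambda>i x. g i (\<Theta> i x)) i x))
       - f (i + 1 - m) (\<Psi>Q m g i (\<Theta> i x))
       - ksgn m (f (i + 1 - m) (del Q m g (i + 1) (Z i x))) = h1 (i - 1) (diff P i x)"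
    and e2: "\<And>i x. x \<in> crr P i \<Longrightarrow> g (i + 1 - n) (\<Theta> (i + 1 - n) (\<Psi>P n (\<lambda>i x. f i (\<Theta> i x)) i x))
       - g (i + 1 - n) (\<Psi>Q n f i (\<Theta> i x))
       - ksgn n (g (i + 1 - n) (del Q n f (i + 1) (Z i x))) = h2 (i - 1) (diff P i x)"
    by auto
  let ?s = "ksgn ((n - 1) * (m - 1))"
  show ?thesis
  proof (intro exI[of _ "\<lambda>i x. h1 i x - ?s (h2 i x)"] conjI allI ballI)
    show "deg_hom P Alg (2 - n - m) (\<lambda>i x. h1 i x - ?s (h2 i x))"
      using h1 h2 by (intro deg_hom_diff deg_hom_ksgn) (simp_all add: algebra_simps)
    fix i x assume x: "x \<in> crr P i"
    show "brs \<Psi>P n m (\<lambda>i x. f i (\<Theta> i x)) (\<lambda>i x. g i (\<Theta> i x)) i x - brs \<Psi>Q n m f g i (\<Theta> i x) =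
      h1 (i - 1) (diff P i x) - ?s (h2 (i - 1) (diff P i x))"
      unfolding e1[OF x, symmetric] e2[OF x, symmetric] brs_def ksgn_diff
      using del_cancel[OF Q cocyclesD(1)[OF g] cocyclesD(1)[OF f] dh_mem[OF P Z x refl]]
      by simp
  qed
qed

lemma hh_relI:
  assumes "f \<in> cocycles scale P n" "g \<in> cocycles scale P n" "deg_hom P Alg t h" "t = 1 - n"
    "\<And>i x. x \<in> crr P i \<Longrightarrow> f i x - g i x = h (i - 1) (diff P i x)"
  shows "(f, g) \<in> hh_rel scale P n"
  using assms by (auto simp: hh_rel_def eq_on_def)

lemma hh_relE:
  assumes "(f, g) \<in> hh_rel scale P n"
  obtains h where "f \<in> cocycles scale P n" "g \<in> cocycles scale P n" "deg_hom P Alg (1 - n) h"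
    "\<And>i x. x \<in> crr P i \<Longrightarrow> f i x - g i x = h (i - 1) (diff P i x)"
  using assms by (auto simp: hh_rel_def eq_on_def)

text \<open>When \<open>g'\<close> is changed by the coboundary of \<open>h\<close>, the Leibniz
  rule \<open>del_d\<close> shows that \<open>\<psi>\<close> has to be corrected by the commutator
  with \<open>h\<close> on the diagonal. This makes liftings of cohomologous cocycles
  comparable.\<close>

lemma hlift_shift:
  assumes ld: "lifting_data Q \<nu> Dl \<kappa>" and l: "hlift Q \<nu> Dl \<kappa> m g' \<psi>"
    and g: "deg_hom Q Alg (- m) g" and g': "deg_hom Q Alg (- m) g'" and h: "deg_hom Q Alg (1 - m) h"
    and gg: "\<And>i x. x \<in> crr Q i \<Longrightarrow> g i x = g' i x + h (i - 1) (diff Q i x)"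
  shows "hlift Q \<nu> Dl \<kappa> m g (\<lambda>i x. \<psi> i x + ksgn m (del Q (m - 1) h i (Dl i x)))"
proof -
  have r: "resolves Q \<nu>" using ld by (auto simp: lifting_data_def)
  note Q [simp] = resolvesD(1)[OF r] and z = resolvesD(2)[OF r]
  have Dl: "deg_hom Q (Q \<otimes> Q) 0 Dl" and \<kappa>: "deg_hom Q Q 1 \<kappa>"
    and Dd: "\<And>i x. x \<in> crr Q i \<Longrightarrow> Dl (i - 1) (diff Q i x) = diff (Q \<otimes> Q) i (Dl i x)"
    and kd: "\<And>i x. x \<in> crr Q i \<Longrightarrow> \<kappa> (i - 1) (diff Q i x) + diff Q (i + 1) (\<kappa> i x) = del Q 0 (zext \<nu>) i (Dl i x)"
    using ld by (auto simp: lifting_data_def)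
  have h': "deg_hom Q Alg (- (m - 1)) h" using h by simp
  have hd: "deg_hom Q Alg (- m) (\<lambda>i x. h (i - 1) (diff Q i x))" using hd_hom[OF Q h'] by simp
  have dh: "deg_hom (Q \<otimes> Q) Q (1 - m) (del Q (m - 1) h)" using del_hom[OF Q h'] by simp
  from l obtain u where \<psi>: "deg_hom Q Q (1 - m) \<psi>"
    and \<psi>d: "\<And>i x. x \<in> crr Q i \<Longrightarrow> \<psi> (i - 1) (diff Q i x) + ksgn m (diff Q (i + 1 - m) (\<psi> i x)) =
      ksgn m (del Q m g' i (Dl i x))"
    and u: "deg_hom Q Alg (2 - m) u"
    and \<nu>\<psi>: "\<And>i x. x \<in> crr Q i \<Longrightarrow> zext \<nu> (i + 1 - m) (\<psi> i x) = - ksgn m (g' (i + 1) (\<kappa> i x)) + u (i - 1) (diff Q i x)"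
    by (auto simp: hlift_def)
  note s = dh_simps[OF Q Dl] dh_simps[OF Q \<kappa>] dh_simps[OF Q \<psi>] dh_simps[OF _ dh] dh_simps[OF _ del_hom[OF Q g']] d_simps
  show ?thesis
    unfolding hlift_def
  \<comment> \<open>The augmentation of the correction is, up to sign, \<open>h\<close> of
    \<open>\<kappa> d + d \<kappa>\<close>: the part \<open>h \<kappa> d\<close> enters the new
    \<open>u\<close>, while \<open>h d \<kappa>\<close> turns \<open>g' \<kappa>\<close> into
    \<open>g \<kappa>\<close>.\<close>
  proof (intro conjI exI[of _ "\<lambda>i x. u i x - ksgn m (h (i + 1) (\<kappa> i x))"] allI ballI)
    show "deg_hom Q Q (1 - m) (\<lambda>i x. \<psi> i x + ksgn m (del Q (m - 1) h i (Dl i x)))"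
      by (intro deg_hom_add deg_hom_ksgn \<psi> deg_hom_comp[OF _ Dl dh]) simp_all
    show "deg_hom Q Alg (2 - m) (\<lambda>i x. u i x - ksgn m (h (i + 1) (\<kappa> i x)))"
      by (intro deg_hom_diff deg_hom_ksgn u deg_hom_comp[OF _ \<kappa> h]) simp_all
    fix i x assume x: "x \<in> crr Q i"
    have t: "Dl i x \<in> crr (Q \<otimes> Q) i" using x by (simp add: s)
    have lin: "del Q m g i t = del Q m g' i t + del Q m (\<lambda>i x. h (i - 1) (diff Q i x)) i t"
      if "t \<in> crr (Q \<otimes> Q) i" for i t
      by (rule QQ_ext[OF Q del_hom[OF Q g] _ _ that, where G = "\<lambda>i t. del Q m g' i t +
           del Q m (\<lambda>i x. h (i - 1) (diff Q i x)) i t"])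
        (auto intro: deg_hom_add[OF _ _ del_hom[OF Q g'] del_hom[OF Q hd]]
          simp: del_tprod[OF Q g] del_tprod[OF Q g'] del_tprod[OF Q hd] gg add_lact add_ract ksgn_add)
    have 1: "del Q (m - 1) h (i - 1) (diff (Q \<otimes> Q) i (Dl i x)) =
      - ksgn m (diff Q (i + 1 - m) (del Q (m - 1) h i (Dl i x))) + del Q m (\<lambda>i x. h (i - 1) (diff Q i x)) i (Dl i x)"
    proof -
      have i: "i - (m - 1) = i + 1 - m" by simp
      show ?thesis using del_d[OF Q h' t] unfolding ksgn_pred i by simp
    qed
    show "\<psi> (i - 1) (diff Q i x) + ksgn m (del Q (m - 1) h (i - 1) (Dl (i - 1) (diff Q i x))) +
         ksgn m (diff Q (i + 1 - m) (\<psi> i x + ksgn m (del Q (m - 1) h i (Dl i x)))) =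
         ksgn m (del Q m g i (Dl i x))"
      using x \<psi>d[OF x] by (simp add: Dd 1 lin[OF t] s ksgn_add ksgn_minus ksgn_diff algebra_simps)
    have 2: "zext \<nu> (i + 1 - m) (del Q (m - 1) h i (Dl i x)) = - h i (del Q 0 (zext \<nu>) i (Dl i x))"
      using del_swap[OF Q h', of 0 "zext \<nu>", OF _ t] z by (simp add: algebra_simps)
    have 3: "h i (del Q 0 (zext \<nu>) i (Dl i x)) = h i (\<kappa> (i - 1) (diff Q i x)) + h i (diff Q (i + 1) (\<kappa> i x))"
      unfolding kd[OF x, symmetric] using x by (simp add: dh_add[OF Q h] s)
    have 4: "g (i + 1) (\<kappa> i x) = g' (i + 1) (\<kappa> i x) + h i (diff Q (i + 1) (\<kappa> i x))"
      using gg[of "\<kappa> i x" "i + 1"] x by (simp add: s)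
    show "zext \<nu> (i + 1 - m) (\<psi> i x + ksgn m (del Q (m - 1) h i (Dl i x))) =
      - ksgn m (g (i + 1) (\<kappa> i x)) + (u (i - 1) (diff Q i x) - ksgn m (h (i - 1 + 1) (\<kappa> (i - 1) (diff Q i x))))"
    proof -
      have "zext \<nu> (i + 1 - m) (\<psi> i x + ksgn m (del Q (m - 1) h i (Dl i x))) =
          zext \<nu> (i + 1 - m) (\<psi> i x) + ksgn m (zext \<nu> (i + 1 - m) (del Q (m - 1) h i (Dl i x)))"
        using x by (simp add: dh_add[OF Q z] dh_ksgn[OF Q z] s)
      then show ?thesis unfolding \<nu>\<psi>[OF x] 2 3 4 by (simp add: ksgn_add ksgn_minus ksgn_diff)
    qed
  qed
qed

text \<open>The chosen lifting of \<open>g\<close> is compared with the shifted lifting of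
  \<open>g'\<close>. One half of the bracket changes by \<open>f\<close> of the commutator with
  \<open>h\<close>, the other by \<open>h d\<close> on the lifting of \<open>f\<close>, hence by
  \<open>h\<close> of the commutator with \<open>f\<close>. Up to coboundaries the two changes
  cancel by \<open>del_swap\<close>.\<close>

lemma brs_cong_right:
  assumes proj: "\<And>i. projective_bimod scale (obj Q i)"
    and sys: "lifting_system Q \<nu> Dl \<kappa> \<Psi>" and mn: "m \<ge> 0" "n \<ge> 0"
    and f: "f \<in> cocycles scale Q n" and gg: "(g, g') \<in> hh_rel scale Q m"
  shows "(brs \<Psi> n m f g, brs \<Psi> n m f g') \<in> hh_rel scale Q (n + m - 1)"
proof -
  from gg obtain h where g: "g \<in> cocycles scale Q m" and g': "g' \<in> cocycles scale Q m"
    and h: "deg_hom Q Alg (1 - m) h" and hg: "\<And>i x. x \<in> crr Q i \<Longrightarrow> g i x - g' i x = h (i - 1) (diff Q i x)"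
    by (auto elim!: hh_relE)
  have ld: "lifting_data Q \<nu> Dl \<kappa>" and lg: "hlift Q \<nu> Dl \<kappa> m g (\<Psi> m g)"
    and lg': "hlift Q \<nu> Dl \<kappa> m g' (\<Psi> m g')" and lf: "hlift Q \<nu> Dl \<kappa> n f (\<Psi> n f)"
    using sys mn f g g' by (auto simp: lifting_system_def)
  have Q [simp]: "cpx Q" and Dl: "deg_hom Q (Q \<otimes> Q) 0 Dl" using ld by (auto simp: lifting_data_def resolves_def)
  note gh = cocyclesD(1)[OF g] and gh' = cocyclesD(1)[OF g'] and fh = cocyclesD(1)[OF f]
  have h': "deg_hom Q Alg (- (m - 1)) h" using h by simp
  note T = tmap[OF Q Q Q Q deg_hom_id deg_hom_id]
  have Tid: "tmap Q Q 0 0 idm idm i t = t" if "t \<in> crr (Q \<otimes> Q) i" for i t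
    by (rule QQ_ext[OF Q T(1) deg_hom_id _ that]) (simp add: T(2))
  have hg': "g i x = g' i x + h (i - 1) (diff Q i x)" if "x \<in> crr Q i" for i x
    using hg[OF that] by (simp add: diff_eq_eq add.commute)
  note lh = hlift_shift[OF ld lg' gh gh' h hg']
  \<comment> \<open>Both liftings live on \<open>Q\<close> with the same diagonal, so
    \<open>\<Theta>\<close> is the identity and \<open>Z = 0\<close>.\<close>
  have "\<exists>h1. deg_hom Q Alg (2 - n - m) h1 \<and> (\<forall>i. \<forall>x\<in>crr Q i.
     f (i + 1 - m) (\<Psi> m g i x) - f (i + 1 - m) (\<Psi> m g' i x + ksgn m (del Q (m - 1) h i (Dl i x)))
       - ksgn m (f (i + 1 - m) (del Q m g (i + 1) 0)) = h1 (i - 1) (diff Q i x))"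
    by (rule compare_liftings[OF proj ld ld deg_hom_id refl refl _ _ g f lg lh, where Z = "\<lambda>_ _. 0"])
      (use dh_mem[OF Q Dl] in \<open>auto simp: Tid deg_hom_zero\<close>)
  then obtain h1 where h1: "deg_hom Q Alg (2 - n - m) h1"
    and e1: "\<And>i x. x \<in> crr Q i \<Longrightarrow> f (i + 1 - m) (\<Psi> m g i x) -
      f (i + 1 - m) (\<Psi> m g' i x + ksgn m (del Q (m - 1) h i (Dl i x)))
       - ksgn m (f (i + 1 - m) (del Q m g (i + 1) 0)) = h1 (i - 1) (diff Q i x)"
    by auto
  have hf: "deg_hom Q Q (1 - n) (\<Psi> n f)" and hg'': "deg_hom Q Q (1 - m) (\<Psi> m g')"
    and fd: "\<And>i x. x \<in> crr Q i \<Longrightarrow> \<Psi> n f (i - 1) (diff Q i x) + ksgn n (diff Q (i + 1 - n) (\<Psi> n f i x)) =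
      ksgn n (del Q n f i (Dl i x))"
    using lf lg' by (auto simp: hlift_def)
  have dh: "deg_hom (Q \<otimes> Q) Q (1 - m) (del Q (m - 1) h)" using del_hom[OF Q h'] by simp
  note dg = del_hom[OF Q gh] and df = del_hom[OF Q fh]
  let ?s = "ksgn ((n - 1) * (m - 1))"
  let ?h = "\<lambda>i x. h1 i x + ?s (ksgn n (h (i + 1 - n) (\<Psi> n f i x)))"
  show ?thesis
  proof (rule hh_relI[where h = ?h and t = "2 - n - m"])
    show "brs \<Psi> n m f g \<in> cocycles scale Q (n + m - 1)" "brs \<Psi> n m f g' \<in> cocycles scale Q (n + m - 1)"
      by (rule brs_cocycle[OF sys mn f]; fact)+
    show "deg_hom Q Alg (2 - n - m) ?h"
      by (intro deg_hom_add deg_hom_ksgn h1 deg_hom_comp[OF _ hf h]) simp_all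
    fix i x assume x: "x \<in> crr Q i"
    have t: "Dl i x \<in> crr (Q \<otimes> Q) i" using dh_mem[OF Q Dl x] by simp
    have A: "f (i + 1 - m) (\<Psi> m g i x) - f (i + 1 - m) (\<Psi> m g' i x) =
      ksgn m (f (i + 1 - m) (del Q (m - 1) h i (Dl i x))) + h1 (i - 1) (diff Q i x)"
      using e1[OF x] x t
      by (simp add: dh_add[OF Q fh] dh_ksgn[OF Q fh] dh_mem[OF Q hg''] dh_mem[OF _ dh] dh_0[OF _ dg]
          dh_0[OF Q fh] algebra_simps)
    have B: "g (i + 1 - n) (\<Psi> n f i x) - g' (i + 1 - n) (\<Psi> n f i x) = h (i - n) (del Q n f i (Dl i x))
      - ksgn n (h (i - n) (\<Psi> n f (i - 1) (diff Q i x)))"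
    proof -
      have m: "\<Psi> n f i x \<in> crr Q (i + 1 - n)" "\<Psi> n f (i - 1) (diff Q i x) \<in> crr Q (i - n)"
        using x by (simp_all add: dh_mem[OF Q hf])
      have "diff Q (i + 1 - n) (\<Psi> n f i x) = del Q n f i (Dl i x) - ksgn n (\<Psi> n f (i - 1) (diff Q i x))"
        using arg_cong[OF fd[OF x], of "ksgn n"] by (simp add: ksgn_add eq_diff_eq add.commute)
      then show ?thesis
        using hg[OF m(1)] m t by (simp add: dh_diff[OF Q h] dh_ksgn[OF Q h] dh_mem[OF _ df])
    qed
    have C: "ksgn m (f (i + 1 - m) (del Q (m - 1) h i (Dl i x))) = ?s (h (i - n) (del Q n f i (Dl i x)))"
    proof -
      have e: "i - (m - 1) = i + 1 - m" by simp
      have "f (i + 1 - m) (del Q (m - 1) h i (Dl i x)) = - ksgn (n * (m - 1)) (h (i - n) (del Q n f i (Dl i x)))"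
        using del_swap[OF Q h' fh t] unfolding e .
      then show ?thesis by (auto simp: ksgn_def)
    qed
    have "brs \<Psi> n m f g i x - brs \<Psi> n m f g' i x =
      (f (i + 1 - m) (\<Psi> m g i x) - f (i + 1 - m) (\<Psi> m g' i x)) -
      ?s (g (i + 1 - n) (\<Psi> n f i x) - g' (i + 1 - n) (\<Psi> n f i x))"
      by (simp add: brs_def ksgn_diff)
    also have "\<dots> = ?h (i - 1) (diff Q i x)"
      unfolding A B C ksgn_diff by (simp add: algebra_simps)
    finally show "brs \<Psi> n m f g i x - brs \<Psi> n m f g' i x = ?h (i - 1) (diff Q i x)" .
  qed simp
qed

text \<open>Graded antisymmetry (\<open>brs_swap\<close>) reduces this to the right
  argument.\<close>

lemma brs_cong_left:
  assumes proj: "\<And>i. projective_bimod scale (obj Q i)"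
    and sys: "lifting_system Q \<nu> Dl \<kappa> \<Psi>" and mn: "m \<ge> 0" "n \<ge> 0"
    and g: "g \<in> cocycles scale Q m" and ff: "(f, f') \<in> hh_rel scale Q n"
  shows "(brs \<Psi> n m f g, brs \<Psi> n m f' g) \<in> hh_rel scale Q (n + m - 1)"
proof -
  have Q [simp]: "cpx Q" using sys by (auto simp: lifting_system_def lifting_data_def resolves_def)
  from brs_cong_right[OF proj sys mn(2,1) g ff] obtain h where
    h: "deg_hom Q Alg (1 - (m + n - 1)) h"
    and e: "\<And>i x. x \<in> crr Q i \<Longrightarrow> brs \<Psi> m n g f i x - brs \<Psi> m n g f' i x = h (i - 1) (diff Q i x)"
    by (auto elim!: hh_relE)
  let ?s = "ksgn ((n - 1) * (m - 1))"
  show ?thesis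
  proof (rule hh_relI[where h = "\<lambda>i x. - ?s (h i x)"])
    show "brs \<Psi> n m f g \<in> cocycles scale Q (n + m - 1)" "brs \<Psi> n m f' g \<in> cocycles scale Q (n + m - 1)"
      using ff by (auto elim!: hh_relE intro!: brs_cocycle[OF sys mn _ g])
    show "deg_hom Q Alg (1 - (m + n - 1)) (\<lambda>i x. - ?s (h i x))"
      by (intro deg_hom_minus deg_hom_ksgn h) simp_all
    show "brs \<Psi> n m f g i x - brs \<Psi> n m f' g i x = - ?s (h (i - 1) (diff Q i x))" if "x \<in> crr Q i" for i x
      unfolding e[OF that, symmetric] brs_swap[of \<Psi> n m] ksgn_diff by simp
  qed simp
qed


section \<open>The lifting system of a diagonal approximation\<close>

lemma ksgn_uminus: "ksgn (- m) x = ksgn m x"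
  by (simp add: ksgn_def)

lemma TT_ext:
  assumes P: "cpx P" and Q: "cpx Q" and F: "deg_hom (P \<otimes> Q) R u F" and G: "deg_hom (P \<otimes> Q) R u' G"
    and "\<And>i x j y. i + j = n \<Longrightarrow> x \<in> crr P i \<Longrightarrow> y \<in> crr Q j \<Longrightarrow> F n (tprod P Q i x j y) = G n (tprod P Q i x j y)"
    and "t \<in> crr (P \<otimes> Q) n"
  shows "F n t = G n t"
  by (rule tens_ext[OF P Q assms(6)]) (use P Q in \<open>simp_all add: assms(5) dh_add[OF _ F] dh_add[OF _ G]\<close>)

lemma TTT_ext:
  fixes P :: "('k, 'a, 'm::ab_group_add) cplx" and F G :: "int \<Rightarrow> ('k, ('k, 'm, 'm) tens, 'm) tens \<Rightarrow> 'z::ab_group_add"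
  assumes P [simp]: "cpx P" and F: "deg_hom (P \<otimes> P \<otimes> P) R u F" and G: "deg_hom (P \<otimes> P \<otimes> P) R u' G"
    and e: "\<And>i x j y k z. i + j + k = n \<Longrightarrow> x \<in> crr P i \<Longrightarrow> y \<in> crr P j \<Longrightarrow> z \<in> crr P k \<Longrightarrow>
      F n (tprod (P \<otimes> P) P (i + j) (tprod P P i x j y) k z) = G n (tprod (P \<otimes> P) P (i + j) (tprod P P i x j y) k z)"
    and t: "t \<in> crr (P \<otimes> P \<otimes> P) n"
  shows "F n t = G n t"
proof (rule TT_ext[OF _ P F G _ t])
  fix l w k z assume lk: "l + k = n" and w: "w \<in> crr (P \<otimes> P) l" and z: "z \<in> crr P k"
  show "F n (tprod (P \<otimes> P) P l w k z) = G n (tprod (P \<otimes> P) P l w k z)"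
    using w
  proof (rule tens_ext[OF P P])
    fix i x j y assume "i + j = l" "x \<in> crr P i" "y \<in> crr P j"
    then show "F n (tprod (P \<otimes> P) P l (tprod P P i x j y) k z) = G n (tprod (P \<otimes> P) P l (tprod P P i x j y) k z)"
      using e[of i j k x y z] lk z by auto
  qed (use lk z in \<open>simp_all add: tprod_add_l dh_add[OF _ F] dh_add[OF _ G]\<close>)
qed simp

lemma tmap_chain:
  fixes P :: "('k, 'a, 'm::ab_group_add) cplx" and Q :: "('k, 'a, 'n::ab_group_add) cplx"
    and P' :: "('k, 'a, 'm1::ab_group_add) cplx" and Q' :: "('k, 'a, 'n1::ab_group_add) cplx"
  assumes c [simp]: "cpx P" "cpx Q" "cpx P'" "cpx Q'"
    and f: "deg_hom P P' t f" and g: "deg_hom Q Q' u g"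
    and fd: "\<And>i x. x \<in> crr P i \<Longrightarrow> f (i - 1) (diff P i x) = ksgn t (diff P' (i + t) (f i x))"
    and gd: "\<And>i x. x \<in> crr Q i \<Longrightarrow> g (i - 1) (diff Q i x) = ksgn u (diff Q' (i + u) (g i x))"
    and w: "w \<in> crr (P \<otimes> Q) n"
  shows "tmap P' Q' t u f g (n - 1) (diff (P \<otimes> Q) n w) = ksgn (t + u) (diff (P' \<otimes> Q') (n + t + u) (tmap P' Q' t u f g n w))"
proof (rule TT_ext[OF c(1,2) _ _ _ w, where R = "P' \<otimes> Q'" and u = "t + u - 1" and u' = "t + u - 1" and
    F = "\<lambda>n w. tmap P' Q' t u f g (n - 1) (diff (P \<otimes> Q) n w)" and
    G = "\<lambda>n w. ksgn (t + u) (diff (P' \<otimes> Q') (n + t + u) (tmap P' Q' t u f g n w))"])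
  note T = tmap[OF c f g]
  show "deg_hom (P \<otimes> Q) (P' \<otimes> Q') (t + u - 1) (\<lambda>n w. tmap P' Q' t u f g (n - 1) (diff (P \<otimes> Q) n w))"
    by (rule deg_hom_comp[OF _ diff_hom T(1)]) simp_all
  show "deg_hom (P \<otimes> Q) (P' \<otimes> Q') (t + u - 1) (\<lambda>n w. ksgn (t + u) (diff (P' \<otimes> Q') (n + t + u) (tmap P' Q' t u f g n w)))"
    by (intro deg_hom_ksgn deg_hom_comp[OF _ T(1) diff_hom]) simp_all
  fix i x j y assume a: "i + j = n" "x \<in> crr P i" "y \<in> crr Q j"
  note s = dh_simps[OF _ T(1)] dh_simps[OF _ f] dh_simps[OF _ g]
  have i1: "i - 1 + t = i + t - 1" "j - 1 + u = j + u - 1" by simp_all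
  have L: "tmap P' Q' t u f g (n - 1) (diff (P \<otimes> Q) n (tprod P Q i x j y)) =
    ksgn ((i - 1) * u + t) (tprod P' Q' (i + t - 1) (diff P' (i + t) (f i x)) (j + u) (g j y)) +
    ksgn (i + i * u + u) (tprod P' Q' (i + t) (f i x) (j + u - 1) (diff Q' (j + u) (g j y)))"
    using a by (simp add: diff_tprod s T(2) fd gd i1 tprod_lin ksgn_ksgn add.assoc)
  have R: "ksgn (t + u) (diff (P' \<otimes> Q') (n + t + u) (tmap P' Q' t u f g n (tprod P Q i x j y))) =
    ksgn (t + u + i * u) (tprod P' Q' (i + t - 1) (diff P' (i + t) (f i x)) (j + u) (g j y)) +
    ksgn (t + u + i * u + (i + t)) (tprod P' Q' (i + t) (f i x) (j + u - 1) (diff Q' (j + u) (g j y)))"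
  proof -
    have n: "n + t + u = (i + t) + (j + u)" using a by simp
    show ?thesis using a unfolding n
      by (simp add: T(2) s d_ksgn diff_tprod ksgn_add ksgn_ksgn add.assoc)
  qed
  \<comment> \<open>The exponents differ by \<open>2 u\<close> in the first equation and by
    \<open>2 t\<close> in the second.\<close>
  have "ksgn ((i - 1) * u + t) v = ksgn (t + u + i * u) v" "ksgn (i + i * u + u) v = ksgn (t + u + i * u + (i + t)) v"
    for v :: "('k, 'm1, 'n1) tens"
    by (auto simp: ksgn_def)
  then show "tmap P' Q' t u f g (n - 1) (diff (P \<otimes> Q) n (tprod P Q i x j y)) =
    ksgn (t + u) (diff (P' \<otimes> Q') (n + t + u) (tmap P' Q' t u f g n (tprod P Q i x j y)))"
    unfolding L R by simp
qed

lemma tens_neg: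
  assumes P [simp]: "cpx P" and Q [simp]: "cpx Q"
    and nP: "\<And>n x. n < 0 \<Longrightarrow> x \<in> crr P n \<Longrightarrow> x = 0" and nQ: "\<And>n x. n < 0 \<Longrightarrow> x \<in> crr Q n \<Longrightarrow> x = 0"
    and n: "n < 0" and t: "t \<in> crr (P \<otimes> Q) n"
  shows "t = 0"
  using t
proof (rule tens_ext[OF P Q, where F = "\<lambda>t. t" and G = "\<lambda>_. 0"])
  fix i x j y assume a: "i + j = n" "x \<in> crr P i" "y \<in> crr Q j"
  then have "x = 0 \<or> y = 0" using n nP[of i x] nQ[of j y] by linarith
  then show "tprod P Q i x j y = 0" using a by auto
qed simp_all

lemma lunit:
  assumes P [simp]: "cpx P"
  shows lunit_hom: "deg_hom (Alg \<otimes> P) P 0 (lunit P)"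
    and lunit_tprod: "\<And>k i a j x. k = i + j \<Longrightarrow> a \<in> crr Alg i \<Longrightarrow> x \<in> crr P j \<Longrightarrow>
      lunit P k (tprod Alg P i a j x) = lact (obj P j) a x"
proof -
  let ?b = "\<lambda>i a j x. lact (obj P j) a x"
  have mem: "?b i a j x \<in> crr P n" if "i + j = n" "a \<in> crr Alg i" "x \<in> crr P j" for i a j x n
    using that by (cases "i = 0") (auto simp: crr_Alg)
  have l: "?b i (c * a) j x = lact (obj P n) c (?b i a j x)" if "i + j = n" "a \<in> crr Alg i" "x \<in> crr P j" for i a j x n c
    using that by (cases "i = 0") (auto simp: crr_Alg lact_lact)
  have r: "?b i a j (ract (obj P j) x c) = ract (obj P n) (?b i a j x) c" if "i + j = n" "a \<in> crr Alg i" "x \<in> crr P j" for i a j x n c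
    using that by (cases "i = 0") (auto simp: crr_Alg lact_ract)
  have bal: "lact (obj P j) (a * c) x = lact (obj P j) a (lact (obj P j) c x)" if "x \<in> crr P j" for j a c x
    using that by (simp add: lact_lact)
  have "bimod_hom (obj (Alg \<otimes> P) n) (obj P n) (lunit P n)" for n
    unfolding lunit_def
    by (rule tens_hom(1)[where b = ?b]) (simp_all add: mem l r bal add_lact lact_add)
  then show "deg_hom (Alg \<otimes> P) P 0 (lunit P)" by (simp add: deg_hom_def)
  show "lunit P k (tprod Alg P i a j x) = lact (obj P j) a x" if "k = i + j" "a \<in> crr Alg i" "x \<in> crr P j" for k i a j x
    unfolding lunit_def
    by (rule tens_hom(2)[where b = ?b and n = k]) (simp_all add: mem l r bal add_lact lact_add that)
qed

lemma runit:
  assumes P [simp]: "cpx P"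
  shows runit_hom: "deg_hom (P \<otimes> Alg) P 0 (runit P)"
    and runit_tprod: "\<And>k i a j x. k = i + j \<Longrightarrow> a \<in> crr Alg j \<Longrightarrow> x \<in> crr P i \<Longrightarrow>
      runit P k (tprod P Alg i x j a) = ract (obj P i) x a"
proof -
  let ?b = "\<lambda>i x j a. ract (obj P i) x a"
  have mem: "?b i x j a \<in> crr P n" if "i + j = n" "a \<in> crr Alg j" "x \<in> crr P i" for i a j x n
    using that by (cases "j = 0") (auto simp: crr_Alg)
  have r: "?b i x j (a * c) = ract (obj P n) (?b i x j a) c" if "i + j = n" "a \<in> crr Alg j" "x \<in> crr P i" for i a j x n c
    using that by (cases "j = 0") (auto simp: crr_Alg ract_ract)
  have l: "?b i (lact (obj P i) c x) j a = lact (obj P n) c (?b i x j a)" if "i + j = n" "a \<in> crr Alg j" "x \<in> crr P i" for i a j x n c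
    using that by (cases "j = 0") (auto simp: crr_Alg lact_ract)
  have bal: "ract (obj P i) x (c * a) = ract (obj P i) (ract (obj P i) x c) a" if "x \<in> crr P i" for i a c x
    using that by (simp add: ract_ract)
  have "bimod_hom (obj (P \<otimes> Alg) n) (obj P n) (runit P n)" for n
    unfolding runit_def
    by (rule tens_hom(1)[where b = ?b]) (simp_all add: mem l r, simp_all add: bal add_ract ract_add)
  then show "deg_hom (P \<otimes> Alg) P 0 (runit P)" by (simp add: deg_hom_def)
  show "runit P k (tprod P Alg i x j a) = ract (obj P i) x a" if "k = i + j" "a \<in> crr Alg j" "x \<in> crr P i" for k i a j x
    unfolding runit_def
    by (rule tens_hom(2)[where b = ?b and n = k]) (simp_all add: mem l r that, simp_all add: bal add_ract ract_add)
qed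

text \<open>The operation under study is phrased with \<open>tmap\<close> and the unit isomorphisms.
  This lemma and the next two translate it into \<open>Lop\<close> and \<open>Rop\<close>, with
  which the computations are done.\<close>

lemma lunit_tmap:
  assumes P [simp]: "cpx P" and g: "deg_hom P Alg (- m) g" and t: "t \<in> crr (P \<otimes> P) k"
  shows "lunit P (k - m) (tmap Alg P (- m) 0 g idm k t) = Lop P m g k t"
proof -
  note T = tmap[OF P P cpx_Alg P g deg_hom_id]
  show ?thesis
  proof (rule QQ_ext[OF P _ Lop[OF P g] _ t, where F = "\<lambda>k t. lunit P (k - m) (tmap Alg P (- m) 0 g idm k t)"])
    show "deg_hom (P \<otimes> P) P (- m) (\<lambda>k t. lunit P (k - m) (tmap Alg P (- m) 0 g idm k t))"
      by (rule deg_hom_comp[OF _ T(1) lunit_hom]) simp_all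
  qed (use dh_mem[OF P g] in \<open>simp add: T(2) lunit_tprod Lop_tprod[OF P g]\<close>)
qed

lemma runit_tmap:
  assumes P [simp]: "cpx P" and g: "deg_hom P Alg (- m) g" and t: "t \<in> crr (P \<otimes> P) k"
  shows "runit P (k - m) (tmap P Alg 0 (- m) idm g k t) = Rop P m g k t"
proof -
  note T = tmap[OF P P P cpx_Alg deg_hom_id g]
  show ?thesis
  proof (rule QQ_ext[OF P _ Rop[OF P g] _ t, where F = "\<lambda>k t. runit P (k - m) (tmap P Alg 0 (- m) idm g k t)"])
    show "deg_hom (P \<otimes> P) P (- m) (\<lambda>k t. runit P (k - m) (tmap P Alg 0 (- m) idm g k t))"
      by (rule deg_hom_comp[OF _ T(1) runit_hom]) simp_all
    fix i x j y assume a: "i + j = k" "x \<in> crr P i" "y \<in> crr P j"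
    then have m: "g j y \<in> crr Alg (j - m)" using dh_mem[OF P g, of y j "j - m"] by simp
    show "runit P (k - m) (tmap P Alg 0 (- m) idm g k (tprod P P i x j y)) = Rop P m g k (tprod P P i x j y)"
      using a(2,3) m unfolding a(1)[symmetric]
      by (simp add: T(2) dh_ksgn[OF _ runit_hom] runit_tprod Rop_tprod[OF P g] ksgn_uminus)
  qed
qed

text \<open>Once \<open>A \<otimes> A\<close> is identified with \<open>A\<close>, the map
  \<open>f \<otimes> g\<close> is \<open>f\<close> after \<open>1 \<otimes> g\<close>. Thus
  \<open>f\<close> can be split off from the summand with \<open>\<epsilon>\<close> as well.\<close>

lemma lunit_tmap_Alg:
  assumes P [simp]: "cpx P" and g: "deg_hom P Alg (- m) g" and f: "deg_hom P Alg (- n) f" and t: "t \<in> crr (P \<otimes> P) k"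
  shows "lunit Alg (k - n - m) (tmap Alg Alg (- n) (- m) f g k t) = f (k - m) (Rop P m g k t)"
proof -
  note T = tmap[OF P P cpx_Alg cpx_Alg f g]
  show ?thesis
  proof (rule QQ_ext[OF P _ _ _ t, where u = "- n - m" and u' = "- n - m" and R = Alg and
      F = "\<lambda>k t. lunit Alg (k - n - m) (tmap Alg Alg (- n) (- m) f g k t)" and G = "\<lambda>k t. f (k - m) (Rop P m g k t)"])
    show "deg_hom (P \<otimes> P) Alg (- n - m) (\<lambda>k t. lunit Alg (k - n - m) (tmap Alg Alg (- n) (- m) f g k t))"
      by (rule deg_hom_comp[OF _ T(1) lunit_hom]) simp_all
    show "deg_hom (P \<otimes> P) Alg (- n - m) (\<lambda>k t. f (k - m) (Rop P m g k t))"
      by (rule deg_hom_comp[OF _ Rop[OF P g] f]) simp_all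
    fix i x j y assume a: "i + j = k" "x \<in> crr P i" "y \<in> crr P j"
    then have m: "g j y \<in> crr Alg (j - m)" "f i x \<in> crr Alg (i - n)" "ract (obj P i) x (g j y) \<in> crr P (k - m)"
      using dh_mem[OF P g, of y j "j - m"] dh_mem[OF P f, of x i "i - n"] Rop_mem0[OF P g a(2,3), of "k - m"] by simp_all
    show "lunit Alg (k - n - m) (tmap Alg Alg (- n) (- m) f g k (tprod P P i x j y)) = f (k - m) (Rop P m g k (tprod P P i x j y))"
      using a(2,3) m unfolding a(1)[symmetric]
      by (simp add: T(2) dh_ksgn[OF _ lunit_hom] lunit_tprod Rop_tprod[OF P g] dh_ksgn[OF P f]
          cochain_Rop[OF P g f] ksgn_uminus)
  qed
qed

section \<open>The diagonal and the liftings attached to a 3-approximation\<close>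

context
  fixes P :: "('k, 'a, 'p::ab_group_add) cplx" and \<mu> \<Delta> \<phi> \<epsilon>
  assumes res: "proj_resolution scale P \<mu>" and \<Delta>: "diag3_approx scale P \<mu> \<Delta>"
    and \<phi>: "phi_condition scale P \<mu> \<phi>" and \<epsilon>: "eps_condition scale P \<mu> \<Delta> \<epsilon>"
begin

text \<open>The maps \<open>\<mu> \<otimes> 1 \<otimes> 1\<close>,
  \<open>1 \<otimes> 1 \<otimes> \<mu>\<close> and \<open>1 \<otimes> g \<otimes> 1\<close> on the
  triple tensor product are \<open>m11\<close>, \<open>om1\<close> and \<open>ogo\<close>; in
  \<open>ogo\<close> the first two factors are contracted by \<open>1 \<otimes> g\<close>.\<close>

definition m11 :: "int \<Rightarrow> ('k, ('k, 'p, 'p) tens, 'p) tens \<Rightarrow> ('k, 'p, 'p) tens" where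
  "m11 = tmap P P 0 0 (Lop P 0 (zext \<mu>)) idm"

definition om1 :: "int \<Rightarrow> ('k, ('k, 'p, 'p) tens, 'p) tens \<Rightarrow> ('k, 'p, 'p) tens" where
  "om1 = (\<lambda>i t. runit (P \<otimes> P) i (tmap (P \<otimes> P) Alg 0 0 idm (zext \<mu>) i t))"

definition ogo :: "int \<Rightarrow> (int \<Rightarrow> 'p \<Rightarrow> 'a) \<Rightarrow> int \<Rightarrow> ('k, ('k, 'p, 'p) tens, 'p) tens \<Rightarrow> ('k, 'p, 'p) tens" where
  "ogo m g = tmap P P (- m) 0 (Rop P m g) idm"

definition Dl\<^sub>P :: "int \<Rightarrow> 'p \<Rightarrow> ('k, 'p, 'p) tens" where
  "Dl\<^sub>P i x = m11 i (\<Delta> i x)"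

text \<open>This comes from applying \<open>\<mu> \<otimes> 1\<close> to the equation of
  \<open>\<epsilon>\<close>: the first term becomes the left counit contraction of the diagonal, and
  the second becomes the right one by \<open>Lz_om1\<close>.\<close>

definition \<kappa>\<^sub>P :: "int \<Rightarrow> 'p \<Rightarrow> 'p" where
  "\<kappa>\<^sub>P i x = Lop P 0 (zext \<mu>) (i + 1) (\<epsilon> i x)"

text \<open>Chosen so that \<open>f\<close> composed with it is the circle product of
  \<open>f\<close> and \<open>g\<close> (\<open>circ_P_eq\<close>); that it is a lifting is
  \<open>hlift_P\<close>.\<close>

definition \<Psi>\<^sub>P :: "int \<Rightarrow> (int \<Rightarrow> 'p \<Rightarrow> 'a) \<Rightarrow> int \<Rightarrow> 'p \<Rightarrow> 'p" where
  "\<Psi>\<^sub>P m g i x = \<phi> (i - m) (ogo m g i (\<Delta> i x)) - ksgn m (Rop P m g (i + 1) (\<epsilon> i x))"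

lemma rP: "resolves P \<mu>"
  using res by (rule proj_resolution_resolves)

lemmas P = resolvesD(1)[OF rP]
lemmas z = resolvesD(2)[OF rP]
declare P [simp]

lemma z': "deg_hom P Alg (- 0) (zext \<mu>)" using z by simp

lemma Lz: "deg_hom (P \<otimes> P) P 0 (Lop P 0 (zext \<mu>))" and Rz: "deg_hom (P \<otimes> P) P 0 (Rop P 0 (zext \<mu>))"
  using Lop[OF P z'] Rop[OF P z'] by simp_all

lemma \<Delta>_hom: "deg_hom P (P \<otimes> P \<otimes> P) 0 \<Delta>"
  and \<Delta>_d: "x \<in> crr P i \<Longrightarrow> \<Delta> (i - 1) (diff P i x) = diff (P \<otimes> P \<otimes> P) i (\<Delta> i x)"
  using \<Delta> by (auto simp: diag3_approx_def chain_map_def Let_def eq_on_def bd_def)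

lemma tmap_cong:
  assumes "cpx Q" "cpx R" "cpx Q'" "cpx R'" "deg_hom Q Q' t f" "deg_hom R R' u g"
    "\<And>i x. x \<in> crr Q i \<Longrightarrow> f' i x = f i x" and w: "w \<in> crr (Q \<otimes> R) n"
  shows "tmap Q' R' t u f' g n w = tmap Q' R' t u f g n w"
proof -
  have f': "deg_hom Q Q' t f'" by (rule deg_hom_cong[OF assms(1,5)]) (use assms in auto)
  note T = tmap[OF assms(1-4) f' assms(6)] and T' = tmap[OF assms(1-6)]
  show ?thesis by (rule TT_ext[OF assms(1,2) T(1) T'(1) _ w]) (simp add: T(2) T'(2) assms(7))
qed

lemma \<phi>_hom: "deg_hom (P \<otimes> P) P 1 \<phi>"
  and \<phi>_d: "t \<in> crr (P \<otimes> P) i \<Longrightarrow> \<phi> (i - 1) (diff (P \<otimes> P) i t) =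
    Lop P 0 (zext \<mu>) i t - Rop P 0 (zext \<mu>) i t - diff P (i + 1) (\<phi> i t)"
proof -
  show "deg_hom (P \<otimes> P) P 1 \<phi>" using \<phi> by (simp add: phi_condition_def)
  have "bd (P \<otimes> P) P 1 \<phi> i t = lunit P i (tmap Alg P 0 0 (zext \<mu>) idm i t) - runit P i (tmap P Alg 0 0 idm (zext \<mu>) i t)"
    if "t \<in> crr (P \<otimes> P) i"
    using \<phi> that by (simp add: phi_condition_def eq_on_def)
  then show "t \<in> crr (P \<otimes> P) i \<Longrightarrow> \<phi> (i - 1) (diff (P \<otimes> P) i t) =
    Lop P 0 (zext \<mu>) i t - Rop P 0 (zext \<mu>) i t - diff P (i + 1) (\<phi> i t)"
    using lunit_tmap[OF P z', of t i] runit_tmap[OF P z', of t i]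
    by (simp add: bd_def ksgn_def eq_diff_eq)
qed

lemma m11_hom: "deg_hom (P \<otimes> P \<otimes> P) (P \<otimes> P) 0 m11"
  and m11_tprod: "i + j = n \<Longrightarrow> w \<in> crr (P \<otimes> P) i \<Longrightarrow> y \<in> crr P j \<Longrightarrow>
    m11 n (tprod (P \<otimes> P) P i w j y) = tprod P P i (Lop P 0 (zext \<mu>) i w) j y"
  unfolding m11_def using tmap[OF cpx_tensor[OF P P] P P P Lz deg_hom_id] by auto

lemma om1_hom: "deg_hom (P \<otimes> P \<otimes> P) (P \<otimes> P) 0 om1"
  and om1_tprod: "i + j = n \<Longrightarrow> w \<in> crr (P \<otimes> P) i \<Longrightarrow> y \<in> crr P j \<Longrightarrow>
    om1 n (tprod (P \<otimes> P) P i w j y) = ract (obj (P \<otimes> P) i) w (zext \<mu> j y)"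
proof -
  have PP: "cpx (P \<otimes> P)" by simp
  note T = tmap[OF PP P PP cpx_Alg deg_hom_id z]
  show "deg_hom (P \<otimes> P \<otimes> P) (P \<otimes> P) 0 om1"
    unfolding om1_def by (rule deg_hom_comp[OF _ T(1) runit_hom]) simp_all
  show "i + j = n \<Longrightarrow> w \<in> crr (P \<otimes> P) i \<Longrightarrow> y \<in> crr P j \<Longrightarrow>
    om1 n (tprod (P \<otimes> P) P i w j y) = ract (obj (P \<otimes> P) i) w (zext \<mu> j y)"
    using dh_mem[OF P z, of y j j] by (auto simp: om1_def T(2) runit_tprod)
qed

lemma \<epsilon>_hom: "deg_hom P (P \<otimes> P) 1 \<epsilon>"
  and \<epsilon>_d: "x \<in> crr P i \<Longrightarrow> \<epsilon> (i - 1) (diff P i x) =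
    m11 i (\<Delta> i x) - om1 i (\<Delta> i x) - diff (P \<otimes> P) (i + 1) (\<epsilon> i x)"
proof -
  let ?\<mu>1 = "\<lambda>i t. lunit P i (tmap Alg P 0 0 (zext \<mu>) idm i t)"
  have c: "tmap P P 0 0 ?\<mu>1 idm i w = m11 i w" if "w \<in> crr (P \<otimes> P \<otimes> P) i" for i w
    unfolding m11_def
    by (rule tmap_cong[OF _ P P P Lz deg_hom_id _ that]) (use lunit_tmap[OF P z'] in simp_all)
  have e: "deg_hom P (P \<otimes> P) 1 \<epsilon>" and ed: "\<And>i x. x \<in> crr P i \<Longrightarrow>
      bd P (P \<otimes> P) 1 \<epsilon> i x = tmap P P 0 0 ?\<mu>1 idm i (\<Delta> i x) - om1 i (\<Delta> i x)"
    using \<epsilon> by (auto simp: eps_condition_def Let_def eq_on_def om1_def)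
  show "deg_hom P (P \<otimes> P) 1 \<epsilon>" by fact
  show "x \<in> crr P i \<Longrightarrow> \<epsilon> (i - 1) (diff P i x) =
    m11 i (\<Delta> i x) - om1 i (\<Delta> i x) - diff (P \<otimes> P) (i + 1) (\<epsilon> i x)"
    using ed[of x i] c[OF dh_mem[OF P \<Delta>_hom, of x i i]] by (simp add: bd_def ksgn_def eq_diff_eq)
qed

lemma Lz_d: "t \<in> crr (P \<otimes> P) n \<Longrightarrow> Lop P 0 (zext \<mu>) (n - 1) (diff (P \<otimes> P) n t) = diff P n (Lop P 0 (zext \<mu>) n t)"
  using Lop_chain[OF P resolvesD(3)[OF rP]] by simp

lemma m11_d: "t \<in> crr (P \<otimes> P \<otimes> P) n \<Longrightarrow> m11 (n - 1) (diff (P \<otimes> P \<otimes> P) n t) = diff (P \<otimes> P) n (m11 n t)"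
  using tmap_chain[OF cpx_tensor[OF P P] P P P Lz deg_hom_id, of t n] Lz_d by (simp add: m11_def)

text \<open>The two augmentations contract the outer factors of a triple tensor, so their order does
  not matter.\<close>

lemma Lz_om1:
  assumes "t \<in> crr (P \<otimes> P \<otimes> P) n"
  shows "Lop P 0 (zext \<mu>) n (om1 n t) = Rop P 0 (zext \<mu>) n (m11 n t)"
proof (rule TTT_ext[OF P _ _ _ assms, where F = "\<lambda>n t. Lop P 0 (zext \<mu>) n (om1 n t)" and
    G = "\<lambda>n t. Rop P 0 (zext \<mu>) n (m11 n t)" and R = P and u = 0 and u' = 0])
  show "deg_hom (P \<otimes> P \<otimes> P) P 0 (\<lambda>n t. Lop P 0 (zext \<mu>) n (om1 n t))"
    by (rule deg_hom_comp[OF _ om1_hom Lz]) simp_all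
  show "deg_hom (P \<otimes> P \<otimes> P) P 0 (\<lambda>n t. Rop P 0 (zext \<mu>) n (m11 n t))"
    by (rule deg_hom_comp[OF _ m11_hom Rz]) simp_all
  fix i x j y k w assume a: "i + j + k = n" "x \<in> crr P i" "y \<in> crr P j" "w \<in> crr P k"
  have m: "lact (obj P j) (zext \<mu> i x) y \<in> crr P (i + j)" using Lop_mem0[OF P z'] a by simp
  have w: "zext \<mu> k w = 0" if "k \<noteq> 0" using that by (simp add: zext_def)
  have x: "zext \<mu> i x = 0" if "i \<noteq> 0" using that by (simp add: zext_def)
  have n: "tprod P P i x j (ract (obj P j) y (zext \<mu> k w)) \<in> crr (P \<otimes> P) n"
    using a w by (cases "k = 0") auto
  have L: "om1 n (tprod (P \<otimes> P) P (i + j) (tprod P P i x j y) k w) = tprod P P i x j (ract (obj P j) y (zext \<mu> k w))"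
    using a by (simp add: om1_tprod ract_tprod)
  have "Lop P 0 (zext \<mu>) n (tprod P P i x j (ract (obj P j) y (zext \<mu> k w))) = lact (obj P j) (zext \<mu> i x) (ract (obj P j) y (zext \<mu> k w))"
    using a w by (cases "k = 0") (auto simp: Lop_tprod[OF P z'] dh_0[OF _ Lz])
  moreover have "Rop P 0 (zext \<mu>) n (m11 n (tprod (P \<otimes> P) P (i + j) (tprod P P i x j y) k w)) =
      ract (obj P (i + j)) (lact (obj P j) (zext \<mu> i x) y) (zext \<mu> k w)"
    using a m by (simp add: m11_tprod Lop_tprod[OF P z'] Rop_tprod[OF P z'])
  ultimately show "Lop P 0 (zext \<mu>) n (om1 n (tprod (P \<otimes> P) P (i + j) (tprod P P i x j y) k w)) =
    Rop P 0 (zext \<mu>) n (m11 n (tprod (P \<otimes> P) P (i + j) (tprod P P i x j y) k w))"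
    unfolding L using a x by (cases "i = 0") (auto simp: lact_ract)
qed

lemma Dl\<^sub>P_hom: "deg_hom P (P \<otimes> P) 0 Dl\<^sub>P"
  unfolding Dl\<^sub>P_def by (rule deg_hom_comp[OF _ \<Delta>_hom m11_hom]) simp_all

text \<open>The triple augmentation of \<open>\<Delta>\<close> can be evaluated one factor at a
  time, which turns the normalisation of the 3-approximation into one of the diagonal. It starts the
  homotopy built in \<open>compare_diagonals\<close>.\<close>

lemma Dl\<^sub>P_aug:
  assumes x: "x \<in> crr P 0"
  shows "\<mu> (Lop P 0 (zext \<mu>) 0 (Dl\<^sub>P 0 x)) = \<mu> x"
proof -
  let ?\<mu>\<mu> = "\<lambda>i t. lunit Alg i (tmap Alg Alg 0 0 (zext \<mu>) (zext \<mu>) i t)"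
  let ?\<mu>\<mu>\<mu> = "\<lambda>i t. lunit Alg i (tmap Alg Alg 0 0 ?\<mu>\<mu> (zext \<mu>) i t)"
  have PP: "cpx (P \<otimes> P)" by simp
  note T = tmap[OF P P cpx_Alg cpx_Alg z z]
  have mm: "deg_hom (P \<otimes> P) Alg 0 ?\<mu>\<mu>"
    by (rule deg_hom_comp[OF _ T(1) lunit_hom]) simp_all
  note T3 = tmap[OF PP P cpx_Alg cpx_Alg mm z]
  have "?\<mu>\<mu>\<mu> 0 (\<Delta> 0 x) = zext \<mu> 0 x"
    using \<Delta> x by (auto simp: diag3_approx_def Let_def eq_on_def)
  moreover have "?\<mu>\<mu>\<mu> 0 t = zext \<mu> 0 (Lop P 0 (zext \<mu>) 0 (m11 0 t))" if t: "t \<in> crr (P \<otimes> P \<otimes> P) 0" for t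
  proof (rule TTT_ext[OF P _ _ _ t, where F = ?\<mu>\<mu>\<mu> and G = "\<lambda>n t. zext \<mu> n (Lop P 0 (zext \<mu>) n (m11 n t))" and R = Alg and u = 0 and u' = 0])
    show "deg_hom (P \<otimes> P \<otimes> P) Alg 0 ?\<mu>\<mu>\<mu>"
      by (rule deg_hom_comp[OF _ T3(1) lunit_hom]) simp_all
    have zl: "deg_hom (P \<otimes> P) Alg 0 (\<lambda>n t. zext \<mu> n (Lop P 0 (zext \<mu>) n t))"
      by (rule deg_hom_comp[OF _ Lz z]) simp_all
    show "deg_hom (P \<otimes> P \<otimes> P) Alg 0 (\<lambda>n t. zext \<mu> n (Lop P 0 (zext \<mu>) n (m11 n t)))"
      by (rule deg_hom_comp[OF _ m11_hom zl]) simp_all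
    fix i x j y k w assume a: "i + j + k = 0" "x \<in> crr P i" "y \<in> crr P j" "w \<in> crr P k"
    have m: "lact (obj P j) (zext \<mu> i x) y \<in> crr P (i + j)" using Lop_mem0[OF P z'] a by simp
    have k: "k = - (i + j)" using a by simp
    have "zext \<mu> i x \<in> crr Alg i" "zext \<mu> j y \<in> crr Alg j" "zext \<mu> k w \<in> crr Alg k"
      using a dh_mem[OF P z] by auto
    moreover then have "zext \<mu> i x * zext \<mu> j y \<in> crr Alg (i + j)" by (auto simp: crr_Alg)
    ultimately have "?\<mu>\<mu>\<mu> 0 (tprod (P \<otimes> P) P (i + j) (tprod P P i x j y) k w) = zext \<mu> i x * zext \<mu> j y * zext \<mu> k w"
      using a by (simp add: T3(2) T(2) lunit_tprod)
    moreover have "zext \<mu> 0 (Lop P 0 (zext \<mu>) 0 (m11 0 (tprod (P \<otimes> P) P (i + j) (tprod P P i x j y) k w))) =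
        zext \<mu> (i + j) (lact (obj P j) (zext \<mu> i x) y) * zext \<mu> k w"
    proof -
      have "m11 0 (tprod (P \<otimes> P) P (i + j) (tprod P P i x j y) k w) = tprod P P (i + j) (lact (obj P j) (zext \<mu> i x) y) k w"
        using a by (simp add: m11_tprod Lop_tprod[OF P z'])
      then show ?thesis using a m cochain_Lop[OF P z' z', of "lact (obj P j) (zext \<mu> i x) y" "i + j" w k 0]
        by (simp add: Lop_tprod[OF P z'])
    qed
    moreover have "zext \<mu> (i + j) (lact (obj P j) (zext \<mu> i x) y) = zext \<mu> i x * zext \<mu> j y"
      using cochain_Lop[OF P z' z' a(2,3), of "i + j"] by simp
    ultimately show "?\<mu>\<mu>\<mu> 0 (tprod (P \<otimes> P) P (i + j) (tprod P P i x j y) k w) =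
      zext \<mu> 0 (Lop P 0 (zext \<mu>) 0 (m11 0 (tprod (P \<otimes> P) P (i + j) (tprod P P i x j y) k w)))"
      by simp
  qed
  ultimately show ?thesis
    using dh_mem[OF P \<Delta>_hom x, of 0] by (simp add: Dl\<^sub>P_def zext_def)
qed

lemma lifting_data_P: "lifting_data P \<mu> Dl\<^sub>P \<kappa>\<^sub>P"
  unfolding lifting_data_def
proof (intro conjI allI ballI)
  show "deg_hom P P 1 \<kappa>\<^sub>P"
    unfolding \<kappa>\<^sub>P_def by (rule deg_hom_comp[OF _ \<epsilon>_hom Lz]) simp_all
  fix i x assume x: "x \<in> crr P i"
  have t: "\<Delta> i x \<in> crr (P \<otimes> P \<otimes> P) i" using dh_mem[OF P \<Delta>_hom x] by simp
  have e: "\<epsilon> i x \<in> crr (P \<otimes> P) (i + 1)" using dh_mem[OF P \<epsilon>_hom x] by simp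
  show "Dl\<^sub>P (i - 1) (diff P i x) = diff (P \<otimes> P) i (Dl\<^sub>P i x)"
    by (simp add: Dl\<^sub>P_def \<Delta>_d[OF x] m11_d t)
  have m: "m11 i (\<Delta> i x) \<in> crr (P \<otimes> P) i" "om1 i (\<Delta> i x) \<in> crr (P \<otimes> P) i"
    using dh_mem[OF _ m11_hom t] dh_mem[OF _ om1_hom t] by simp_all
  show "\<kappa>\<^sub>P (i - 1) (diff P i x) + diff P (i + 1) (\<kappa>\<^sub>P i x) = del P 0 (zext \<mu>) i (Dl\<^sub>P i x)"
    using Lz_d[OF e] e m by (simp add: \<kappa>\<^sub>P_def \<epsilon>_d[OF x] dh_diff[OF _ Lz] Lz_om1[OF t] Dl\<^sub>P_def del_def)
qed (use rP Dl\<^sub>P_hom in auto)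

context
  fixes m g assumes g: "g \<in> cocycles scale P m"
begin

lemmas gh = cocyclesD(1)[OF g]

lemma ogo_hom: "deg_hom (P \<otimes> P \<otimes> P) (P \<otimes> P) (- m) (ogo m g)"
  and ogo_tprod: "i + j = n \<Longrightarrow> w \<in> crr (P \<otimes> P) i \<Longrightarrow> y \<in> crr P j \<Longrightarrow>
    ogo m g n (tprod (P \<otimes> P) P i w j y) = tprod P P (i - m) (Rop P m g i w) j y"
  unfolding ogo_def using tmap[OF cpx_tensor[OF P P] P P P Rop[OF P gh] deg_hom_id] by auto

lemma ogo_d:
  assumes "t \<in> crr (P \<otimes> P \<otimes> P) n"
  shows "ogo m g (n - 1) (diff (P \<otimes> P \<otimes> P) n t) = ksgn m (diff (P \<otimes> P) (n - m) (ogo m g n t))"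
proof -
  have k: "ksgn (- m) y = ksgn m y" for y :: "('k, 'p, 'p) tens" by (simp add: ksgn_def)
  have k': "ksgn (- m) y = ksgn m y" for y :: 'p by (simp add: ksgn_def)
  show ?thesis
    using tmap_chain[OF cpx_tensor[OF P P] P P P Rop[OF P gh] deg_hom_id _ _ assms] Rop_chain[OF P g]
    by (simp add: ogo_def k k')
qed

text \<open>The factor contracted by \<open>\<mu>\<close> has degree 0 whenever the term is nonzero,
  so the Koszul sign of \<open>1 \<otimes> g\<close> disappears.\<close>

lemma Lz_ogo:
  assumes "t \<in> crr (P \<otimes> P \<otimes> P) n"
  shows "Lop P 0 (zext \<mu>) (n - m) (ogo m g n t) = Lop P m g n (m11 n t)"
proof (rule TTT_ext[OF P _ _ _ assms, where F = "\<lambda>n t. Lop P 0 (zext \<mu>) (n - m) (ogo m g n t)" and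
    G = "\<lambda>n t. Lop P m g n (m11 n t)" and R = P and u = "- m" and u' = "- m"])
  show "deg_hom (P \<otimes> P \<otimes> P) P (- m) (\<lambda>n t. Lop P 0 (zext \<mu>) (n - m) (ogo m g n t))"
    by (rule deg_hom_comp[OF _ ogo_hom Lz]) simp_all
  show "deg_hom (P \<otimes> P \<otimes> P) P (- m) (\<lambda>n t. Lop P m g n (m11 n t))"
    by (rule deg_hom_comp[OF _ m11_hom Lop[OF P gh]]) simp_all
  fix i x j y k w assume a: "i + j + k = n" "x \<in> crr P i" "y \<in> crr P j" "w \<in> crr P k"
  have m: "lact (obj P j) (zext \<mu> i x) y \<in> crr P (i + j)" "ract (obj P i) x (g j y) \<in> crr P (i + j - m)"
    using Lop_mem0[OF P z'] Rop_mem0[OF P gh] a by simp_all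
  have 1: "g (i + j) (lact (obj P j) (zext \<mu> i x) y) = zext \<mu> i x * g j y"
    using cochain_Lop[OF P z' gh a(2,3)] by simp
  have 2: "zext \<mu> (i + j - m) (ksgn (i * m) (ract (obj P i) x (g j y))) = zext \<mu> i x * g j y"
    unfolding dh_ksgn[OF P z m(2)] cochain_Rop[OF P gh z' a(2,3) refl]
    by (cases "i = 0") (auto simp: zext_def)
  show "Lop P 0 (zext \<mu>) (n - m) (ogo m g n (tprod (P \<otimes> P) P (i + j) (tprod P P i x j y) k w)) =
    Lop P m g n (m11 n (tprod (P \<otimes> P) P (i + j) (tprod P P i x j y) k w))"
    using a m by (simp add: ogo_tprod m11_tprod Lop_tprod[OF P z'] Lop_tprod[OF P gh] Rop_tprod[OF P gh] 1 2)
qed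

text \<open>The value of \<open>\<mu>\<close> acts from the right on the middle factor, and
  \<open>g\<close> is right linear.\<close>

lemma Rz_ogo:
  assumes "t \<in> crr (P \<otimes> P \<otimes> P) n"
  shows "Rop P 0 (zext \<mu>) (n - m) (ogo m g n t) = Rop P m g n (om1 n t)"
proof (rule TTT_ext[OF P _ _ _ assms, where F = "\<lambda>n t. Rop P 0 (zext \<mu>) (n - m) (ogo m g n t)" and
    G = "\<lambda>n t. Rop P m g n (om1 n t)" and R = P and u = "- m" and u' = "- m"])
  show "deg_hom (P \<otimes> P \<otimes> P) P (- m) (\<lambda>n t. Rop P 0 (zext \<mu>) (n - m) (ogo m g n t))"
    by (rule deg_hom_comp[OF _ ogo_hom Rz]) simp_all
  show "deg_hom (P \<otimes> P \<otimes> P) P (- m) (\<lambda>n t. Rop P m g n (om1 n t))"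
    by (rule deg_hom_comp[OF _ om1_hom Rop[OF P gh]]) simp_all
  fix i x j y k w assume a: "i + j + k = n" "x \<in> crr P i" "y \<in> crr P j" "w \<in> crr P k"
  have m: "ract (obj P i) x (g j y) \<in> crr P (i + j - m)"
    using Rop_mem0[OF P gh] a by simp
  have L: "Rop P 0 (zext \<mu>) (n - m) (ogo m g n (tprod (P \<otimes> P) P (i + j) (tprod P P i x j y) k w)) =
    ract (obj P (i + j - m)) (ksgn (i * m) (ract (obj P i) x (g j y))) (zext \<mu> k w)"
    using a m by (simp add: ogo_tprod Rop_tprod[OF P gh] Rop_tprod[OF P z'])
  have R: "om1 n (tprod (P \<otimes> P) P (i + j) (tprod P P i x j y) k w) = tprod P P i x j (ract (obj P j) y (zext \<mu> k w))"
    using a by (simp add: om1_tprod ract_tprod)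
  show "Rop P 0 (zext \<mu>) (n - m) (ogo m g n (tprod (P \<otimes> P) P (i + j) (tprod P P i x j y) k w)) =
    Rop P m g n (om1 n (tprod (P \<otimes> P) P (i + j) (tprod P P i x j y) k w))"
  proof (cases "k = 0")
    case True
    then have R2: "Rop P m g n (tprod P P i x j (ract (obj P j) y (zext \<mu> k w))) =
        ksgn (i * m) (ract (obj P i) x (g j y * zext \<mu> k w))"
      using a by (simp add: Rop_tprod[OF P gh] cochain_act[OF P gh])
    show ?thesis
    proof (cases "j = m")
      case True
      then show ?thesis unfolding L R R2 using a by (simp add: ract_ksgn ract_ract)
    next
      case False
      then have "g j y = 0" using a g0[OF P gh] by simp
      then show ?thesis unfolding L R R2 using a by simp
    qed
  next
    case False
    then have "zext \<mu> k w = 0" by (simp add: zext_def)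
    then show ?thesis unfolding L R using a m by (simp add: dh_0[OF _ Rop[OF P gh]])
  qed
qed

text \<open>The equation of \<open>\<phi>\<close>, used on \<open>ogo m g\<close> of
  \<open>\<Delta>\<close>, gives \<open>g \<otimes> 1\<close> on \<open>m11\<close> of
  \<open>\<Delta>\<close> minus \<open>1 \<otimes> g\<close> on \<open>om1\<close> of
  \<open>\<Delta>\<close>. Only \<open>m11\<close> of \<open>\<Delta>\<close> is the diagonal; the
  summand with \<open>\<epsilon>\<close> exchanges \<open>om1\<close> for \<open>m11\<close> and
  completes the commutator.\<close>

lemma hlift_P: "hlift P \<mu> Dl\<^sub>P \<kappa>\<^sub>P m g (\<Psi>\<^sub>P m g)"
  unfolding hlift_def
\<comment> \<open>The normalisation holds exactly, so the cochain \<open>u\<close> is 0.\<close>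
proof (intro conjI allI ballI exI[of _ "\<lambda>_ _. 0"])
  show "deg_hom P P (1 - m) (\<Psi>\<^sub>P m g)"
  proof -
    have "deg_hom P (P \<otimes> P) (- m) (\<lambda>i x. ogo m g i (\<Delta> i x))"
      by (rule deg_hom_comp[OF _ \<Delta>_hom ogo_hom]) simp_all
    then show ?thesis
      unfolding \<Psi>\<^sub>P_def
      by (intro deg_hom_diff deg_hom_ksgn deg_hom_comp[OF _ \<epsilon>_hom Rop[OF P gh]] deg_hom_comp[OF _ _ \<phi>_hom]) simp_all
  qed
  show "deg_hom P Alg (2 - m) (\<lambda>_ _. 0)" by (rule deg_hom_zero) simp
  fix i x assume x: "x \<in> crr P i"
  have t: "\<Delta> i x \<in> crr (P \<otimes> P \<otimes> P) i" using dh_mem[OF P \<Delta>_hom x] by simp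
  have e: "\<epsilon> i x \<in> crr (P \<otimes> P) (i + 1)" using dh_mem[OF P \<epsilon>_hom x] by simp
  have o: "ogo m g i (\<Delta> i x) \<in> crr (P \<otimes> P) (i - m)" using dh_mem[OF _ ogo_hom t] by simp
  have ph: "\<phi> (i - m) (ogo m g i (\<Delta> i x)) \<in> crr P (i + 1 - m)" using dh_mem[OF _ \<phi>_hom o, of "i + 1 - m"] by simp
  have re: "Rop P m g (i + 1) (\<epsilon> i x) \<in> crr P (i + 1 - m)" using dh_mem[OF _ Rop[OF P gh] e] by simp
  have mo: "m11 i (\<Delta> i x) \<in> crr (P \<otimes> P) i" "om1 i (\<Delta> i x) \<in> crr (P \<otimes> P) i"
    using dh_mem[OF _ m11_hom t] dh_mem[OF _ om1_hom t] by simp_all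
  have 1: "\<phi> (i - 1 - m) (ogo m g (i - 1) (\<Delta> (i - 1) (diff P i x))) =
    ksgn m (Lop P m g i (m11 i (\<Delta> i x)) - Rop P m g i (om1 i (\<Delta> i x)) - diff P (i + 1 - m) (\<phi> (i - m) (ogo m g i (\<Delta> i x))))"
  proof -
    have i: "i - 1 - m = i - m - 1" "i + 1 - m = i - m + 1" by simp_all
    have "\<phi> (i - 1 - m) (ogo m g (i - 1) (\<Delta> (i - 1) (diff P i x))) = ksgn m (\<phi> (i - m - 1) (diff (P \<otimes> P) (i - m) (ogo m g i (\<Delta> i x))))"
      unfolding \<Delta>_d[OF x] ogo_d[OF t] i using o by (simp add: dh_ksgn[OF _ \<phi>_hom])
    then show ?thesis unfolding \<phi>_d[OF o] Lz_ogo[OF t] Rz_ogo[OF t] i .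
  qed
  have 2: "Rop P m g (i - 1 + 1) (\<epsilon> (i - 1) (diff P i x)) =
    Rop P m g i (m11 i (\<Delta> i x)) - Rop P m g i (om1 i (\<Delta> i x)) - ksgn m (diff P (i + 1 - m) (Rop P m g (i + 1) (\<epsilon> i x)))"
    using Rop_chain[OF P g e] mo e by (simp add: \<epsilon>_d[OF x] dh_diff[OF _ Rop[OF P gh]])
  show "\<Psi>\<^sub>P m g (i - 1) (diff P i x) + ksgn m (diff P (i + 1 - m) (\<Psi>\<^sub>P m g i x)) = ksgn m (del P m g i (Dl\<^sub>P i x))"
    unfolding \<Psi>\<^sub>P_def 1 2 del_def Dl\<^sub>P_def
    using ph re by (simp add: d_diff d_ksgn ksgn_diff)
  \<comment> \<open>In the only degree where \<open>\<mu>\<close> is nonzero, \<open>\<phi>\<close>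
    is applied to an element of degree -1 of \<open>P \<otimes> P\<close>, which is 0.\<close>
  have 3: "zext \<mu> (i + 1 - m) (\<phi> (i - m) (ogo m g i (\<Delta> i x))) = 0"
  proof (cases "i + 1 - m = 0")
    case True
    have "ogo m g i (\<Delta> i x) = 0"
      by (rule tens_neg[OF P P resolvesD(4)[OF rP] resolvesD(4)[OF rP] _ o]) (use True in simp_all)
    then show ?thesis by (simp add: dh_0[OF _ \<phi>_hom] dh_0[OF P z])
  qed (simp add: zext_def)
  \<comment> \<open>Both sides send \<open>x \<otimes> y\<close> to \<open>\<mu>(x) g(y)\<close>; at
    \<open>\<epsilon>\<close> the right side is \<open>g\<close> of
    \<open>\<kappa>\<^sub>P\<close>.\<close>
  have 4: "zext \<mu> (k - m) (Rop P m g k t) = g k (Lop P 0 (zext \<mu>) k t)" if t: "t \<in> crr (P \<otimes> P) k" for k t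
  proof (rule QQ_ext[OF P _ _ _ t, where u = "- m" and u' = "- m" and R = Alg and
      F = "\<lambda>k t. zext \<mu> (k - m) (Rop P m g k t)" and G = "\<lambda>k t. g k (Lop P 0 (zext \<mu>) k t)"])
    show "deg_hom (P \<otimes> P) Alg (- m) (\<lambda>k t. zext \<mu> (k - m) (Rop P m g k t))"
      by (rule deg_hom_comp[OF _ Rop[OF P gh] z]) simp_all
    show "deg_hom (P \<otimes> P) Alg (- m) (\<lambda>k t. g k (Lop P 0 (zext \<mu>) k t))"
      by (rule deg_hom_comp[OF _ Lz gh]) simp_all
    fix i x j y assume a: "i + j = k" "x \<in> crr P i" "y \<in> crr P j"
    have m: "ract (obj P i) x (g j y) \<in> crr P (k - m)" using Rop_mem0[OF P gh a(2,3), of "k - m"] a(1) by simp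
    have "zext \<mu> (k - m) (Rop P m g k (tprod P P i x j y)) = ksgn (i * m) (zext \<mu> i x * g j y)"
      using a m cochain_Rop[OF P gh z' a(2,3), of "k - m"] by (simp add: Rop_tprod[OF P gh] dh_ksgn[OF P z])
    also have "\<dots> = zext \<mu> i x * g j y" by (simp add: zext_def)
    also have "\<dots> = g k (Lop P 0 (zext \<mu>) k (tprod P P i x j y))"
      using a cochain_Lop[OF P z' gh a(2,3), of k] by (simp add: Lop_tprod[OF P z'])
    finally show "zext \<mu> (k - m) (Rop P m g k (tprod P P i x j y)) = g k (Lop P 0 (zext \<mu>) k (tprod P P i x j y))" .
  qed
  show "zext \<mu> (i + 1 - m) (\<Psi>\<^sub>P m g i x) = - ksgn m (g (i + 1) (\<kappa>\<^sub>P i x)) + 0"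
    using ph re by (simp add: \<Psi>\<^sub>P_def dh_diff[OF P z] dh_ksgn[OF P z] 3 4[OF e] \<kappa>\<^sub>P_def)
qed

end

lemma lifting_system_P: "lifting_system P \<mu> Dl\<^sub>P \<kappa>\<^sub>P \<Psi>\<^sub>P"
  unfolding lifting_system_def using lifting_data_P hlift_P by simp

lemma circ_P_eq:
  assumes f: "f \<in> cocycles scale P n" and g: "g \<in> cocycles scale P m" and x: "x \<in> crr P i"
  shows "circ_P scale P \<Delta> \<phi> \<epsilon> n m f g i x = f (i + 1 - m) (\<Psi>\<^sub>P m g i x)"
proof -
  note gh = cocyclesD(1)[OF g] and fh = cocyclesD(1)[OF f]
  have t: "\<Delta> i x \<in> crr (P \<otimes> P \<otimes> P) i" using dh_mem[OF P \<Delta>_hom x] by simp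
  have e: "\<epsilon> i x \<in> crr (P \<otimes> P) (i + 1)" using dh_mem[OF P \<epsilon>_hom x] by simp
  have o: "ogo m g i (\<Delta> i x) \<in> crr (P \<otimes> P) (i - m)" using dh_mem[OF _ ogo_hom[OF g] t] by simp
  have ph: "\<phi> (i - m) (ogo m g i (\<Delta> i x)) \<in> crr P (i + 1 - m)" using dh_mem[OF _ \<phi>_hom o, of "i + 1 - m"] by simp
  have re: "Rop P m g (i + 1) (\<epsilon> i x) \<in> crr P (i + 1 - m)" using dh_mem[OF _ Rop[OF P gh] e] by simp
  have 1: "tmap P P (- m) 0 (\<lambda>i t. runit P (i - m) (tmap P Alg 0 (- m) idm g i t)) idm i (\<Delta> i x) = ogo m g i (\<Delta> i x)"
    unfolding ogo_def
    by (rule tmap_cong[OF _ P P P Rop[OF P gh] deg_hom_id _ t]) (simp_all add: runit_tmap[OF P gh])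
  have 2: "lunit Alg (i + 1 - n - m) (tmap Alg Alg (- n) (- m) f g (i + 1) (\<epsilon> i x)) = f (i + 1 - m) (Rop P m g (i + 1) (\<epsilon> i x))"
    by (rule lunit_tmap_Alg[OF P gh fh e])
  have i: "i - m + 1 = i + 1 - m" by simp
  show ?thesis
    unfolding circ_P_def Let_def 1 2 \<Psi>\<^sub>P_def i using ph re by (simp add: dh_diff[OF P fh] dh_ksgn[OF P fh])
qed

lemma bracket_P_eq:
  assumes "f \<in> cocycles scale P n" "g \<in> cocycles scale P m" "x \<in> crr P i"
  shows "bracket_P scale P \<Delta> \<phi> \<epsilon> n m f g i x = brs \<Psi>\<^sub>P n m f g i x"
  using circ_P_eq[OF assms] circ_P_eq[OF assms(2,1,3)] by (simp add: bracket_P_def brs_def)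

end

end

lemma lext_linear:
  assumes "vector_space sc"
  shows lext_plus: "lext sc b (u + v) = lext sc b u + lext sc b v"
    and lext_minus: "lext sc b (- u) = - lext sc b u"
    and lext_diff: "lext sc b (u - v) = lext sc b u - lext sc b v"
    and lext_scale: "lext sc b (pscale c u) = sc c (lext sc b u)"
    and lext_sum: "lext sc b (sum h S) = (\<Sum>x\<in>S. lext sc b (h x))"
proof -
  interpret V: vector_space sc by fact
  interpret fp: vector_space_pair "pscale :: _ \<Rightarrow> (_ \<Rightarrow>\<^sub>0 _) \<Rightarrow> _" sc by unfold_locales
  have l: "Vector_Spaces.linear pscale sc (lext sc b)" by (rule linear_lext) fact
  show "lext sc b (u + v) = lext sc b u + lext sc b v" "lext sc b (- u) = - lext sc b u"
    "lext sc b (u - v) = lext sc b u - lext sc b v" "lext sc b (pscale c u) = sc c (lext sc b u)"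
    "lext sc b (sum h S) = (\<Sum>x\<in>S. lext sc b (h x))"
    by (simp_all add: fp.linear_add[OF l] fp.linear_neg[OF l] fp.linear_diff[OF l] fp.linear_scale[OF l] fp.linear_sum[OF l])
qed

lemma lext_ksgn: "vector_space sc \<Longrightarrow> lext sc b (ksgn n u) = ksgn n (lext sc b u)"
  by (simp add: ksgn_def lext_minus)

lemma pscale_vector_space: "vector_space (pscale :: 'k::field \<Rightarrow> ('x \<Rightarrow>\<^sub>0 'k) \<Rightarrow> _)"
  by unfold_locales

lemmas plext_linear = lext_linear[OF pscale_vector_space] lext_ksgn[OF pscale_vector_space]

context k_algebra
begin

section \<open>The bar resolution\<close>

abbreviation "bt \<equiv> btens scale"

definition mlin :: "nat \<Rightarrow> ('k \<Rightarrow> 'z \<Rightarrow> 'z) \<Rightarrow> ('a list \<Rightarrow> 'z::ab_group_add) \<Rightarrow> bool" where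
  "mlin N sc b \<longleftrightarrow>
     (\<forall>us a a' vs. length us + 1 + length vs = N \<longrightarrow> b (us @ (a + a') # vs) = b (us @ a # vs) + b (us @ a' # vs)) \<and>
     (\<forall>us c a vs. length us + 1 + length vs = N \<longrightarrow> b (us @ scale c a # vs) = sc c (b (us @ a # vs)))"

text \<open>The tensor power of \<open>A\<close> with \<open>N\<close> factors; for
  \<open>n \<ge> 0\<close>, degree \<open>n\<close> of the bar complex is
  \<open>TB (n + 2)\<close>.\<close>

definition TB :: "nat \<Rightarrow> ('a list \<Rightarrow>\<^sub>0 'k) set" where
  "TB N = fv.span {bt xs | xs. length xs = N}"

lemma TB_0 [simp]: "0 \<in> TB N"
  and TB_add [simp]: "t \<in> TB N \<Longrightarrow> t' \<in> TB N \<Longrightarrow> t + t' \<in> TB N"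
  and TB_minus [simp]: "t \<in> TB N \<Longrightarrow> - t \<in> TB N"
  and TB_diff [simp]: "t \<in> TB N \<Longrightarrow> t' \<in> TB N \<Longrightarrow> t - t' \<in> TB N"
  and TB_scale [simp]: "t \<in> TB N \<Longrightarrow> pscale c t \<in> TB N"
  unfolding TB_def by (simp_all add: fv.span_zero fv.span_add fv.span_neg fv.span_diff fv.span_scale)

lemma TB_ksgn [simp]: "t \<in> TB N \<Longrightarrow> ksgn i t \<in> TB N"
  by (simp add: ksgn_def)

lemma TB_sum: "(\<And>x. x \<in> S \<Longrightarrow> h x \<in> TB N) \<Longrightarrow> sum h S \<in> TB N"
  by (induction S rule: infinite_finite_induct) auto

lemma TB_bt [simp]: "length xs = N \<Longrightarrow> bt xs \<in> TB N"
  unfolding TB_def by (rule fv.span_base) auto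

lemma mlin_bt: "mlin N pscale bt"
  unfolding mlin_def
proof (intro conjI allI impI)
  fix us vs :: "'a list" and a a' c assume l: "length us + 1 + length vs = N"
  show "bt (us @ (a + a') # vs) = bt (us @ a # vs) + bt (us @ a' # vs)"
  proof -
    have "gen (us @ [a + a'] @ vs) - (gen (us @ [a] @ vs) + gen (us @ [a'] @ vs)) \<in> bar_rel scale N"
      using l unfolding bar_rel_def diff_diff_eq[symmetric] by blast
    from nform_relD[OF this] show ?thesis using l by (simp add: btens_def nform_add)
  qed
  have "gen (us @ [scale c a] @ vs) - pscale c (gen (us @ [a] @ vs)) \<in> bar_rel scale N"
    using l unfolding bar_rel_def by blast
  from nform_relD[OF this] show "bt (us @ scale c a # vs) = pscale c (bt (us @ a # vs))"
    using l by (simp add: btens_def nform_scale)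
qed

lemma bt_Cons: "bt ((a + a') # xs) = bt (a # xs) + bt (a' # xs)" "bt (scale c a # xs) = pscale c (bt (a # xs))"
  using mlin_bt[of "Suc (length xs)", unfolded mlin_def, THEN conjunct1, rule_format, of "[]" xs a a']
    mlin_bt[of "Suc (length xs)", unfolded mlin_def, THEN conjunct2, rule_format, of "[]" xs c a]
  by simp_all

lemma blext:
  assumes "vector_space sc" "mlin N sc b" "length xs = N"
  shows "lext sc b (bt xs) = b xs"
proof -
  let ?K = "{xs :: 'a list. length xs = N}"
  note vs = vs_on_UNIV[OF assms(1)]
  have R: "Poly_Mapping.keys r \<subseteq> ?K \<and> lext sc b r = 0" if "r \<in> bar_rel scale N" for r
  proof -
    from that consider
      (1) us a a' vs where "r = gen (us @ (a + a') # vs) - gen (us @ a # vs) - gen (us @ a' # vs)" "length us + 1 + length vs = N"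
    | (2) us c a vs where "r = gen (us @ scale c a # vs) - pscale c (gen (us @ a # vs))" "length us + 1 + length vs = N"
      unfolding bar_rel_def by auto
    then show ?thesis
    proof cases
      case 1
      then show ?thesis unfolding 1(1) using assms(2)
        by (intro lext_rel_add[OF vs]) (auto simp: mlin_def)
    next
      case 2
      then show ?thesis unfolding 2(1) using assms(2)
        by (intro lext_rel_scale[OF vs]) (auto simp: mlin_def)
    qed
  qed
  show ?thesis
    unfolding btens_def assms(3)
    by (subst lext_on_nform(2)[OF vs _ R]) (use assms(3) in \<open>auto simp: lext_gen[OF vs, of UNIV]\<close>)
qed

lemmas pblext = blext[OF pscale_vector_space]

text \<open>With at least one factor a scalar can be absorbed by the first letter, so no scalar case
  remains.\<close>

lemma TB_induct [consumes 2, case_names zero bt add]: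
  assumes "t \<in> TB N" "N > 0" and "pr 0" and g: "\<And>a xs. Suc (length xs) = N \<Longrightarrow> pr (bt (a # xs))"
    and add: "\<And>t t'. t \<in> TB N \<Longrightarrow> t' \<in> TB N \<Longrightarrow> pr t \<Longrightarrow> pr t' \<Longrightarrow> pr (t + t')"
  shows "pr t"
proof -
  have "pr t \<and> t \<in> TB N"
    using assms(1) unfolding TB_def
  proof (induction rule: fv.span_induct_alt)
    case base
    then show ?case using assms(3) by (simp add: fv.span_zero)
  next
    case (step c t t')
    then obtain xs where "t = bt xs" "length xs = N" by auto
    with assms(2) obtain a ys where t: "t = bt (a # ys)" "Suc (length ys) = N" by (cases xs) auto
    have p: "pscale c t = bt (scale c a # ys)" by (simp add: t bt_Cons)
    have "pr (pscale c t)" "pscale c t \<in> TB N" unfolding p using t by (auto intro: g)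
    then show ?case using step add by (auto simp: TB_def[symmetric])
  qed
  then show ?thesis by simp
qed

lemma TB_ext:
  assumes "t \<in> TB N" "N > 0"
    "\<And>x y. x \<in> TB N \<Longrightarrow> y \<in> TB N \<Longrightarrow> F (x + y) = F x + (F y :: 'z::ab_group_add)"
    "\<And>x y. x \<in> TB N \<Longrightarrow> y \<in> TB N \<Longrightarrow> G (x + y) = G x + G y"
    "\<And>a xs. Suc (length xs) = N \<Longrightarrow> F (bt (a # xs)) = G (bt (a # xs))"
  shows "F t = G t"
proof -
  have z: "F 0 = 0" "G 0 = 0" using assms(3,4)[of 0 0] by auto
  show ?thesis using assms(1,2) by (induction rule: TB_induct) (use assms(3-5) z in auto)
qed

text \<open>\<open>sg 1\<close> is the standard contraction of the bar resolution. Keeping the first letter free makes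
  induction on the length possible: the elements \<open>sg a t\<close> generate \<open>A\<^bsup>\<otimes>(N+1)\<^esup>\<close>.\<close>

definition sg :: "'a \<Rightarrow> ('a list \<Rightarrow>\<^sub>0 'k) \<Rightarrow> ('a list \<Rightarrow>\<^sub>0 'k)" where
  "sg a = lext pscale (\<lambda>xs. bt (a # xs))"

lemma mlin_bt_Cons: "mlin N pscale (\<lambda>xs. bt (a # xs))"
  using mlin_bt[of "Suc N", unfolded mlin_def, THEN conjunct1, rule_format, of "a # _"]
    mlin_bt[of "Suc N", unfolded mlin_def, THEN conjunct2, rule_format, of "a # _"]
  by (simp add: mlin_def)

lemma sg_bt [simp]: "sg a (bt xs) = bt (a # xs)"
  unfolding sg_def by (rule pblext[OF mlin_bt_Cons refl])

lemma sg_lin: "sg a (u + v) = sg a u + sg a v" "sg a (- u) = - sg a u" "sg a (u - v) = sg a u - sg a v"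
  "sg a (pscale c u) = pscale c (sg a u)" "sg a (sum h S) = (\<Sum>x\<in>S. sg a (h x))" "sg a (ksgn n u) = ksgn n (sg a u)"
  by (simp_all add: sg_def plext_linear)

lemma lext_zero [simp]: "lext sc b 0 = 0" by (simp add: lext_def)

lemma sg_0 [simp]: "sg a 0 = 0" by (simp add: sg_def)

lemma sg_mem [simp]:
  assumes "t \<in> TB N" "N > 0" "M = Suc N"
  shows "sg a t \<in> TB M"
  using assms(1,2) by (induction rule: TB_induct) (auto simp: sg_lin assms(3))

lemma sg_l:
  assumes "t \<in> TB N" "N > 0"
  shows "sg (a + a') t = sg a t + sg a' t" "sg (scale c a) t = pscale c (sg a t)"
  using assms by (induction rule: TB_induct) (auto simp: sg_lin bt_Cons fv.scale_right_distrib)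

lemma mlin_Cons:
  assumes "\<And>a. mlin N sc (\<lambda>xs. b (a # xs))"
    and "\<And>a a' xs. length xs = N \<Longrightarrow> b ((a + a') # xs) = b (a # xs) + b (a' # xs)"
    and "\<And>c a xs. length xs = N \<Longrightarrow> b (scale c a # xs) = sc c (b (a # xs))"
  shows "mlin (Suc N) sc b"
  unfolding mlin_def
proof (intro conjI allI impI)
  fix us vs :: "'a list" and a a' c assume l: "length us + 1 + length vs = Suc N"
  show "b (us @ (a + a') # vs) = b (us @ a # vs) + b (us @ a' # vs)"
    using assms(1) assms(2) l by (cases us) (auto simp: mlin_def)
  show "b (us @ scale c a # vs) = sc c (b (us @ a # vs))"
    using assms(1) assms(3) l by (cases us) (auto simp: mlin_def)
qed

lemma mlin_cong: "(\<And>xs. length xs = N \<Longrightarrow> b xs = b' xs) \<Longrightarrow> mlin N sc b \<longleftrightarrow> mlin N sc b'"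
  unfolding mlin_def by simp

lemma mlin_add: "mlin N pscale b \<Longrightarrow> mlin N pscale b' \<Longrightarrow> mlin N pscale (\<lambda>xs. b xs + b' xs)"
  and mlin_diff: "mlin N pscale b \<Longrightarrow> mlin N pscale b' \<Longrightarrow> mlin N pscale (\<lambda>xs. b xs - b' xs)"
  and mlin_ksgn: "mlin N pscale b \<Longrightarrow> mlin N pscale (\<lambda>xs. ksgn i (b xs))"
  unfolding mlin_def by (auto simp: fv.scale_right_distrib fv.scale_right_diff_distrib ksgn_add ksgn_def)

lemma mlin_zero: "mlin N pscale (\<lambda>_. 0)"
  by (simp add: mlin_def)

lemma mlin_lext:
  assumes "vector_space sc" "mlin N pscale b"
  shows "mlin N sc (\<lambda>xs. lext sc c (b xs))"
  using assms(2) unfolding mlin_def by (simp add: lext_linear[OF assms(1)])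

lemma mlin_sg: "mlin N pscale b \<Longrightarrow> mlin N pscale (\<lambda>xs. sg a (b xs))"
  unfolding sg_def by (rule mlin_lext[OF pscale_vector_space])

text \<open>The device behind the multilinearity of recursively described functions of lists: the
  first letter is prefixed to a multilinear function of the rest.\<close>

lemma mlin_sg_Cons:
  assumes "mlin N pscale b" "\<And>xs. length xs = N \<Longrightarrow> b xs \<in> TB M" "M > 0"
  shows "mlin (Suc N) pscale (\<lambda>xs. sg (hd xs) (b (tl xs)))"
  using assms(2,3) by (intro mlin_Cons) (auto intro: mlin_sg assms(1) sg_l)

section \<open>Bimodule structure and differential of the bar complex\<close>

definition lB :: "'a \<Rightarrow> ('a list \<Rightarrow>\<^sub>0 'k) \<Rightarrow> ('a list \<Rightarrow>\<^sub>0 'k)" where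
  "lB a = lext pscale (\<lambda>xs. bt ((a * hd xs) # tl xs))"

definition rB :: "('a list \<Rightarrow>\<^sub>0 'k) \<Rightarrow> 'a \<Rightarrow> ('a list \<Rightarrow>\<^sub>0 'k)" where
  "rB t a = lext pscale (\<lambda>xs. bt (butlast xs @ [last xs * a])) t"

definition dl :: "'a list \<Rightarrow> ('a list \<Rightarrow>\<^sub>0 'k)" where
  "dl xs = (\<Sum>i<length xs - 1. ksgn (int i) (bt (take i xs @ [xs ! i * xs ! (i + 1)] @ drop (i + 2) xs)))"

definition dB :: "('a list \<Rightarrow>\<^sub>0 'k) \<Rightarrow> ('a list \<Rightarrow>\<^sub>0 'k)" where
  "dB = lext pscale dl"

lemma B_lin:
  "lB a (u + v) = lB a u + lB a v" "lB a (- u) = - lB a u" "lB a (u - v) = lB a u - lB a v"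
  "lB a (pscale c u) = pscale c (lB a u)" "lB a 0 = 0"
  "rB (u + v) a = rB u a + rB v a" "rB (- u) a = - rB u a" "rB (u - v) a = rB u a - rB v a"
  "rB (pscale c u) a = pscale c (rB u a)" "rB 0 a = 0"
  "dB (u + v) = dB u + dB v" "dB (- u) = - dB u" "dB (u - v) = dB u - dB v"
  "dB (pscale c u) = pscale c (dB u)" "dB 0 = 0"
  "dB (ksgn i u) = ksgn i (dB u)" "lB a (ksgn i u) = ksgn i (lB a u)" "rB (ksgn i u) a = ksgn i (rB u a)"
  by (simp_all add: lB_def rB_def dB_def plext_linear)

lemma lB_bt [simp]: "lB a (bt (b # xs)) = bt ((a * b) # xs)"
  unfolding lB_def
proof (subst pblext)
  show "mlin (Suc (length xs)) pscale (\<lambda>xs. bt ((a * hd xs) # tl xs))"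
    by (rule mlin_Cons) (auto simp: mlin_bt_Cons distrib_left bt_Cons scale_mult_right)
qed auto

lemma lB_mem [simp]: "t \<in> TB N \<Longrightarrow> N > 0 \<Longrightarrow> lB a t \<in> TB N"
  by (induction rule: TB_induct) (auto simp: B_lin)

lemma lB_sg: "t \<in> TB N \<Longrightarrow> N > 0 \<Longrightarrow> lB a (sg b t) = sg (a * b) t"
  by (induction rule: TB_induct) (auto simp: B_lin sg_lin)

lemma lB_l:
  assumes "t \<in> TB N" "N > 0"
  shows "lB (a + b) t = lB a t + lB b t" "lB (a * b) t = lB a (lB b t)" "lB 1 t = t" "lB (scale c a) t = pscale c (lB a t)"
  using assms by (induction rule: TB_induct)
    (auto simp: B_lin distrib_right bt_Cons mult.assoc scale_mult_left fv.scale_right_distrib)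

lemma mlin_rB: "N > 0 \<Longrightarrow> mlin N pscale (\<lambda>xs. bt (butlast xs @ [last xs * a]))"
proof (induction N)
  case (Suc N)
  show ?case
  proof (cases "N = 0")
    case True
    have "mlin (Suc 0) pscale (\<lambda>xs. bt (butlast xs @ [last xs * a]))"
      by (rule mlin_Cons) (auto simp: mlin_def distrib_right bt_Cons scale_mult_left)
    then show ?thesis using True by simp
  next
    case False
    have "mlin (Suc N) pscale (\<lambda>xs. sg (hd xs) (bt (butlast (tl xs) @ [last (tl xs) * a])))"
      by (rule mlin_sg_Cons[of N _ N]) (use Suc False in auto)
    then show ?thesis
      by (rule iffD1[OF mlin_cong, rotated]) (use False in \<open>auto simp: length_Suc_conv\<close>)
  qed
qed simp

lemma rB_bt [simp]: "rB (bt (xs @ [b])) a = bt (xs @ [b * a])"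
  unfolding rB_def by (subst pblext[OF mlin_rB[of "Suc (length xs)"]]) auto

lemma rB_bt': "xs \<noteq> [] \<Longrightarrow> rB (bt xs) a = bt (butlast xs @ [last xs * a])"
  by (metis append_butlast_last_id rB_bt)

lemma rB_mem [simp]: "t \<in> TB N \<Longrightarrow> N > 0 \<Longrightarrow> rB t a \<in> TB N"
  by (induction rule: TB_induct) (auto simp: B_lin rB_bt')

lemma rB_sg: "t \<in> TB N \<Longrightarrow> N > 0 \<Longrightarrow> rB (sg b t) a = sg b (rB t a)"
  by (induction rule: TB_induct) (auto simp: B_lin sg_lin rB_bt')

text \<open>The right action meets the last letter, while \<open>TB_induct\<close> exposes the
  first; hence the induction on the number of factors.\<close>

lemma rB_l1: "N > 0 \<Longrightarrow> t \<in> TB N \<Longrightarrow> rB t (a + b) = rB t a + rB t b \<and> rB t (a * b) = rB (rB t a) b \<and> rB t 1 = t \<and>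
    rB t (scale c a) = pscale c (rB t a) \<and> lB b (rB t a) = rB (lB b t) a"
proof (induction N arbitrary: t)
  case (Suc N)
  show ?case
  proof (cases "N = 0")
    case True
    have 1: "rB (bt [x]) a = bt [x * a]" for x a using rB_bt[of "[]" x a] by simp
    have "t \<in> TB (Suc 0)" "Suc 0 > 0" using Suc True by auto
    then show ?thesis
      by (induction rule: TB_induct)
        (auto simp: B_lin 1 distrib_left bt_Cons mult.assoc scale_mult_right fv.scale_right_distrib)
  next
    case False
    show ?thesis
      using Suc(3) zero_less_Suc
    proof (induction rule: TB_induct)
      case (bt x xs)
      then have m: "bt xs \<in> TB N" "N > 0" using False by auto
      note IH = Suc(1)[OF m(2,1)]
      have l: "lB b (sg x t) = sg (b * x) t" if "t \<in> TB N" for t using lB_sg[OF that m(2)] .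
      show ?case
        using IH m rB_sg[OF m, of x] rB_sg[OF rB_mem[OF m], of x] rB_sg[OF m, of "b * x"] l
        by (simp add: sg_lin)
    qed (auto simp: B_lin fv.scale_right_distrib)
  qed
qed simp

lemmas rB_l = rB_l1[rotated, THEN conjunct1] rB_l1[rotated, THEN conjunct2, THEN conjunct1]
  rB_l1[rotated, THEN conjunct2, THEN conjunct2, THEN conjunct1]
  rB_l1[rotated, THEN conjunct2, THEN conjunct2, THEN conjunct2, THEN conjunct1]
  rB_l1[rotated, THEN conjunct2, THEN conjunct2, THEN conjunct2, THEN conjunct2]

lemma dl_single: "dl [a] = 0" by (simp add: dl_def)

lemma dl_mem: "length xs = Suc N \<Longrightarrow> dl xs \<in> TB N"
  unfolding dl_def by (intro TB_sum TB_ksgn TB_bt) auto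

text \<open>The sum is split at its first term; the other terms are those of the tail, with
  \<open>a\<close> in front and opposite sign. Later proofs argue with this recursion.\<close>

lemma dl_Cons: "dl (a # b # xs) = bt ((a * b) # xs) - sg a (dl (b # xs))"
proof -
  let ?f = "\<lambda>ys i. ksgn (int i) (bt (take i ys @ [ys ! i * ys ! (i + 1)] @ drop (i + 2) ys))"
  have "dl (a # b # xs) = sum (?f (a # b # xs)) {..<Suc (length xs)}"
    by (simp add: dl_def del: sum.lessThan_Suc)
  also have "\<dots> = ?f (a # b # xs) 0 + (\<Sum>i<length xs. ?f (a # b # xs) (Suc i))"
    by (rule sum.lessThan_Suc_shift)
  also have "(\<Sum>i<length xs. ?f (a # b # xs) (Suc i)) = (\<Sum>i<length xs. - sg a (?f (b # xs) i))"
    by (intro sum.cong refl) (auto simp: sg_lin ksgn_def)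
  finally show ?thesis by (simp add: dl_def sg_lin sum_negf)
qed

lemma mlin_dl: "N > 0 \<Longrightarrow> mlin N pscale dl"
proof (induction N)
  case (Suc N)
  show ?case
  proof (cases "N = 0")
    case True
    have "mlin (Suc 0) pscale dl" by (rule mlin_Cons) (auto simp: mlin_def dl_single)
    then show ?thesis using True by simp
  next
    case False
    have 1: "mlin (Suc N) pscale (\<lambda>xs. lB (hd xs) (bt (tl xs)))"
    proof (rule mlin_Cons)
      show "mlin N pscale (\<lambda>xs. lB (hd (a # xs)) (bt (tl (a # xs))))" for a
        using mlin_lext[OF pscale_vector_space mlin_bt] by (simp add: lB_def)
    qed (use False lB_l[OF TB_bt] in auto)
    have "mlin (Suc N) pscale (\<lambda>xs. sg (hd xs) (dl (tl xs)))"
    \<comment> \<open>With a single letter in the tail, \<open>dl\<close> lands in the zeroth tensor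
      power, which \<open>mlin_sg_Cons\<close> excludes; its value there is 0.\<close>
    proof (cases "N = 1")
      case True
      have "mlin (Suc N) pscale (\<lambda>_. 0)" by (rule mlin_zero)
      then show ?thesis
        by (rule iffD1[OF mlin_cong, rotated]) (auto simp: True length_Suc_conv dl_single)
    next
      case n1: False
      show ?thesis
        by (rule mlin_sg_Cons[of N _ "N - 1"]) (use Suc False n1 dl_mem[of _ "N - 1"] in auto)
    qed
    from mlin_diff[OF 1 this] show ?thesis
      by (rule iffD1[OF mlin_cong, rotated]) (use False in \<open>auto simp: length_Suc_conv dl_Cons gr0_conv_Suc\<close>)
  qed
qed simp

lemma dB_bt [simp]: "xs \<noteq> [] \<Longrightarrow> dB (bt xs) = dl xs"
  unfolding dB_def by (rule pblext[OF mlin_dl refl]) simp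

lemma dB_1: "t \<in> TB (Suc 0) \<Longrightarrow> dB t = 0"
proof -
  assume "t \<in> TB (Suc 0)"
  moreover have "Suc 0 > 0" by simp
  ultimately show ?thesis by (induction rule: TB_induct) (auto simp: B_lin dl_single)
qed

lemma dB_mem [simp]: "t \<in> TB M \<Longrightarrow> M = Suc N \<Longrightarrow> dB t \<in> TB N"
proof -
  assume "t \<in> TB M" "M = Suc N"
  then have "t \<in> TB (Suc N)" "Suc N > 0" by simp_all
  then show ?thesis by (induction rule: TB_induct) (auto simp: B_lin dl_mem)
qed

text \<open>For \<open>a = 1\<close> this says that prefixing 1 is a contracting homotopy; for
  general \<open>a\<close> it is the recursion for the differential.\<close>

lemma dB_sg: "t \<in> TB N \<Longrightarrow> N > 0 \<Longrightarrow> dB (sg a t) = lB a t - sg a (dB t)"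
  by (induction rule: TB_induct) (auto simp: B_lin sg_lin dl_Cons)

lemma dB_lB: "t \<in> TB N \<Longrightarrow> N > 0 \<Longrightarrow> dB (lB a t) = lB a (dB t)"
proof (induction rule: TB_induct)
  case (bt b xs)
  show ?case
  proof (cases "xs = []")
    case False
    then have m: "bt xs \<in> TB (length xs)" "length xs > 0" by auto
    have e: "bt (b # xs) = sg b (bt xs)" by simp
    have s: "lB a (sg b (dB (bt xs))) = sg (a * b) (dB (bt xs))"
    proof (cases "length xs = 1")
      case True
      then have "dB (bt xs) = 0" by (intro dB_1) simp
      then show ?thesis by (simp add: B_lin)
    next
      case False
      have l: "length xs = Suc (length xs - 1)" using m(2) by simp
      have l': "length xs - 1 > 0" using m(2) False by (cases "length xs") simp_all
      show ?thesis by (rule lB_sg[OF dB_mem[OF m(1) l] l'])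
    qed
    show ?thesis
      unfolding e by (simp only: lB_sg[OF m] dB_sg[OF m] B_lin lB_l(2)[OF m] s)
  qed (simp add: dl_single B_lin)
qed (auto simp: B_lin)

lemma dB_rB: "N > 0 \<Longrightarrow> t \<in> TB N \<Longrightarrow> dB (rB t a) = rB (dB t) a"
proof (induction N arbitrary: t)
  case (Suc N)
  show ?case
  proof (cases "N = 0")
    case True
    have t: "t \<in> TB (Suc 0)" using Suc True by simp
    moreover have "rB t a \<in> TB (Suc 0)" using rB_mem[OF t] by simp
    ultimately show ?thesis by (simp add: dB_1 B_lin)
  next
    case False
    show ?thesis
      using Suc(3) zero_less_Suc
    proof (induction rule: TB_induct)
      case (bt x xs)
      then have m: "bt xs \<in> TB N" "N > 0" using False by auto
      have r: "rB (bt xs) a \<in> TB N" using m by simp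
      have e: "bt (x # xs) = sg x (bt xs)" by simp
      have s: "rB (sg x (dB (bt xs))) a = sg x (rB (dB (bt xs)) a)"
      proof (cases "N = 1")
        case True
        then have "dB (bt xs) = 0" using m by (intro dB_1) simp
        then show ?thesis by (simp add: B_lin)
      next
        case False
        show ?thesis by (rule rB_sg[of _ "N - 1"]) (use m False in auto)
      qed
      show ?case
        unfolding e
        by (simp only: rB_sg[OF m] dB_sg[OF r m(2)] dB_sg[OF m] B_lin s Suc(1)[OF m(2,1)] rB_l(5)[OF m])
    qed (auto simp: B_lin)
  qed
qed simp

text \<open>On \<open>x \<otimes> t\<close> the two terms of \<open>dB_sg\<close> contribute
  \<open>x d t\<close> with opposite signs, and \<open>x \<otimes> d d t\<close> vanishes by
  induction.\<close>

lemma dB_dB: "N > 0 \<Longrightarrow> t \<in> TB N \<Longrightarrow> dB (dB t) = 0"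
proof (induction N arbitrary: t)
  case (Suc N)
  show ?case
  proof (cases "N = 0")
    case True
    then show ?thesis using Suc by (simp add: dB_1 B_lin)
  next
    case False
    show ?thesis
      using Suc(3) zero_less_Suc
    proof (induction rule: TB_induct)
      case (bt x xs)
      then have m: "bt xs \<in> TB N" "N > 0" using False by auto
      have e: "bt (x # xs) = sg x (bt xs)" by simp
      have s: "dB (sg x (dB (bt xs))) = lB x (dB (bt xs))"
      proof (cases "N = 1")
        case True
        then have "dB (bt xs) = 0" using m by (intro dB_1) simp
        then show ?thesis by (simp add: B_lin)
      next
        case False
        have d: "dB (bt xs) \<in> TB (N - 1)" "N - 1 > 0" using m False by auto
        show ?thesis unfolding dB_sg[OF d] Suc(1)[OF m(2,1)] by simp
      qed
      show ?case
        unfolding e dB_sg[OF m] B_lin dB_lB[OF m] s by simp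
    qed (auto simp: B_lin)
  qed
qed simp

section \<open>Exactness of the augmented bar complex\<close>

abbreviation "Bar \<equiv> bar_cplx scale"
abbreviation "\<beta> \<equiv> bar_aug scale"

lemma bar_simps:
  "crr Bar n = (if n < 0 then {0} else TB (nat (n + 2)))" "bscale (obj Bar n) = pscale"
  "lact (obj Bar n) = lB" "ract (obj Bar n) = rB" "diff Bar n = (if n \<le> 0 then (\<lambda>t. 0) else dB)"
proof -
  have "{bt xs | xs. int (length xs) = n + 2} = {bt xs | xs. length xs = nat (n + 2)}" if "\<not> n < 0"
    using that by (intro Collect_cong) auto
  then show "crr Bar n = (if n < 0 then {0} else TB (nat (n + 2)))"
    by (simp add: bar_cplx_def TB_def)
qed (simp_all add: bar_cplx_def lB_def[abs_def] rB_def[abs_def] dB_def dl_def[abs_def])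

lemma bar_mem: "n \<ge> 0 \<Longrightarrow> x \<in> crr Bar n \<longleftrightarrow> x \<in> TB (nat (n + 2))"
  by (simp add: bar_simps)

lemma cpx_Bar [simp]: "cpx Bar"
proof -
  have b: "bim (obj Bar n)" for n
  proof (cases "n < 0")
    case True
    then show ?thesis by (simp add: bimodule_def bar_simps B_lin)
  next
    case False
    then have p: "nat (n + 2) > 0" by simp
    have c: "crr Bar n = TB (nat (n + 2))" using False by (simp add: bar_simps)
    have 1: "lB (scale c 1) x = pscale c x" "rB x (scale c 1) = pscale c x" if "x \<in> TB (nat (n + 2))" for c x
      using lB_l(4)[OF that p, where c = c and a = 1] rB_l(4)[OF that p, where c = c and a = 1]
        lB_l(3)[OF that p] rB_l(3)[OF that p] by simp_all
    show ?thesis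
      unfolding bimodule_def c bar_simps using p
      by (simp add: B_lin lB_l(1-3) rB_l(1-3,5) 1)
  qed
  have d: "bimod_hom (obj Bar n) (obj Bar (n - 1)) (diff Bar n)" for n
  proof (cases "n \<le> 0")
    case True
    then show ?thesis using b[of "n - 1"] by (intro bimod_homI) (auto simp: bar_simps B_lin)
  next
    case False
    then have p: "nat (n + 2) > 0" "nat (n + 2) = Suc (nat (n - 1 + 2))" by simp_all
    have c: "crr Bar n = TB (nat (n + 2))" "crr Bar (n - 1) = TB (nat (n - 1 + 2))" using False by (simp_all add: bar_simps)
    have e: "lact (obj Bar k) = lB" "ract (obj Bar k) = rB" "diff Bar n = dB" for k
      using False by (simp_all add: bar_simps)
    show ?thesis
    proof (rule bimod_homI; unfold c e)
      show "x \<in> TB (nat (n + 2)) \<Longrightarrow> dB x \<in> TB (nat (n - 1 + 2))" for x by (rule dB_mem[OF _ p(2)])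
      show "x \<in> TB (nat (n + 2)) \<Longrightarrow> dB (lB a x) = lB a (dB x)" for a x by (rule dB_lB[OF _ p(1)])
      show "x \<in> TB (nat (n + 2)) \<Longrightarrow> dB (rB x a) = rB (dB x) a" for a x by (rule dB_rB[OF p(1)])
    qed (rule B_lin)
  qed
  have "diff Bar (n - 1) (diff Bar n x) = 0" if "x \<in> crr Bar n" for n x
  proof (cases "n \<le> 1")
    case True
    then show ?thesis by (auto simp: bar_simps)
  next
    case False
    then show ?thesis using that dB_dB[of "nat (n + 2)" x] by (simp add: bar_simps)
  qed
  then show ?thesis unfolding is_complex_def using b d by blast
qed

lemma \<beta>_lin: "\<beta> (u + v) = \<beta> u + \<beta> v"
  unfolding bar_aug_def by (rule lext_plus) unfold_locales

lemma \<beta>_bt: "\<beta> (bt [a, b]) = a * b"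
proof -
  have v: "vector_space scale" by unfold_locales
  have "mlin (Suc (Suc 0)) scale (\<lambda>xs. hd xs * last xs)"
  proof (rule mlin_Cons)
    show "mlin (Suc 0) scale (\<lambda>xs. hd (a # xs) * last (a # xs))" for a
      by (rule mlin_Cons) (auto simp: mlin_def distrib_left scale_mult_right)
  qed (auto simp: distrib_right scale_mult_left length_Suc_conv)
  from blext[OF v this, of "[a, b]"] show ?thesis by (simp add: bar_aug_def)
qed

lemma TB_2: "t \<in> TB 2 \<Longrightarrow> pr 0 \<Longrightarrow> (\<And>a b. pr (bt [a, b])) \<Longrightarrow>
  (\<And>t t'. t \<in> TB 2 \<Longrightarrow> t' \<in> TB 2 \<Longrightarrow> pr t \<Longrightarrow> pr t' \<Longrightarrow> pr (t + t')) \<Longrightarrow> pr t"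
proof -
  assume a: "t \<in> TB 2" "pr 0" "\<And>a b. pr (bt [a, b])"
    "\<And>t t'. t \<in> TB 2 \<Longrightarrow> t' \<in> TB 2 \<Longrightarrow> pr t \<Longrightarrow> pr t' \<Longrightarrow> pr (t + t')"
  have "(2::nat) > 0" by simp
  with a(1) show ?thesis
  proof (induction rule: TB_induct)
    case (bt x xs)
    then obtain y where "xs = [y]" by (auto simp: length_Suc_conv numeral_2_eq_2)
    then show ?case using a(3) by simp
  qed (use a in auto)
qed

lemma \<beta>_0: "\<beta> 0 = 0" using \<beta>_lin[of 0 0] by simp

lemma \<beta>_hom: "bimod_hom (obj Bar 0) (alg_bimod scale UNIV) \<beta>"
proof (rule bimod_homI)
  have c: "crr Bar 0 = TB 2" by (simp add: bar_simps)
  fix a x assume x: "x \<in> crr Bar 0"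
  show "\<beta> (lact (obj Bar 0) a x) = lact (alg_bimod scale UNIV) a (\<beta> x)"
    using x unfolding c
    by (rule TB_2) (auto simp: bar_simps B_lin \<beta>_lin \<beta>_bt \<beta>_0 alg_bimod_def mult.assoc distrib_left)
  show "\<beta> (ract (obj Bar 0) x a) = ract (alg_bimod scale UNIV) (\<beta> x) a"
    using x unfolding c
    by (rule TB_2) (auto simp: bar_simps B_lin \<beta>_lin \<beta>_bt \<beta>_0 alg_bimod_def mult.assoc distrib_right rB_bt')
qed (auto simp: \<beta>_lin alg_bimod_def)

lemma bt_zero: "bt (xs @ 0 # ys) = 0"
  using mlin_bt[of "length xs + 1 + length ys", unfolded mlin_def, THEN conjunct1, rule_format, of xs ys 0 0]
  by simp

text \<open>\<open>diff Bar 0\<close> is set to 0, but \<open>dB\<close> continues to the tensor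
  power with one factor, where it is the augmentation. Identities for \<open>dB\<close> thus also
  cover the augmented complex.\<close>

lemma dB_2: "t \<in> TB 2 \<Longrightarrow> dB t = bt [\<beta> t]"
proof (erule TB_2)
  show "dB 0 = bt [\<beta> 0]" using bt_zero[of "[]" "[]"] by (simp add: \<beta>_0 B_lin)
  show "dB (bt [a, b]) = bt [\<beta> (bt [a, b])]" for a b by (simp add: dl_Cons dl_single \<beta>_bt)
  show "dB t = bt [\<beta> t] \<Longrightarrow> dB t' = bt [\<beta> t'] \<Longrightarrow> dB (t + t') = bt [\<beta> (t + t')]" for t t'
    by (simp add: \<beta>_lin B_lin bt_Cons)
qed

lemma sg_bt1: "sg a (bt [b]) = rB (bt [a, 1]) b"
  using rB_bt[of "[a]" 1 b] by simp

lemma resolves_Bar: "resolves Bar \<beta>"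
  unfolding resolves_def
proof (intro conjI allI impI ballI)
  show "\<beta> ` crr Bar 0 = UNIV"
  proof (rule, simp, rule)
    fix a show "a \<in> \<beta> ` crr Bar 0"
      using \<beta>_bt[of a 1] by (intro image_eqI[of _ _ "bt [a, 1]"]) (auto simp: bar_simps)
  qed
  have key: "t = dB (sg 1 t) + sg 1 (dB t)" if "t \<in> TB N" "N > 0" for t N
    using dB_sg[OF that, of 1] lB_l(3)[OF that] by simp
  show "x \<in> diff Bar (n + 1) ` crr Bar (n + 1)" if "n > 0" "x \<in> crr Bar n" "diff Bar n x = 0" for n x
  proof -
    have x: "x \<in> TB (nat (n + 2))" "dB x = 0" "nat (n + 2) > 0" using that by (auto simp: bar_simps)
    have "x = diff Bar (n + 1) (sg 1 x)" using key[OF x(1,3)] x that by (simp add: bar_simps)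
    moreover have "sg 1 x \<in> crr Bar (n + 1)" using x that by (auto simp: bar_simps)
    ultimately show ?thesis by (rule image_eqI)
  qed
  fix x assume "x \<in> crr Bar 0"
  then have x: "x \<in> TB 2" by (simp add: bar_simps)
  show "\<beta> x = 0 \<longleftrightarrow> x \<in> diff Bar 1 ` crr Bar 1"
  proof
    assume b: "\<beta> x = 0"
    have "sg 1 (dB x) = 0" using dB_2[OF x] bt_zero[of "[1]" "[]"] b by simp
    then have "x = diff Bar 1 (sg 1 x)" using key[OF x] by (simp add: bar_simps)
    moreover have "sg 1 x \<in> crr Bar 1" using x by (auto simp: bar_simps)
    ultimately show "x \<in> diff Bar 1 ` crr Bar 1" by (rule image_eqI)
  next
    assume "x \<in> diff Bar 1 ` crr Bar 1"
    then obtain y where y: "y \<in> TB 3" "x = dB y" by (auto simp: bar_simps)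
    have "dB x = 0" using dB_dB[OF _ y(1)] y by simp
    then have z: "bt [\<beta> x] = 0" using dB_2[OF x] by simp
    \<comment> \<open>The vanishing of a one-letter tensor is carried to its letter by prefixing 1
      and applying \<open>\<beta>\<close>.\<close>
    have "sg 1 (bt [\<beta> x]) = bt [1, \<beta> x]" by simp
    then have "bt [1, \<beta> x] = 0" using z by simp
    then show "\<beta> x = 0" using \<beta>_bt[of 1 "\<beta> x"] \<beta>_0 by simp
  qed
qed (use \<beta>_hom in \<open>auto simp: bar_simps\<close>)

text \<open>A basis for the free bimodule is extracted from the vector space spanned by the elements
  \<open>1 \<otimes> w \<otimes> 1\<close>. The tensor \<open>a \<otimes> w \<otimes> b\<close> goes
  to the coordinates of \<open>1 \<otimes> w \<otimes> 1\<close>, with \<open>a\<close> and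
  \<open>b\<close> on the outside, and evaluation of the free bimodule is a left inverse.\<close>

lemma projective_Bar: "projective_bimod scale (obj Bar n)"
proof (cases "n < 0")
  case True
  \<comment> \<open>The zero bimodule is a summand of the free bimodule on the empty set.\<close>
  have "fv.span {} = ({0} :: ('a \<times> ('a list \<Rightarrow>\<^sub>0 'k) \<times> 'a \<Rightarrow>\<^sub>0 'k) set)" by simp
  then have F: "carr (FB ({} :: ('a list \<Rightarrow>\<^sub>0 'k) set)) = {0}" by (simp add: FB_simps)
  have z: "lact (FB X) a 0 = 0" "ract (FB X) 0 a = 0" for X :: "('a list \<Rightarrow>\<^sub>0 'k) set" and a
    using FB_act(3)[of X a 0 0] FB_act(4)[of X 0 0 a] by auto
  show ?thesis
    unfolding projective_bimod_def
    by (intro conjI exI[of _ "{} :: ('a list \<Rightarrow>\<^sub>0 'k) set"] exI[of _ "\<lambda>_. 0"])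
      (use True in \<open>simp_all add: bimod_hom_def F z bar_simps B_lin\<close>)
next
  case False
  define N where "N = nat n"
  have c: "crr Bar n = TB (Suc (Suc N))" using False by (simp add: bar_simps N_def nat_add_distrib)
  have p: "Suc (Suc N) > 0" by simp
  obtain X where X: "X \<subseteq> {bt (1 # w @ [1]) | w. length w = N}" "fv.independent X"
    "{bt (1 # w @ [1]) | w. length w = N} \<subseteq> fv.span X"
    by (rule fv.maximal_independent_subset)
  interpret fp: vector_space_pair "pscale :: 'k \<Rightarrow> ('a list \<Rightarrow>\<^sub>0 'k) \<Rightarrow> _" "pscale :: 'k \<Rightarrow> ('a \<times> ('a list \<Rightarrow>\<^sub>0 'k) \<times> 'a \<Rightarrow>\<^sub>0 'k) \<Rightarrow> _"
    by unfold_locales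
  \<comment> \<open>On the span of \<open>X\<close>, this is the linear map sending a basis vector
    \<open>x\<close> to \<open>a \<otimes> b\<close> in the summand of \<open>x\<close>.\<close>
  define ct where "ct a b = fp.construct X (\<lambda>x. fgen (a, x, b))" for a b
  have ctl: "Vector_Spaces.linear pscale pscale (ct a b)" for a b
    unfolding ct_def by (rule fp.linear_construct) fact
  have ctx: "ct a b x = fgen (a, x, b)" if "x \<in> X" for a b x
    unfolding ct_def by (rule fp.construct_basis) (use X that in auto)
  have ct_lin: "ct a b (u + v) = ct a b u + ct a b v" "ct a b (pscale k u) = pscale k (ct a b u)" "ct a b 0 = 0" for a b u v k
    using fp.linear_add[OF ctl] fp.linear_scale[OF ctl] fp.linear_0[OF ctl] by auto
  have sp: "pr v" if "v \<in> fv.span X" "pr 0" "\<And>k x v. x \<in> X \<Longrightarrow> v \<in> fv.span X \<Longrightarrow> pr v \<Longrightarrow> pr (pscale k x + v)" for pr v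
  proof -
    have "pr v \<and> v \<in> fv.span X"
      using that(1) by (induction rule: fv.span_induct_alt)
        (use that(2,3) in \<open>auto intro: fv.span_zero fv.span_add fv.span_scale fv.span_base\<close>)
    then show ?thesis by simp
  qed
  have ct_a: "ct (a + a') b v = ct a b v + ct a' b v" "ct a (b + b') v = ct a b v + ct a b' v"
    "ct (scale k a) b v = pscale k (ct a b v)" "ct a (scale k b) v = pscale k (ct a b v)"
    if "v \<in> fv.span X" for a a' b b' k v
    using that
    by (rule sp; simp add: ct_lin ctx fgen_add fgen_scale fv.scale_right_distrib fv.scale_left_commute)+
  have ctm: "ct a b v \<in> carr (FB X)" if "v \<in> fv.span X" for a b v
    using that
  proof (rule sp)
    show "ct a b 0 \<in> carr (FB X)" by (simp add: ct_lin FB_simps fv.span_zero)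
    fix k x v assume x: "x \<in> X" and v: "ct a b v \<in> carr (FB X)"
    have "fgen (a, x, b) \<in> carr (FB X)" unfolding FB_simps by (rule fv.span_base) (use x in blast)
    then show "ct a b (pscale k x + v) \<in> carr (FB X)"
      using v unfolding ct_lin ctx[OF x] FB_simps by (intro fv.span_add fv.span_scale)
  qed
  have ct_act: "lact (FB X) c (ct a b v) = ct (c * a) b v" "ract (FB X) (ct a b v) c = ct a (b * c) v"
    if "v \<in> fv.span X" for a b c v
  proof -
    have z: "lact (FB X) a 0 = 0" "ract (FB X) 0 a = 0" for a
      using FB_act(3)[of X a 0 0] FB_act(4)[of X 0 0 a] by auto
    show "lact (FB X) c (ct a b v) = ct (c * a) b v" "ract (FB X) (ct a b v) c = ct a (b * c) v"
      using that by (rule sp; simp add: ct_lin ctx FB_act z)+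
  qed
  define mid where "mid xs = bt (1 # butlast (tl xs) @ [1])" for xs :: "'a list"
  have midX: "mid xs \<in> fv.span X" if "length xs = Suc (Suc N)" for xs
    unfolding mid_def by (rule subsetD[OF X(3)], rule CollectI, rule exI, rule conjI[OF refl]) (use that in simp)
  \<comment> \<open>The outer letters are replaced by 1 in the basis part and kept as
    coefficients.\<close>
  define il where "il xs = ct (hd xs) (last xs) (mid xs)" for xs
  have il: "il (a # w @ [b]) = ct a b (bt (1 # w @ [1]))" for a w b by (simp add: il_def mid_def)
  have il': "il (a # us @ d # zs @ [b]) = ct a b (bt (1 # us @ d # zs @ [1]))" for a us d zs b
    using il[of a "us @ d # zs" b] by simp
  have wX: "bt (1 # w @ [1]) \<in> fv.span X" if "length w = N" for w by (rule subsetD[OF X(3)]) (use that in blast)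
  have ml: "mlin (Suc (Suc N)) pscale il"
  proof (rule mlin_Cons)
    fix a
    show "mlin (Suc N) pscale (\<lambda>xs. il (a # xs))"
      unfolding mlin_def
    proof (intro conjI allI impI)
      fix us vs :: "'a list" and d d' k assume l: "length us + 1 + length vs = Suc N"
      have bt3: "bt (1 # us @ (d + d') # zs) = bt (1 # us @ d # zs) + bt (1 # us @ d' # zs)"
        "bt (1 # us @ scale k d # zs) = pscale k (bt (1 # us @ d # zs))" for zs
        using mlin_bt_Cons[of "length us + 1 + length zs" 1] unfolding mlin_def by auto
      show "il (a # us @ (d + d') # vs) = il (a # us @ d # vs) + il (a # us @ d' # vs)"
      proof (cases vs rule: rev_cases)
        case Nil
        then show ?thesis using wX[of us] l by (simp add: il ct_a)
      next
        case (snoc zs b)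
        then show ?thesis by (simp add: il' bt3 ct_lin)
      qed
      show "il (a # us @ scale k d # vs) = pscale k (il (a # us @ d # vs))"
      proof (cases vs rule: rev_cases)
        case Nil
        then show ?thesis using wX[of us] l by (simp add: il ct_a)
      next
        case (snoc zs b)
        then show ?thesis by (simp add: il' bt3 ct_lin)
      qed
    qed
  next
    fix a a' k and xs :: "'a list" assume l: "length xs = Suc N"
    define v where "v = mid (1 # xs)"
    have m: "mid (a # xs) = v" "v \<in> fv.span X" for a
      using midX[of "1 # xs"] l by (simp_all add: mid_def v_def)
    have e: "last (a # xs) = last xs" for a using l by auto
    show "il ((a + a') # xs) = il (a # xs) + il (a' # xs)" "il (scale k a # xs) = pscale k (il (a # xs))"
      using m(2) by (simp_all only: il_def list.sel m(1) e ct_a)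
  qed
  define i where "i = lext pscale il"
  have i_lin: "i (u + v) = i u + i v" "i 0 = 0" for u v by (simp_all add: i_def plext_linear)
  have i_bt: "i (bt (a # w @ [b])) = ct a b (bt (1 # w @ [1]))" if "length w = N" for a w b
    unfolding i_def using pblext[OF ml, of "a # w @ [b]"] il that by simp
  have ind: "pr t" if "t \<in> TB (Suc (Suc N))" "pr 0" "\<And>a w b. length w = N \<Longrightarrow> pr (bt (a # w @ [b]))"
    "\<And>t t'. t \<in> TB (Suc (Suc N)) \<Longrightarrow> t' \<in> TB (Suc (Suc N)) \<Longrightarrow> pr t \<Longrightarrow> pr t' \<Longrightarrow> pr (t + t')" for pr t
    using that(1) p
  proof (induction rule: TB_induct)
    case (bt a xs)
    then show ?case using that(3) by (cases xs rule: rev_cases) auto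
  qed (use that in auto)
  have Fz: "0 \<in> carr (FB X)" "u \<in> carr (FB X) \<Longrightarrow> v \<in> carr (FB X) \<Longrightarrow> u + v \<in> carr (FB X)" for u v
    unfolding FB_simps by (auto intro: fv.span_zero fv.span_add)
  have Fa: "lact (FB X) a 0 = 0" "ract (FB X) 0 a = 0" for a
    using FB_act(3)[of X a 0 0] FB_act(4)[of X 0 0 a] by auto
  have ih: "bimod_hom (obj Bar n) (FB X) i"
  proof (rule bimod_homI)
    fix x a assume x: "x \<in> crr Bar n"
    show "i x \<in> carr (FB X)"
      using x unfolding c by (rule ind) (auto simp: i_lin i_bt Fz ctm wX)
    show "i (lact (obj Bar n) a x) = lact (FB X) a (i x)"
      using x unfolding c by (rule ind) (auto simp: i_lin i_bt bar_simps B_lin Fa FB_act ct_act wX)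
    have rb: "rB (bt (b # w @ [d])) a = bt (b # w @ [d * a])" for b w d
      using rB_bt[of "b # w" d a] by simp
    show "i (ract (obj Bar n) x a) = ract (FB X) (i x) a"
      using x unfolding c by (rule ind) (auto simp: i_lin i_bt bar_simps B_lin Fa FB_act ct_act wX rb)
  qed (simp add: i_lin)
  have XB: "x \<in> crr Bar n" if "x \<in> X" for x using X(1) that unfolding c by auto
  obtain r where r: "bimod_hom (FB X) (obj Bar n) r"
    and rg: "\<And>a x b. x \<in> X \<Longrightarrow> r (fgen (a, x, b)) = lact (obj Bar n) a (ract (obj Bar n) x b)"
    using FB_hom[of "obj Bar n" X "\<lambda>x. x"] XB cpx_bim[OF cpx_Bar] by auto
  have ra: "u \<in> carr (FB X) \<Longrightarrow> v \<in> carr (FB X) \<Longrightarrow> r (u + v) = r u + r v" for u v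
    using r by (simp add: bimod_hom_def)
  have r0: "r 0 = 0" using ra[OF Fz(1) Fz(1)] by simp
  have spm: "v \<in> TB (Suc (Suc N))" if "v \<in> fv.span X" for v
    using that by (rule sp) (use XB in \<open>auto simp: c\<close>)
  \<comment> \<open>Evaluation turns \<open>ct a b v\<close> into \<open>a v b\<close>; for
    \<open>v = 1 \<otimes> w \<otimes> 1\<close> this gives back
    \<open>a \<otimes> w \<otimes> b\<close>.\<close>
  have rct: "r (ct a b v) = lB a (rB v b)" if "v \<in> fv.span X" for a b v
    using that
  proof (rule sp)
    show "r (ct a b 0) = lB a (rB 0 b)" by (simp add: ct_lin r0 B_lin)
    fix k x v assume x: "x \<in> X" and v: "v \<in> fv.span X" and e: "r (ct a b v) = lB a (rB v b)"
    have "r (pscale k (fgen (a, x, b))) = pscale k (lB a (rB x b))"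
      unfolding fgen_scale(1)[symmetric] rg[OF x] bar_simps
      by (rule lB_l(4)[of _ "Suc (Suc N)"]) (use XB[OF x] in \<open>auto simp: c\<close>)
    moreover have "pscale k (fgen (a, x, b)) \<in> carr (FB X)" unfolding FB_simps
      by (intro fv.span_scale fv.span_base) (use x in auto)
    ultimately show "r (ct a b (pscale k x + v)) = lB a (rB (pscale k x + v) b)"
      using e x ctm[OF v] by (simp add: ct_lin ctx ra B_lin)
  qed
  have "r (i x) = x" if "x \<in> crr Bar n" for x
    using that unfolding c
  proof (rule ind)
    show "r (i (bt (a # w @ [b]))) = bt (a # w @ [b])" if "length w = N" for a w b
      using that rB_bt[of "1 # w" 1 b] by (simp add: i_bt rct wX)
    show "r (i (t + t')) = t + t'" if "t \<in> TB (Suc (Suc N))" "t' \<in> TB (Suc (Suc N))" "r (i t) = t" "r (i t') = t'" for t t'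
      using that ih by (simp add: i_lin ra bimod_hom_def c)
  qed (simp add: i_lin r0)
  then show ?thesis
    unfolding projective_bimod_def using ih r cpx_bim[OF cpx_Bar]
    by (intro conjI exI[of _ X] exI[of _ i] exI[of _ r] ballI)
qed


section \<open>Contracting the tensor square of the bar resolution\<close>

lemma bt_crr [simp]: "n \<ge> 0 \<Longrightarrow> int (length xs) = n + 2 \<Longrightarrow> bt xs \<in> crr Bar n"
  by (simp add: bar_mem)

lemma crr_TB: "t \<in> TB (Suc (Suc N)) \<longleftrightarrow> t \<in> crr Bar (int N)"
  by (simp add: bar_mem nat_add_distrib)

lemma bar_neg: "n < 0 \<Longrightarrow> x \<in> crr Bar n \<Longrightarrow> x = 0"
  by (simp add: bar_simps)

lemma bar_case:
  assumes "x \<in> crr Bar n"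
  obtains "n < 0" "x = 0" | N where "n = int N" "x \<in> TB (Suc (Suc N))"
proof (cases "n < 0")
  case False
  then have "n = int (nat n)" by simp
  moreover have "x \<in> TB (Suc (Suc (nat n)))" unfolding crr_TB using assms False by simp
  ultimately show thesis using that(2) by blast
qed (use assms that bar_neg in blast)

lemma sg_crr [simp]: "x \<in> crr Bar i \<Longrightarrow> k = i + 1 \<Longrightarrow> sg a x \<in> crr Bar k"
proof (erule bar_case)
  show "i < 0 \<Longrightarrow> x = 0 \<Longrightarrow> k = i + 1 \<Longrightarrow> sg a x \<in> crr Bar k" by simp
  fix N assume a: "i = int N" "x \<in> TB (Suc (Suc N))" "k = i + 1"
  have "sg a x \<in> TB (Suc (Suc (Suc N)))" using a by simp
  then show "sg a x \<in> crr Bar k" unfolding crr_TB using a by (simp add: add.commute)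
qed

lemma sg_rB: "x \<in> crr Bar i \<Longrightarrow> sg a (rB x c) = rB (sg a x) c"
  by (erule bar_case) (auto simp: B_lin rB_sg)

lemma sg_lB: "x \<in> crr Bar i \<Longrightarrow> lB c (sg a x) = sg (c * a) x"
  by (erule bar_case) (auto simp: B_lin lB_sg)

lemma sg_add_l: "x \<in> crr Bar i \<Longrightarrow> sg (a + a') x = sg a x + sg a' x"
  and sg_scale_l: "x \<in> crr Bar i \<Longrightarrow> sg (scale c a) x = pscale c (sg a x)"
  by (erule bar_case; auto simp: sg_l)+

text \<open>The differential of the bar complex stops at degree 0, where \<open>dB\<close> would go
  on to the augmentation. The missing term \<open>a \<otimes> \<beta>(x)\<close> is written as
  \<open>a \<otimes> 1\<close> times \<open>\<beta>(x)\<close>.\<close>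

lemma sg_d:
  assumes "x \<in> crr Bar i"
  shows "diff Bar (i + 1) (sg a x) + sg a (diff Bar i x) = lB a x - (if i = 0 then rB (bt [a, 1]) (\<beta> x) else 0)"
  using assms
proof (cases rule: bar_case)
  case (2 N)
  have s: "dB (sg a x) = lB a x - sg a (dB x)" using dB_sg[OF 2(2)] by simp
  show ?thesis
  proof (cases "N = 0")
    case True
    then have "sg a (dB x) = rB (bt [a, 1]) (\<beta> x)" using dB_2[of x] 2 sg_bt1[of a "\<beta> x"] by (simp add: numeral_2_eq_2)
    then show ?thesis using True 2(1) s by (simp add: bar_simps)
  qed (use 2(1) s in \<open>simp add: bar_simps\<close>)
qed (simp add: B_lin)

lemma bar_l: "bscale (obj Bar n) = pscale" "lact (obj Bar n) = lB" "ract (obj Bar n) = rB"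
  by (simp_all add: bar_simps)

abbreviation "BB \<equiv> Bar \<otimes> Bar"
abbreviation "tp \<equiv> tprod Bar Bar"

text \<open>The operator \<open>sg a\<close> on the left factor. It is balanced over
  \<open>A\<close> because prefixing a letter commutes with the right action.\<close>

definition SA :: "'a \<Rightarrow> ('k, 'a list \<Rightarrow>\<^sub>0 'k, 'a list \<Rightarrow>\<^sub>0 'k) tens \<Rightarrow> ('k, 'a list \<Rightarrow>\<^sub>0 'k, 'a list \<Rightarrow>\<^sub>0 'k) tens" where
  "SA a = lext pscale (\<lambda>((i, x), (j, y)). tp (i + 1) (sg a x) j y)"

lemma SA_lin: "SA a (u + v) = SA a u + SA a v" "SA a 0 = 0" "SA a (u - v) = SA a u - SA a v"
  "SA a (sum h S) = (\<Sum>x\<in>S. SA a (h x))" "SA a (ksgn n u) = ksgn n (SA a u)" "SA a (pscale c u) = pscale c (SA a u)"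
  by (simp_all add: SA_def plext_linear)

lemma tbil_SA: "tbil Bar Bar n pscale (crr BB (n + 1)) (\<lambda>((i, x), (j, y)). tp (i + 1) (sg a x) j y)"
proof (unfold tbil_def split, intro allI impI ballI conjI)
  fix i j x y assume h: "i + j = n" "x \<in> crr Bar i" "y \<in> crr Bar j"
  show "tp (i + 1) (sg a x) j y \<in> crr BB (n + 1)" using h by simp
  show "tp (i + 1) (sg a (x + x')) j y = tp (i + 1) (sg a x) j y + tp (i + 1) (sg a x') j y" if "x' \<in> crr Bar i" for x'
    using h that by (simp add: sg_lin tprod_lin)
  show "tp (i + 1) (sg a x) j (y + y') = tp (i + 1) (sg a x) j y + tp (i + 1) (sg a x) j y'" if "y' \<in> crr Bar j" for y'
    using h that by (simp add: tprod_lin)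
  show "tp (i + 1) (sg a (ract (obj Bar i) x c)) j y = tp (i + 1) (sg a x) j (lact (obj Bar j) c y)" for c
    using tprod_bal[OF cpx_Bar cpx_Bar, of "sg a x" "i + 1" y j c] h by (simp add: bar_l sg_rB)
  show "tp (i + 1) (sg a (bscale (obj Bar i) c x)) j y = pscale c (tp (i + 1) (sg a x) j y)" for c
    using tprod_scale_l[OF cpx_Bar cpx_Bar, of "sg a x" "i + 1" y j c] h by (simp add: bar_l sg_lin)
qed

lemma SA_tprod: "x \<in> crr Bar i \<Longrightarrow> y \<in> crr Bar j \<Longrightarrow> SA a (tp i x j y) = tp (i + 1) (sg a x) j y"
  unfolding SA_def by (subst tlext_tprod[OF cpx_Bar cpx_Bar vs_on_tensor tbil_SA]) (auto)

lemma SA_mem [simp]: "w \<in> crr BB n \<Longrightarrow> k = n + 1 \<Longrightarrow> SA a w \<in> crr BB k"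
  unfolding SA_def using tlext_mem[OF cpx_Bar cpx_Bar vs_on_tensor tbil_SA, of w n] by simp

lemma BB_ext:
  assumes "w \<in> crr BB n"
    "\<And>u v. u \<in> crr BB n \<Longrightarrow> v \<in> crr BB n \<Longrightarrow> F (u + v) = F u + F v"
    "\<And>u v. u \<in> crr BB n \<Longrightarrow> v \<in> crr BB n \<Longrightarrow> G (u + v) = G u + (G v :: 'z::ab_group_add)"
    "\<And>i x j y. i + j = n \<Longrightarrow> x \<in> crr Bar i \<Longrightarrow> y \<in> crr Bar j \<Longrightarrow> F (tp i x j y) = G (tp i x j y)"
  shows "F w = G w"
  by (rule tens_ext[OF cpx_Bar cpx_Bar assms])

lemma cBB [simp]: "cpx BB" by simp

lemma SA_l:
  assumes w: "w \<in> crr BB n"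
  shows "SA (a + a') w = SA a w + SA a' w" "SA (scale c a) w = pscale c (SA a w)"
    "lact (obj BB (n + 1)) c' (SA a w) = SA (c' * a) w" "ract (obj BB (n + 1)) (SA a w) c' = SA a (ract (obj BB n) w c')"
proof -
  show "SA (a + a') w = SA a w + SA a' w"
    by (rule BB_ext[OF w]) (auto simp: SA_lin SA_tprod sg_add_l tprod_lin)
  show "SA (scale c a) w = pscale c (SA a w)"
  proof (rule BB_ext[OF w])
    fix i x j y assume h: "i + j = n" "x \<in> crr Bar i" "y \<in> crr Bar j"
    show "SA (scale c a) (tp i x j y) = pscale c (SA a (tp i x j y))"
      using tprod_scale_l[OF cpx_Bar cpx_Bar, of "sg a x" "i + 1" y j c] h by (simp add: bar_l SA_tprod sg_scale_l)
  qed (auto simp: SA_lin fv.scale_right_distrib)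
  show "lact (obj BB (n + 1)) c' (SA a w) = SA (c' * a) w"
    by (rule BB_ext[OF w]) (auto simp: SA_lin SA_tprod lact_add lact_tprod bar_l sg_lB)
  show "ract (obj BB (n + 1)) (SA a w) c' = SA a (ract (obj BB n) w c')"
  proof (rule BB_ext[OF w])
    fix i x j y assume h: "i + j = n" "x \<in> crr Bar i" "y \<in> crr Bar j"
    have "ract (obj Bar j) y c' \<in> crr Bar j" using h by simp
    then show "ract (obj BB (n + 1)) (SA a (tp i x j y)) c' = SA a (ract (obj BB n) (tp i x j y) c')"
      using h by (simp add: SA_tprod ract_tprod)
  qed (auto simp: SA_lin ract_add)
qed

lemmas z\<beta> = zext_hom[OF \<beta>_hom]

lemma z\<beta>': "deg_hom Bar Alg (- 0) (zext \<beta>)" using z\<beta> by simp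

lemma L\<beta>: "deg_hom BB Bar 0 (Lop Bar 0 (zext \<beta>))" and R\<beta>: "deg_hom BB Bar 0 (Rop Bar 0 (zext \<beta>))"
  using Lop[OF cpx_Bar z\<beta>'] Rop[OF cpx_Bar z\<beta>'] by simp_all

text \<open>Contracting the left factor leaves its augmentation behind, and balancing moves that
  value to the right factor. For \<open>a = 1\<close> the identity becomes homotopic to \<open>w
  \<mapsto> (1 \<otimes> 1) \<otimes> (\<beta> \<otimes> 1) w\<close>.\<close>

lemma SA_d:
  assumes w: "w \<in> crr BB n"
  shows "diff BB (n + 1) (SA a w) + SA a (diff BB n w) =
    lact (obj BB n) a w - tp 0 (bt [a, 1]) n (Lop Bar 0 (zext \<beta>) n w)"
proof (rule BB_ext[OF w])
  fix i x j y assume h: "i + j = n" "x \<in> crr Bar i" "y \<in> crr Bar j"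
  have n: "n + 1 = (i + 1) + j" using h by simp
  have k: "ksgn (i + 1) v = - ksgn i v" for v :: "('k, 'a list \<Rightarrow>\<^sub>0 'k, 'a list \<Rightarrow>\<^sub>0 'k) tens" by (simp add: ksgn_def)
  have dx: "diff Bar (i + 1) (sg a x) \<in> crr Bar i" "sg a (diff Bar i x) \<in> crr Bar i"
    using h by (auto intro!: d_mem sg_crr)
  have 1: "diff BB (n + 1) (SA a (tp i x j y)) = tp i (diff Bar (i + 1) (sg a x)) j y - ksgn i (tp (i + 1) (sg a x) (j - 1) (diff Bar j y))"
    unfolding n SA_tprod[OF h(2,3)] using h by (subst diff_tprod) (simp_all add: k)
  have 2: "SA a (diff BB n (tp i x j y)) = tp i (sg a (diff Bar i x)) j y + ksgn i (tp (i + 1) (sg a x) (j - 1) (diff Bar j y))"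
    using h by (simp add: diff_tprod SA_lin SA_tprod)
  have "diff BB (n + 1) (SA a (tp i x j y)) + SA a (diff BB n (tp i x j y)) = tp i (diff Bar (i + 1) (sg a x) + sg a (diff Bar i x)) j y"
    unfolding 1 2 tprod_add_l[OF cpx_Bar cpx_Bar dx h(3)] by simp
  also have "\<dots> = lact (obj BB n) a (tp i x j y) - tp 0 (bt [a, 1]) n (Lop Bar 0 (zext \<beta>) n (tp i x j y))"
  proof (cases "i = 0")
    case True
    have m: "lB a x \<in> crr Bar i" "rB (bt [a, 1]) (\<beta> x) \<in> crr Bar i"
      using h True bim_lact[OF cpx_bim[OF cpx_Bar], of x i a] bim_ract[OF cpx_bim[OF cpx_Bar], of "bt [a, 1]" 0 "\<beta> x"]
      by (simp_all add: bar_l)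
    have b: "tp 0 (rB (bt [a, 1]) (\<beta> x)) j y = tp 0 (bt [a, 1]) j (lB (\<beta> x) y)"
      using tprod_bal[OF cpx_Bar cpx_Bar, of "bt [a, 1]" 0 y j "\<beta> x"] h by (simp add: bar_l)
    have z: "zext \<beta> i x = \<beta> x" using True by (simp add: zext_def)
    show ?thesis
      unfolding sg_d[OF h(2)] using h m True b z
      by (simp add: tprod_lin lact_tprod bar_l Lop_tprod[OF cpx_Bar z\<beta>'])
  next
    case False
    have z: "zext \<beta> i x = 0" using False by (simp add: zext_def)
    show ?thesis
      unfolding sg_d[OF h(2)] using h False z
      by (simp add: lact_tprod Lop_tprod[OF cpx_Bar z\<beta>']) (simp add: bar_l)
  qed
  finally show "diff BB (n + 1) (SA a (tp i x j y)) + SA a (diff BB n (tp i x j y)) =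
    lact (obj BB n) a (tp i x j y) - tp 0 (bt [a, 1]) n (Lop Bar 0 (zext \<beta>) n (tp i x j y))" .
qed (simp_all add: SA_lin d_add lact_add dh_simps[OF _ L\<beta>] tprod_lin)

lemma L\<beta>_d: "w \<in> crr BB n \<Longrightarrow> Lop Bar 0 (zext \<beta>) (n - 1) (diff BB n w) = diff Bar n (Lop Bar 0 (zext \<beta>) n w)"
  using Lop_chain[OF cpx_Bar resolvesD(3)[OF resolves_Bar]] by simp

lemma BB_neg:
  assumes "n < 0" "t \<in> crr BB n"
  shows "t = 0"
  by (rule tens_neg[OF cpx_Bar cpx_Bar _ _ assms]) (erule (1) bar_neg)+

text \<open>A cycle is compressed by \<open>SA 1\<close> onto the right factor, where exactness of
  the bar resolution itself finishes the argument.\<close>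

lemma resolves_BB: "resolves BB (\<lambda>w. \<beta> (Lop Bar 0 (zext \<beta>) 0 w))"
  unfolding resolves_def
proof (intro conjI allI impI ballI)
  let ?L = "Lop Bar 0 (zext \<beta>)"
  show "crr BB n = {0}" if "n < 0" for n
    using BB_neg[OF that] by auto
  have key: "w = diff BB (n + 1) (SA 1 w) + tp 0 (bt [1, 1]) n (?L n w)" if "w \<in> crr BB n" "diff BB n w = 0" for w n
    using SA_d[OF that(1), of 1] that by (simp add: SA_lin)
  \<comment> \<open>Placing \<open>1 \<otimes> 1\<close> on the left is a chain map, since this
    element has degree 0 and differential 0.\<close>
  have J: "tp 0 (bt [1, 1]) n (diff Bar (n + 1) y) = diff BB (n + 1) (tp 0 (bt [1, 1]) (n + 1) y)" if "y \<in> crr Bar (n + 1)" for n y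
  proof -
    have "diff Bar 0 (bt [1, 1]) = 0" by (simp add: bar_simps)
    then show ?thesis using that by (simp add: diff_tprod)
  qed
  have ex: "w \<in> diff BB (n + 1) ` crr BB (n + 1)" if w: "w \<in> crr BB n" "diff BB n w = 0"
    and y: "y \<in> crr Bar (n + 1)" "?L n w = diff Bar (n + 1) y" for w n y
  proof (rule image_eqI)
    show "SA 1 w + tp 0 (bt [1, 1]) (n + 1) y \<in> crr BB (n + 1)" using w y by simp
    show "w = diff BB (n + 1) (SA 1 w + tp 0 (bt [1, 1]) (n + 1) y)"
      using key[OF w] w y by (simp add: d_add J)
  qed
  have Lm: "?L n w \<in> crr Bar n" if "w \<in> crr BB n" for w n using dh_mem[OF _ L\<beta> that] by simp
  show "w \<in> diff BB (n + 1) ` crr BB (n + 1)" if "n > 0" "w \<in> crr BB n" "diff BB n w = 0" for w n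
  proof -
    have "diff Bar n (?L n w) = 0" using L\<beta>_d[OF that(2)] that(3) by (simp add: dh_0[OF _ L\<beta>])
    from resolvesD(6)[OF resolves_Bar that(1) Lm[OF that(2)] this]
    show ?thesis using ex[OF that(2,3)] by auto
  qed
  show "bimod_hom (obj BB 0) (alg_bimod scale UNIV) (\<lambda>w. \<beta> (?L 0 w))"
    using deg_homD[OF L\<beta>, of 0 0] \<beta>_hom by (auto simp: bimod_hom_def)
  show "(\<lambda>w. \<beta> (?L 0 w)) ` crr BB 0 = UNIV"
  proof (rule, simp, rule)
    fix a
    have "\<beta> (?L 0 (tp 0 (bt [1, 1]) 0 (bt [1, a]))) = a"
    proof -
      have "zext \<beta> 0 (bt [1, 1]) = 1" using \<beta>_bt[of 1 1] by (simp add: zext_def)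
      then show ?thesis using \<beta>_bt[of 1 a] by (simp add: Lop_tprod[OF cpx_Bar z\<beta>'] bar_l)
    qed
    then show "a \<in> (\<lambda>w. \<beta> (?L 0 w)) ` crr BB 0" by (intro image_eqI[of _ _ "tp 0 (bt [1, 1]) 0 (bt [1, a])"]) simp_all
  qed
  fix w assume w: "w \<in> crr BB 0"
  show "\<beta> (?L 0 w) = 0 \<longleftrightarrow> w \<in> diff BB 1 ` crr BB 1"
  proof
    assume "\<beta> (?L 0 w) = 0"
    then obtain y where y: "y \<in> crr Bar (0 + 1)" "?L 0 w = diff Bar (0 + 1) y"
      using resolvesD(7)[OF resolves_Bar Lm[OF w]] by auto
    have "diff BB 0 w \<in> crr BB (- 1)" using w by simp
    then have "diff BB 0 w = 0" using BB_neg[of "- 1"] by simp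
    from ex[OF w this y] show "w \<in> diff BB 1 ` crr BB 1" by simp
  next
    assume "w \<in> diff BB 1 ` crr BB 1"
    then obtain v where v: "v \<in> crr BB 1" "w = diff BB 1 v" by auto
    show "\<beta> (?L 0 w) = 0" using L\<beta>_d[OF v(1)] resolvesD(8)[OF resolves_Bar Lm[OF v(1)]] v by simp
  qed
qed simp

section \<open>The lifting system of the bar resolution\<close>

text \<open>The deconcatenation diagonal: the list is cut after the letter of index
  \<open>k\<close>, and a 1 is put at either side of the cut, which gives pieces of degrees
  \<open>k\<close> and \<open>n - k\<close>.\<close>

definition Dll :: "'a list \<Rightarrow> ('k, 'a list \<Rightarrow>\<^sub>0 'k, 'a list \<Rightarrow>\<^sub>0 'k) tens" where
  "Dll xs = (\<Sum>k<length xs - 1. tp (int k) (bt (take (k + 1) xs @ [1])) (int (length xs) - 2 - int k) (bt (1 # drop (k + 1) xs)))"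

definition Dlt :: "('a list \<Rightarrow>\<^sub>0 'k) \<Rightarrow> ('k, 'a list \<Rightarrow>\<^sub>0 'k, 'a list \<Rightarrow>\<^sub>0 'k) tens" where
  "Dlt = lext pscale Dll"

lemma Dlt_lin: "Dlt (u + v) = Dlt u + Dlt v" "Dlt 0 = 0" "Dlt (u - v) = Dlt u - Dlt v"
  by (simp_all add: Dlt_def plext_linear)

lemma Dll_1: "Dll [a] = 0" by (simp add: Dll_def)

lemma Dll_summand:
  assumes "k < length xs - 1"
  shows "bt (take (k + 1) xs @ [1]) \<in> crr Bar (int k)" "bt (1 # drop (k + 1) xs) \<in> crr Bar (int (length xs) - 2 - int k)"
  using assms by (auto intro!: bt_crr simp: of_nat_diff)

lemma BB_sum: "(\<And>k. k \<in> S \<Longrightarrow> h k \<in> crr BB n) \<Longrightarrow> sum h S \<in> crr BB n"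
  by (induction S rule: infinite_finite_induct) auto

lemma Dll_mem: "n = int (length xs) - 2 \<Longrightarrow> Dll xs \<in> crr BB n"
  unfolding Dll_def by (intro BB_sum tprod_mem[OF cpx_Bar cpx_Bar]) (auto simp: Dll_summand[simplified] simp del: bt_crr)

text \<open>The cut after \<open>a\<close> is split off; all other cuts lie in the tail, and
  \<open>SA a\<close> restores \<open>a\<close> on the left.\<close>

lemma Dll_Cons:
  assumes "xs \<noteq> []"
  shows "Dll (a # xs) = tp 0 (bt [a, 1]) (int (length xs) - 1) (bt (1 # xs)) + SA a (Dll xs)"
proof -
  let ?f = "\<lambda>ys k. tp (int k) (bt (take (k + 1) ys @ [1])) (int (length ys) - 2 - int k) (bt (1 # drop (k + 1) ys))"
  have l: "length (a # xs) - 1 = Suc (length xs - 1)" using assms by simp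
  have "Dll (a # xs) = ?f (a # xs) 0 + (\<Sum>k<length xs - 1. ?f (a # xs) (Suc k))"
    unfolding Dll_def l by (rule sum.lessThan_Suc_shift)
  also have "(\<Sum>k<length xs - 1. ?f (a # xs) (Suc k)) = (\<Sum>k<length xs - 1. SA a (?f xs k))"
  proof (rule sum.cong[OF refl])
    fix k assume "k \<in> {..<length xs - 1}"
    then have k: "k < length xs - 1" by simp
    show "?f (a # xs) (Suc k) = SA a (?f xs k)"
      unfolding SA_tprod[OF Dll_summand[OF k]] by (simp add: algebra_simps)
  qed
  finally show ?thesis by (simp add: Dll_def SA_lin)
qed

lemma mlin_Dll: "N > 0 \<Longrightarrow> mlin N pscale Dll"
proof (induction N)
  case (Suc N)
  show ?case
  proof (cases "N = 0")
    case True
    have "mlin (Suc 0) pscale Dll" by (rule mlin_Cons) (auto simp: mlin_def Dll_1)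
    then show ?thesis using True by simp
  next
    case False
    have m: "bt (1 # xs) \<in> crr Bar (int N - 1)" if "length xs = N" for xs using that False by simp
    have b: "bt [a, 1] \<in> crr Bar 0" for a by simp
    note ps = tprod_scale_r[OF cpx_Bar cpx_Bar, unfolded bar_l] tprod_scale_l[OF cpx_Bar cpx_Bar, unfolded bar_l]
    show ?thesis
    proof (rule mlin_Cons)
      fix a
      have 1: "mlin N pscale (\<lambda>xs. tp 0 (bt [a, 1]) (int N - 1) (bt (1 # xs)))"
        unfolding mlin_def
      proof (intro conjI allI impI)
        fix us vs :: "'a list" and d d' c assume l: "length us + 1 + length vs = N"
        note mb = mlin_bt_Cons[of N 1, unfolded mlin_def]
        have mm: "bt (1 # us @ d # vs) \<in> crr Bar (int N - 1)" for d by (rule m) (use l in simp)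
        have e: "bt (1 # us @ (d + d') # vs) = bt (1 # us @ d # vs) + bt (1 # us @ d' # vs)"
          "bt (1 # us @ scale c d # vs) = pscale c (bt (1 # us @ d # vs))"
          using mb l by blast+
        show "tp 0 (bt [a, 1]) (int N - 1) (bt (1 # us @ (d + d') # vs)) =
          tp 0 (bt [a, 1]) (int N - 1) (bt (1 # us @ d # vs)) + tp 0 (bt [a, 1]) (int N - 1) (bt (1 # us @ d' # vs))"
          unfolding e by (rule tprod_add_r[OF cpx_Bar cpx_Bar b mm mm])
        show "tp 0 (bt [a, 1]) (int N - 1) (bt (1 # us @ scale c d # vs)) = pscale c (tp 0 (bt [a, 1]) (int N - 1) (bt (1 # us @ d # vs)))"
          unfolding e by (rule ps(1)[OF b mm])
      qed
      have 2: "mlin N pscale (\<lambda>xs. SA a (Dll xs))"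
        unfolding SA_def by (rule mlin_lext[OF pscale_vector_space]) (use Suc False in simp)
      show "mlin N pscale (\<lambda>xs. Dll (a # xs))"
        by (rule iffD1[OF mlin_cong mlin_add[OF 1 2]]) (use False in \<open>auto simp: Dll_Cons\<close>)
    next
      fix a a' c and xs :: "'a list" assume l: "length xs = N"
      then have ne: "xs \<noteq> []" using False by auto
      have D: "Dll xs \<in> crr BB (int N - 2)" using Dll_mem[of "int N - 2" xs] l by simp
      note mm = m[OF l]
      have e: "bt [a + a', 1] = bt [a, 1] + bt [a', 1]" "bt [scale c a, 1] = pscale c (bt [a, 1])" by (simp_all add: bt_Cons)
      show "Dll ((a + a') # xs) = Dll (a # xs) + Dll (a' # xs)"
        unfolding Dll_Cons[OF ne] SA_l(1)[OF D] e l tprod_add_l[OF cpx_Bar cpx_Bar b b mm] by (simp add: algebra_simps)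
      show "Dll (scale c a # xs) = pscale c (Dll (a # xs))"
        unfolding Dll_Cons[OF ne] SA_l(2)[OF D] e l ps(2)[OF b mm] by (simp add: fv.scale_right_distrib)
    qed
  qed
qed simp

lemma Dlt_bt: "xs \<noteq> [] \<Longrightarrow> Dlt (bt xs) = Dll xs"
  unfolding Dlt_def by (rule pblext[OF mlin_Dll refl]) simp

lemma Dlt_1: "t \<in> TB (Suc 0) \<Longrightarrow> Dlt t = 0"
  by (rule TB_ext[of t "Suc 0" Dlt "\<lambda>_. 0"]) (auto simp: Dlt_lin Dlt_bt Dll_1)

lemma Dlt_sg:
  assumes t: "t \<in> TB N" "N > 0"
  shows "Dlt (sg a t) = tp 0 (bt [a, 1]) (int N - 1) (sg 1 t) + SA a (Dlt t)"
proof (rule TB_ext[OF t])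
  have m: "sg 1 x \<in> crr Bar (int N - 1)" if "x \<in> TB N" for x
  proof -
    obtain K where K: "N = Suc K" using t(2) by (cases N) auto
    have "sg 1 x \<in> TB (Suc (Suc K))" using that K by simp
    then show ?thesis unfolding crr_TB by (simp add: K)
  qed
  show "tp 0 (bt [a, 1]) (int N - 1) (sg 1 (x + y)) + SA a (Dlt (x + y)) = tp 0 (bt [a, 1]) (int N - 1) (sg 1 x) + SA a (Dlt x) +
    (tp 0 (bt [a, 1]) (int N - 1) (sg 1 y) + SA a (Dlt y))" if "x \<in> TB N" "y \<in> TB N" for x y
    using m[OF that(1)] m[OF that(2)] by (simp add: sg_lin Dlt_lin SA_lin tprod_lin)
qed (auto simp: Dlt_lin sg_lin Dlt_bt Dll_Cons)

lemma Dlt_mem: "t \<in> crr Bar n \<Longrightarrow> k = n \<Longrightarrow> Dlt t \<in> crr BB k"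
proof (erule bar_case)
  fix N assume a: "n = int N" "t \<in> TB (Suc (Suc N))" "k = n"
  have "Suc (Suc N) > 0" by simp
  from a(2) this show "Dlt t \<in> crr BB k"
    by (induction rule: TB_induct) (use a in \<open>auto simp: Dlt_lin Dlt_bt intro!: Dll_mem\<close>)
qed (simp add: Dlt_lin)

lemma Dlt_lB:
  assumes "t \<in> crr Bar n"
  shows "Dlt (lB c t) = lact (obj BB n) c (Dlt t)"
  using assms
proof (cases rule: bar_case)
  case (2 N)
  have "Suc (Suc N) > 0" by simp
  from 2(2) this show ?thesis
  proof (induction rule: TB_induct)
    case (bt b xs)
    have m: "bt xs \<in> TB (Suc N)" "Suc N > 0" using bt by auto
    have e: "bt (b # xs) = sg b (bt xs)" by simp
    have D: "Dlt (bt xs) \<in> crr BB (n - 1)" using bt 2(1) by (subst Dlt_bt) (auto intro!: Dll_mem)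
    have s: "sg 1 (bt xs) \<in> crr Bar n" using bt 2(1) by simp
    have l: "lact (obj BB n) c (tp 0 (bt [b, 1]) n (sg 1 (bt xs))) = tp 0 (bt [c * b, 1]) n (sg 1 (bt xs))"
      using s by (subst lact_tprod) (simp_all add: bar_l)
    have tm: "tp 0 (bt [b, 1]) n (sg 1 (bt xs)) \<in> crr BB n" using s by simp
    have n: "int (Suc N) - 1 = n" "n - 1 + 1 = n" using 2(1) by simp_all
    show ?case
      unfolding e lB_sg[OF m] Dlt_sg[OF m] n
      using SA_l(3)[OF D, of c b] tm D by (simp add: n lact_add l del: sg_bt)
  qed (auto simp: Dlt_lin B_lin lact_add Dlt_mem 2(1) crr_TB)
qed (simp add: Dlt_lin B_lin)

lemma Dlt_rB1: "t \<in> TB (Suc (Suc N)) \<Longrightarrow> Dlt (rB t c) = ract (obj BB (int N)) (Dlt t) c"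
proof (induction N arbitrary: t)
  case (0 t)
  have p: "Suc (Suc 0) > 0" by simp
  from 0 p show ?case
  proof (induction rule: TB_induct)
    case (bt b xs)
    then obtain d where xs: "xs = [d]" by (auto simp: length_Suc_conv)
    have r: "rB (bt [b, d]) c = bt [b, d * c]" "rB (bt [1, d]) c = bt [1, d * c]"
      using rB_bt[of "[_]" d c] by simp_all
    have D: "Dll [b, d] = tp 0 (bt [b, 1]) 0 (bt [1, d])" for b d by (simp add: Dll_Cons Dll_1 SA_lin)
    show ?case using ract_tprod[OF cpx_Bar cpx_Bar, of 0 0 0 "bt [b, 1]" "bt [1, d]" c]
      by (simp add: xs r Dlt_bt D bar_l)
  qed (auto simp: Dlt_lin B_lin ract_add Dlt_mem crr_TB[of _ 0, simplified])
next
  case (Suc N t)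
  have p: "Suc (Suc (Suc N)) > 0" by simp
  from Suc(2) p show ?case
  proof (induction rule: TB_induct)
    case (bt b xs)
    let ?n = "int (Suc N)"
    have m: "bt xs \<in> TB (Suc (Suc N))" "Suc (Suc N) > 0" using bt by auto
    have r: "rB (bt xs) c \<in> TB (Suc (Suc N))" using m by simp
    have e: "bt (b # xs) = sg b (bt xs)" by simp
    have D: "Dlt (bt xs) \<in> crr BB (int N)" by (rule Dlt_mem[OF m(1)[unfolded crr_TB]]) simp
    have s: "sg 1 (bt xs) \<in> crr Bar ?n" by (rule sg_crr[OF m(1)[unfolded crr_TB]]) simp
    have l: "ract (obj BB ?n) (tp 0 (bt [b, 1]) ?n (sg 1 (bt xs))) c = tp 0 (bt [b, 1]) ?n (rB (sg 1 (bt xs)) c)"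
      using s by (subst ract_tprod) (simp_all add: bar_l)
    have tm: "tp 0 (bt [b, 1]) ?n (sg 1 (bt xs)) \<in> crr BB ?n" using s by simp
    have n: "int (Suc (Suc N)) - 1 = ?n" "int N + 1 = ?n" by simp_all
    have sm: "SA b (Dlt (bt xs)) \<in> crr BB ?n" by (rule SA_mem[OF D]) simp
    show ?case
      unfolding e rB_sg[OF m] Dlt_sg[OF m] Dlt_sg[OF r m(2)] n ract_add[OF cpx_bim[OF cBB] tm sm] l
        Suc(1)[OF m(1)] using SA_l(4)[OF D, of b c] unfolding n rB_sg[OF m] by simp
  next
    case (add t t')
    then show ?case using Dlt_mem[of _ "int (Suc N)"] unfolding crr_TB by (simp add: Dlt_lin B_lin ract_add)
  qed (auto simp: Dlt_lin B_lin)
qed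

lemma Dlt_hom: "deg_hom Bar BB 0 (\<lambda>_. Dlt)"
  unfolding deg_hom_def
proof (intro allI bimod_homI)
  fix i x y a assume x: "x \<in> crr Bar i"
  show "Dlt x \<in> crr BB (i + 0)" using Dlt_mem[OF x] by simp
  show "Dlt (x + y) = Dlt x + Dlt y" by (rule Dlt_lin)
  show "Dlt (lact (obj Bar i) a x) = lact (obj BB (i + 0)) a (Dlt x)" using Dlt_lB[OF x] by (simp add: bar_l)
  show "Dlt (ract (obj Bar i) x a) = ract (obj BB (i + 0)) (Dlt x) a"
    using x by (cases rule: bar_case) (simp_all add: bar_l B_lin Dlt_lin Dlt_rB1)
qed

lemma Lop_lin: "Lop Bar m g n (u + v) = Lop Bar m g n u + Lop Bar m g n v" "Lop Bar m g n 0 = 0"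
  "Lop Bar m g n (sum h S) = (\<Sum>x\<in>S. Lop Bar m g n (h x))"
  and Rop_lin: "Rop Bar m g n (u + v) = Rop Bar m g n u + Rop Bar m g n v" "Rop Bar m g n 0 = 0"
  "Rop Bar m g n (sum h S) = (\<Sum>x\<in>S. Rop Bar m g n (h x))"
  by (simp_all add: Lop_def Rop_def bar_l plext_linear)

section \<open>Contraction and insertion of a cochain on the bar resolution\<close>

context
  fixes m :: nat and g
  assumes g: "deg_hom Bar Alg (- int m) g"
begin

abbreviation "L \<equiv> Lop Bar (int m) g"
abbreviation "R \<equiv> Rop Bar (int m) g"

text \<open>A cochain of degree \<open>m\<close> sees only the cut whose left piece has degree
  \<open>m\<close>.\<close>

lemma Lop_Dll:
  assumes "length xs = N + 2"
  shows "L (int N) (Dll xs) = (if m \<le> N then lB (g (int m) (bt (take (m + 1) xs @ [1]))) (bt (1 # drop (m + 1) xs)) else 0)"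
proof -
  have l: "length xs - 1 = Suc N" "int (length xs) - 2 = int N" using assms by simp_all
  have "L (int N) (Dll xs) = (\<Sum>k<Suc N. if k = m then lB (g (int m) (bt (take (m + 1) xs @ [1]))) (bt (1 # drop (m + 1) xs)) else 0)"
    unfolding Dll_def l Lop_lin
  proof (rule sum.cong[OF refl])
    fix k assume "k \<in> {..<Suc N}"
    then have "k < length xs - 1" using l by simp
    note s = Dll_summand[OF this, unfolded l]
    have z: "g (int k) (bt (take (k + 1) xs @ [1])) = 0" if "k \<noteq> m" using g0[OF cpx_Bar g s(1)] that by simp
    have z2: "lB 0 (bt (1 # drop (k + 1) xs)) = 0"
      using lact_0'[OF cpx_bim[OF cpx_Bar] s(2)] by (simp only: bar_l)
    show "L (int N) (tp (int k) (bt (take (k + 1) xs @ [1])) (int N - int k) (bt (1 # drop (k + 1) xs))) =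
      (if k = m then lB (g (int m) (bt (take (m + 1) xs @ [1]))) (bt (1 # drop (m + 1) xs)) else 0)"
    proof (cases "k = m")
      case True
      then show ?thesis using Lop_tprod[OF cpx_Bar g _ s, of "int N"] by (simp add: bar_l)
    next
      case False
      then show ?thesis using Lop_tprod[OF cpx_Bar g _ s, of "int N"] z z2 by (simp add: bar_l)
    qed
  qed
  then show ?thesis by simp
qed

lemma Rop_Dll:
  assumes "length xs = N + 2"
  shows "R (int N) (Dll xs) = (if m \<le> N then ksgn (int (N - m) * int m)
    (rB (bt (take (N - m + 1) xs @ [1])) (g (int m) (bt (1 # drop (N - m + 1) xs)))) else 0)"
proof -
  have l: "length xs - 1 = Suc N" "int (length xs) - 2 = int N" using assms by simp_all
  \<comment> \<open>The right piece has degree \<open>N - k\<close>. The guard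
    \<open>m \<le> N\<close> matters, since subtraction of naturals gives \<open>N - m = 0\<close>
    for \<open>m > N\<close>.\<close>
  have "R (int N) (Dll xs) = (\<Sum>k<Suc N. if k = N - m \<and> m \<le> N then ksgn (int (N - m) * int m)
    (rB (bt (take (N - m + 1) xs @ [1])) (g (int m) (bt (1 # drop (N - m + 1) xs)))) else 0)"
    unfolding Dll_def l Rop_lin
  proof (rule sum.cong[OF refl])
    fix k assume k: "k \<in> {..<Suc N}"
    then have "k < length xs - 1" using l by simp
    note s = Dll_summand[OF this, unfolded l]
    have z: "g (int N - int k) (bt (1 # drop (k + 1) xs)) = 0" if "int N - int k \<noteq> int m" using g0[OF cpx_Bar g s(2)] that by simp
    have z2: "rB (bt (take (k + 1) xs @ [1])) 0 = 0"
      using ract_0'[OF cpx_bim[OF cpx_Bar] s(1)] by (simp only: bar_l)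
    show "R (int N) (tp (int k) (bt (take (k + 1) xs @ [1])) (int N - int k) (bt (1 # drop (k + 1) xs))) =
      (if k = N - m \<and> m \<le> N then ksgn (int (N - m) * int m)
    (rB (bt (take (N - m + 1) xs @ [1])) (g (int m) (bt (1 # drop (N - m + 1) xs)))) else 0)"
    proof (cases "k = N - m \<and> m \<le> N")
      case True
      then have "int N - int k = int m" by (simp add: of_nat_diff)
      then show ?thesis using Rop_tprod[OF cpx_Bar g _ s, of "int N"] True by (simp add: bar_l)
    next
      case False
      then have "int N - int k \<noteq> int m" using k by auto
      then show ?thesis
        unfolding if_not_P[OF False] using Rop_tprod[OF cpx_Bar g _ s, of "int N"] z z2 by (simp add: bar_l)
    qed
  qed
  then show ?thesis by (cases "m \<le> N") (simp_all add: less_Suc_eq_le del: sum.lessThan_Suc)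
qed

text \<open>Gerstenhaber's insertion of \<open>g\<close>, with values in the bar resolution.\<close>

definition psl :: "'a list \<Rightarrow> ('a list \<Rightarrow>\<^sub>0 'k)" where
  "psl xs = (\<Sum>k<length xs - m - 1. ksgn ((int m - 1) * int k)
     (bt (take (k + 1) xs @ [g (int m) (bt (1 # take m (drop (k + 1) xs) @ [1]))] @ drop (k + 1 + m) xs)))"

definition psi :: "('a list \<Rightarrow>\<^sub>0 'k) \<Rightarrow> ('a list \<Rightarrow>\<^sub>0 'k)" where
  "psi = lext pscale psl"

lemma psi_lin: "psi (u + v) = psi u + psi v" "psi 0 = 0" "psi (u - v) = psi u - psi v"
  by (simp_all add: psi_def plext_linear)

text \<open>The insertion directly after \<open>a\<close> is split off. In the others
  \<open>a\<close> is only carried along, and moving the position by one costs the sign of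
  \<open>m - 1\<close>.\<close>

lemma psl_Cons: "psl (a # xs) = (if m < length xs then bt (a # g (int m) (bt (1 # take m xs @ [1])) # drop m xs) else 0) +
    ksgn (int m - 1) (sg a (psl xs))"
proof (cases "m < length xs")
  case True
  let ?f = "\<lambda>ys k. ksgn ((int m - 1) * int k)
     (bt (take (k + 1) ys @ [g (int m) (bt (1 # take m (drop (k + 1) ys) @ [1]))] @ drop (k + 1 + m) ys))"
  have l: "length (a # xs) - m - 1 = Suc (length xs - m - 1)" using True by simp
  have "psl (a # xs) = ?f (a # xs) 0 + (\<Sum>k<length xs - m - 1. ?f (a # xs) (Suc k))"
    unfolding psl_def l by (rule sum.lessThan_Suc_shift)
  also have "(\<Sum>k<length xs - m - 1. ?f (a # xs) (Suc k)) = (\<Sum>k<length xs - m - 1. ksgn (int m - 1) (sg a (?f xs k)))"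
    by (intro sum.cong refl) (simp add: sg_lin ksgn_ksgn algebra_simps)
  also have "\<dots> = ksgn (int m - 1) (sg a (psl xs))"
    by (simp add: psl_def sg_lin ksgn_def sum_negf)
  finally show ?thesis using True by simp
next
  case False
  then show ?thesis by (simp add: psl_def)
qed

lemma psl_mem: "psl xs \<in> TB (Suc (length xs - m))"
  unfolding psl_def by (intro TB_sum TB_ksgn TB_bt) auto

lemma psl_0: "length xs \<le> m + 1 \<Longrightarrow> psl xs = 0"
  by (simp add: psl_def)

text \<open>The left contraction of the diagonal. On \<open>1 \<otimes> xs\<close> it evaluates
  \<open>g\<close> on the first \<open>m\<close> letters of \<open>xs\<close>, so it gives the first
  insertion in \<open>psl_Cons\<close> once \<open>a\<close> is prefixed. In this form
  multilinearity and bimodule linearity are inherited from \<open>Dlt\<close> and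
  \<open>Lop\<close>.\<close>

definition G :: "nat \<Rightarrow> ('a list \<Rightarrow>\<^sub>0 'k) \<Rightarrow> ('a list \<Rightarrow>\<^sub>0 'k)" where
  "G N t = L (int N) (Dlt t)"

lemma G_bt:
  assumes "length xs = Suc N"
  shows "G N (bt (1 # xs)) = (if m < length xs then bt (g (int m) (bt (1 # take m xs @ [1])) # drop m xs) else 0)"
  using assms by (simp add: G_def Dlt_bt Lop_Dll)

lemma G_lin: "G N (u + v) = G N u + G N v" "G N 0 = 0"
  by (simp_all add: G_def Dlt_lin Lop_lin)

lemma G_hom: "bimod_hom (obj Bar (int N)) (obj Bar (int N - int m)) (G N)"
proof -
  have "deg_hom Bar Bar (- int m) (\<lambda>i t. L i (Dlt t))"
    by (rule deg_hom_comp[OF _ Dlt_hom Lop[OF cpx_Bar g]]) simp_all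
  from deg_homD[OF this, of "int N - int m" "int N"] show ?thesis by (simp add: G_def[abs_def])
qed

lemma G_mem:
  assumes "t \<in> TB (Suc (Suc N))"
  shows "G N t \<in> TB (Suc (Suc N - m))"
proof (cases "m \<le> N")
  case True
  have "G N t \<in> crr Bar (int (N - m))"
    using hom_mem[OF cpx_bim[OF cpx_Bar] G_hom] assms True unfolding crr_TB by (simp add: of_nat_diff)
  then show ?thesis unfolding crr_TB[symmetric] using True by (simp add: Suc_diff_le)
next
  case False
  then have "G N t = 0"
    using bar_neg[OF _ hom_mem[OF cpx_bim[OF cpx_Bar] G_hom assms[unfolded crr_TB]]] by simp
  then show ?thesis by simp
qed

lemma mlin_psl: "N > 0 \<Longrightarrow> mlin N pscale psl"
proof (induction N)
  case (Suc N)
  show ?case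
  proof (cases "N = 0")
    case True
    have "mlin (Suc 0) pscale psl" by (rule mlin_Cons) (auto simp: mlin_def psl_0)
    then show ?thesis using True by simp
  next
    case False
    then obtain K where K: "N = Suc K" by (cases N) auto
    have b: "mlin N pscale (\<lambda>xs. G K (bt (1 # xs)))"
    proof -
      have "mlin N pscale (\<lambda>xs. Dlt (bt (1 # xs)))"
        unfolding Dlt_def by (rule mlin_lext[OF pscale_vector_space mlin_bt_Cons])
      then show ?thesis unfolding G_def Lop_def bar_l by (rule mlin_lext[OF pscale_vector_space])
    qed
    have 1: "mlin (Suc N) pscale (\<lambda>xs. sg (hd xs) (G K (bt (1 # tl xs))))"
    proof (rule mlin_sg_Cons[OF b])
      show "G K (bt (1 # xs)) \<in> TB (Suc (Suc K - m))" if "length xs = N" for xs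
        by (rule G_mem) (use that K in simp)
    qed simp
    have 2: "mlin (Suc N) pscale (\<lambda>xs. ksgn (int m - 1) (sg (hd xs) (psl (tl xs))))"
    proof (rule mlin_ksgn, rule mlin_sg_Cons)
      show "mlin N pscale psl" using Suc False by simp
      show "psl xs \<in> TB (Suc (N - m))" if "length xs = N" for xs using psl_mem[of xs] that by simp
    qed simp
    show ?thesis
      by (rule iffD1[OF mlin_cong mlin_add[OF 1 2]]) (auto simp: length_Suc_conv psl_Cons G_bt K)
  qed
qed simp

lemma psi_bt: "xs \<noteq> [] \<Longrightarrow> psi (bt xs) = psl xs"
  unfolding psi_def by (rule pblext[OF mlin_psl refl]) simp

lemma psi_mem: "t \<in> TB (Suc N) \<Longrightarrow> psi t \<in> TB (Suc (Suc N - m))"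
proof -
  assume t: "t \<in> TB (Suc N)"
  have "Suc N > 0" by simp
  with t show ?thesis
  proof (induction rule: TB_induct)
    case (bt a xs)
    then show ?case using psl_mem[of "a # xs"] by (simp add: psi_bt)
  qed (simp_all add: psi_lin)
qed

lemma psi_0: "t \<in> TB (Suc N) \<Longrightarrow> N \<le> m \<Longrightarrow> psi t = 0"
  by (rule TB_ext[of t "Suc N" psi "\<lambda>_. 0"]) (auto simp: psi_lin psi_bt psl_0)

text \<open>The recursion \<open>psl_Cons\<close> for arbitrary tensors, with the first insertion
  expressed through \<open>G\<close>. The properties of \<open>psi\<close> are proved by induction
  along it.\<close>

lemma psi_sg:
  assumes t: "t \<in> TB (Suc N)"
  shows "psi (sg a t) = sg a (G N (sg 1 t)) + ksgn (int m - 1) (sg a (psi t))"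
  by (rule TB_ext[OF t]) (auto simp: psi_lin sg_lin G_lin ksgn_add psi_bt psl_Cons G_bt)

lemma psi_lB:
  assumes t: "t \<in> TB (Suc (Suc N))"
  shows "psi (lB c t) = lB c (psi t)"
proof (rule TB_ext[OF t])
  fix b and xs :: "'a list" assume l: "Suc (length xs) = Suc (Suc N)"
  have m: "bt xs \<in> TB (Suc N)" "Suc N > 0" using l by auto
  have e: "bt (b # xs) = sg b (bt xs)" by simp
  have s: "sg 1 (bt xs) \<in> TB (Suc (Suc N))" using l by simp
  show "psi (lB c (bt (b # xs))) = lB c (psi (bt (b # xs)))"
    unfolding e lB_sg[OF m] psi_sg[OF m(1)] B_lin lB_sg[OF G_mem[OF s] zero_less_Suc] lB_sg[OF psi_mem[OF m(1)] zero_less_Suc] ..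
qed (auto simp: psi_lin B_lin)

lemma psi_rB: "t \<in> TB (Suc N) \<Longrightarrow> psi (rB t c) = rB (psi t) c"
proof (induction N arbitrary: t)
  case 0
  then show ?case using psi_0[of _ 0] rB_mem[of t "Suc 0" c] by (simp add: B_lin)
next
  case (Suc N)
  from Suc(2) zero_less_Suc show ?case
  proof (rule TB_ext)
    fix b and xs :: "'a list" assume l: "Suc (length xs) = Suc (Suc N)"
    have m: "bt xs \<in> TB (Suc N)" "Suc N > 0" using l by auto
    have e: "bt (b # xs) = sg b (bt xs)" by simp
    have r: "rB (bt xs) c \<in> TB (Suc N)" using m by simp
    have s: "sg 1 (bt xs) \<in> TB (Suc (Suc N))" using l by simp
    have G: "G N (sg 1 (rB (bt xs) c)) = rB (G N (sg 1 (bt xs))) c"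
      unfolding rB_sg[OF m, symmetric]
      using hom_ract[OF cpx_bim[OF cpx_Bar] G_hom, of "sg 1 (bt xs)" N c] s unfolding crr_TB by (simp add: bar_l)
    show "psi (rB (bt (b # xs)) c) = rB (psi (bt (b # xs))) c"
      unfolding e rB_sg[OF m] psi_sg[OF m(1)] psi_sg[OF r] B_lin rB_sg[OF G_mem[OF s] zero_less_Suc]
        rB_sg[OF psi_mem[OF m(1)] zero_less_Suc] G Suc(1)[OF m(1)] ..
  qed (auto simp: psi_lin B_lin)
qed

lemma psi_hom: "deg_hom Bar Bar (1 - int m) (\<lambda>_. psi)"
  unfolding deg_hom_def
proof (intro allI bimod_homI)
  fix i x y a assume x: "x \<in> crr Bar i"
  show "psi x \<in> crr Bar (i + (1 - int m))"
    using x
  proof (cases rule: bar_case)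
    case (2 N)
    show ?thesis
    proof (cases "m \<le> N")
      case True
      then have i: "i + (1 - int m) = int (Suc N - m)" using 2(1) by (simp add: of_nat_diff)
      show ?thesis using psi_mem[OF 2(2)] True unfolding i crr_TB[symmetric] by (simp add: Suc_diff_le)
    next
      case False
      then show ?thesis using psi_0[OF 2(2)] by simp
    qed
  qed (simp add: psi_lin)
  show "psi (x + y) = psi x + psi y" by (rule psi_lin)
  show "psi (lact (obj Bar i) a x) = lact (obj Bar (i + (1 - int m))) a (psi x)"
    using x by (cases rule: bar_case) (simp_all add: bar_l psi_lin B_lin psi_lB)
  show "psi (ract (obj Bar i) x a) = ract (obj Bar (i + (1 - int m))) (psi x) a"
    using x by (cases rule: bar_case) (simp_all add: bar_l psi_lin B_lin psi_rB)
qed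

text \<open>A right contraction acts on the last letters and lets the new first letter pass; the
  left piece grows by one degree, whence the sign.\<close>

lemma Rop_sg:
  assumes t: "t \<in> TB (Suc (Suc N))" and m: "m \<le> N"
  shows "R (int (Suc N)) (Dlt (sg a t)) = ksgn (int m) (sg a (R (int N) (Dlt t)))"
proof (rule TB_ext[OF t])
  fix b and xs :: "'a list" assume l: "Suc (length xs) = Suc (Suc N)"
  have d: "Suc N - m = Suc (N - m)" using m by simp
  have k: "bt (b # take (N - m) xs @ [1]) \<in> TB (Suc (Suc (N - m)))" using l by simp
  have s: "ksgn (int (Suc (N - m)) * int m) y = ksgn (int m) (ksgn (int (N - m) * int m) y)" for y :: "'a list \<Rightarrow>\<^sub>0 'k"
    by (simp add: ksgn_ksgn algebra_simps)
  show "R (int (Suc N)) (Dlt (sg a (bt (b # xs)))) = ksgn (int m) (sg a (R (int N) (Dlt (bt (b # xs)))))"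
    using l m rB_sg[OF k, of a]
    by (simp add: Dlt_bt Rop_Dll[of _ "Suc N"] Rop_Dll[of _ N] d s sg_lin del: of_nat_Suc)
qed (auto simp: Dlt_lin Rop_lin sg_lin ksgn_add)

lemma \<beta>_Lop:
  assumes w: "w \<in> crr BB k"
  shows "zext \<beta> (k - int m) (L k w) = g k (Rop Bar 0 (zext \<beta>) k w)"
proof (rule QQ_ext[OF cpx_Bar _ _ _ w, where u = "- int m" and u' = "- int m" and R = Alg and
    F = "\<lambda>k w. zext \<beta> (k - int m) (L k w)" and G = "\<lambda>k w. g k (Rop Bar 0 (zext \<beta>) k w)"])
  show "deg_hom BB Alg (- int m) (\<lambda>k w. zext \<beta> (k - int m) (L k w))"
    by (rule deg_hom_comp[OF _ Lop[OF cpx_Bar g] z\<beta>]) simp_all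
  show "deg_hom BB Alg (- int m) (\<lambda>k w. g k (Rop Bar 0 (zext \<beta>) k w))"
    by (rule deg_hom_comp[OF _ R\<beta> g]) simp_all
  fix i x j y assume h: "i + j = k" "x \<in> crr Bar i" "y \<in> crr Bar j"
  show "zext \<beta> (k - int m) (L k (tp i x j y)) = g k (Rop Bar 0 (zext \<beta>) k (tp i x j y))"
    using h cochain_Lop[OF cpx_Bar g z\<beta>' h(2,3), of "k - int m"] cochain_Rop[OF cpx_Bar z\<beta>' g h(2,3), of k]
    by (simp add: Lop_tprod[OF cpx_Bar g] Rop_tprod[OF cpx_Bar z\<beta>'])
qed

end

text \<open>Only the cut after the first letter \<open>a\<close> survives, and
  \<open>a \<otimes> 1\<close> has augmentation \<open>a\<close>. Together with
  \<open>R\<beta>_Dlt\<close> this strict counitality permits \<open>\<kappa> = 0\<close>.\<close>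

lemma L\<beta>_Dlt: "t \<in> crr Bar n \<Longrightarrow> Lop Bar 0 (zext \<beta>) n (Dlt t) = t"
proof (erule bar_case)
  fix N assume a: "n = int N" "t \<in> TB (Suc (Suc N))"
  have g: "deg_hom Bar Alg (- int 0) (zext \<beta>)" using z\<beta> by simp
  show "Lop Bar 0 (zext \<beta>) n (Dlt t) = t"
    using Lop_Dll[OF g] a(1) \<beta>_bt[of _ 1]
    by (intro TB_ext[OF a(2), of "\<lambda>t. Lop Bar 0 (zext \<beta>) n (Dlt t)"]) (auto simp: Dlt_lin Lop_lin Dlt_bt zext_def)
qed (simp add: Dlt_lin Lop_lin)

lemma R\<beta>_Dlt: "t \<in> crr Bar n \<Longrightarrow> Rop Bar 0 (zext \<beta>) n (Dlt t) = t"
proof (erule bar_case)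
  fix N assume a: "n = int N" "t \<in> TB (Suc (Suc N))"
  have g: "deg_hom Bar Alg (- int 0) (zext \<beta>)" using z\<beta> by simp
  show "Rop Bar 0 (zext \<beta>) n (Dlt t) = t"
  proof (rule TB_ext[OF a(2), of "\<lambda>t. Rop Bar 0 (zext \<beta>) n (Dlt t)"])
    fix b and xs :: "'a list" assume l: "Suc (length xs) = Suc (Suc N)"
    then obtain ys c where xs: "xs = ys @ [c]" "length ys = N" by (cases xs rule: rev_cases) auto
    have "rB (bt (b # ys @ [1])) c = bt (b # ys @ [c])" using rB_bt[of "b # ys" 1 c] by simp
    then show "Rop Bar 0 (zext \<beta>) n (Dlt (bt (b # xs))) = bt (b # xs)"
      using Rop_Dll[OF g, of "b # xs" N] a(1) \<beta>_bt[of 1 c] xs by (simp add: Dlt_bt zext_def)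
  qed (auto simp: Dlt_lin Rop_lin)
qed (simp add: Dlt_lin Rop_lin)

text \<open>Induction along \<open>a \<otimes> t\<close> with the recursion \<open>Dlt_sg\<close>.
  The term in which \<open>SA_d\<close> augments the left factor is evaluated by
  \<open>L\<beta>_Dlt\<close> and cancels against a part of the differential of the first
  summand.\<close>

lemma Dlt_d1: "t \<in> TB (Suc (Suc N)) \<Longrightarrow> Dlt (diff Bar (int N) t) = diff BB (int N) (Dlt t)"
proof (induction N arbitrary: t)
  case (0 t)
  have "diff BB 0 (Dlt t) \<in> crr BB (- 1)" using Dlt_mem[OF 0[unfolded crr_TB]] by simp
  then have "diff BB 0 (Dlt t) = 0" using BB_neg[of "- 1"] by simp
  then show ?case by (simp add: bar_simps Dlt_lin)
next
  case (Suc N t)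
  from Suc(2) zero_less_Suc show ?case
  proof (rule TB_ext)
    fix a and xs :: "'a list" assume l: "Suc (length xs) = Suc (Suc (Suc N))"
    let ?n = "int (Suc N)"
    let ?t = "bt xs"
    have m: "?t \<in> TB (Suc (Suc N))" "Suc (Suc N) > 0" using l by auto
    note mB = m(1)[unfolded crr_TB]
    have e: "bt (a # xs) = sg a ?t" by simp
    have d: "dB ?t \<in> TB (Suc N)" "Suc N > 0" using m by auto
    have n: "int (Suc (Suc N)) - 1 = ?n" "int N + 1 = ?n" "?n - 1 = int N" "int (Suc N) - 1 = int N" by simp_all
    have D: "Dlt ?t \<in> crr BB (int N)" using Dlt_mem[OF mB] by simp
    have s1: "sg 1 ?t \<in> crr Bar ?n" by (rule sg_crr[OF mB]) simp
    have s2: "sg 1 (dB ?t) \<in> crr Bar (int N)" using d by (simp add: crr_TB[symmetric])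
    \<comment> \<open>For \<open>N = 0\<close> the two differentials disagree, but
      \<open>Dlt\<close> vanishes on tensors with one factor.\<close>
    have dN: "Dlt (diff Bar (int N) ?t) = Dlt (dB ?t)"
      using Dlt_1[of "dB ?t"] d by (cases "N = 0") (auto simp: bar_simps Dlt_lin simp del: dB_bt)
    have dn: "diff Bar ?n x = dB x" for x by (simp add: bar_simps)
    have ds: "diff Bar ?n (sg 1 ?t) = ?t - sg 1 (dB ?t)"
      unfolding dn using dB_sg[OF m, of 1] lB_l(3)[OF m] by simp
    have "diff BB ?n (Dlt (sg a ?t)) = diff BB ?n (tp 0 (bt [a, 1]) ?n (sg 1 ?t)) + diff BB ?n (SA a (Dlt ?t))"
      unfolding Dlt_sg[OF m] n using s1 D by (simp add: d_add)
    also have "diff BB ?n (tp 0 (bt [a, 1]) ?n (sg 1 ?t)) = tp 0 (bt [a, 1]) (int N) ?t - tp 0 (bt [a, 1]) (int N) (sg 1 (dB ?t))"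
    proof -
      have "diff Bar 0 (bt [a, 1]) = 0" by (simp add: bar_simps)
      then have "diff BB ?n (tp 0 (bt [a, 1]) ?n (sg 1 ?t)) = tp 0 (bt [a, 1]) (int N) (diff Bar ?n (sg 1 ?t))"
        using s1 by (subst diff_tprod) (simp_all del: sg_bt)
      then show ?thesis unfolding ds using mB s2 by (simp add: tprod_lin del: sg_bt dB_bt)
    qed
    also have "diff BB ?n (SA a (Dlt ?t)) = lact (obj BB (int N)) a (Dlt ?t) - tp 0 (bt [a, 1]) (int N) ?t - SA a (Dlt (dB ?t))"
      using SA_d[OF D, of a] unfolding n L\<beta>_Dlt[OF mB] Suc(1)[OF m(1), symmetric] dN by (simp add: eq_diff_eq)
    also have "tp 0 (bt [a, 1]) (int N) ?t - tp 0 (bt [a, 1]) (int N) (sg 1 (dB ?t)) +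
        (lact (obj BB (int N)) a (Dlt ?t) - tp 0 (bt [a, 1]) (int N) ?t - SA a (Dlt (dB ?t))) =
      Dlt (lB a ?t - sg a (dB ?t))"
      unfolding Dlt_lin Dlt_sg[OF d] n Dlt_lB[OF mB] by (simp del: dB_bt)
    also have "\<dots> = Dlt (diff Bar ?n (sg a ?t))" unfolding dn dB_sg[OF m] ..
    finally show "Dlt (diff Bar ?n (bt (a # xs))) = diff BB ?n (Dlt (bt (a # xs)))" unfolding e ..
  next
    fix x y assume xy: "x \<in> TB (Suc (Suc (Suc N)))" "y \<in> TB (Suc (Suc (Suc N)))"
    then show "Dlt (diff Bar (int (Suc N)) (x + y)) = Dlt (diff Bar (int (Suc N)) x) + Dlt (diff Bar (int (Suc N)) y)"
      unfolding crr_TB by (simp only: d_add[OF cpx_Bar] Dlt_lin)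
    show "diff BB (int (Suc N)) (Dlt (x + y)) = diff BB (int (Suc N)) (Dlt x) + diff BB (int (Suc N)) (Dlt y)"
      using xy Dlt_mem[of _ "int (Suc N)"] unfolding crr_TB by (simp only: Dlt_lin d_add[OF cBB])
  qed
qed

lemma Dlt_d: "t \<in> crr Bar n \<Longrightarrow> Dlt (diff Bar n t) = diff BB n (Dlt t)"
  by (erule bar_case) (simp_all add: Dlt_d1 Dlt_lin)

lemma lifting_data_Bar: "lifting_data Bar \<beta> (\<lambda>_. Dlt) (\<lambda>_ _. 0)"
  unfolding lifting_data_def
  using resolves_Bar Dlt_hom Dlt_d deg_hom_zero[OF cpx_Bar] L\<beta>_Dlt R\<beta>_Dlt by (simp add: del_def)

text \<open>The sign bookkeeping for the inductive step of \<open>psi_d1\<close> on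
  \<open>a \<otimes> t\<close>. There \<open>v\<close> is the left contraction of the diagonal of
  \<open>a \<otimes> t\<close>, \<open>p\<close> is \<open>a\<close> times the insertion into
  \<open>t\<close>, \<open>q\<close> is \<open>a \<otimes> G(1 \<otimes> d t)\<close>,
  \<open>r\<close> is \<open>a \<otimes> psi(d t)\<close>, and \<open>w\<close>, \<open>z\<close>
  are the left and right contractions of the diagonal of \<open>t\<close> with \<open>a\<close>
  prefixed.\<close>

lemma psi_d_sign: "p - (q + ksgn (m - 1) r) + ksgn m (v - ksgn m (w - q) + ksgn (m - 1) (p - (w - z - ksgn m r))) =
    ksgn m (v - ksgn m z)"
  by (cases "even m") (auto simp: ksgn_def)

text \<open>Three ranges of degrees behave differently. Below \<open>m\<close> there is no room for
  \<open>g\<close> and everything vanishes. In degree \<open>m\<close> there is one insertion, and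
  the augmentation hidden in its differential produces the right contraction. Above \<open>m\<close>
  the recursions for \<open>psi\<close> and \<open>dB\<close> reduce the claim to the tail.\<close>

lemma psi_d1:
  assumes g: "g \<in> cocycles scale Bar (int m)"
    and t0: "t \<in> TB (Suc (Suc N))"
  shows "psi m g (diff Bar (int N) t) + ksgn (int m) (diff Bar (int N + 1 - int m) (psi m g t)) =
    ksgn (int m) (del Bar (int m) g (int N) (Dlt t))"
proof -
  note gh = cocyclesD(1)[OF g]
  let ?L = "Lop Bar (int m) g" and ?R = "Rop Bar (int m) g"
  let ?G = "G m g"
  have add: "psi m g (diff Bar (int N) (x + y)) + ksgn (int m) (diff Bar (int N + 1 - int m) (psi m g (x + y))) =
     psi m g (diff Bar (int N) x) + ksgn (int m) (diff Bar (int N + 1 - int m) (psi m g x)) +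
     (psi m g (diff Bar (int N) y) + ksgn (int m) (diff Bar (int N + 1 - int m) (psi m g y)))"
    "ksgn (int m) (del Bar (int m) g (int N) (Dlt (x + y))) = ksgn (int m) (del Bar (int m) g (int N) (Dlt x)) +
      ksgn (int m) (del Bar (int m) g (int N) (Dlt y))"
    if "x \<in> TB (Suc (Suc N))" "y \<in> TB (Suc (Suc N))" for x y N
  proof -
    have p: "psi m g x \<in> crr Bar (int N + 1 - int m)" "psi m g y \<in> crr Bar (int N + 1 - int m)"
      using that dh_mem[OF cpx_Bar psi_hom[OF gh], of _ "int N" "int N + 1 - int m"] unfolding crr_TB by simp_all
    show "psi m g (diff Bar (int N) (x + y)) + ksgn (int m) (diff Bar (int N + 1 - int m) (psi m g (x + y))) =
     psi m g (diff Bar (int N) x) + ksgn (int m) (diff Bar (int N + 1 - int m) (psi m g x)) +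
     (psi m g (diff Bar (int N) y) + ksgn (int m) (diff Bar (int N + 1 - int m) (psi m g y)))"
      using that p unfolding crr_TB by (simp add: psi_lin[OF gh] d_add ksgn_add)
    show "ksgn (int m) (del Bar (int m) g (int N) (Dlt (x + y))) = ksgn (int m) (del Bar (int m) g (int N) (Dlt x)) +
      ksgn (int m) (del Bar (int m) g (int N) (Dlt y))"
      by (simp add: del_def Dlt_lin Lop_lin Rop_lin ksgn_add ksgn_diff)
  qed
  have lt: "psi m g (diff Bar (int N) t) + ksgn (int m) (diff Bar (int N + 1 - int m) (psi m g t)) =
    ksgn (int m) (del Bar (int m) g (int N) (Dlt t))" if t: "t \<in> TB (Suc (Suc N))" and N: "N < m" for N t
  proof -
    have 1: "psi m g t = 0" by (rule psi_0[OF gh t]) (use N in simp)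
    have 2: "psi m g (diff Bar (int N) t) = 0"
    proof (cases "N = 0")
      case True
      then show ?thesis by (simp add: bar_simps psi_lin[OF gh])
    next
      case False
      have "dB t \<in> TB (Suc N)" using t by simp
      from psi_0[OF gh this] show ?thesis using N False by (simp add: bar_simps)
    qed
    have "del Bar (int m) g (int N) (Dlt t) \<in> crr Bar (int N - int m)"
      using dh_mem[OF cBB del_hom[OF cpx_Bar gh] Dlt_mem[OF t[unfolded crr_TB] refl]] by simp
    then have "del Bar (int m) g (int N) (Dlt t) = 0" using N by (simp add: bar_simps)
    then show ?thesis using 1 2 by simp
  qed
  have eqc: "psi m g (diff Bar (int m) t) + ksgn (int m) (diff Bar (int m + 1 - int m) (psi m g t)) =
    ksgn (int m) (del Bar (int m) g (int m) (Dlt t))" if t: "t \<in> TB (Suc (Suc m))" for t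
  proof (rule TB_ext[OF t])
    fix a and xs :: "'a list" assume l: "Suc (length xs) = Suc (Suc m)"
    let ?t = "bt xs"
    have tm: "?t \<in> TB (Suc m)" "Suc m > 0" using l by auto
    have e: "bt (a # xs) = sg a ?t" "bt (a # xs) = lB a (sg 1 ?t)" by simp_all
    have s: "sg 1 ?t \<in> TB (Suc (Suc m))" using l by simp
    note sB = s[unfolded crr_TB]
    let ?u = "?G m (sg 1 ?t)"
    have u: "?u \<in> TB 2" using G_mem[OF gh s] by (simp add: numeral_2_eq_2)
    have 1: "psi m g (diff Bar (int m) (bt (a # xs))) = 0"
    proof (cases "m = 0")
      case True
      then show ?thesis using psi_lin(2)[OF gh] by (simp add: bar_simps)
    next
      case False
      have "dB (bt (a # xs)) \<in> TB (Suc m)" by (rule dB_mem[of _ "Suc (Suc m)"]) (use l in simp_all)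
      from psi_0[OF gh this] show ?thesis using False by (simp add: bar_simps)
    qed
    have "psi m g ?t = 0" by (rule psi_0[OF gh tm(1)]) simp
    then have 2: "psi m g (bt (a # xs)) = sg a ?u" unfolding e(1) psi_sg[OF gh tm(1)] by (simp del: sg_bt)
    \<comment> \<open>Augmenting the left contraction amounts to \<open>g\<close> of the right
      counit contraction of the diagonal, which is the identity.\<close>
    have b: "\<beta> ?u = g (int m) (sg 1 ?t)"
      using \<beta>_Lop[OF gh, of "Dlt (sg 1 ?t)" "int m"] Dlt_mem[OF sB refl] R\<beta>_Dlt[OF sB]
      by (simp add: G_def[OF gh] zext_def del: sg_bt)
    have 3: "diff Bar (int m + 1 - int m) (sg a ?u) = lB a ?u - rB (bt [a, 1]) (g (int m) (sg 1 ?t))"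
      using dB_sg[OF u, of a] dB_2[OF u] sg_bt1[of a "\<beta> ?u"] b by (simp add: bar_simps del: sg_bt)
    have 4: "?L (int m) (Dlt (bt (a # xs))) = lB a ?u"
      unfolding e(2) using hom_lact[OF cpx_bim[OF cpx_Bar] G_hom[OF gh] sB, of a] by (simp add: G_def[OF gh] bar_l del: sg_bt)
    have 5: "?R (int m) (Dlt (bt (a # xs))) = rB (bt [a, 1]) (g (int m) (sg 1 ?t))"
      using Rop_Dll[OF gh, of "a # xs" m] l by (simp add: Dlt_bt)
    show "psi m g (diff Bar (int m) (bt (a # xs))) + ksgn (int m) (diff Bar (int m + 1 - int m) (psi m g (bt (a # xs)))) =
      ksgn (int m) (del Bar (int m) g (int m) (Dlt (bt (a # xs))))"
      unfolding 1 2 3 del_def 4 5 by simp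
  qed (simp, (rule add; assumption)+)
  show ?thesis
    using t0
  proof (induction N arbitrary: t)
    case (0 t)
    show ?case using lt[OF 0] eqc 0 by (cases "m = 0") auto
  next
    case (Suc N t)
    show ?case
    proof (cases "m \<le> N")
      case False
      then show ?thesis using lt[OF Suc(2)] eqc[of t] Suc(2) by (cases "m = Suc N") auto
    next
      case True
      show ?thesis
      proof (rule TB_ext[OF Suc(2)])
        fix a and xs :: "'a list" assume l: "Suc (length xs) = Suc (Suc (Suc N))"
        let ?n = "int (Suc N)"
        let ?t = "bt xs"
        have tm: "?t \<in> TB (Suc (Suc N))" "Suc (Suc N) > 0" using l by auto
        note tB = tm(1)[unfolded crr_TB]
        have e: "bt (a # xs) = sg a ?t" "bt (a # xs) = lB a (sg 1 ?t)" by simp_all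
        have d: "dB ?t \<in> TB (Suc N)" using tm by auto
        have s: "sg 1 ?t \<in> TB (Suc (Suc (Suc N)))" using l by simp
        note sB = s[unfolded crr_TB]
        let ?u = "?G (Suc N) (sg 1 ?t)"
        have u: "?u \<in> TB (Suc (Suc (Suc N) - m))" by (rule G_mem[OF gh s])
        have p: "psi m g ?t \<in> TB (Suc (Suc (Suc N) - m))" by (rule psi_mem[OF gh tm(1)])
        have dn: "diff Bar ?n x = dB x" "diff Bar (?n + 1 - int m) x = dB x" "diff Bar (int N + 1 - int m) x = dB x" for x
          using True by (simp_all add: bar_simps)
        have dN: "psi m g (diff Bar (int N) ?t) = psi m g (dB ?t)"
          using psi_0[OF gh d] by (cases "N = 0") (auto simp: bar_simps psi_lin[OF gh] simp del: dB_bt)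
        have ds: "dB (sg 1 ?t) = ?t - sg 1 (dB ?t)"
          using dB_sg[OF tm, of 1] lB_l(3)[OF tm] by simp
        \<comment> \<open>\<open>G\<close> is composed of maps that commute with the differentials
          up to sign, so this is the left contraction of the diagonal of
          \<open>d (1 \<otimes> t) = t - 1 \<otimes> d t\<close>.\<close>
        have du: "dB ?u = ksgn (int m) (?L (int N) (Dlt ?t) - ?G N (sg 1 (dB ?t)))"
        proof -
          have D: "Dlt (sg 1 ?t) \<in> crr BB ?n" using Dlt_mem[OF sB] by simp
          have n: "?n - 1 = int N" "?n - int m = int N + 1 - int m" by simp_all
          have 1: "?L (int N) (diff BB ?n (Dlt (sg 1 ?t))) = ksgn (int m) (dB ?u)"
            using Lop_chain[OF cpx_Bar g D] unfolding n dn(3) G_def[OF gh] .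
          have 2: "diff BB ?n (Dlt (sg 1 ?t)) = Dlt ?t - Dlt (sg 1 (dB ?t))"
          proof -
            have "diff BB ?n (Dlt (sg 1 ?t)) = Dlt (diff Bar ?n (sg 1 ?t))" by (rule Dlt_d[OF sB, symmetric])
            also have "\<dots> = Dlt (?t - sg 1 (dB ?t))" unfolding dn(1) ds ..
            also have "\<dots> = Dlt ?t - Dlt (sg 1 (dB ?t))" by (rule Dlt_lin)
            finally show ?thesis .
          qed
          have 3: "?L (int N) (x - y) = ?L (int N) x - ?L (int N) y" for x y
            by (simp add: Lop_def bar_l plext_linear)
          have "ksgn (int m) (dB ?u) = ?L (int N) (diff BB ?n (Dlt (sg 1 ?t)))" by (rule 1[symmetric])
          also have "\<dots> = ?L (int N) (Dlt ?t) - ?G N (sg 1 (dB ?t))" unfolding 2 3 G_def[OF gh] ..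
          finally have "ksgn (int m) (dB ?u) = ?L (int N) (Dlt ?t) - ?G N (sg 1 (dB ?t))" .
          from arg_cong[OF this, of "ksgn (int m)"] show ?thesis unfolding ksgn_self .
        qed
        have IH: "psi m g (dB ?t) + ksgn (int m) (dB (psi m g ?t)) = ksgn (int m) (?L (int N) (Dlt ?t) - ?R (int N) (Dlt ?t))"
          using Suc(1)[OF tm(1)] unfolding dN dn del_def .
        have IH': "dB (psi m g ?t) = ?L (int N) (Dlt ?t) - ?R (int N) (Dlt ?t) - ksgn (int m) (psi m g (dB ?t))"
          using arg_cong[OF IH, of "ksgn (int m)"] by (simp add: ksgn_add eq_diff_eq add.commute)
        have A: "psi m g (dB (sg a ?t)) = lB a (psi m g ?t) - (sg a (?G N (sg 1 (dB ?t))) + ksgn (int m - 1) (sg a (psi m g (dB ?t))))"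
          unfolding dB_sg[OF tm] psi_lin[OF gh] psi_lB[OF gh tm(1)] psi_sg[OF gh d] ..
        have B: "dB (psi m g (sg a ?t)) = lB a ?u - sg a (dB ?u) + ksgn (int m - 1) (lB a (psi m g ?t) - sg a (dB (psi m g ?t)))"
          unfolding psi_sg[OF gh tm(1)] B_lin dB_sg[OF u zero_less_Suc] dB_sg[OF p zero_less_Suc] ..
        have L1: "?L ?n (Dlt (sg a ?t)) = lB a ?u"
          unfolding e(1)[symmetric] e(2)
          using hom_lact[OF cpx_bim[OF cpx_Bar] G_hom[OF gh] sB, of a] by (simp add: G_def[OF gh] bar_l del: sg_bt)
        show "psi m g (diff Bar ?n (bt (a # xs))) + ksgn (int m) (diff Bar (?n + 1 - int m) (psi m g (bt (a # xs)))) =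
          ksgn (int m) (del Bar (int m) g ?n (Dlt (bt (a # xs))))"
          unfolding e(1) dn A B del_def L1 Rop_sg[OF gh tm(1) True] du IH' sg_lin
          by (rule psi_d_sign)
      qed (simp, (rule add; assumption)+)
    qed
  qed
qed

lemma hlift_Bar:
  assumes g: "g \<in> cocycles scale Bar (int m)"
  shows "hlift Bar \<beta> (\<lambda>_. Dlt) (\<lambda>_ _. 0) (int m) g (\<lambda>_. psi m g)"
  unfolding hlift_def
proof (intro conjI allI ballI exI[of _ "\<lambda>_ _. 0"])
  note gh = cocyclesD(1)[OF g]
  show "deg_hom Bar Bar (1 - int m) (\<lambda>_. psi m g)" by (rule psi_hom[OF gh])
  show "deg_hom Bar Alg (2 - int m) (\<lambda>_ _. 0)" by (rule deg_hom_zero) simp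
  fix i x assume x: "x \<in> crr Bar i"
  show "psi m g (diff Bar i x) + ksgn (int m) (diff Bar (i + 1 - int m) (psi m g x)) = ksgn (int m) (del Bar (int m) g i (Dlt x))"
    using x by (cases rule: bar_case) (simp_all add: psi_d1[OF g] psi_lin[OF gh] Dlt_lin del_def Lop_lin Rop_lin)
  \<comment> \<open>Degree 0 of the target is reached from degree \<open>m - 1\<close>, where no
    insertion is possible.\<close>
  have "zext \<beta> (i + 1 - int m) (psi m g x) = 0"
  proof (cases "i + 1 - int m = 0")
    case True
    from x show ?thesis
    proof (cases rule: bar_case)
      case (2 N)
      have "psi m g x = 0" by (rule psi_0[OF gh 2(2)]) (use 2(1) True in simp)
      then show ?thesis by (simp add: \<beta>_0 zext_def)
    qed (simp add: psi_lin[OF gh] zext_def \<beta>_0)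
  qed (simp add: zext_def)
  then show "zext \<beta> (i + 1 - int m) (psi m g x) = - ksgn (int m) (g (i + 1) 0) + 0"
    by (simp add: dh_0[OF cpx_Bar gh])
qed

lemma lifting_system_Bar: "lifting_system Bar \<beta> (\<lambda>_. Dlt) (\<lambda>_ _. 0) (\<lambda>m g _. psi (nat m) g)"
  unfolding lifting_system_def
proof (intro conjI allI impI ballI)
  fix m g assume "0 \<le> m" "g \<in> cocycles scale Bar m"
  then show "hlift Bar \<beta> (\<lambda>_. Dlt) (\<lambda>_ _. 0) m g (\<lambda>_. psi (nat m) g)" using hlift_Bar[of g "nat m"] by simp
qed (rule lifting_data_Bar)


section \<open>The Gerstenhaber bracket as a bracket of homotopy liftings\<close>

lemma dh_sum:
  assumes "cpx P" "deg_hom P Q t f" "\<And>k. k \<in> S \<Longrightarrow> h k \<in> crr P i"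
  shows "sum h S \<in> crr P i \<and> f i (sum h S) = (\<Sum>k\<in>S. f i (h k))"
  using assms(3)
proof (induction S rule: infinite_finite_induct)
  case (insert k S)
  then have "sum h S \<in> crr P i" "f i (sum h S) = (\<Sum>k\<in>S. f i (h k))" "h k \<in> crr P i" by auto
  then show ?case using insert(1,2) assms(1) by (simp add: dh_add[OF assms(1,2)])
qed (simp_all add: assms(1) dh_0[OF assms(1,2)])

text \<open>On \<open>1 \<otimes> w \<otimes> 1\<close> the position \<open>i\<close> of the circle
  product corresponds to the summand \<open>k = i - 1\<close> of the insertion, and the signs agree
  term by term. The length of \<open>w\<close> leaves exactly \<open>n\<close> positions.\<close>

lemma gcirc_psi:
  assumes f: "deg_hom Bar Alg (- int n) f" and g: "deg_hom Bar Alg (- int m) g" and l: "length w + 1 = n + m"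
  shows "gcirc n m (to_cochain scale n f) (to_cochain scale m g) w = f (int n) (psi m g (bt (1 # w @ [1])))"
proof -
  let ?s = "\<lambda>k. ksgn ((int m - 1) * int k)"
  let ?u = "\<lambda>k. bt (1 # take k w @ g (int m) (bt (1 # take m (drop k w) @ [1])) # drop (k + m) w @ [1])"
  have "psi m g (bt (1 # w @ [1])) = psl m g (1 # w @ [1])" by (rule psi_bt[OF g]) simp
  also have "\<dots> = (\<Sum>k<n. ?s k (?u k))"
    unfolding psl_def[OF g] by (intro sum.cong) (use l in auto)
  finally have e: "psi m g (bt (1 # w @ [1])) = (\<Sum>k<n. ?s k (?u k))" .
  have m: "?u k \<in> crr Bar (int n)" if "k < n" for k
    by (rule bt_crr) (use that l in auto)
  have "f (int n) (\<Sum>k<n. ?s k (?u k)) = (\<Sum>k<n. f (int n) (?s k (?u k)))"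
    by (rule dh_sum[OF cpx_Bar f, THEN conjunct2]) (use m in simp)
  also have "\<dots> = (\<Sum>k<n. ?s k (f (int n) (?u k)))"
    by (intro sum.cong refl dh_ksgn[OF cpx_Bar f]) (use m in simp)
  also have "\<dots> = gcirc n m (to_cochain scale n f) (to_cochain scale m g) w"
    unfolding gcirc_def One_nat_def sum.atLeast1_atMost_eq
    by (intro sum.cong refl) (simp add: gcirc_at_def to_cochain_def)
  finally show ?thesis unfolding e by simp
qed

text \<open>Both sides vanish outside degree \<open>n + m - 1\<close>; in that degree both are
  determined by their values on \<open>1 \<otimes> w \<otimes> 1\<close>, which
  \<open>gcirc_psi\<close> computes. Multilinearity of the list formula is inferred from that of the
  right side.\<close>

lemma bar_bracket_eq:
  assumes f: "f \<in> cocycles scale Bar (int n)" and g: "g \<in> cocycles scale Bar (int m)" and x: "x \<in> crr Bar i"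
  shows "bar_bracket scale n m f g i x = brs (\<lambda>m g _. psi (nat m) g) (int n) (int m) f g i x"
proof -
  note fh = cocyclesD(1)[OF f] and gh = cocyclesD(1)[OF g]
  let ?F = "brs (\<lambda>m g _. psi (nat m) g) (int n) (int m) f g"
  let ?\<gamma> = "gbracket n m (to_cochain scale n f) (to_cochain scale m g)"
  let ?c = "\<lambda>xs. hd xs * ?\<gamma> (butlast (tl xs)) * last xs"
  have F: "deg_hom Bar Alg (- (int n + int m - 1)) ?F"
    by (rule cocyclesD(1)[OF brs_cocycle[OF lifting_system_Bar _ _ f g]]) simp_all
  show ?thesis
  proof (cases "i = int n + int m - 1")
    case False
    then show ?thesis using cochain_0[OF cpx_Bar F x] by (simp add: bar_bracket_def of_cochain_def)
  next
    case True
    have b: "bar_bracket scale n m f g i x = lext scale ?c x"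
      using True by (simp add: bar_bracket_def of_cochain_def)
    from x show ?thesis
    proof (cases rule: bar_case)
      \<comment> \<open>This occurs for \<open>n = m = 0\<close> only, when the bracket sits in
        degree -1.\<close>
      case 1
      then show ?thesis unfolding b by (simp add: dh_0[OF cpx_Bar F])
    next
      case (2 N)
      have nN: "N + 1 = n + m" "int N + 1 - int m = int n" "int N + 1 - int n = int m" using 2(1) True by simp_all
      have \<gamma>: "?\<gamma> w = ?F (int N) (bt (1 # w @ [1]))" if "length w = N" for w
        using that nN(1) gcirc_psi[OF fh gh, of w] gcirc_psi[OF gh fh, of w]
        by (simp add: gbracket_def brs_def nN(2,3) add.commute[of m n])
      have c: "?c xs = ?F (int N) (bt xs)" if "length xs = Suc (Suc N)" for xs
      proof -
        from that obtain a ys where "xs = a # ys" "length ys = Suc N" by (cases xs) auto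
        then obtain w d where xs: "xs = a # w @ [d]" and w: "length w = N" by (cases ys rule: rev_cases) auto
        have B: "bt (1 # w @ [1]) \<in> crr Bar (int N)" using w by (intro bt_crr) simp_all
        have "bt xs = lact (obj Bar (int N)) a (ract (obj Bar (int N)) (bt (1 # w @ [1])) d)"
          using rB_bt[of "1 # w" 1 d] by (simp add: bar_l xs)
        then have "?F (int N) (bt xs) = a * (?F (int N) (bt (1 # w @ [1])) * d)"
          using cochain_act[OF cpx_Bar F] B by simp
        then show ?thesis using \<gamma>[OF w] by (simp add: xs mult.assoc)
      qed
      have add: "?F (int N) (u + v) = ?F (int N) u + ?F (int N) v"
        if "u \<in> TB (Suc (Suc N))" "v \<in> TB (Suc (Suc N))" for u v
        using that unfolding crr_TB by (rule dh_add[OF cpx_Bar F])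
      have sc: "?F (int N) (pscale r u) = scale r (?F (int N) u)" if "u \<in> TB (Suc (Suc N))" for r u
      proof -
        have "bimod_hom (obj Bar (int N)) (obj Alg (int N + - (int n + int m - 1))) (?F (int N))"
          using F by (simp only: deg_hom_def)
        from hom_bscale[OF cpx_bim[OF cpx_Bar] this cpx_bim[OF cpx_Alg] that[unfolded crr_TB], of r]
        show ?thesis by (simp add: bar_l alg_cplx_def alg_bimod_def)
      qed
      have ml: "mlin (Suc (Suc N)) scale ?c"
      proof -
        have "mlin (Suc (Suc N)) scale (\<lambda>xs. ?F (int N) (bt xs))"
          using mlin_bt[of "Suc (Suc N)"] add sc unfolding mlin_def by simp
        then show ?thesis by (rule iffD1[OF mlin_cong, rotated]) (rule c[symmetric])
      qed
      have vs: "vector_space scale" by unfold_locales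
      have "lext scale ?c x = ?F (int N) x"
        using 2(2)
      proof (rule TB_ext)
        fix a and xs :: "'a list" assume "Suc (length xs) = Suc (Suc N)"
        then show "lext scale ?c (bt (a # xs)) = ?F (int N) (bt (a # xs))"
          using blext[OF vs ml, of "a # xs"] c[of "a # xs"] by simp
      qed (auto simp: lext_plus[OF vs] add)
      from trans[OF b[unfolded 2(1)] this] show ?thesis unfolding 2(1) .
    qed
  qed
qed

section \<open>Cohomology classes and comparison maps\<close>

lemma cocycles_cong:
  assumes P: "cpx P" and f: "f \<in> cocycles scale P n" and e: "\<And>i x. x \<in> crr P i \<Longrightarrow> g i x = f i x"
  shows "g \<in> cocycles scale P n" "(g, f) \<in> hh_rel scale P n"
proof -
  show g: "g \<in> cocycles scale P n"
    using deg_hom_cong[OF P cocyclesD(1)[OF f] e] cocyclesD(2)[OF f] P by (simp add: cocycles_def eq_on_def e)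
  show "(g, f) \<in> hh_rel scale P n"
    by (rule hh_relI[OF g f deg_hom_zero[OF cpx_Alg] refl]) (simp add: e)
qed

lemma hh_equiv:
  assumes P: "cpx P"
  shows "equiv (cocycles scale P n) (hh_rel scale P n)"
proof (rule equivI)
  show "hh_rel scale P n \<subseteq> cocycles scale P n \<times> cocycles scale P n" by (auto simp: hh_rel_def)
  show "refl_on (cocycles scale P n) (hh_rel scale P n)"
    by (rule refl_onI) (rule cocycles_cong(2)[OF P _ refl])
  show "sym (hh_rel scale P n)"
  proof (rule symI)
    fix f g assume "(f, g) \<in> hh_rel scale P n"
    then show "(g, f) \<in> hh_rel scale P n"
    proof (rule hh_relE)
      fix h assume h: "f \<in> cocycles scale P n" "g \<in> cocycles scale P n" "deg_hom P Alg (1 - n) h"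
        "\<And>i x. x \<in> crr P i \<Longrightarrow> f i x - g i x = h (i - 1) (diff P i x)"
      show ?thesis
        by (rule hh_relI[OF h(2,1) deg_hom_minus[OF P cpx_Alg h(3)] refl]) (simp add: h(4)[symmetric])
    qed
  qed
  show "trans (hh_rel scale P n)"
  proof (rule transI)
    fix f g k assume a: "(f, g) \<in> hh_rel scale P n" "(g, k) \<in> hh_rel scale P n"
    from a(1) show "(f, k) \<in> hh_rel scale P n"
    proof (rule hh_relE)
      fix h assume h: "f \<in> cocycles scale P n" "deg_hom P Alg (1 - n) h"
        "\<And>i x. x \<in> crr P i \<Longrightarrow> f i x - g i x = h (i - 1) (diff P i x)"
      from a(2) show ?thesis
      proof (rule hh_relE)
        fix h' assume h': "k \<in> cocycles scale P n" "deg_hom P Alg (1 - n) h'"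
          "\<And>i x. x \<in> crr P i \<Longrightarrow> g i x - k i x = h' (i - 1) (diff P i x)"
        show ?thesis
          by (rule hh_relI[OF h(1) h'(1) deg_hom_add[OF P cpx_Alg h(2) h'(2)] refl])
            (simp add: h(3)[symmetric] h'(3)[symmetric])
      qed
    qed
  qed
qed

lemma hh_trans: "cpx P \<Longrightarrow> (f, g) \<in> hh_rel scale P n \<Longrightarrow> (g, k) \<in> hh_rel scale P n \<Longrightarrow> (f, k) \<in> hh_rel scale P n"
  and hh_sym: "cpx P \<Longrightarrow> (f, g) \<in> hh_rel scale P n \<Longrightarrow> (g, f) \<in> hh_rel scale P n"
  using hh_equiv[of P n] by (auto simp: equiv_def elim: transE symE)

lemma comparison_iff:
  "comparison P \<mu> Q \<nu> \<Theta> \<longleftrightarrow> deg_hom P Q 0 \<Theta> \<and>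
     (\<forall>i. \<forall>x\<in>crr P i. \<Theta> (i - 1) (diff P i x) = diff Q i (\<Theta> i x)) \<and> (\<forall>x\<in>crr P 0. \<nu> (\<Theta> 0 x) = \<mu> x)"
  by (simp add: comparison_def chain_map_def eq_on_def bd_def)

lemma comparisonD:
  assumes "comparison P \<mu> Q \<nu> \<Theta>"
  shows "deg_hom P Q 0 \<Theta>" "x \<in> crr P i \<Longrightarrow> \<Theta> (i - 1) (diff P i x) = diff Q i (\<Theta> i x)"
    "y \<in> crr P 0 \<Longrightarrow> \<nu> (\<Theta> 0 y) = \<mu> y"
  using assms by (auto simp: comparison_iff)

lemma comparison_id: "comparison P \<mu> P \<mu> idm"
  by (simp add: comparison_iff deg_hom_id)

lemma comparison_comp:
  assumes P: "cpx P" and \<Theta>: "comparison P \<mu> Q \<nu> \<Theta>" and \<Psi>: "comparison Q \<nu> S \<rho> \<Psi>"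
  shows "comparison P \<mu> S \<rho> (\<lambda>i x. \<Psi> i (\<Theta> i x))"
  unfolding comparison_iff
  using deg_hom_comp[OF P comparisonD(1)[OF \<Theta>] comparisonD(1)[OF \<Psi>], of 0 "\<lambda>i. i"]
    comparisonD(2,3)[OF \<Theta>] comparisonD(2,3)[OF \<Psi>] dh_mem[OF P comparisonD(1)[OF \<Theta>]]
  by auto

text \<open>A null homotopy of the zero map of degree -1, with augmentation prescribed to be
  \<open>\<mu>\<close>, is a comparison map.\<close>

lemma comparison_exists:
  assumes P: "resolves P \<mu>" and proj: "\<And>i. projective_bimod scale (obj P i)" and Q: "resolves Q \<nu>"
  shows "\<exists>\<Theta>. comparison P \<mu> Q \<nu> \<Theta>"
proof -
  have "\<exists>K. deg_hom P Q (- 1 + 1) K \<and>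
    (\<forall>i. \<forall>x\<in>crr P i. K (i - 1) (diff P i x) + ksgn (- 1) (diff Q (i + - 1 + 1) (K i x)) = 0) \<and>
    (\<forall>x\<in>crr P (- (- 1) - 1). \<nu> (K (- (- 1) - 1) x) = \<mu> x)"
    by (rule null_homotopy[OF resolvesD(1)[OF P] proj Q deg_hom_zero[OF resolvesD(1)[OF Q]]])
      (use resolvesD(5,8)[OF P] hom_0[OF cpx_bim[OF resolvesD(1)[OF Q]] resolvesD(5)[OF Q]]
          resolvesD(1)[OF Q] in simp_all)
  then show ?thesis by (auto simp: comparison_iff ksgn_def)
qed

lemma pull_cocycle:
  assumes P: "cpx P" and \<Theta>: "comparison P \<mu> Q \<nu> \<Theta>" and f: "f \<in> cocycles scale Q n"
  shows "(\<lambda>i x. f i (\<Theta> i x)) \<in> cocycles scale P n"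
proof -
  have "deg_hom P Alg (- n) (\<lambda>i x. f i (\<Theta> i x))"
    by (rule deg_hom_comp[OF P comparisonD(1)[OF \<Theta>] cocyclesD(1)[OF f]]) simp_all
  then show ?thesis using cocyclesD(2)[OF f] dh_mem[OF P comparisonD(1)[OF \<Theta>]] comparisonD(2)[OF \<Theta>]
    by (auto simp: cocycles_def eq_on_def)
qed

text \<open>The difference of two comparison maps has zero augmentation and is therefore null
  homotopic. A cocycle kills the summand \<open>d K\<close>, so only a coboundary remains.\<close>

lemma comparison_unique:
  assumes P: "cpx P" and proj: "\<And>i. projective_bimod scale (obj P i)" and Q: "resolves Q \<nu>"
    and \<Theta>: "comparison P \<mu> Q \<nu> \<Theta>" and \<Theta>': "comparison P \<mu> Q \<nu> \<Theta>'" and f: "f \<in> cocycles scale Q n"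
  shows "(\<lambda>i x. f i (\<Theta> i x), \<lambda>i x. f i (\<Theta>' i x)) \<in> hh_rel scale P n"
proof -
  note Qc = resolvesD(1)[OF Q] and fh = cocyclesD(1)[OF f]
  note h = comparisonD(1)[OF \<Theta>] and h' = comparisonD(1)[OF \<Theta>']
  note s = dh_mem[OF P h] dh_mem[OF P h']
  have "\<exists>K. deg_hom P Q (0 + 1) K \<and>
    (\<forall>i. \<forall>x\<in>crr P i. K (i - 1) (diff P i x) + ksgn 0 (diff Q (i + 0 + 1) (K i x)) = \<Theta> i x - \<Theta>' i x) \<and>
    (\<forall>x\<in>crr P (- 0 - 1). \<nu> (K (- 0 - 1) x) = 0)"
  proof (rule null_homotopy[OF P proj Q deg_hom_diff[OF P Qc h h'], where u = "\<lambda>_. 0"])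
    show "\<Theta> (i - 1) (diff P i x) - \<Theta>' (i - 1) (diff P i x) = ksgn 0 (diff Q (i + 0) (\<Theta> i x - \<Theta>' i x))"
      if "x \<in> crr P i" for i x
      using that comparisonD(2)[OF \<Theta> that] comparisonD(2)[OF \<Theta>' that] by (simp add: d_diff[OF Qc] s)
    show "\<nu> (\<Theta> (- 0) x - \<Theta>' (- 0) x) = 0" if "x \<in> crr P (- 0)" for x
      using that comparisonD(3)[OF \<Theta>] comparisonD(3)[OF \<Theta>']
        hom_diff[OF cpx_bim[OF Qc] resolvesD(5)[OF Q]] by (simp add: s)
  qed (simp add: bimod_hom_def alg_bimod_def)
  then obtain K where K: "deg_hom P Q 1 K"
    and Kd: "\<And>i x. x \<in> crr P i \<Longrightarrow> \<Theta> i x - \<Theta>' i x = K (i - 1) (diff P i x) + diff Q (i + 1) (K i x)"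
    by auto
  show ?thesis
  proof (rule hh_relI[OF pull_cocycle[OF P \<Theta> f] pull_cocycle[OF P \<Theta>' f]])
    show "deg_hom P Alg (1 - n) (\<lambda>i x. f (i + 1) (K i x))"
      by (rule deg_hom_comp[OF P K fh]) simp_all
    fix i x assume x: "x \<in> crr P i"
    have m: "K (i - 1) (diff P i x) \<in> crr Q i" "K i x \<in> crr Q (i + 1)" "diff Q (i + 1) (K i x) \<in> crr Q i"
      using x P Qc by (simp_all add: dh_mem[OF P K])
    have "f i (\<Theta> i x) - f i (\<Theta>' i x) = f i (\<Theta> i x - \<Theta>' i x)"
      using x by (simp add: dh_diff[OF Qc fh] s)
    also have "\<dots> = f i (K (i - 1) (diff P i x)) + f i (diff Q (i + 1) (K i x))"
      unfolding Kd[OF x] by (rule dh_add[OF Qc fh m(1,3)])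
    also have "f i (diff Q (i + 1) (K i x)) = 0" by (rule cocyclesD(3)[OF f m(2)]) simp
    finally show "f i (\<Theta> i x) - f i (\<Theta>' i x) = f (i - 1 + 1) (K (i - 1) (diff P i x))" by simp
  qed simp
qed

lemma pull_rel:
  assumes P: "cpx P" and Q: "cpx Q" and \<Theta>: "comparison P \<mu> Q \<nu> \<Theta>" and fg: "(f, g) \<in> hh_rel scale Q n"
  shows "(\<lambda>i x. f i (\<Theta> i x), \<lambda>i x. g i (\<Theta> i x)) \<in> hh_rel scale P n"
  using fg
proof (rule hh_relE)
  fix h assume h: "f \<in> cocycles scale Q n" "g \<in> cocycles scale Q n" "deg_hom Q Alg (1 - n) h"
    "\<And>i x. x \<in> crr Q i \<Longrightarrow> f i x - g i x = h (i - 1) (diff Q i x)"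
  show ?thesis
  proof (rule hh_relI[OF pull_cocycle[OF P \<Theta> h(1)] pull_cocycle[OF P \<Theta> h(2)]])
    show "deg_hom P Alg (1 - n) (\<lambda>i x. h i (\<Theta> i x))"
      by (rule deg_hom_comp[OF P comparisonD(1)[OF \<Theta>] h(3)]) simp_all
  qed (simp_all add: h(4) dh_mem[OF P comparisonD(1)[OF \<Theta>]] comparisonD(2)[OF \<Theta>])
qed

text \<open>Families are meaningful on carriers only, so \<open>B\<close> is tied to
  \<open>brs\<close> by agreement there instead of equality of functions; in cohomology the
  difference is invisible.\<close>

lemma bracket_congruent2:
  assumes proj: "\<And>i. projective_bimod scale (obj Q i)"
    and sys: "lifting_system Q \<nu> Dl \<kappa> \<Psi>" and mn: "m \<ge> 0" "n \<ge> 0"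
    and B: "\<And>f g i x. f \<in> cocycles scale Q n \<Longrightarrow> g \<in> cocycles scale Q m \<Longrightarrow> x \<in> crr Q i \<Longrightarrow>
      B f g i x = brs \<Psi> n m f g i x"
  shows "f \<in> cocycles scale Q n \<Longrightarrow> g \<in> cocycles scale Q m \<Longrightarrow> B f g \<in> cocycles scale Q (n + m - 1)"
    and "f \<in> cocycles scale Q n \<Longrightarrow> g \<in> cocycles scale Q m \<Longrightarrow> (B f g, brs \<Psi> n m f g) \<in> hh_rel scale Q (n + m - 1)"
    and "congruent2 (hh_rel scale Q n) (hh_rel scale Q m) (\<lambda>f g. hh_rel scale Q (n + m - 1) `` {B f g})"
proof -
  have Q: "cpx Q" using sys by (auto simp: lifting_system_def lifting_data_def resolves_def)
  show "B f g \<in> cocycles scale Q (n + m - 1)" and b: "(B f g, brs \<Psi> n m f g) \<in> hh_rel scale Q (n + m - 1)"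
    if "f \<in> cocycles scale Q n" "g \<in> cocycles scale Q m" for f g
    using cocycles_cong[OF Q brs_cocycle[OF sys mn that] B[OF that]] by simp_all
  show "congruent2 (hh_rel scale Q n) (hh_rel scale Q m) (\<lambda>f g. hh_rel scale Q (n + m - 1) `` {B f g})"
  proof (rule congruent2I')
    fix f f' g g' assume a: "(f, f') \<in> hh_rel scale Q n" "(g, g') \<in> hh_rel scale Q m"
    then have c: "f \<in> cocycles scale Q n" "f' \<in> cocycles scale Q n" "g \<in> cocycles scale Q m" "g' \<in> cocycles scale Q m"
      by (auto simp: hh_rel_def)
    have "(B f g, brs \<Psi> n m f' g) \<in> hh_rel scale Q (n + m - 1)"
      by (rule hh_trans[OF Q b[OF c(1,3)] brs_cong_left[OF proj sys mn c(3) a(1)]])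
    from hh_trans[OF Q this brs_cong_right[OF proj sys mn c(2) a(2)]]
    have "(B f g, brs \<Psi> n m f' g') \<in> hh_rel scale Q (n + m - 1)" .
    from hh_trans[OF Q this hh_sym[OF Q b[OF c(2,4)]]]
    show "hh_rel scale Q (n + m - 1) `` {B f g} = hh_rel scale Q (n + m - 1) `` {B f' g'}"
      by (rule equiv_class_eq[OF hh_equiv[OF Q]])
  qed
qed

lemma hh_op_class:
  assumes Q: "cpx Q" and "f \<in> cocycles scale Q n" "g \<in> cocycles scale Q m"
    and "congruent2 (hh_rel scale Q n) (hh_rel scale Q m) (\<lambda>f g. hh_rel scale Q (n + m - 1) `` {B f g})"
  shows "hh_op scale Q B n m (hh_rel scale Q n `` {f}) (hh_rel scale Q m `` {g}) = hh_rel scale Q (n + m - 1) `` {B f g}"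
  unfolding hh_op_def by (rule UN_equiv_class2[OF hh_equiv[OF Q] hh_equiv[OF Q] assms(4,2,3)])

lemma hh_map_class:
  assumes P: "cpx P" and Q: "cpx Q" and \<Theta>: "comparison P \<mu> Q \<nu> \<Theta>" and f: "f \<in> cocycles scale Q n"
  shows "hh_map scale P \<Theta> n (hh_rel scale Q n `` {f}) = hh_rel scale P n `` {\<lambda>i x. f i (\<Theta> i x)}"
  unfolding hh_map_def
proof (rule UN_equiv_class[OF hh_equiv[OF Q] _ f])
  show "(\<lambda>f. hh_rel scale P n `` {\<lambda>i x. f i (\<Theta> i x)}) respects hh_rel scale Q n"
    by (rule congruentI) (rule equiv_class_eq[OF hh_equiv[OF P] pull_rel[OF P Q \<Theta>]])
qed

lemma hh_map_inverse:
  assumes P: "resolves P \<mu>" and Q: "resolves Q \<nu>" and pQ: "\<And>i. projective_bimod scale (obj Q i)"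
    and \<Theta>: "comparison P \<mu> Q \<nu> \<Theta>" and \<Psi>: "comparison Q \<nu> P \<mu> \<Psi>" and X: "X \<in> HH scale Q n"
  shows "hh_map scale P \<Theta> n X \<in> HH scale P n" "hh_map scale Q \<Psi> n (hh_map scale P \<Theta> n X) = X"
proof -
  note Pc = resolvesD(1)[OF P] and Qc = resolvesD(1)[OF Q]
  from X obtain f where f: "f \<in> cocycles scale Q n" and Xf: "X = hh_rel scale Q n `` {f}"
    unfolding HH_def by (rule quotientE)
  note f\<Theta> = pull_cocycle[OF Pc \<Theta> f]
  show "hh_map scale P \<Theta> n X \<in> HH scale P n"
    unfolding Xf hh_map_class[OF Pc Qc \<Theta> f] HH_def using f\<Theta> by (rule quotientI)
  have "hh_map scale Q \<Psi> n (hh_map scale P \<Theta> n X) = hh_rel scale Q n `` {\<lambda>i x. f i (\<Theta> i (\<Psi> i x))}"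
    unfolding Xf hh_map_class[OF Pc Qc \<Theta> f] by (rule hh_map_class[OF Qc Pc \<Psi> f\<Theta>])
  also have "\<dots> = X"
    unfolding Xf
    by (rule equiv_class_eq[OF hh_equiv[OF Qc]
          comparison_unique[OF Qc pQ Q comparison_comp[OF Qc \<Psi> \<Theta>] comparison_id f]])
  finally show "hh_map scale Q \<Psi> n (hh_map scale P \<Theta> n X) = X" .
qed

lemma hh_map_bij:
  assumes P: "resolves P \<mu>" and Q: "resolves Q \<nu>" and pP: "\<And>i. projective_bimod scale (obj P i)"
    and pQ: "\<And>i. projective_bimod scale (obj Q i)" and \<Theta>: "comparison P \<mu> Q \<nu> \<Theta>"
  shows "bij_betw (hh_map scale P \<Theta> n) (HH scale Q n) (HH scale P n)"
proof -
  obtain \<Psi> where \<Psi>: "comparison Q \<nu> P \<mu> \<Psi>" using comparison_exists[OF Q pQ P] by auto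
  show ?thesis
    by (rule bij_betw_byWitness[where f' = "hh_map scale Q \<Psi> n"])
      (use hh_map_inverse[OF P Q pQ \<Theta> \<Psi>] hh_map_inverse[OF Q P pP \<Psi> \<Theta>] in auto)
qed

section \<open>Comparing an arbitrary resolution with the bar resolution\<close>

context
  fixes P :: "('k, 'a, 'p::ab_group_add) cplx" and \<mu> \<Delta> \<phi> \<epsilon>
  assumes res: "proj_resolution scale P \<mu>" and \<Delta>: "diag3_approx scale P \<mu> \<Delta>"
    and \<phi>: "phi_condition scale P \<mu> \<phi>" and \<epsilon>: "eps_condition scale P \<mu> \<Delta> \<epsilon>"
begin

lemmas resP = proj_resolution_resolves[OF res]
lemmas cpxP = resolvesD(1)[OF resP]

lemma projP: "projective_bimod scale (obj P i)"
  using res by (simp add: proj_resolution_def)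

abbreviation "DlP \<equiv> Dl\<^sub>P P \<mu> \<Delta>"
abbreviation "brB \<equiv> brs (\<lambda>m g _. psi (nat m) g)"

lemmas sysP = lifting_system_P[OF res \<Delta> \<phi> \<epsilon>]

text \<open>\<open>\<Theta>\<close> respects augmentations and left actions, so the left factor may
  be contracted before or after it.\<close>

lemma Lop_nat:
  assumes \<Theta>: "comparison P \<mu> Bar \<beta> \<Theta>" and t: "t \<in> crr (P \<otimes> P) k"
  shows "Lop Bar 0 (zext \<beta>) k (tmap Bar Bar 0 0 \<Theta> \<Theta> k t) = \<Theta> k (Lop P 0 (zext \<mu>) k t)"
proof (rule QQ_ext[OF cpxP _ _ _ t, where R = Bar and u = 0 and u' = 0 and
    F = "\<lambda>k t. Lop Bar 0 (zext \<beta>) k (tmap Bar Bar 0 0 \<Theta> \<Theta> k t)" and G = "\<lambda>k t. \<Theta> k (Lop P 0 (zext \<mu>) k t)"])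
  note h = comparisonD(1)[OF \<Theta>]
  note T = tmap[OF cpxP cpxP cpx_Bar cpx_Bar h h]
  have z: "deg_hom P Alg (- 0) (zext \<mu>)" using resolvesD(2)[OF resP] by simp
  have L: "deg_hom (P \<otimes> P) P 0 (Lop P 0 (zext \<mu>))" using Lop[OF cpxP z] by simp
  have PP: "cpx (P \<otimes> P)" by (rule cpx_tensor[OF cpxP cpxP])
  show "deg_hom (P \<otimes> P) Bar 0 (\<lambda>k t. Lop Bar 0 (zext \<beta>) k (tmap Bar Bar 0 0 \<Theta> \<Theta> k t))"
    by (rule deg_hom_comp[OF PP T(1) L\<beta>]) simp_all
  show "deg_hom (P \<otimes> P) Bar 0 (\<lambda>k t. \<Theta> k (Lop P 0 (zext \<mu>) k t))"
    by (rule deg_hom_comp[OF PP L h]) simp_all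
  fix i x j y assume a: "i + j = k" "x \<in> crr P i" "y \<in> crr P j"
  have m: "\<Theta> i x \<in> crr Bar i" "\<Theta> j y \<in> crr Bar j" using a by (simp_all add: dh_mem[OF cpxP h])
  have e: "tmap Bar Bar 0 0 \<Theta> \<Theta> k (tprod P P i x j y) = tp i (\<Theta> i x) j (\<Theta> j y)"
    using a by (simp add: T(2))
  have "\<Theta> k (lact (obj P j) (zext \<mu> i x) y) = lact (obj Bar j) (zext \<beta> i (\<Theta> i x)) (\<Theta> j y)"
  proof (cases "i = 0")
    case True
    then show ?thesis
      using a comparisonD(3)[OF \<Theta>] dh_lact[OF cpxP h a(3), of j] by (simp add: zext_def)
  next
    case False
    then show ?thesis
      using a m(2) dh_0[OF cpxP h] by (simp add: zext_def cpxP)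
  qed
  then show "Lop Bar 0 (zext \<beta>) k (tmap Bar Bar 0 0 \<Theta> \<Theta> k (tprod P P i x j y)) = \<Theta> k (Lop P 0 (zext \<mu>) k (tprod P P i x j y))"
    unfolding e using a m by (simp add: Lop_tprod[OF cpx_Bar z\<beta>'] Lop_tprod[OF cpxP z])
qed

text \<open>Both diagonals give chain maps from \<open>P\<close> to the acyclic complex
  \<open>BB\<close>, and their augmentations agree by \<open>Dl\<^sub>P_aug\<close> and
  \<open>L\<beta>_Dlt\<close>; a null homotopy of the difference is the desired
  \<open>Z\<close>.\<close>

lemma compare_diagonals:
  assumes \<Theta>: "comparison P \<mu> Bar \<beta> \<Theta>"
  shows "\<exists>Z. deg_hom P BB 1 Z \<and> (\<forall>i. \<forall>x\<in>crr P i. Z (i - 1) (diff P i x) + diff BB (i + 1) (Z i x) =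
    tmap Bar Bar 0 0 \<Theta> \<Theta> i (DlP i x) - Dlt (\<Theta> i x))"
proof -
  note h = comparisonD(1)[OF \<Theta>]
  note T = tmap[OF cpxP cpxP cpx_Bar cpx_Bar h h]
  have D: "deg_hom P (P \<otimes> P) 0 DlP" and Dd: "\<And>i x. x \<in> crr P i \<Longrightarrow> DlP (i - 1) (diff P i x) = diff (P \<otimes> P) i (DlP i x)"
    using sysP by (auto simp: lifting_system_def lifting_data_def)
  note m = dh_mem[OF cpxP h] dh_mem[OF cpxP D] dh_mem[OF cpx_tensor[OF cpxP cpxP] T(1)] Dlt_mem
  let ?D = "\<lambda>i x. tmap Bar Bar 0 0 \<Theta> \<Theta> i (DlP i x) - Dlt (\<Theta> i x)"
  have Dh: "deg_hom P BB 0 ?D"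
    by (intro deg_hom_diff cpxP cBB deg_hom_comp[OF cpxP D T(1)] deg_hom_comp[OF cpxP h Dlt_hom]) simp_all
  have "\<exists>Z. deg_hom P BB (0 + 1) Z \<and>
    (\<forall>i. \<forall>x\<in>crr P i. Z (i - 1) (diff P i x) + ksgn 0 (diff BB (i + 0 + 1) (Z i x)) = ?D i x) \<and>
    (\<forall>x\<in>crr P (- 0 - 1). (\<beta> (Lop Bar 0 (zext \<beta>) 0 (Z (- 0 - 1) x))) = 0)"
  proof (rule null_homotopy[OF cpxP projP resolves_BB Dh, where u = "\<lambda>_. 0"])
    show "?D (i - 1) (diff P i x) = ksgn 0 (diff BB (i + 0) (?D i x))" if x: "x \<in> crr P i" for i x
    proof -
      have 1: "tmap Bar Bar 0 0 \<Theta> \<Theta> (i - 1) (diff (P \<otimes> P) i (DlP i x)) = diff BB i (tmap Bar Bar 0 0 \<Theta> \<Theta> i (DlP i x))"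
        using tmap_chain[OF cpxP cpxP cpx_Bar cpx_Bar h h, of "DlP i x" i] x comparisonD(2)[OF \<Theta>] by (simp add: m)
      have 2: "Dlt (diff Bar i (\<Theta> i x)) = diff BB i (Dlt (\<Theta> i x))" by (rule Dlt_d) (simp add: m x)
      have "tmap Bar Bar 0 0 \<Theta> \<Theta> i (DlP i x) \<in> crr BB i" "Dlt (\<Theta> i x) \<in> crr BB i"
        using x by (simp_all add: m Dlt_mem[OF m(1)])
      then show ?thesis
        unfolding Dd[OF x] comparisonD(2)[OF \<Theta> x] 1 2 by (simp add: d_diff[OF cBB])
    qed
    show "\<beta> (Lop Bar 0 (zext \<beta>) 0 (?D (- 0) x)) = 0" if "x \<in> crr P (- 0)" for x
    proof -
      have x: "x \<in> crr P 0" using that by simp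
      have n: "deg_hom P Alg (- 0) (zext \<mu>)" using resolvesD(2)[OF resP] by simp
      have t: "DlP 0 x \<in> crr (P \<otimes> P) 0" "\<Theta> 0 x \<in> crr Bar 0" using x by (simp_all add: m)
      have l: "Lop P 0 (zext \<mu>) 0 (DlP 0 x) \<in> crr P 0"
        by (rule dh_mem[OF cpx_tensor[OF cpxP cpxP] Lop[OF cpxP n] t(1)]) simp
      have "Lop Bar 0 (zext \<beta>) 0 (?D 0 x) =
          Lop Bar 0 (zext \<beta>) 0 (tmap Bar Bar 0 0 \<Theta> \<Theta> 0 (DlP 0 x)) - Lop Bar 0 (zext \<beta>) 0 (Dlt (\<Theta> 0 x))"
        by (rule dh_diff[OF cBB L\<beta>]) (use t in \<open>simp_all add: m\<close>)
      also have "\<dots> = \<Theta> 0 (Lop P 0 (zext \<mu>) 0 (DlP 0 x)) - \<Theta> 0 x"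
        unfolding Lop_nat[OF \<Theta> t(1)] L\<beta>_Dlt[OF t(2)] ..
      finally have e: "Lop Bar 0 (zext \<beta>) 0 (?D 0 x) = \<Theta> 0 (Lop P 0 (zext \<mu>) 0 (DlP 0 x)) - \<Theta> 0 x" .
      have "\<beta> (Lop Bar 0 (zext \<beta>) 0 (?D 0 x)) = \<beta> (\<Theta> 0 (Lop P 0 (zext \<mu>) 0 (DlP 0 x))) - \<beta> (\<Theta> 0 x)"
        unfolding e by (rule hom_diff[OF cpx_bim[OF cpx_Bar] \<beta>_hom]) (use l t(2) in \<open>simp_all add: m\<close>)
      then show ?thesis
        using comparisonD(3)[OF \<Theta> l] comparisonD(3)[OF \<Theta> x] Dl\<^sub>P_aug[OF res \<Delta> \<phi> \<epsilon> x] by simp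
    qed
  qed (simp add: bimod_hom_def alg_bimod_def)
  then have "\<exists>Z. deg_hom P BB (0 + 1) Z \<and>
    (\<forall>i. \<forall>x\<in>crr P i. Z (i - 1) (diff P i x) + ksgn 0 (diff BB (i + 0 + 1) (Z i x)) = ?D i x)" by blast
  then show ?thesis by simp
qed

text \<open>\<open>brs_compare\<close> speaks of cocycles pulled back from the bar resolution along
  \<open>\<Theta>\<close>, whereas \<open>f\<close> and \<open>g\<close> live on \<open>P\<close>.
  They are replaced by their pullbacks along the composite \<open>\<Psi> \<Theta>\<close>, which
  changes neither class; the resulting relation on \<open>P\<close> is then carried to the bar
  resolution along \<open>\<Psi>\<close>.\<close>

lemma bracket_compare:
  assumes \<Psi>: "comparison Bar \<beta> P \<mu> \<Psi>" and f: "f \<in> cocycles scale P (int n)" and g: "g \<in> cocycles scale P (int m)"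
  shows "(\<lambda>i x. bracket_P scale P \<Delta> \<phi> \<epsilon> n m f g i (\<Psi> i x), bar_bracket scale n m (\<lambda>i x. f i (\<Psi> i x)) (\<lambda>i x. g i (\<Psi> i x)))
    \<in> hh_rel scale Bar (int n + int m - 1)"
proof -
  note projB = projective_Bar and sysB = lifting_system_Bar
  obtain \<Theta> where \<Theta>: "comparison P \<mu> Bar \<beta> \<Theta>" using comparison_exists[OF resP projP resolves_Bar] by auto
  obtain Z where Z: "deg_hom P BB 1 Z" and Zd: "\<And>i x. x \<in> crr P i \<Longrightarrow> Z (i - 1) (diff P i x) + diff BB (i + 1) (Z i x) =
    tmap Bar Bar 0 0 \<Theta> \<Theta> i (DlP i x) - Dlt (\<Theta> i x)"
    using compare_diagonals[OF \<Theta>] by auto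
  have mn: "int m \<ge> 0" "int n \<ge> 0" by simp_all
  let ?k = "int n + int m - 1"
  let ?f = "\<lambda>i x. f i (\<Psi> i x)" and ?g = "\<lambda>i x. g i (\<Psi> i x)"
  let ?brP = "brs (\<Psi>\<^sub>P P \<Delta> \<phi> \<epsilon>) (int n) (int m)"
  let ?w = "brB (int n) (int m) ?f ?g"
  note fB = pull_cocycle[OF cpx_Bar \<Psi> f] and gB = pull_cocycle[OF cpx_Bar \<Psi> g]
  have w: "?w \<in> cocycles scale Bar ?k" by (rule brs_cocycle[OF sysB mn fB gB])
  \<comment> \<open>\<open>\<Psi> \<Theta>\<close> is a comparison map from \<open>P\<close> to
    itself, and so is the identity.\<close>
  have ret: "(\<lambda>i x. u i (\<Psi> i (\<Theta> i x)), u) \<in> hh_rel scale P l" if "u \<in> cocycles scale P l" for u l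
    by (rule comparison_unique[OF cpxP projP resP comparison_comp[OF cpxP \<Theta> \<Psi>] comparison_id that])
  have 1: "(bracket_P scale P \<Delta> \<phi> \<epsilon> n m f g, ?brP f g) \<in> hh_rel scale P ?k"
    by (rule bracket_congruent2(2)[OF projP sysP mn bracket_P_eq[OF res \<Delta> \<phi> \<epsilon>] f g])
  have 2: "(?brP f g, ?brP (\<lambda>i x. ?f i (\<Theta> i x)) g) \<in> hh_rel scale P ?k"
    by (rule brs_cong_left[OF projP sysP mn g hh_sym[OF cpxP ret[OF f]]])
  have 3: "(?brP (\<lambda>i x. ?f i (\<Theta> i x)) g, ?brP (\<lambda>i x. ?f i (\<Theta> i x)) (\<lambda>i x. ?g i (\<Theta> i x))) \<in> hh_rel scale P ?k"
    by (rule brs_cong_right[OF projP sysP mn pull_cocycle[OF cpxP \<Theta> fB] hh_sym[OF cpxP ret[OF g]]])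
  have 4: "(?brP (\<lambda>i x. ?f i (\<Theta> i x)) (\<lambda>i x. ?g i (\<Theta> i x)), \<lambda>i x. ?w i (\<Theta> i x)) \<in> hh_rel scale P ?k"
  proof -
    obtain h where h: "deg_hom P Alg (2 - int n - int m) h"
      and e: "\<And>i x. x \<in> crr P i \<Longrightarrow>
        ?brP (\<lambda>i x. ?f i (\<Theta> i x)) (\<lambda>i x. ?g i (\<Theta> i x)) i x - ?w i (\<Theta> i x) = h (i - 1) (diff P i x)"
      using brs_compare[OF projP sysP sysB comparisonD[OF \<Theta>] Z Zd mn fB gB] by auto
    show ?thesis
      by (rule hh_relI[OF brs_cocycle[OF sysP mn pull_cocycle[OF cpxP \<Theta> fB] pull_cocycle[OF cpxP \<Theta> gB]]
            pull_cocycle[OF cpxP \<Theta> w] h _ e]) simp_all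
  qed
  have "(bracket_P scale P \<Delta> \<phi> \<epsilon> n m f g, \<lambda>i x. ?w i (\<Theta> i x)) \<in> hh_rel scale P ?k"
    using 1 2 3 4 by (blast intro: hh_trans[OF cpxP])
  from pull_rel[OF cpx_Bar cpxP \<Psi> this]
  have 5: "(\<lambda>i x. bracket_P scale P \<Delta> \<phi> \<epsilon> n m f g i (\<Psi> i x), \<lambda>i x. ?w i (\<Theta> i (\<Psi> i x))) \<in> hh_rel scale Bar ?k" .
  have 6: "(\<lambda>i x. ?w i (\<Theta> i (\<Psi> i x)), ?w) \<in> hh_rel scale Bar ?k"
    by (rule comparison_unique[OF cpx_Bar projB resolves_Bar comparison_comp[OF cpx_Bar \<Psi> \<Theta>] comparison_id w])
  have 7: "(bar_bracket scale n m ?f ?g, ?w) \<in> hh_rel scale Bar ?k"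
    by (rule bracket_congruent2(2)[OF projB sysB mn bar_bracket_eq fB gB])
  show ?thesis by (rule hh_trans[OF cpx_Bar hh_trans[OF cpx_Bar 5 6] hh_sym[OF cpx_Bar 7]])
qed

lemma bracket_P_cocycle: "f \<in> cocycles scale P (int n) \<Longrightarrow> g \<in> cocycles scale P (int m) \<Longrightarrow>
    bracket_P scale P \<Delta> \<phi> \<epsilon> n m f g \<in> cocycles scale P (int n + int m - 1)"
  by (rule bracket_congruent2(1)[OF projP sysP of_nat_0_le_iff of_nat_0_le_iff bracket_P_eq[OF res \<Delta> \<phi> \<epsilon>]])

lemma bracket_P_congruent2: "congruent2 (hh_rel scale P (int n)) (hh_rel scale P (int m))
    (\<lambda>f g. hh_rel scale P (int n + int m - 1) `` {bracket_P scale P \<Delta> \<phi> \<epsilon> n m f g})"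
  by (rule bracket_congruent2(3)[OF projP sysP of_nat_0_le_iff of_nat_0_le_iff bracket_P_eq[OF res \<Delta> \<phi> \<epsilon>]])

lemma hh_map_bracket:
  assumes \<Psi>: "comparison Bar \<beta> P \<mu> \<Psi>" and X: "X \<in> HH scale P (int n)" and Y: "Y \<in> HH scale P (int m)"
  shows "hh_map scale Bar \<Psi> (int n + int m - 1) (hh_op scale P (bracket_P scale P \<Delta> \<phi> \<epsilon> n m) n m X Y) =
    hh_op scale Bar (bar_bracket scale n m) n m (hh_map scale Bar \<Psi> n X) (hh_map scale Bar \<Psi> m Y)"
proof -
  from X obtain f where f: "f \<in> cocycles scale P (int n)" and Xf: "X = hh_rel scale P (int n) `` {f}"
    unfolding HH_def by (rule quotientE)
  from Y obtain g where g: "g \<in> cocycles scale P (int m)" and Yg: "Y = hh_rel scale P (int m) `` {g}"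
    unfolding HH_def by (rule quotientE)
  note fB = pull_cocycle[OF cpx_Bar \<Psi> f] and gB = pull_cocycle[OF cpx_Bar \<Psi> g]
  have "congruent2 (hh_rel scale Bar (int n)) (hh_rel scale Bar (int m))
      (\<lambda>f g. hh_rel scale Bar (int n + int m - 1) `` {bar_bracket scale n m f g})"
    by (rule bracket_congruent2(3)[OF projective_Bar lifting_system_Bar of_nat_0_le_iff of_nat_0_le_iff bar_bracket_eq])
  note opB = hh_op_class[OF cpx_Bar fB gB this]
  note b = bracket_P_cocycle[OF f g]
  show ?thesis
    unfolding Xf Yg hh_op_class[OF cpxP f g bracket_P_congruent2] hh_map_class[OF cpx_Bar cpxP \<Psi> b]
      hh_map_class[OF cpx_Bar cpxP \<Psi> f] hh_map_class[OF cpx_Bar cpxP \<Psi> g] opB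
    by (rule equiv_class_eq[OF hh_equiv[OF cpx_Bar] bracket_compare[OF \<Psi> f g]])
qed

end

end

theorem corollary5:
  fixes s :: "'k::field \<Rightarrow> 'a::{ring,monoid_mult} \<Rightarrow> 'a"
    and P :: "('k, 'a, 'p::ab_group_add) cplx"
    and \<mu> :: "'p \<Rightarrow> 'a"
    and \<Delta> :: "int \<Rightarrow> 'p \<Rightarrow> ('k, ('k, 'p, 'p) tens, 'p) tens"
    and \<phi> :: "int \<Rightarrow> ('k, 'p, 'p) tens \<Rightarrow> 'p"
    and \<epsilon> :: "int \<Rightarrow> 'p \<Rightarrow> ('k, 'p, 'p) tens"
  assumes "k_algebra s"
    and "proj_resolution s P \<mu>"
    and "diag3_approx s P \<mu> \<Delta>"
    and "phi_condition s P \<mu> \<phi>"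
    and "eps_condition s P \<mu> \<Delta> \<epsilon>"
  shows
    "(\<forall>n m :: nat. \<forall>f \<in> cocycles s P n. \<forall>g \<in> cocycles s P m.
        bracket_P s P \<Delta> \<phi> \<epsilon> n m f g \<in> cocycles s P (int n + int m - 1))
   \<and> (\<forall>n m :: nat. congruent2 (hh_rel s P n) (hh_rel s P m)
        (\<lambda>f g. hh_rel s P (int n + int m - 1) `` {bracket_P s P \<Delta> \<phi> \<epsilon> n m f g}))
   \<and> (\<exists>\<Psi>. comparison (bar_cplx s) (bar_aug s) P \<mu> \<Psi>)
   \<and> (\<forall>\<Psi>. comparison (bar_cplx s) (bar_aug s) P \<mu> \<Psi> \<longrightarrow>
        (\<forall>n :: nat. bij_betw (hh_map s (bar_cplx s) \<Psi> n) (HH s P n) (HH s (bar_cplx s) n)) \<and>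
        (\<forall>n m :: nat. \<forall>X \<in> HH s P n. \<forall>Y \<in> HH s P m.
           hh_map s (bar_cplx s) \<Psi> (int n + int m - 1)
             (hh_op s P (bracket_P s P \<Delta> \<phi> \<epsilon> n m) n m X Y) =
           hh_op s (bar_cplx s) (bar_bracket s n m) n m
             (hh_map s (bar_cplx s) \<Psi> n X) (hh_map s (bar_cplx s) \<Psi> m Y)))"
proof -
  interpret k_algebra s by fact
  note a = assms(2-5)
  note pP = projP[OF a] and rP = resP[OF a]
  show ?thesis
  proof (intro conjI allI ballI impI)
    show "bracket_P s P \<Delta> \<phi> \<epsilon> n m f g \<in> cocycles s P (int n + int m - 1)"
      if "f \<in> cocycles s P n" "g \<in> cocycles s P m" for n m :: nat and f g
      by (rule bracket_P_cocycle[OF a that])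
    show "congruent2 (hh_rel s P n) (hh_rel s P m)
        (\<lambda>f g. hh_rel s P (int n + int m - 1) `` {bracket_P s P \<Delta> \<phi> \<epsilon> n m f g})" for n m :: nat
      by (rule bracket_P_congruent2[OF a])
    show "\<exists>\<Psi>. comparison Bar \<beta> P \<mu> \<Psi>" by (rule comparison_exists[OF resolves_Bar projective_Bar rP])
    fix \<Psi> assume \<Psi>: "comparison Bar \<beta> P \<mu> \<Psi>"
    show "bij_betw (hh_map s Bar \<Psi> n) (HH s P n) (HH s Bar n)" for n :: nat
      by (rule hh_map_bij[OF resolves_Bar rP projective_Bar pP \<Psi>])
    show "hh_map s Bar \<Psi> (int n + int m - 1) (hh_op s P (bracket_P s P \<Delta> \<phi> \<epsilon> n m) n m X Y) =
      hh_op s Bar (bar_bracket s n m) n m (hh_map s Bar \<Psi> n X) (hh_map s Bar \<Psi> m Y)"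
      if "X \<in> HH s P n" "Y \<in> HH s P m" for n m :: nat and X Y
      by (rule hh_map_bracket[OF a \<Psi> that])
  qed
qed

end
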